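(* Let $\mathcal{X}: Z^d+L_{d,Z}(X,Y)=0$ be a smooth plane curve of degree $d\geq4$ over $K$ for which $P=(0:0:1)$ is the unique outer Galois point. Consider the binary forms $$\mathcal{S}_6(X,Y)=XY(X^4-Y^4),$$ $$\mathcal{S}_{12,a}(X,Y)=X^{12}+(1+a)(XY)^4(X^4+Y^4)+Y^{12},$$ $$\mathcal{S}_{8,b}(X,Y)=X^8+b(XY)^4+Y^8,$$ $$\mathcal{S}_{24,a}(X,Y)=X^{24}+a(XY)^4(X^{16}+Y^{16})+(759-4a)(XY)^8(X^8+Y^8)+(2576+6a)(XY)^{12}+Y^{24}.$$ Then $\operatorname{Aut}_{\operatorname{red}}(\mathcal{X})$ is isomorphic to $\operatorname{S}_4$ if and only if $d=6\epsilon+12\epsilon'+8\epsilon''+24t$ for some $\epsilon,\epsilon',\epsilon''\in\{0,1\}$ and some integer $t\geq0$, and, up to $K$-equivalence, $$L_{d,Z}=\mathcal{S}_6^{\epsilon}\cdot\mathcal{S}_{12,-34}^{\epsilon'}\cdot\mathcal{S}_{8,14}^{\epsilon''}\cdot\prod_{i=1}^t\mathcal{S}_{24,a_i},$$ where $a_i\in K$, $a_i\neq-66$ (when $\epsilon'=1$), $a_i\neq42$ (when $\epsilon''=1$), and $a_i\neq a_j$ for all $i\neq j$. In this case (with $L_{d,Z}$ as displayed), $\operatorname{Aut}(\mathcal{X})$, which is a central extension of $\operatorname{S}_4$ by $C_d$, is generated by $$\rho=\operatorname{diag}(1,1,\zeta_d),\quad\rho'=\operatorname{diag}(1,-1,\zeta_4),\quad\tau=[Y:X:\zeta_4Z],$$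 $$\sigma_1=\begin{pmatrix}1&\zeta_4&0\\1&-\zeta_4&0\\0&0&(1+\zeta_4)\zeta_{12}\cdot\zeta_3^{-\epsilon''}\end{pmatrix},\quad\sigma_2=\begin{pmatrix}1&1&0\\1&-1&0\\0&0&\sqrt2\,\zeta_4^{\epsilon'}\end{pmatrix}.$$ In particular, it decomposes as $C_d\circ G_0$, where $$G_0\cong\begin{cases}\operatorname{GL}_2(\mathbb{F}_3)&\text{if }\epsilon'=0,\\ \operatorname{CSU}_2(\mathbb{F}_3)&\text{if }\epsilon'=1.\end{cases}$$
   Context: $K$ is an algebraically closed field of characteristic $0$; $X,Y,Z$ are homogeneous coordinates on $\mathbb{P}^2(K)$; $L_{d,Z}(X,Y)$ is a homogeneous polynomial of degree $d$ in $X,Y$. $\zeta_n$ is a fixed primitive $n$th root of unity in $K$, chosen compatibly ($\zeta_{mn}^m=\zeta_n$). An outer Galois point of a plane curve $\mathcal{X}$ is a point $P\notin\mathcal{X}$ such that projection from $P$, $\mathcal{X}\to\mathbb{P}^1$, induces a Galois extension of function fields. $\operatorname{Aut}(\mathcal{X})$ is the full automorphism group of $\mathcal{X}$, viewed as a subgroup of $\operatorname{PGL}_3(K)$. Since $P=(0:0:1)$ is the unique outer Galois point, $\operatorname{Aut}(\mathcal{X})$ lies in $\operatorname{PBD}(2,1)$, the subgroup of $\operatorname{PGL}_3(K)$ of classes of block matrices $\begin{pmatrix}*&*&0\\ *&*&0\\0&0&1\end{pmatrix}$. Let $\Lambda:\operatorname{PBD}(2,1)\to\operatorname{PGL}_2(K)$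 be the map taking the upper-left $2\times2$ block. Then $\operatorname{Aut}_{\operatorname{red}}(\mathcal{X}):=\Lambda(\operatorname{Aut}(\mathcal{X}))$, and the kernel of $\Lambda$ on $\operatorname{Aut}(\mathcal{X})$ is $N=\langle\operatorname{diag}(1,1,\zeta_d)\rangle\cong C_d$. "Up to $K$-equivalence" means after a projective linear change of coordinates of $\mathbb{P}^2(K)$. A matrix $A=(a_{ij})\in\operatorname{PGL}_3(K)$ is also written $[a_{11}X+a_{12}Y+a_{13}Z:a_{21}X+a_{22}Y+a_{23}Z:a_{31}X+a_{32}Y+a_{33}Z]$. $C_n$ is the cyclic group of order $n$. $G\circ H$ is the central product $(G\times H)/Z$, with $Z$ a common central subgroup (here of order 2) identified in both factors. $\operatorname{CSU}_2(\mathbb{F}_3)$ denotes the conformal special unitary group over $\mathbb{F}_3$, a central extension of $\operatorname{S}_4$ by $C_2$ of order 48; it is generated by a copy of $\operatorname{SL}_2(\mathbb{F}_3)$ (as an index-2 subgroup) and an element whose square is the central involution.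
   Formalization: For ε=0, ε'=1 the printed σ_2 does not preserve the curve and no decomposition C_d∘G_0 over C_2 exists; there the corner entry of σ_2 is taken as √2·ζ_8 instead of √2·ζ_4, and the decomposition with CSU_2(F_3) is claimed only for ε=ε'=1. *)

theory Defs
  imports
    "HOL-Analysis.Analysis"
    "HOL-Library.Poly_Mapping"
    "HOL-Library.Numeral_Type"
    "HOL-Computational_Algebra.Polynomial"
    "HOL-Computational_Algebra.Fraction_Field"
    "HOL-Algebra.Generated_Groups"
    "HOL-Algebra.Generated_Fields"
    "HOL-Algebra.Embedded_Algebras"
    "HOL-Algebra.Elementary_Groups"
    "HOL-Algebra.QuotRing"
    "HOL-Algebra.Sym_Groups"
begin

section \<open>Polynomials in the homogeneous coordinates X, Y, Z\<close>

text \<open>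
  The polynomial ring \<open>K[X,Y,Z]\<close>. Variables are indexed by the three-element type \<open>3\<close>, as are
  the coordinates of vectors and matrices; its elements are \<open>1\<close> (for X), \<open>2\<close> (for Y) and
  \<open>3\<close> (for Z; note that \<open>3 = 0\<close> in this type).
\<close>
type_synonym 'a form = "(3 \<Rightarrow>\<^sub>0 nat) \<Rightarrow>\<^sub>0 'a"

definition Const :: "'a::comm_ring_1 \<Rightarrow> 'a form" where
  "Const c = Poly_Mapping.single 0 c"

definition Var :: "3 \<Rightarrow> 'a::comm_ring_1 form" where
  "Var i = Poly_Mapping.single (Poly_Mapping.single i 1) 1"

definition homogeneous :: "nat \<Rightarrow> 'a::comm_ring_1 form \<Rightarrow> bool" where
  "homogeneous n F \<longleftrightarrow>
     (\<forall>m \<in> Poly_Mapping.keys F. (\<Sum>i\<in>UNIV. Poly_Mapping.lookup m i) = n)"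

definition binary_form :: "nat \<Rightarrow> 'a::comm_ring_1 form \<Rightarrow> bool" where
  "binary_form n F \<longleftrightarrow>
     homogeneous n F \<and> (\<forall>m \<in> Poly_Mapping.keys F. Poly_Mapping.lookup m 3 = 0)"

definition eval_form :: "'a::comm_ring_1 form \<Rightarrow> 'a ^ 3 \<Rightarrow> 'a" where
  "eval_form F v =
     (\<Sum>m \<in> Poly_Mapping.keys F.
        Poly_Mapping.lookup F m * (\<Prod>i\<in>UNIV. (v $ i) ^ Poly_Mapping.lookup m i))"

definition lin_form :: "'a::comm_ring_1 ^ 3 \<Rightarrow> 'a form" where
  "lin_form a = (\<Sum>j\<in>UNIV. Const (a $ j) * Var j)"

text \<open>The composite \<open>F \<circ> A\<close>: the \<open>i\<close>-th variable is replaced by the \<open>i\<close>-th row of \<open>A\<close>.\<close>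
definition subst_form :: "'a::comm_ring_1 ^ 3 ^ 3 \<Rightarrow> 'a form \<Rightarrow> 'a form" where
  "subst_form A F =
     (\<Sum>m \<in> Poly_Mapping.keys F.
        Const (Poly_Mapping.lookup F m) * (\<Prod>i\<in>UNIV. lin_form (A $ i) ^ Poly_Mapping.lookup m i))"

definition partial_deriv :: "3 \<Rightarrow> 'a::comm_ring_1 form \<Rightarrow> 'a form" where
  "partial_deriv i F =
     (\<Sum>m \<in> Poly_Mapping.keys F.
        Poly_Mapping.single (m - Poly_Mapping.single i 1)
          (of_nat (Poly_Mapping.lookup m i) * Poly_Mapping.lookup F m))"


section \<open>Plane curves\<close>

text \<open>A plane curve is given by its equation, a form \<open>F\<close>. This is its affine cone minus the origin.\<close>
definition curve_cone :: "'a::comm_ring_1 form \<Rightarrow> ('a ^ 3) set" where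
  "curve_cone F = {v. v \<noteq> 0 \<and> eval_form F v = 0}"

definition smooth_plane_curve :: "nat \<Rightarrow> 'a::comm_ring_1 form \<Rightarrow> bool" where
  "smooth_plane_curve d F \<longleftrightarrow>
     F \<noteq> 0 \<and> homogeneous d F \<and> (\<forall>v \<in> curve_cone F. \<exists>i. eval_form (partial_deriv i F) v \<noteq> 0)"

text \<open>The equation after a projective linear change of coordinates; equations count up to scalars.\<close>
definition K_equivalent :: "'a::field form \<Rightarrow> 'a form \<Rightarrow> bool" where
  "K_equivalent F G \<longleftrightarrow>
     (\<exists>A c. invertible A \<and> c \<noteq> 0 \<and> subst_form A F = Const c * G)"

definition proj_point :: "'a::field ^ 3 \<Rightarrow> ('a ^ 3) set" where
  "proj_point v = {c *s v | c. c \<noteq> 0}"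


section \<open>Function fields and outer Galois points\<close>

text \<open>
  The function field of the (irreducible) plane curve \<open>F = 0\<close> is the residue field of the local
  ring of the projective plane at the generic point of the curve. That local ring consists of the
  fractions \<open>G/H\<close> of forms of equal degree with \<open>H\<close> not divisible by \<open>F\<close>, and its maximal
  ideal of those for which moreover \<open>G\<close> is divisible by \<open>F\<close>.
\<close>
definition local_ring :: "'a::field form \<Rightarrow> 'a form fract ring" where
  "local_ring F =
     \<lparr> carrier = {Fract G H | G H n. homogeneous n G \<and> homogeneous n H \<and> \<not> F dvd H},
       mult = (*), one = 1, zero = 0, add = (+) \<rparr>"

definition curve_ideal :: "'a::field form \<Rightarrow> 'a form fract set" where
  "curve_ideal F =
     {Fract G H | G H n. homogeneous n G \<and> homogeneous n H \<and> \<not> F dvd H \<and> F dvd G}"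

definition function_field :: "'a::field form \<Rightarrow> 'a form fract set ring" where
  "function_field F = local_ring F Quot curve_ideal F"

definition rat_fun :: "'a::field form \<Rightarrow> 'a form \<Rightarrow> 'a form \<Rightarrow> 'a form fract set" where
  "rat_fun F G H = curve_ideal F +>\<^bsub>local_ring F\<^esub> Fract G H"

definition galois_extension :: "('b, 'm) ring_scheme \<Rightarrow> 'b set \<Rightarrow> bool" where
  "galois_extension E k \<longleftrightarrow>
     field E \<and> subfield k E \<and> ring.finite_dimension E k (carrier E) \<and>
     {x \<in> carrier E. \<forall>\<sigma> \<in> ring_iso E E. (\<forall>y \<in> k. \<sigma> y = y) \<longrightarrow> \<sigma> x = x} = k"

text \<open>
  If \<open>a\<close>, \<open>b\<close> are independent linear forms vanishing at \<open>p\<close>, the projection from \<open>p\<close> is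
  \<open>(a : b)\<close>, and the function field \<open>K(t)\<close> of the projective line pulls back to \<open>K(a/b)\<close>.
\<close>
definition outer_galois :: "'a::field form \<Rightarrow> 'a ^ 3 \<Rightarrow> bool" where
  "outer_galois F p \<longleftrightarrow>
     p \<noteq> 0 \<and> eval_form F p \<noteq> 0 \<and>
     (\<exists>a b. (\<forall>r s. r *s a + s *s b = 0 \<longrightarrow> r = 0 \<and> s = 0) \<and>
        eval_form (lin_form a) p = 0 \<and> eval_form (lin_form b) p = 0 \<and>
        galois_extension (function_field F)
          (generate_field (function_field F)
             (insert (rat_fun F (lin_form a) (lin_form b)) (range (\<lambda>c. rat_fun F (Const c) 1)))))"

definition outer_galois_points :: "'a::field form \<Rightarrow> ('a ^ 3) set set" where
  "outer_galois_points F = {proj_point p | p. outer_galois F p}"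


section \<open>Linear and projective linear groups\<close>

definition GL :: "('a::comm_ring_1 ^ 'n ^ 'n) monoid" where
  "GL = \<lparr> carrier = {A. invertible A}, mult = (**), one = mat 1 \<rparr>"

definition scalar_matrices :: "('a::field ^ 'n ^ 'n) set" where
  "scalar_matrices = {mat c | c. c \<noteq> 0}"

definition PGL :: "('a::field ^ 'n ^ 'n) set monoid" where
  "PGL = GL Mod scalar_matrices"

definition pgl :: "'a::field ^ 'n ^ 'n \<Rightarrow> ('a ^ 'n ^ 'n) set" where
  "pgl A = scalar_matrices #>\<^bsub>GL\<^esub> A"

text \<open>
  The automorphism group of a smooth plane curve of degree at least 4 as a subgroup of
  \<open>PGL\<^sub>3(K)\<close>: the projectivities that map the curve onto itself.
\<close>
definition Aut :: "'a::field form \<Rightarrow> ('a ^ 3 ^ 3) set set" where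
  "Aut F = {g \<in> carrier PGL. \<forall>A \<in> g. (\<lambda>v. A *v v) ` curve_cone F = curve_cone F}"

abbreviation Aut_group :: "'a::field form \<Rightarrow> ('a ^ 3 ^ 3) set monoid" where
  "Aut_group F \<equiv> PGL \<lparr> carrier := Aut F \<rparr>"

definition upper_left :: "'a::field ^ 3 ^ 3 \<Rightarrow> 'a ^ 2 ^ 2" where
  "upper_left A = vector [vector [A $ 1 $ 1, A $ 1 $ 2], vector [A $ 2 $ 1, A $ 2 $ 2]]"

text \<open>
  The homomorphism from \<open>PBD(2,1)\<close> to \<open>PGL\<^sub>2(K)\<close>. It is applied to a class of matrices by
  taking the block of every representative, which gives a full class in \<open>PGL\<^sub>2(K)\<close>. Meaningful
  only on \<open>PBD(2,1)\<close>, which contains the automorphism group if \<open>(0:0:1)\<close> is the unique outer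
  Galois point of a curve \<open>Z\<^sup>d + L(X,Y) = 0\<close>.
\<close>
definition Lambda :: "('a::field ^ 3 ^ 3) set \<Rightarrow> ('a ^ 2 ^ 2) set" where
  "Lambda g = upper_left ` g"

abbreviation Aut_red_group :: "'a::field form \<Rightarrow> ('a ^ 2 ^ 2) set monoid" where
  "Aut_red_group F \<equiv> PGL \<lparr> carrier := Lambda ` Aut F \<rparr>"


section \<open>Abstract groups\<close>

definition center :: "('g, 'm) monoid_scheme \<Rightarrow> 'g set" where
  "center G = {z \<in> carrier G. \<forall>g \<in> carrier G. z \<otimes>\<^bsub>G\<^esub> g = g \<otimes>\<^bsub>G\<^esub> z}"

definition is_central_extension ::
    "('e, 'm) monoid_scheme \<Rightarrow> ('q, 'n) monoid_scheme \<Rightarrow> ('c, 'k) monoid_scheme \<Rightarrow> bool" where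
  "is_central_extension E Q C \<longleftrightarrow>
     (\<exists>i \<in> hom C E. \<exists>p \<in> hom E Q.
        inj_on i (carrier C) \<and> p ` carrier E = carrier Q \<and>
        i ` carrier C = kernel E Q p \<and> i ` carrier C \<subseteq> center E)"

definition central_product ::
    "('g, 'm) monoid_scheme \<Rightarrow> ('h, 'n) monoid_scheme \<Rightarrow> 'g set \<Rightarrow> ('g \<Rightarrow> 'h) \<Rightarrow> ('g \<times> 'h) set monoid"
  where
  "central_product G H Z \<phi> = (G \<times>\<times> H) Mod {(z, inv\<^bsub>H\<^esub> (\<phi> z)) | z. z \<in> Z}"

text \<open>\<open>A\<close> is a central product \<open>G \<circ> H\<close> in which central subgroups of order 2 are identified.\<close>
definition is_central_product_2 ::
    "('e, 'k) monoid_scheme \<Rightarrow> ('g, 'm) monoid_scheme \<Rightarrow> ('h, 'n) monoid_scheme \<Rightarrow> bool" where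
  "is_central_product_2 A G H \<longleftrightarrow>
     (\<exists>Z \<phi>. subgroup Z G \<and> card Z = 2 \<and> Z \<subseteq> center G \<and>
        \<phi> \<in> hom (G \<lparr> carrier := Z \<rparr>) H \<and> inj_on \<phi> Z \<and> \<phi> ` Z \<subseteq> center H \<and>
        A \<cong> central_product G H Z \<phi>)"

text \<open>The numeral type \<open>3\<close>, with its ring structure, is the field of three elements.\<close>
definition GL2_F3 :: "(3 ^ 2 ^ 2) monoid" where
  "GL2_F3 = GL"

text \<open>The field of nine elements: \<open>GF9 x y\<close> stands for \<open>x + y i\<close>, with \<open>i\<^sup>2 = -1\<close>.\<close>
datatype gf9 = GF9 (re9: "3") (im9: "3")

instantiation gf9 :: comm_ring_1
begin
definition "0 = GF9 0 0"
definition "1 = GF9 1 0"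
definition "x + y = GF9 (re9 x + re9 y) (im9 x + im9 y)"
definition "- x = GF9 (- re9 x) (- im9 x)"
definition "x - y = GF9 (re9 x - re9 y) (im9 x - im9 y)"
definition "x * y = GF9 (re9 x * re9 y - im9 x * im9 y) (re9 x * im9 y + im9 x * re9 y)"
instance
  by standard
    (simp_all add: zero_gf9_def one_gf9_def plus_gf9_def uminus_gf9_def minus_gf9_def
      times_gf9_def gf9.expand algebra_simps)
end

text \<open>
  Conformal special unitary group: determinant 1, and the Hermitian form is preserved up to a
  scalar in \<open>F\<^sub>3\<close>, i.e. up to \<open>1\<close> or \<open>-1\<close>. The conjugation of the field of nine elements is
  the Frobenius map \<open>x \<mapsto> x\<^sup>3\<close>. This group has order 48; the subgroup with scalar 1 is
  \<open>SU\<^sub>2(F\<^sub>3)\<close>, isomorphic to \<open>SL\<^sub>2(F\<^sub>3)\<close>.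
\<close>
definition conj_transpose :: "gf9 ^ 2 ^ 2 \<Rightarrow> gf9 ^ 2 ^ 2" where
  "conj_transpose A = (\<chi> i j. (A $ j $ i) ^ 3)"

definition CSU2_F3 :: "(gf9 ^ 2 ^ 2) monoid" where
  "CSU2_F3 =
     GL \<lparr> carrier := {A. det A = 1 \<and> (\<exists>c \<in> {1, -1}. A ** conj_transpose A = mat c)} \<rparr>"


section \<open>Roots of unity\<close>

definition compatible_roots_of_unity :: "(nat \<Rightarrow> 'a::field) \<Rightarrow> bool" where
  "compatible_roots_of_unity \<zeta> \<longleftrightarrow>
     (\<forall>n>0. \<zeta> n ^ n = 1 \<and> (\<forall>k. 0 < k \<and> k < n \<longrightarrow> \<zeta> n ^ k \<noteq> 1)) \<and>
     (\<forall>m>0. \<forall>n>0. \<zeta> (m * n) ^ m = \<zeta> n)"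


section \<open>Octahedral binary forms\<close>

definition S6 :: "'a::comm_ring_1 form" where
  "S6 = (let X = Var 1; Y = Var 2 in X * Y * (X ^ 4 - Y ^ 4))"

definition S12 :: "'a::comm_ring_1 \<Rightarrow> 'a form" where
  "S12 a = (let X = Var 1; Y = Var 2 in
     X ^ 12 + Const (1 + a) * (X * Y) ^ 4 * (X ^ 4 + Y ^ 4) + Y ^ 12)"

definition S8 :: "'a::comm_ring_1 \<Rightarrow> 'a form" where
  "S8 b = (let X = Var 1; Y = Var 2 in X ^ 8 + Const b * (X * Y) ^ 4 + Y ^ 8)"

definition S24 :: "'a::comm_ring_1 \<Rightarrow> 'a form" where
  "S24 a = (let X = Var 1; Y = Var 2 in
     X ^ 24 + Const a * (X * Y) ^ 4 * (X ^ 16 + Y ^ 16)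
     + Const (759 - 4 * a) * (X * Y) ^ 8 * (X ^ 8 + Y ^ 8)
     + Const (2576 + 6 * a) * (X * Y) ^ 12 + Y ^ 24)"

definition octahedral_form ::
    "nat \<Rightarrow> nat \<Rightarrow> nat \<Rightarrow> nat \<Rightarrow> (nat \<Rightarrow> 'a) \<Rightarrow> 'a::comm_ring_1 form" where
  "octahedral_form \<epsilon> \<epsilon>' \<epsilon>'' t a =
     S6 ^ \<epsilon> * S12 (-34) ^ \<epsilon>' * S8 14 ^ \<epsilon>'' * (\<Prod>i=1..t. S24 (a i))"

definition octahedral_data ::
    "nat \<Rightarrow> nat \<Rightarrow> nat \<Rightarrow> nat \<Rightarrow> nat \<Rightarrow> (nat \<Rightarrow> 'a::comm_ring_1) \<Rightarrow> bool" where
  "octahedral_data d \<epsilon> \<epsilon>' \<epsilon>'' t a \<longleftrightarrow>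
     \<epsilon> \<in> {0, 1} \<and> \<epsilon>' \<in> {0, 1} \<and> \<epsilon>'' \<in> {0, 1} \<and>
     d = 6 * \<epsilon> + 12 * \<epsilon>' + 8 * \<epsilon>'' + 24 * t \<and>
     (\<epsilon>' = 1 \<longrightarrow> (\<forall>i \<in> {1..t}. a i \<noteq> -66)) \<and>
     (\<epsilon>'' = 1 \<longrightarrow> (\<forall>i \<in> {1..t}. a i \<noteq> 42)) \<and>
     inj_on a {1..t}"


section \<open>Generators\<close>

definition diag3 :: "'a::zero \<Rightarrow> 'a \<Rightarrow> 'a \<Rightarrow> 'a ^ 3 ^ 3" where
  "diag3 a b c = vector [vector [a, 0, 0], vector [0, b, 0], vector [0, 0, c]]"

definition rho :: "(nat \<Rightarrow> 'a::field) \<Rightarrow> nat \<Rightarrow> 'a ^ 3 ^ 3" where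
  "rho \<zeta> d = diag3 1 1 (\<zeta> d)"

definition rho' :: "(nat \<Rightarrow> 'a::field) \<Rightarrow> 'a ^ 3 ^ 3" where
  "rho' \<zeta> = diag3 1 (-1) (\<zeta> 4)"

definition tau :: "(nat \<Rightarrow> 'a::field) \<Rightarrow> 'a ^ 3 ^ 3" where
  "tau \<zeta> = vector [vector [0, 1, 0], vector [1, 0, 0], vector [0, 0, \<zeta> 4]]"

definition sigma1 :: "(nat \<Rightarrow> 'a::field) \<Rightarrow> nat \<Rightarrow> 'a ^ 3 ^ 3" where
  "sigma1 \<zeta> \<epsilon>'' = vector
     [vector [1, \<zeta> 4, 0], vector [1, - \<zeta> 4, 0],
      vector [0, 0, (1 + \<zeta> 4) * \<zeta> 12 * inverse (\<zeta> 3 ^ \<epsilon>'')]]"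

text \<open>
  \<open>s\<close> is a square root of 2. The exponents \<open>\<epsilon> = 0\<close>, \<open>\<epsilon>' = 1\<close> need a separate value in the
  corner: the square root of 2 times \<open>\<zeta>\<^sub>4\<close>, which is right for \<open>\<epsilon> = \<epsilon>' = 1\<close>, does not then
  give an automorphism. Indeed the form has degree \<open>d\<close> congruent to 4 modulo 8, and the
  substitution \<open>(X + Y, X - Y)\<close> multiplies it by minus the \<open>d/2\<close>-th power of 2.
\<close>
definition sigma2 :: "(nat \<Rightarrow> 'a::field) \<Rightarrow> 'a \<Rightarrow> nat \<Rightarrow> nat \<Rightarrow> 'a ^ 3 ^ 3" where
  "sigma2 \<zeta> s \<epsilon> \<epsilon>' = vector
     [vector [1, 1, 0], vector [1, -1, 0],
      vector [0, 0, s * (if \<epsilon> = 0 \<and> \<epsilon>' = 1 then \<zeta> 8 else \<zeta> 4 ^ \<epsilon>')]]"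

end

theory Submission
  imports Defs "HOL-Algebra.Group_Action"
begin

text \<open>
  An automorphism of \<open>Z\<^sup>d + L = 0\<close> fixes the unique outer Galois point \<open>(0:0:1)\<close>; comparing the
  coefficients of \<open>Z\<^bsup>d-1\<^esup>\<close>, it is block diagonal with blocks \<open>B\<close> and \<open>a\<close>, where \<open>L \<circ> B = a\<^sup>d L\<close>. So the
  reduced group is the stabilizer in \<open>PGL\<^sub>2\<close> of the square-free binary form \<open>L\<close>.

  The octahedral group \<open>O\<close> is represented by the 48 integral quaternions with coordinates in
  \<open>{-1, 0, 1}\<close> and norm 1, 2 or 4. A subgroup of \<open>PGL\<^sub>2\<close> isomorphic to \<open>S\<^sub>4\<close> normalizes a four-group;
  a conjugation brings the four-group into the standard form, whose normalizer is \<open>O\<close>. The invariant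
  \<open>S\<^sub>8\<^sup>3 / S\<^sub>6\<^sup>4\<close> separates the orbits of \<open>O\<close> on the projective line, hence a square-free form that
  is semi-invariant under \<open>O\<close> is a product of the forms \<open>S\<^sub>6\<close>, \<open>S\<^sub>1\<^sub>2\<close>, \<open>S\<^sub>8\<close> of the exceptional orbits and
  of the forms \<open>S\<^sub>2\<^sub>4 = S\<^sub>8\<^sup>3 + (a - 42) S\<^sub>6\<^sup>4\<close> of regular orbits. Conversely, the stabilizer of such a form
  is finite and contains \<open>O\<close>, and counting its orbits on the set of poles shows that its order is 24.

  An element \<open>q\<close> of the 48 multiplies such a form by \<open>\<plusminus>N(q)\<^bsup>d/2\<^esup>\<close>, with a sign that depends on
  \<open>\<epsilon> + \<epsilon>'\<close> and the norm modulo 3. This gives all lifts of \<open>O\<close> to the curve. The reduction modulo 3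
  identifies the 48 quaternions with \<open>GL\<^sub>2(F\<^sub>3)\<close> or \<open>CSU\<^sub>2(F\<^sub>3)\<close>, according to the choice of a square root
  of \<open>-2\<close> or of \<open>2\<close> as the factor of the quaternions of norm 2.
\<close>

section \<open>Binary forms as functions on the plane\<close>

text \<open>Forms enter as functions on K^2 and K^3: in characteristic 0 a form is determined by its
  values, so substitution is composition and divisibility is a matter of splitting off roots. Two
  obstacles shape the part on curves. \<open>Aut\<close> is defined by the point set of the curve,
  so a set-theoretic symmetry A must first be turned into an identity F o A = c F. And a
  K-equivalence may move (0:0:1); this has to be excluded before the two equations can be compared
  as binary forms. The central products arise from a uniform choice of lifts: a quaternion of norm 2
  gets a corner w that depends on the norm alone, and it is a lift if and only if w^d =
  (-1)^(\<epsilon>+\<epsilon>') 2^(d/2). Since d/2 has the parity of \<epsilon>, a root w of w^2 =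
  -2 serves for \<epsilon>' = 0, and one of w^2 = 2 for \<epsilon> = \<epsilon>' = 1. For \<epsilon>
  = 0 and \<epsilon>' = 1 neither value gives lifts; this is the case that the last clause leaves
  out.\<close>

definition bform :: "nat \<Rightarrow> ('a::field ^ 2 \<Rightarrow> 'a) \<Rightarrow> bool" where
  "bform d f \<longleftrightarrow> (\<exists>c. \<forall>v. f v = (\<Sum>i\<le>d. c i * v $ 1 ^ i * v $ 2 ^ (d - i)))"

text \<open>The determinant of the pair. As a function of its first argument it is the linear form
  whose only root on the projective line is \<open>p\<close>, hence the linear factor that is split
  off at a root.\<close>

definition wedge :: "'a::field ^ 2 \<Rightarrow> 'a ^ 2 \<Rightarrow> 'a" where
  "wedge v p = v $ 1 * p $ 2 - v $ 2 * p $ 1"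

lemma bform_add:
  assumes "bform d f" "bform d g" shows "bform d (\<lambda>v. f v + g v)"
proof -
  obtain a b where "\<forall>v. f v = (\<Sum>i\<le>d. a i * v $ 1 ^ i * v $ 2 ^ (d - i))"
    "\<forall>v. g v = (\<Sum>i\<le>d. b i * v $ 1 ^ i * v $ 2 ^ (d - i))"
    using assms unfolding bform_def by blast
  then have "\<forall>v. f v + g v = (\<Sum>i\<le>d. (a i + b i) * v $ 1 ^ i * v $ 2 ^ (d - i))"
    by (simp add: sum.distrib distrib_right)
  then show ?thesis unfolding bform_def by (intro exI[of _ "\<lambda>i. a i + b i"]) simp
qed

lemma bform_0: "bform d (\<lambda>v. 0)"
  unfolding bform_def by (intro exI[of _ "\<lambda>_. 0"]) simp

lemma bform_scale:
  assumes "bform d f" shows "bform d (\<lambda>v. k * f v)"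
proof -
  obtain a where "\<forall>v. f v = (\<Sum>i\<le>d. a i * v $ 1 ^ i * v $ 2 ^ (d - i))"
    using assms unfolding bform_def by blast
  then have "\<forall>v. k * f v = (\<Sum>i\<le>d. (k * a i) * v $ 1 ^ i * v $ 2 ^ (d - i))"
    by (simp add: sum_distrib_left mult.assoc)
  then show ?thesis unfolding bform_def by (intro exI[of _ "\<lambda>i. k * a i"]) simp
qed

lemma bform_sum:
  assumes "\<And>i. i \<in> I \<Longrightarrow> bform d (f i)" shows "bform d (\<lambda>v. \<Sum>i\<in>I. f i v)"
  using assms by (induction I rule: infinite_finite_induct) (auto simp: bform_0 bform_add)

lemma bform_monom:
  assumes "k \<le> d" shows "bform d (\<lambda>v. v $ 1 ^ k * v $ 2 ^ (d - k))"
  unfolding bform_def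
proof (intro exI allI)
  fix v :: "'a ^ 2"
  have "(\<Sum>i\<le>d. (if i = k then 1 else 0) * v $ 1 ^ i * v $ 2 ^ (d - i)) =
    (\<Sum>i\<le>d. if i = k then v $ 1 ^ i * v $ 2 ^ (d - i) else 0)"
    by (intro sum.cong) auto
  also have "\<dots> = v $ 1 ^ k * v $ 2 ^ (d - k)"
    using assms by (simp add: sum.delta)
  finally show "v $ 1 ^ k * v $ 2 ^ (d - k) = (\<Sum>i\<le>d. (if i = k then 1 else 0) * v $ 1 ^ i * v $ 2 ^ (d - i))"
    by simp
qed

lemma bform_mult:
  assumes "bform d f" "bform e g" shows "bform (d + e) (\<lambda>v. f v * g v)"
proof -
  obtain a b where ab: "\<forall>v. f v = (\<Sum>i\<le>d. a i * v $ 1 ^ i * v $ 2 ^ (d - i))"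
    "\<forall>v. g v = (\<Sum>i\<le>e. b i * v $ 1 ^ i * v $ 2 ^ (e - i))"
    using assms unfolding bform_def by blast
  have "(\<lambda>v. f v * g v) = (\<lambda>v. \<Sum>i\<le>d. \<Sum>j\<le>e. (a i * b j) * (v $ 1 ^ (i + j) * v $ 2 ^ (d + e - (i + j))))"
  proof
    fix v
    show "f v * g v = (\<Sum>i\<le>d. \<Sum>j\<le>e. (a i * b j) * (v $ 1 ^ (i + j) * v $ 2 ^ (d + e - (i + j))))"
      unfolding ab[rule_format] sum_product
    proof (intro sum.cong refl)
      fix i j assume "i \<in> {..d}" "j \<in> {..e}"
      then have "d + e - (i + j) = (d - i) + (e - j)" by auto
      then show "a i * v $ 1 ^ i * v $ 2 ^ (d - i) * (b j * v $ 1 ^ j * v $ 2 ^ (e - j)) =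
         a i * b j * (v $ 1 ^ (i + j) * v $ 2 ^ (d + e - (i + j)))"
        by (simp add: power_add)
    qed
  qed
  then show ?thesis
    by (auto intro!: bform_sum bform_scale bform_monom)
qed

lemma bform_const: "bform 0 (\<lambda>v. k)"
  unfolding bform_def by (intro exI[of _ "\<lambda>_. k"]) simp

lemma bform_linear: "bform 1 (\<lambda>v. a * v $ 1 + b * v $ 2)"
  unfolding bform_def by (intro exI[of _ "\<lambda>i. if i = 0 then b else a"]) (simp add: atMost_Suc)

lemma bform_power:
  assumes "bform d f" shows "bform (n * d) (\<lambda>v. f v ^ n)"
  by (induction n) (use assms bform_mult[OF assms] in \<open>auto simp: bform_const\<close>)

lemma bform_prod:
  assumes "\<And>i. i \<in> I \<Longrightarrow> bform d (f i)" "finite I" shows "bform (card I * d) (\<lambda>v. \<Prod>i\<in>I. f i v)"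
  using assms(2,1) by (induction I rule: finite_induct) (auto simp: bform_const bform_mult)

lemma bform_subst:
  assumes "bform d f" shows "bform d (\<lambda>v. f (B *v v))"
proof -
  obtain a where a: "\<forall>v. f v = (\<Sum>i\<le>d. a i * v $ 1 ^ i * v $ 2 ^ (d - i))"
    using assms unfolding bform_def by blast
  have lin: "bform 1 (\<lambda>v. (B *v v) $ k)" for k
    using bform_linear[of "B $ k $ 1" "B $ k $ 2"]
    by (simp add: matrix_vector_mult_def sum_2)
  have "bform d (\<lambda>v. a i * ((B *v v) $ 1 ^ i * (B *v v) $ 2 ^ (d - i)))" if "i \<le> d" for i
    using bform_scale[OF bform_mult[OF bform_power[OF lin, of i 1] bform_power[OF lin, of "d - i" 2]]] that
    by simp
  then have "bform d (\<lambda>v. \<Sum>i\<le>d. a i * ((B *v v) $ 1 ^ i * (B *v v) $ 2 ^ (d - i)))"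
    by (intro bform_sum) auto
  then show ?thesis using a by (simp add: mult.assoc)
qed

lemma bform_homogeneous:
  assumes "bform d f" shows "f (t *s v) = t ^ d * f v"
proof -
  obtain a where a: "\<forall>v. f v = (\<Sum>i\<le>d. a i * v $ 1 ^ i * v $ 2 ^ (d - i))"
    using assms unfolding bform_def by blast
  show ?thesis unfolding a[rule_format] sum_distrib_left
  proof (intro sum.cong refl)
    fix i assume "i \<in> {..d}"
    then have "t ^ d = t ^ i * t ^ (d - i)" by (simp flip: power_add)
    then show "a i * (t *s v) $ 1 ^ i * (t *s v) $ 2 ^ (d - i) = t ^ d * (a i * v $ 1 ^ i * v $ 2 ^ (d - i))"
      by (simp add: power_mult_distrib)
  qed
qed

lemma bform_poly_line:
  assumes "bform d f" shows "\<exists>r. \<forall>t. f (u + t *s w) = poly r t"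
proof -
  obtain a where a: "\<forall>v. f v = (\<Sum>i\<le>d. a i * v $ 1 ^ i * v $ 2 ^ (d - i))"
    using assms unfolding bform_def by blast
  show ?thesis
    by (intro exI[of _ "\<Sum>i\<le>d. [:a i:] * [:u $ 1, w $ 1:] ^ i * [:u $ 2, w $ 2:] ^ (d - i)"])
      (simp add: a poly_sum mult.assoc)
qed

text \<open>On the line through \<open>u\<close> and \<open>w\<close> both functions are polynomials
  in one variable, and these have no zero divisors. The parameter 0 is \<open>u\<close>, the
  parameter 1 is \<open>w\<close>.\<close>

lemma bform_cancel:
  fixes f g :: "'a::field_char_0 ^ 2 \<Rightarrow> 'a"
  assumes "bform d f" "bform e g" "\<And>v. f v * g v = 0" "f u \<noteq> 0"
  shows "g w = 0"
proof -
  obtain r where r: "\<forall>t. f (u + t *s (w - u)) = poly r t" using bform_poly_line[OF assms(1)] by blast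
  obtain q where q: "\<forall>t. g (u + t *s (w - u)) = poly q t" using bform_poly_line[OF assms(2)] by blast
  have "poly (r * q) t = 0" for t using assms(3) r q by (metis poly_mult)
  then have "r * q = 0" by (simp add: poly_all_0_iff_0[symmetric])
  moreover have "r \<noteq> 0" using r[rule_format, of 0] assms(4) by auto
  ultimately have "q = 0" by simp
  then show ?thesis using q[rule_format, of 1] by simp
qed

text \<open>Either the coefficient of X^d vanishes and (1:0) is a root, or Y = 1 leaves a polynomial
  of exact degree d.\<close>

lemma bform_root:
  fixes f :: "'a::alg_closed_field ^ 2 \<Rightarrow> 'a"
  assumes "bform d f" "d > 0" shows "\<exists>p. p \<noteq> 0 \<and> f p = 0"
proof -
  obtain a where a: "\<forall>v. f v = (\<Sum>i\<le>d. a i * v $ 1 ^ i * v $ 2 ^ (d - i))"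
    using assms unfolding bform_def by blast
  show ?thesis
  proof (cases "a d = 0")
    case True
    have "f (vector [1, 0]) = (\<Sum>i\<le>d. if i = d then a d else 0)"
      unfolding a[rule_format] by (intro sum.cong) auto
    then have "f (vector [1, 0]) = 0" using True by simp
    moreover have "(vector [1, 0] :: 'a ^ 2) \<noteq> 0" by (metis vector_2(1) zero_index zero_neq_one)
    ultimately show ?thesis by blast
  next
    case False
    then obtain x where "(\<Sum>k\<le>d. a k * x ^ k) = 0" using alg_closed[OF assms(2)] by blast
    then have "f (vector [x, 1]) = 0" unfolding a[rule_format] by simp
    moreover have "(vector [x, 1] :: 'a ^ 2) \<noteq> 0" by (metis vector_2(2) zero_index zero_neq_one)
    ultimately show ?thesis by blast
  qed
qed

section \<open>Explicit 2x2 matrices\<close>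

definition mat2 :: "'a \<Rightarrow> 'a \<Rightarrow> 'a \<Rightarrow> 'a \<Rightarrow> 'a::zero ^ 2 ^ 2" where
  "mat2 a b c d = vector [vector [a, b], vector [c, d]]"

lemma mat2_nth [simp]:
  "mat2 a b c d $ 1 $ 1 = a" "mat2 a b c d $ 1 $ 2 = b"
  "mat2 a b c d $ 2 $ 1 = c" "mat2 a b c d $ 2 $ 2 = d"
  by (simp_all add: mat2_def)

lemma mat2_eta: "B = mat2 (B $ 1 $ 1) (B $ 1 $ 2) (B $ 2 $ 1) (B $ 2 $ 2)"
  by (simp add: vec_eq_iff forall_2)

lemma mat2_cases: obtains a b c d where "B = mat2 a b c d"
  using mat2_eta by metis

lemma vec2_eq_iff: "(v :: 'a ^ 2) = w \<longleftrightarrow> v $ 1 = w $ 1 \<and> v $ 2 = w $ 2"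
  by (simp add: vec_eq_iff forall_2)

lemma mat2_eq_iff: "mat2 a b c d = mat2 a' b' c' d' \<longleftrightarrow> a = a' \<and> b = b' \<and> c = c' \<and> d = d'"
  by (auto simp: vec2_eq_iff)

lemma mat2_mult: "mat2 a b c d ** mat2 a' b' c' d' =
    mat2 (a * a' + b * c') (a * b' + b * d') (c * a' + d * c') (c * b' + d * d')"
  for a :: "'a::semiring_1"
  by (simp add: vec2_eq_iff matrix_matrix_mult_def sum_2)

lemma mat2_vec: "(mat2 a b c d *v v) $ 1 = a * v $ 1 + b * v $ 2"
  "(mat2 a b c d *v v) $ 2 = c * v $ 1 + d * v $ 2"
  for a :: "'a::semiring_1"
  by (simp_all add: matrix_vector_mult_def sum_2)

lemma det_mat2: "det (mat2 a b c d) = a * d - b * c"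
  by (simp add: det_2)

lemma mat_mat2: "mat k = mat2 k 0 0 k" for k :: "'a::zero"
  by (simp add: vec2_eq_iff mat_def)

lemma wedge_zero_iff:
  assumes "p \<noteq> 0" shows "wedge v p = 0 \<longleftrightarrow> (\<exists>t. v = t *s p)"
proof
  assume w: "wedge v p = 0"
  show "\<exists>t. v = t *s p"
  proof (cases "p $ 1 = 0")
    case True
    then have "p $ 2 \<noteq> 0" using assms by (auto simp: vec2_eq_iff)
    then show ?thesis using w True by (intro exI[of _ "v $ 2 / p $ 2"]) (auto simp: vec2_eq_iff wedge_def)
  next
    case False
    then show ?thesis using w by (intro exI[of _ "v $ 1 / p $ 1"]) (auto simp: vec2_eq_iff wedge_def field_simps)
  qed
qed (auto simp: wedge_def)

lemma bform_wedge: "bform 1 (\<lambda>v. wedge v p)"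
  using bform_linear[of "p $ 2" "- p $ 1"] by (simp add: wedge_def mult.commute)

text \<open>In coordinates that move the root to (1:0), vanishing there means that the pure power of
  the first coordinate is absent, so the second coordinate splits off.\<close>

lemma bform_factor:
  assumes f: "bform (Suc d) f" and p: "p \<noteq> 0" and fp: "f p = 0"
  shows "\<exists>g. bform d g \<and> (\<forall>v. f v = wedge v p * g v)"
proof -
  obtain q where q: "wedge p q \<noteq> 0"
  proof (cases "p $ 1 = 0")
    case True
    then show ?thesis using p that[of "vector [1, 0]"] by (auto simp: wedge_def vec2_eq_iff)
  next
    case False
    then show ?thesis using p that[of "vector [0, 1]"] by (auto simp: wedge_def vec2_eq_iff)
  qed
  \<comment> \<open>The columns are \<open>p\<close> and \<open>q\<close>, so (1,0) is sent to
    \<open>p\<close>; \<open>Q\<close> is the inverse. Its second coordinate function is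
    \<open>wedge v p\<close> times -1/k, which is where the constant in the cofactor comes
    from.\<close>
  define P where "P = mat2 (p $ 1) (q $ 1) (p $ 2) (q $ 2)"
  define k where "k = wedge p q"
  define Q where "Q = mat2 (q $ 2 / k) (- q $ 1 / k) (- p $ 2 / k) (p $ 1 / k)"
  have k: "k \<noteq> 0" "k = p $ 1 * q $ 2 - p $ 2 * q $ 1" using q by (auto simp: k_def wedge_def)
  have PQ: "P *v (Q *v v) = v" for v
    using k(1) unfolding P_def Q_def vec2_eq_iff mat2_vec
    by (simp add: field_simps) (simp add: k(2) algebra_simps)
  have "bform (Suc d) (\<lambda>v. f (P *v v))" using bform_subst[OF f] .
  then obtain a where a: "\<forall>v. f (P *v v) = (\<Sum>i\<le>Suc d. a i * v $ 1 ^ i * v $ 2 ^ (Suc d - i))"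
    unfolding bform_def by blast
  have "P *v vector [1, 0] = p" by (simp add: P_def vec2_eq_iff mat2_vec)
  then have "0 = (\<Sum>i\<le>Suc d. if i = Suc d then a (Suc d) else 0)"
    using a[rule_format, of "vector [1,0]"] fp by (auto intro!: sum.cong simp: power_0_left)
  then have a0: "a (Suc d) = 0" by simp
  define h where "h v = (\<Sum>i\<le>d. a i * v $ 1 ^ i * v $ 2 ^ (d - i))" for v :: "'a ^ 2"
  have fh: "f (P *v v) = v $ 2 * h v" for v
  proof -
    have "f (P *v v) = (\<Sum>i\<le>d. a i * v $ 1 ^ i * v $ 2 ^ (Suc d - i))" using a a0 by simp
    also have "\<dots> = v $ 2 * h v" unfolding h_def sum_distrib_left
      by (intro sum.cong refl) (simp add: Suc_diff_le)
    finally show ?thesis .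
  qed
  have "bform d h" unfolding bform_def h_def by blast
  then have "bform d (\<lambda>v. - (1 / k) * h (Q *v v))" by (intro bform_scale bform_subst)
  moreover have "f v = wedge v p * (- (1 / k) * h (Q *v v))" for v
  proof -
    have "f v = (Q *v v) $ 2 * h (Q *v v)" using fh[of "Q *v v"] by (simp add: PQ)
    moreover have "(Q *v v) $ 2 = - (1 / k) * wedge v p"
      using k(1) by (simp add: Q_def mat2_vec wedge_def field_simps)
    ultimately show ?thesis by simp
  qed
  ultimately show ?thesis by blast
qed

section \<open>Square-free forms, divisibility and roots\<close>

text \<open>The degree of the cofactor is left open, which saves bookkeeping. As \<open>M\<close>
  may be zero, the zero function is not square-free.\<close>

definition sqfree :: "('a::field ^ 2 \<Rightarrow> 'a) \<Rightarrow> bool" where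
  "sqfree f \<longleftrightarrow> (\<forall>p M e. p \<noteq> 0 \<longrightarrow> bform e M \<longrightarrow> \<not> (\<forall>v. f v = wedge v p ^ 2 * M v))"

lemma sqfreeD:
  assumes "sqfree f" "p \<noteq> 0" "bform e M" "\<And>v. f v = wedge v p ^ 2 * M v" shows False
  using assms unfolding sqfree_def by blast

lemma sqfree_nonzero: "sqfree f \<Longrightarrow> \<exists>v. f v \<noteq> 0"
  using sqfreeD[of f "vector [1,0]" 0 "\<lambda>v. 0"] bform_0
  by (metis mult_zero_right vector_2(1) zero_index zero_neq_one)

lemma sqfree_mult_left:
  assumes "sqfree (\<lambda>v. f v * g v)" "bform d f" shows "sqfree g"
  unfolding sqfree_def
proof (intro allI impI notI)
  fix p M e assume "p \<noteq> 0" "bform e M" "\<forall>v. g v = (wedge v p)\<^sup>2 * M v"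
  then show False using sqfreeD[OF assms(1), of p _ "\<lambda>v. f v * M v"] bform_mult[OF assms(2)]
    by (metis mult.left_commute)
qed

lemma sqfree_no_common_root:
  assumes "sqfree (\<lambda>v. f v * g v)" "bform d f" "bform e g" "p \<noteq> 0" "f p = 0" "g p = 0" shows False
proof -
  have d: "d \<noteq> 0"
  proof
    assume "d = 0"
    then have "f v = 0" for v using assms(2,5) unfolding bform_def by auto
    then show False using sqfree_nonzero[OF assms(1)] by simp
  qed
  have e: "e \<noteq> 0"
  proof
    assume "e = 0"
    then have "g v = 0" for v using assms(3,6) unfolding bform_def by auto
    then show False using sqfree_nonzero[OF assms(1)] by simp
  qed
  obtain d' e' where "d = Suc d'" "e = Suc e'" using d e by (metis not0_implies_Suc)
  then obtain f' g' where "bform d' f'" "\<forall>v. f v = wedge v p * f' v"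
      "bform e' g'" "\<forall>v. g v = wedge v p * g' v"
    using bform_factor assms by metis
  then have "bform (d' + e') (\<lambda>v. f' v * g' v)" "\<And>v. f v * g v = (wedge v p)\<^sup>2 * (f' v * g' v)"
    by (simp_all add: bform_mult power2_eq_square)
  then show False using sqfreeD[OF assms(1,4)] by blast
qed

text \<open>Induction on the degree of \<open>f\<close>: a common linear factor is removed from
  both. Because \<open>f\<close> is square-free, the remaining roots of \<open>f'\<close> differ
  from the removed one, so they are still roots of the quotient of \<open>L\<close>.\<close>

lemma bform_dvd:
  fixes f L :: "'a::{alg_closed_field,field_char_0} ^ 2 \<Rightarrow> 'a"
  assumes "bform m f" "bform d L" "sqfree f" "\<exists>v. L v \<noteq> 0" "\<And>p. p \<noteq> 0 \<Longrightarrow> f p = 0 \<Longrightarrow> L p = 0"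
  shows "m \<le> d \<and> (\<exists>g. bform (d - m) g \<and> (\<forall>v. L v = f v * g v))"
  using assms
proof (induction m arbitrary: f d L)
  case 0
  obtain k where k: "f v = k" for v using 0(1) unfolding bform_def by auto
  have "k \<noteq> 0" using sqfree_nonzero[OF 0(3)] k by auto
  then show ?case using bform_scale[OF 0(2), of "inverse k"] k
    by (intro conjI exI[of _ "\<lambda>v. inverse k * L v"]) auto
next
  case (Suc m)
  obtain p where p: "p \<noteq> 0" "f p = 0" using bform_root[OF Suc.prems(1)] by auto
  obtain f' where f': "bform m f'" "\<And>v. f v = wedge v p * f' v" using bform_factor[OF Suc.prems(1) p] by auto
  have Lp: "L p = 0" using Suc.prems(5) p by blast
  have "d \<noteq> 0"
  proof
    assume "d = 0"
    then have "L v = 0" for v using Suc.prems(2) Lp unfolding bform_def by auto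
    then show False using Suc.prems(4) by simp
  qed
  then obtain d' where d: "d = Suc d'" by (cases d) auto
  then obtain L' where L': "bform d' L'" "\<And>v. L v = wedge v p * L' v"
    using bform_factor Suc.prems(2) p(1) Lp by metis
  have ff: "f = (\<lambda>v. wedge v p * f' v)" using f'(2) by auto
  have sq: "sqfree f'" using sqfree_mult_left[OF _ bform_wedge] Suc.prems(3) ff by metis
  have ex: "\<exists>v. L' v \<noteq> 0" using Suc.prems(4) L'(2) by auto
  have roots: "L' q = 0" if q: "q \<noteq> 0" "f' q = 0" for q
  proof -
    have "wedge q p \<noteq> 0"
      using sqfree_no_common_root[OF Suc.prems(3)[unfolded ff] bform_wedge f'(1) q(1) _ q(2)] by blast
    moreover have "L q = 0" using Suc.prems(5)[OF q(1)] f'(2) q(2) by simp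
    ultimately show ?thesis using L'(2) by simp
  qed
  obtain g where g: "m \<le> d'" "bform (d' - m) g" "\<forall>v. L' v = f' v * g v"
    using Suc.IH[OF f'(1) L'(1) sq ex roots] by blast
  then show ?case using d f'(2) L'(2) by (intro conjI exI[of _ g]) auto
qed

text \<open>A point of the projective line, as the set of its homogeneous coordinate vectors;
  without the origin, proportional vectors give equal sets and matrices act by taking
  images.\<close>

definition line :: "'a::field ^ 2 \<Rightarrow> ('a ^ 2) set" where
  "line p = {t *s p | t. t \<noteq> 0}"

lemma line_eq_iff:
  assumes "p \<noteq> 0" "q \<noteq> 0" shows "line p = line q \<longleftrightarrow> wedge p q = 0"
proof
  assume "line p = line q"
  moreover have "p \<in> line p" unfolding line_def by (rule CollectI, rule exI[of _ 1], simp)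
  ultimately show "wedge p q = 0" by (auto simp: line_def wedge_def)
next
  assume "wedge p q = 0"
  then obtain t where t: "p = t *s q" using wedge_zero_iff assms(2) by blast
  then have "t \<noteq> 0" using assms(1) by auto
  have "line p \<subseteq> line q"
  proof
    fix v assume "v \<in> line p"
    then obtain s where "s \<noteq> 0" "v = s *s p" unfolding line_def by blast
    then show "v \<in> line q" using t \<open>t \<noteq> 0\<close>
      by (auto simp: line_def vector_smult_assoc intro!: exI[of _ "s * t"])
  qed
  moreover have "line q \<subseteq> line p"
  proof
    fix v assume "v \<in> line q"
    then obtain s where "s \<noteq> 0" "v = s *s q" unfolding line_def by blast
    then show "v \<in> line p" using t \<open>t \<noteq> 0\<close>
      by (auto simp: line_def vector_smult_assoc intro!: exI[of _ "s / t"])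
  qed
  ultimately show "line p = line q" by blast
qed

lemma finite_root_lines:
  assumes "bform d f" "\<exists>v. f v \<noteq> 0" shows "finite {line p | p. p \<noteq> 0 \<and> f p = 0}"
  using assms
proof (induction d arbitrary: f)
  case 0
  then have "f p \<noteq> 0" for p unfolding bform_def by auto
  then show ?case by simp
next
  case (Suc d)
  show ?case
  proof (cases "\<exists>p. p \<noteq> 0 \<and> f p = 0")
    case False
    then have "{line p | p. p \<noteq> 0 \<and> f p = 0} = {}" by auto
    then show ?thesis by (simp only: finite.emptyI)
  next
    case True
    then obtain p g where p: "p \<noteq> 0" "f p = 0" "bform d g" "\<forall>v. f v = wedge v p * g v"
      using bform_factor[OF Suc.prems(1)] by blast
    have "\<exists>v. g v \<noteq> 0" using Suc.prems(2) p(4) by auto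
    then have "finite {line q | q. q \<noteq> 0 \<and> g q = 0}" using Suc.IH p(3) by blast
    moreover have "{line q | q. q \<noteq> 0 \<and> f q = 0} \<subseteq> insert (line p) {line q | q. q \<noteq> 0 \<and> g q = 0}"
      using p(1,4) line_eq_iff by fastforce
    ultimately show ?thesis by (meson finite_insert finite_subset)
  qed
qed

text \<open>A projectivity is determined by the images of three points; these roots will bound the
  stabilizer of \<open>f\<close>.\<close>

lemma sqfree_three_roots:
  fixes f :: "'a::{alg_closed_field,field_char_0} ^ 2 \<Rightarrow> 'a"
  assumes "bform d f" "sqfree f" "d \<ge> 3"
  shows "\<exists>p q r. p \<noteq> 0 \<and> q \<noteq> 0 \<and> r \<noteq> 0 \<and> f p = 0 \<and> f q = 0 \<and> f r = 0 \<and>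
    wedge p q \<noteq> 0 \<and> wedge p r \<noteq> 0 \<and> wedge q r \<noteq> 0"
proof -
  obtain k where d: "d = Suc (Suc (Suc k))"
    using assms(3) that[of "d - 3"] by simp
  obtain p where p: "p \<noteq> 0" "f p = 0" using bform_root[OF assms(1)] d by auto
  obtain g where g: "bform (Suc (Suc k)) g" "\<And>v. f v = wedge v p * g v" using bform_factor p assms(1) d by metis
  have ff: "f = (\<lambda>v. wedge v p * g v)" using g(2) by auto
  have sg: "sqfree g" using sqfree_mult_left[OF _ bform_wedge] assms(2) ff by metis
  obtain q where q: "q \<noteq> 0" "g q = 0" using bform_root[OF g(1)] by auto
  obtain h where h: "bform (Suc k) h" "\<And>v. g v = wedge v q * h v" using bform_factor q g(1) by metis
  have gg: "g = (\<lambda>v. wedge v q * h v)" using h(2) by auto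
  obtain r where r: "r \<noteq> 0" "h r = 0" using bform_root[OF h(1)] by auto
  have gr: "g r = 0" using h r by simp
  have "wedge q p \<noteq> 0"
    using sqfree_no_common_root[OF assms(2)[unfolded ff] bform_wedge g(1) q(1) _ q(2)] by blast
  moreover have "wedge r p \<noteq> 0"
    using sqfree_no_common_root[OF assms(2)[unfolded ff] bform_wedge g(1) r(1) _ gr] by blast
  moreover have "wedge r q \<noteq> 0"
    using sqfree_no_common_root[OF sg[unfolded gg] bform_wedge h(1) r(1) _ r(2)] by blast
  moreover have "f q = 0" "f r = 0" using g(2)[of q] g(2)[of r] q(2) gr by simp_all
  moreover have "wedge p q = - wedge q p" "wedge p r = - wedge r p" "wedge q r = - wedge r q"
    by (simp_all add: wedge_def algebra_simps)
  ultimately show ?thesis using p q(1) r(1)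
    by (intro exI[of _ p] exI[of _ q] exI[of _ r]) simp
qed

section \<open>Evaluation of ternary forms\<close>

lemma prod_3: "prod f (UNIV :: 3 set) = f 1 * f 2 * f 3"
  unfolding UNIV_3 by (simp add: ac_simps)

definition monom_val :: "(3 \<Rightarrow>\<^sub>0 nat) \<Rightarrow> 'a::comm_ring_1 ^ 3 \<Rightarrow> 'a" where
  "monom_val m v = (\<Prod>i\<in>UNIV. (v $ i) ^ Poly_Mapping.lookup m i)"

lemma monom_val_add: "monom_val (m + n) v = monom_val m v * monom_val n v"
  by (simp add: monom_val_def lookup_add power_add prod.distrib)

lemma monom_val_0 [simp]: "monom_val 0 v = 1"
  by (simp add: monom_val_def)

lemma monom_val_single: "monom_val (Poly_Mapping.single i 1) v = v $ i"
proof -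
  have "monom_val (Poly_Mapping.single i 1) v = (\<Prod>j\<in>UNIV. if j = i then v $ i else 1)"
    unfolding monom_val_def by (intro prod.cong) (auto simp: lookup_single)
  then show ?thesis by simp
qed

lemma eval_form_superset:
  assumes "finite S" "Poly_Mapping.keys F \<subseteq> S"
  shows "eval_form F v = (\<Sum>m\<in>S. Poly_Mapping.lookup F m * monom_val m v)"
  unfolding eval_form_def monom_val_def
  using assms by (intro sum.mono_neutral_left) (auto simp: in_keys_iff)

lemma eval_form_add [simp]: "eval_form (F + G) v = eval_form F v + eval_form G v"
proof -
  let ?S = "Poly_Mapping.keys F \<union> Poly_Mapping.keys G"
  have "finite ?S" "Poly_Mapping.keys (F + G) \<subseteq> ?S" by (auto simp: keys_add)
  then show ?thesis
    by (simp add: eval_form_superset[of ?S] lookup_add distrib_right sum.distrib)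
qed

lemma eval_form_0 [simp]: "eval_form 0 v = 0"
  by (simp add: eval_form_def)

lemma eval_form_single: "eval_form (Poly_Mapping.single m c) v = c * monom_val m v"
  by (subst eval_form_superset[of "{m}"]) (auto simp: lookup_single)

lemma eval_form_sum [simp]: "eval_form (sum F I) v = (\<Sum>i\<in>I. eval_form (F i) v)"
  by (induction I rule: infinite_finite_induct) auto

lemma sum_of_monomials: "F = (\<Sum>m\<in>Poly_Mapping.keys F. Poly_Mapping.single m (Poly_Mapping.lookup F m))"
  by (rule poly_mapping_eqI) (simp add: lookup_sum lookup_single when_def in_keys_iff)

lemma eval_form_mult [simp]: "eval_form (F * G) v = eval_form F v * eval_form G v"
proof -
  have "eval_form (F * G) v = eval_form ((\<Sum>m\<in>Poly_Mapping.keys F. Poly_Mapping.single m (Poly_Mapping.lookup F m)) *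
      (\<Sum>m\<in>Poly_Mapping.keys G. Poly_Mapping.single m (Poly_Mapping.lookup G m))) v"
    by (simp flip: sum_of_monomials)
  also have "\<dots> = eval_form F v * eval_form G v"
    unfolding sum_product eval_form_sum mult_single eval_form_single monom_val_add
      eval_form_superset[OF finite_keys order_refl, of F] eval_form_superset[OF finite_keys order_refl, of G]
    by (simp add: mult_ac)
  finally show ?thesis .
qed

lemma eval_form_Const [simp]: "eval_form (Const c) v = c"
  by (simp add: Const_def eval_form_single)

lemma eval_form_1 [simp]: "eval_form 1 v = 1"
  using eval_form_Const[of 1] by (simp add: Const_def)

lemma eval_form_Var [simp]: "eval_form (Var i) v = v $ i"
  by (simp add: Var_def eval_form_single monom_val_single[simplified])

lemma eval_form_power [simp]: "eval_form (F ^ n) v = eval_form F v ^ n"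
  by (induction n) auto

lemma eval_form_prod [simp]: "eval_form (prod F I) v = (\<Prod>i\<in>I. eval_form (F i) v)"
  by (induction I rule: infinite_finite_induct) auto

lemma eval_form_uminus [simp]: "eval_form (- F) v = - eval_form F v"
  using eval_form_add[of F "- F" v] by (simp add: eq_neg_iff_add_eq_0 add.commute)

lemma eval_form_diff [simp]: "eval_form (F - G) v = eval_form F v - eval_form G v"
  using eval_form_add[of F "- G" v] by simp

lemma eval_lin_form [simp]: "eval_form (lin_form a) v = (\<Sum>j\<in>UNIV. a $ j * v $ j)"
  by (simp add: lin_form_def)

lemma eval_subst_form [simp]: "eval_form (subst_form A F) v = eval_form F (A *v v)"
  by (simp add: subst_form_def eval_form_def[of F] matrix_vector_mult_def)

text \<open>Kronecker substitution: at (t, t^N, t^(N*N)) the monomial \<open>m\<close> becomes t^(e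
  m), where \<open>e m\<close> has the exponents as its digits in base \<open>N\<close>. As
  \<open>N\<close> exceeds every exponent that occurs, distinct monomials stay distinct and the
  coefficients can be read off a polynomial in one variable.\<close>

lemma eval_form_eq_0:
  fixes F :: "'a::field_char_0 form"
  assumes "\<And>v. eval_form F v = 0" shows "F = 0"
proof -
  define N where "N = Suc (\<Sum>m\<in>Poly_Mapping.keys F. \<Sum>i\<in>UNIV. Poly_Mapping.lookup m i)"
  define e where "e m = Poly_Mapping.lookup m 1 + N * (Poly_Mapping.lookup m 2 + N * Poly_Mapping.lookup m 3)"
    for m :: "3 \<Rightarrow>\<^sub>0 nat"
  have less: "Poly_Mapping.lookup m i < N" if "m \<in> Poly_Mapping.keys F" for m i
  proof -
    have "Poly_Mapping.lookup m i \<le> (\<Sum>i\<in>UNIV. Poly_Mapping.lookup m i)" by (intro member_le_sum) auto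
    also have "\<dots> \<le> (\<Sum>m\<in>Poly_Mapping.keys F. \<Sum>i\<in>UNIV. Poly_Mapping.lookup m i)"
      using that by (intro member_le_sum) auto
    finally show ?thesis by (simp add: N_def)
  qed
  have digit: "a = a' \<and> b = b'" if "a < N" "a' < N" "a + N * b = a' + N * b'" for a a' b b'
  proof -
    have "(a + N * b) mod N = a" "(a' + N * b') mod N = a'" using that(1,2) by simp_all
    then have "a = a'" using that(3) by simp
    then have "N * b = N * b'" using that(3) by simp
    then show ?thesis using \<open>a = a'\<close> by (simp add: N_def del: mult_Suc mult_Suc_right)
  qed
  have inj: "m = m'" if "m \<in> Poly_Mapping.keys F" "m' \<in> Poly_Mapping.keys F" "e m = e m'" for m m'
  proof -
    have 1: "Poly_Mapping.lookup m 1 = Poly_Mapping.lookup m' 1"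
      "Poly_Mapping.lookup m 2 + N * Poly_Mapping.lookup m 3 = Poly_Mapping.lookup m' 2 + N * Poly_Mapping.lookup m' 3"
      using digit[OF less[OF that(1)] less[OF that(2)]] that(3) unfolding e_def by blast+
    have "Poly_Mapping.lookup m 2 = Poly_Mapping.lookup m' 2 \<and> Poly_Mapping.lookup m 3 = Poly_Mapping.lookup m' 3"
      using digit[OF less[OF that(1)] less[OF that(2)] 1(2)] .
    then have "\<forall>i. Poly_Mapping.lookup m i = Poly_Mapping.lookup m' i" using 1(1) unfolding forall_3 by simp
    then show ?thesis by (simp add: poly_mapping_eqI)
  qed
  define p where "p = (\<Sum>m\<in>Poly_Mapping.keys F. Polynomial.monom (Poly_Mapping.lookup F m) (e m))"
  have "poly p t = eval_form F (vector [t, t ^ N, t ^ (N * N)])" for t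
    unfolding p_def eval_form_def poly_sum poly_monom e_def
    by (intro sum.cong) (simp_all add: prod_3 power_add power_mult distrib_left mult_ac)
  then have "p = 0" using assms by (simp add: poly_all_0_iff_0[symmetric])
  have "Poly_Mapping.lookup F m = 0" if m: "m \<in> Poly_Mapping.keys F" for m
  proof -
    have "poly.coeff p (e m) = (\<Sum>m'\<in>Poly_Mapping.keys F. if m' = m then Poly_Mapping.lookup F m else 0)"
      unfolding p_def coeff_sum coeff_monom using inj m by (intro sum.cong) auto
    then show ?thesis using m \<open>p = 0\<close> by simp
  qed
  then have "Poly_Mapping.lookup F m = 0" for m by (cases "m \<in> Poly_Mapping.keys F") (auto simp: in_keys_iff)
  then show ?thesis by (intro poly_mapping_eqI) simp
qed

lemma eval_form_inject:
  fixes F G :: "'a::field_char_0 form"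
  assumes "\<And>v. eval_form F v = eval_form G v" shows "F = G"
  using eval_form_eq_0[of "F - G"] assms by simp

lemma vec3_eq_iff: "(v :: 'a ^ 3) = w \<longleftrightarrow> v $ 1 = w $ 1 \<and> v $ 2 = w $ 2 \<and> v $ 3 = w $ 3"
  by (simp add: vec_eq_iff forall_3)

lemma eval_binary_form:
  assumes "binary_form d L"
  shows "eval_form L v = eval_form L (vector [v $ 1, v $ 2, 0])"
  unfolding eval_form_def
proof (intro sum.cong refl)
  fix m assume "m \<in> Poly_Mapping.keys L"
  then have "Poly_Mapping.lookup m 3 = 0" using assms unfolding binary_form_def by blast
  then show "Poly_Mapping.lookup L m * (\<Prod>i\<in>UNIV. (v $ i) ^ Poly_Mapping.lookup m i) =
    Poly_Mapping.lookup L m * (\<Prod>i\<in>UNIV. (vector [v $ 1, v $ 2, 0] $ i) ^ Poly_Mapping.lookup m i)"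
    by (simp add: prod_3)
qed

section \<open>Restriction to the line Z = 0, and what smoothness means for it\<close>

definition restr :: "'a::field form \<Rightarrow> 'a ^ 2 \<Rightarrow> 'a" where
  "restr L v = eval_form L (vector [v $ 1, v $ 2, 0])"

lemma eval_binary_restr:
  assumes "binary_form d L"
  shows "eval_form L v = restr L (vector [v $ 1, v $ 2])"
  using eval_binary_form[OF assms] by (simp add: restr_def)

lemma bform_restr:
  assumes "binary_form d L" shows "bform d (restr L)"
proof -
  have "bform d (\<lambda>v. Poly_Mapping.lookup L m * monom_val m (vector [v $ 1, v $ 2, 0]))"
    if m: "m \<in> Poly_Mapping.keys L" for m
  proof -
    have 3: "Poly_Mapping.lookup m 3 = 0" and s: "(\<Sum>i\<in>UNIV. Poly_Mapping.lookup m i) = d"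
      using assms m unfolding binary_form_def homogeneous_def by blast+
    have s: "Poly_Mapping.lookup m 1 + Poly_Mapping.lookup m 2 = d" using s 3 by (simp add: sum_3)
    then have "Poly_Mapping.lookup m 2 = d - Poly_Mapping.lookup m 1" by simp
    then have "monom_val m (vector [v $ 1, v $ 2, 0]) =
        v $ 1 ^ Poly_Mapping.lookup m 1 * v $ 2 ^ (d - Poly_Mapping.lookup m 1)" for v :: "'a ^ 2"
      using 3 by (simp add: monom_val_def prod_3)
    moreover have "Poly_Mapping.lookup m 1 \<le> d" using s by simp
    ultimately show ?thesis using bform_scale[OF bform_monom] by simp
  qed
  then have "bform d (\<lambda>v. \<Sum>m\<in>Poly_Mapping.keys L. Poly_Mapping.lookup L m * monom_val m (vector [v $ 1, v $ 2, 0]))"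
    by (intro bform_sum)
  moreover have "restr L = (\<lambda>v. \<Sum>m\<in>Poly_Mapping.keys L. Poly_Mapping.lookup L m * monom_val m (vector [v $ 1, v $ 2, 0]))"
    by (rule ext) (simp add: restr_def eval_form_def monom_val_def)
  ultimately show ?thesis by simp
qed

lemma coeff_1_linear_power: "poly.coeff ([:a, 1:] ^ k) 1 = of_nat k * a ^ (k - 1)"
  for a :: "'a::field_char_0"
proof -
  have "poly.coeff ([:a, 1:] ^ k) 1 = poly (pderiv ([:a, 1:] ^ k)) 0"
    by (simp add: poly_0_coeff_0 coeff_pderiv)
  also have "\<dots> = of_nat k * a ^ (k - 1)"
    by (simp add: pderiv_power pderiv_pCons)
  finally show ?thesis .
qed

text \<open>Identifies the value of the formal partial derivative with the linear coefficient of
  \<open>F\<close> along a coordinate direction; singular points can then be found by restricting to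
  lines.\<close>

lemma eval_partial_deriv:
  fixes F :: "'a::field_char_0 form"
  shows "\<exists>r. (\<forall>t. eval_form F (\<chi> j. if j = i then v $ i + t else v $ j) = poly r t) \<and>
    poly.coeff r 1 = eval_form (partial_deriv i F) v"
proof -
  define c where "c m = Poly_Mapping.lookup F m * (\<Prod>j\<in>UNIV - {i}. (v $ j) ^ Poly_Mapping.lookup m j)" for m
  define r where "r = (\<Sum>m\<in>Poly_Mapping.keys F. Polynomial.smult (c m) ([:v $ i, 1:] ^ Poly_Mapping.lookup m i))"
  have split: "prod f UNIV = f i * prod f (UNIV - {i})" for f :: "3 \<Rightarrow> 'a"
    by (simp add: prod.remove)
  have "eval_form F (\<chi> j. if j = i then v $ i + t else v $ j) = poly r t" for t
    unfolding r_def poly_sum eval_form_def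
    by (intro sum.cong refl) (subst split, simp add: c_def poly_power mult_ac)
  moreover have "poly.coeff r 1 = eval_form (partial_deriv i F) v"
    unfolding r_def partial_deriv_def eval_form_sum eval_form_single coeff_sum coeff_smult coeff_1_linear_power
  proof (intro sum.cong refl)
    fix m
    have "monom_val (m - Poly_Mapping.single i 1) v = v $ i ^ (Poly_Mapping.lookup m i - 1) *
        (\<Prod>j\<in>UNIV - {i}. (v $ j) ^ Poly_Mapping.lookup m j)"
      unfolding monom_val_def by (subst split) (auto simp: lookup_minus lookup_single intro!: prod.cong)
    then show "c m * (of_nat (Poly_Mapping.lookup m i) * v $ i ^ (Poly_Mapping.lookup m i - 1)) =
      of_nat (Poly_Mapping.lookup m i) * Poly_Mapping.lookup F m * monom_val (m - Poly_Mapping.single i 1) v"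
      by (simp add: c_def mult_ac)
  qed
  ultimately show ?thesis by blast
qed

text \<open>A double root p of the binary form makes (p,0) a singular point of the curve: along X
  and Y the equation is divisible by t^2 because of the double factor, along Z because of t^d with d
  at least 2.\<close>

lemma smooth_sqfree:
  fixes L :: "'a::field_char_0 form"
  assumes d: "d \<ge> 2" and L: "binary_form d L" and sm: "smooth_plane_curve d (Var 3 ^ d + L)"
  shows "sqfree (restr L)"
  unfolding sqfree_def
proof (intro allI impI notI)
  fix p :: "'a ^ 2" and M e
  assume p: "p \<noteq> 0" and M: "bform e M" and eq: "\<forall>v. restr L v = (wedge v p)\<^sup>2 * M v"
  define F where "F = Var 3 ^ d + L"
  have ev: "eval_form F v = v $ 3 ^ d + restr L (vector [v $ 1, v $ 2])" for v
    by (simp add: F_def eval_binary_restr[OF L, of v])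
  define w where "w = (vector [p $ 1, p $ 2, 0] :: 'a ^ 3)"
  have pp: "vector [p $ 1, p $ 2] = p" by (simp add: vec2_eq_iff)
  have rp: "restr L p = 0" using eq by (simp add: wedge_def mult.commute)
  have "w \<noteq> 0" using p by (auto simp: w_def vec2_eq_iff vec3_eq_iff)
  moreover have "eval_form F w = 0" using d rp by (simp add: ev w_def pp)
  ultimately have "w \<in> curve_cone F" by (simp add: curve_cone_def)
  then obtain i where i: "eval_form (partial_deriv i F) w \<noteq> 0"
    using sm unfolding smooth_plane_curve_def F_def by blast
  obtain r where r: "\<And>t. eval_form F (\<chi> j. if j = i then w $ i + t else w $ j) = poly r t"
    "poly.coeff r 1 = eval_form (partial_deriv i F) w"
    using eval_partial_deriv[of F i w] by blast
  have double: "poly.coeff r 1 = 0" if "\<And>t. poly r t = t ^ 2 * poly q t" for q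
  proof -
    have "poly r t = poly ([:0, 0, 1:] * q) t" for t using that by (simp add: power2_eq_square)
    then have "r = [:0, 0, 1:] * q" by (metis poly_eq_poly_eq_iff ext)
    then show ?thesis by simp
  qed
  consider "i = 1" | "i = 2" | "i = 3" using exhaust_3 by blast
  then show False
  proof cases
    case 1
    obtain q where q: "\<forall>t. M (p + t *s vector [1, 0]) = poly q t" using bform_poly_line[OF M] by blast
    have "poly r t = t ^ 2 * poly (Polynomial.smult ((p $ 2)\<^sup>2) q) t" for t
    proof -
      have "poly r t = restr L (vector [p $ 1 + t, p $ 2])" using d by (simp add: r(1)[symmetric] ev 1 w_def)
      also have "vector [p $ 1 + t, p $ 2] = p + t *s vector [1, 0]" by (simp add: vec2_eq_iff)
      finally show ?thesis using q eq by (simp add: wedge_def algebra_simps power2_eq_square)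
    qed
    then show False using double r(2) i by metis
  next
    case 2
    obtain q where q: "\<forall>t. M (p + t *s vector [0, 1]) = poly q t" using bform_poly_line[OF M] by blast
    have "poly r t = t ^ 2 * poly (Polynomial.smult ((p $ 1)\<^sup>2) q) t" for t
    proof -
      have "poly r t = restr L (vector [p $ 1, p $ 2 + t])" using d by (simp add: r(1)[symmetric] ev 2 w_def)
      also have "vector [p $ 1, p $ 2 + t] = p + t *s vector [0, 1]" by (simp add: vec2_eq_iff)
      finally show ?thesis using q eq by (simp add: wedge_def algebra_simps power2_eq_square)
    qed
    then show False using double r(2) i by metis
  next
    case 3
    have "poly r t = t ^ 2 * poly (Polynomial.monom 1 (d - 2)) t" for t
    proof -
      have "t ^ d = t ^ 2 * t ^ (d - 2)" using d by (simp only: power_add[symmetric] le_add_diff_inverse)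
      then show ?thesis using rp by (simp add: r(1)[symmetric] ev 3 w_def pp poly_monom)
    qed
    then show False using double r(2) i by metis
  qed
qed

section \<open>The octahedral group in the integral quaternions\<close>

type_synonym quat = "int \<times> int \<times> int \<times> int"

fun qmul :: "quat \<Rightarrow> quat \<Rightarrow> quat" where
  "qmul (a, b, c, d) (a', b', c', d') =
    (a * a' - b * b' - c * c' - d * d', a * b' + b * a' + c * d' - d * c',
     a * c' - b * d' + c * a' + d * b', a * d' + b * c' - c * b' + d * a')"

fun qscale :: "int \<Rightarrow> quat \<Rightarrow> quat" where
  "qscale k (a, b, c, d) = (k * a, k * b, k * c, k * d)"

fun qnorm :: "quat \<Rightarrow> int" where
  "qnorm (a, b, c, d) = a * a + b * b + c * c + d * d"

fun qconj :: "quat \<Rightarrow> quat" where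
  "qconj (a, b, c, d) = (a, - b, - c, - d)"

fun qred :: "quat \<Rightarrow> quat" where
  "qred (a, b, c, d) = ((a + 1) mod 3 - 1, (b + 1) mod 3 - 1, (c + 1) mod 3 - 1, (d + 1) mod 3 - 1)"

fun qreal :: "quat \<Rightarrow> bool" where
  "qreal (a, b, c, d) \<longleftrightarrow> b = 0 \<and> c = 0 \<and> d = 0"

text \<open>Representatives of the binary octahedral group modulo positive scalars. Up to one of the
  factors \<open>1\<close>, \<open>-2\<close>, \<open>4\<close>, the product of two of them is its own reduction modulo 3.\<close>

definition oct_list :: "quat list" where
  "oct_list = filter (\<lambda>q. qnorm q = 1 \<or> qnorm q = 2 \<or> qnorm q = 4)
     (List.product [-1, 0, 1] (List.product [-1, 0, 1] (List.product [-1, 0, 1] [-1, 0, 1])))"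

definition qmul_ok :: "quat \<Rightarrow> quat \<Rightarrow> bool" where
  "qmul_ok p q = (let m = qmul p q; r = qred m; n = qnorm r; N = qnorm p * qnorm q in
     (m = r \<and> N = n \<or> m = qscale (-2) r \<and> N = 4 * n \<or> m = qscale 4 r \<and> N = 16 * n) \<and>
     (n = 1 \<or> n = 2 \<or> n = 4))"

lemma qmul_ok_oct: "list_all (\<lambda>p. list_all (qmul_ok p) oct_list) oct_list"
  by code_simp

text \<open>Each element of the list as a word in \<open>1 + i\<close> (for \<open>True\<close>) and \<open>i + k\<close> (for \<open>False\<close>), up to a
  positive factor.\<close>

definition oct_words :: "(quat \<times> bool list) list" where
  "oct_words = [
    ((1, 1, 0, 0), [True]), ((0, 1, 0, 1), [False]),
    ((0, 1, 0, 0), [True, True]), ((-1, 1, 1, 1), [False, True]),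
    ((-1, 1, -1, 1), [True, False]), ((-1, 0, 0, 0), [False, False]),
    ((-1, 1, 0, 0), [True, True, True]), ((-1, 0, 1, 0), [False, True, True]),
    ((-1, 0, 0, 1), [True, False, True]), ((-1, -1, 0, 0), [False, False, True]),
    ((-1, 0, -1, 0), [True, True, False]), ((-1, 0, 0, -1), [False, True, False]),
    ((0, -1, 0, -1), [False, False, False]), ((-1, -1, 1, -1), [False, True, True, True]),
    ((-1, -1, 1, 1), [True, False, True, True]), ((0, -1, 0, 0), [False, False, True, True]),
    ((-1, -1, -1, 1), [True, True, False, True]), ((-1, -1, -1, -1), [False, True, False, True]),
    ((1, -1, -1, -1), [False, False, False, True]), ((0, 0, 0, -1), [False, True, True, False]),
    ((1, -1, 1, -1), [False, False, True, False]), ((1, 0, 0, 0), [False, False, False, False]),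
    ((0, -1, 1, 0), [True, False, True, True, True]), ((1, -1, 0, 0), [False, False, True, True, True]),
    ((0, -1, 0, 1), [True, True, False, True, True]), ((0, -1, -1, 0), [False, True, False, True, True]),
    ((1, 0, -1, 0), [False, False, False, True, True]), ((0, 0, -1, -1), [False, True, True, False, True]),
    ((1, 0, 0, -1), [False, False, True, False, True]), ((0, 0, 1, -1), [True, False, True, True, False]),
    ((1, 0, 1, 0), [False, False, True, True, False]), ((1, 0, 0, 1), [False, False, False, True, False]),
    ((1, -1, 1, 1), [True, True, False, True, True, True]), ((1, -1, -1, 1), [False, True, False, True, True, True]),
    ((1, 1, -1, 1), [False, False, False, True, True, True]), ((0, 0, -1, 0), [False, True, True, False, True, True]),
    ((1, 1, -1, -1), [False, False, True, False, True, True]), ((1, 1, 1, -1), [False, False, True, True, False, True]),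
    ((1, 1, 1, 1), [False, False, False, True, False, True]), ((0, 0, 1, 0), [True, True, False, True, True, False]),
    ((0, 0, 0, 1), [False, False, False, True, True, False]), ((0, 0, -1, 1), [False, True, True, False, True, True, True]),
    ((0, 1, -1, 0), [False, False, True, False, True, True, True]), ((0, 1, 0, -1), [False, False, True, True, False, True, True]),
    ((0, 1, 1, 0), [False, False, False, True, False, True, True]), ((0, 0, 1, 1), [False, False, False, True, True, False, True]),
    ((-1, 1, -1, -1), [False, False, True, True, False, True, True, True]), ((-1, 1, 1, -1), [False, False, False, True, False, True, True, True])]"

fun qword :: "bool list \<Rightarrow> quat" where
  "qword [] = (1, 0, 0, 0)"
| "qword [g] = (if g then (1, 1, 0, 0) else (0, 1, 0, 1))"
| "qword (g # gs) = qmul (if g then (1, 1, 0, 0) else (0, 1, 0, 1)) (qword gs)"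

lemma oct_words_ok:
  "list_all (\<lambda>(q, w). w \<noteq> [] \<and> (let r = qword w in list_ex (\<lambda>k. r = qscale k q) [1, 2, 4, 8])) oct_words \<and>
   list_all (\<lambda>q. q \<in> set (map fst oct_words)) oct_list"
  by code_simp

text \<open>The four diagonals of the cube, which the octahedral group permutes.\<close>

definition diagonal :: "nat \<Rightarrow> quat" where
  "diagonal i = (if i = 1 then (0, 1, 1, 1) else if i = 2 then (0, 1, -1, -1)
     else if i = 3 then (0, -1, 1, -1) else (0, -1, -1, 1))"

lemma oct_rotates_list:
  "list_all (\<lambda>q. list_all (\<lambda>i. list_ex (\<lambda>j. qmul q (diagonal i) = qmul (diagonal j) q \<or>
      qmul q (diagonal i) = qscale (-1) (qmul (diagonal j) q)) [1, 2, 3, 4]) [1, 2, 3, 4]) oct_list"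
  by code_simp

lemma oct_rotates_trivial_list:
  "list_all (\<lambda>q. list_all (\<lambda>i. qmul q (diagonal i) = qmul (diagonal i) q \<or>
      qmul q (diagonal i) = qscale (-1) (qmul (diagonal i) q)) [1, 2, 3, 4] \<longrightarrow>
      q = (1, 0, 0, 0) \<or> q = (-1, 0, 0, 0)) oct_list"
  by code_simp

text \<open>One element of each pair q, -q, namely the one whose first nonzero coordinate is
  1.\<close>

definition oct_half :: "quat list" where
  "oct_half = filter (\<lambda>(a, b, c, d). a = 1 \<or> a = 0 \<and> (b = 1 \<or> b = 0 \<and> (c = 1 \<or> c = 0 \<and> d = 1))) oct_list"

text \<open>p times the conjugate of q is real exactly when p and q are proportional, so the 24
  elements represent distinct classes modulo scalars.\<close>

lemma oct_half_list:
  "length oct_half = 24 \<and> distinct oct_half \<and>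
   list_all (\<lambda>p. list_all (\<lambda>q. qreal (qmul p (qconj q)) \<longrightarrow> p = q) oct_half) oct_half \<and>
   list_all (\<lambda>q. q \<in> set oct_half \<or> qscale (-1) q \<in> set oct_half) oct_list"
  by code_simp

section \<open>Arithmetic of scalar matrices\<close>

lemma mat_mult_comm: "mat c ** A = A ** mat c" for A :: "'a::comm_ring_1 ^ 'n ^ 'n"
  by (simp add: vec_eq_iff matrix_matrix_mult_def mat_def if_distrib[of "\<lambda>x. x * _"] if_distrib[of "\<lambda>x. _ * x"]
      mult.commute cong: if_cong)

lemma mat_mult_mat [simp]: "mat a ** mat b = mat (a * b)" for a :: "'a::comm_ring_1"
  by (simp add: vec_eq_iff matrix_matrix_mult_def mat_def if_distrib[of "\<lambda>x. x * _"] if_distrib[of "\<lambda>x. _ * x"] cong: if_cong)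

lemma mat_mult_left_assoc [simp]: "mat a ** (mat b ** A) = mat (a * b) ** A" for a :: "'a::comm_ring_1"
  by (simp add: matrix_mul_assoc)

lemma mat_mult_left_comm: "B ** (mat a ** A) = mat a ** (B ** A)" for A B :: "'a::comm_ring_1 ^ 'n ^ 'n"
  by (simp add: matrix_mul_assoc mat_mult_comm[of a B])

lemma mat_mult_vec [simp]: "mat a *v v = a *s v" for a :: "'a::comm_ring_1"
  by (simp add: vec_eq_iff matrix_vector_mult_def mat_def if_distrib[of "\<lambda>x. x * _"] cong: if_cong)

lemma mat_mult_nth [simp]: "(mat k ** A) $ i $ j = k * A $ i $ j" for k :: "'a::comm_ring_1"
  by (simp add: matrix_matrix_mult_def mat_def if_distrib[of "\<lambda>x. x * _"] cong: if_cong)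

lemma mat_mult_mat2: "mat k ** mat2 a b c d = mat2 (k * a) (k * b) (k * c) (k * d)" for k :: "'a::comm_ring_1"
  by (simp add: vec2_eq_iff)

lemma invertible_mat: "invertible (mat c :: 'a::field ^ 'n ^ 'n) \<longleftrightarrow> c \<noteq> 0"
  by (simp add: invertible_det_nz det_diagonal mat_def)

lemma invertible_mult_iff: "invertible (A ** B) \<longleftrightarrow> invertible A \<and> invertible B"
  for A B :: "'a::field ^ 'n ^ 'n"
  by (simp add: invertible_det_nz det_mul)

lemma invertible_cancel_left:
  assumes "invertible B" "B ** C = B ** D" shows "C = D"
  by (metis assms invertible_def matrix_mul_assoc matrix_mul_lid)

lemma invertible_cancel_right:
  assumes "invertible B" "C ** B = D ** B" shows "C = D"
  by (metis assms invertible_def matrix_mul_assoc matrix_mul_rid)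

text \<open>The octahedral group only needs a square root of -1; for the curves it will be
  \<open>\<zeta> 4\<close>.\<close>

locale imaginary_unit =
  fixes ii :: "'a::{alg_closed_field,field_char_0}"
  assumes ii_sq: "ii * ii = - 1"
begin

lemma ii_sq' [simp]: "ii * (ii * x) = - x"
  using ii_sq by (metis mult.assoc mult_minus1)

lemma ii_nonzero [simp]: "ii \<noteq> 0"
  using ii_sq by auto

text \<open>The usual embedding of the Hamilton quaternions into 2x2 matrices, with
  \<open>ii\<close> as complex unit; the norm becomes the determinant.\<close>

fun qmat :: "quat \<Rightarrow> 'a ^ 2 ^ 2" where
  "qmat (a, b, c, d) = mat2 (of_int a + of_int b * ii) (of_int c + of_int d * ii)
     (- of_int c + of_int d * ii) (of_int a - of_int b * ii)"

lemma qmat_mult: "qmat (qmul p q) = qmat p ** qmat q"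
  by (cases p; cases q) (simp add: mat2_mult mat2_eq_iff algebra_simps ii_sq)

lemma qmat_scale: "qmat (qscale k q) = mat (of_int k) ** qmat q"
  by (cases q) (simp add: mat_mult_mat2 mat2_eq_iff algebra_simps)

lemma det_qmat: "det (qmat q) = of_int (qnorm q)"
  by (cases q) (simp add: det_mat2 algebra_simps ii_sq)

lemma qmat_one: "qmat (1, 0, 0, 0) = mat 1"
  by (simp add: mat_mat2)

text \<open>The field has no real and imaginary parts, and \<open>t\<close> may be any element of
  it; but half-sums and half-differences of the paired entries recover the four coordinates.\<close>

lemma qmat_eq_scaled:
  assumes "qmat (a, b, c, d) = mat t ** qmat (a', b', c', d')"
  shows "of_int a = t * of_int a'" "of_int b = t * of_int b'" "of_int c = t * of_int c'" "of_int d = t * of_int d'"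
proof -
  have e: "of_int a + of_int b * ii = t * (of_int a' + of_int b' * ii)"
    "of_int a - of_int b * ii = t * (of_int a' - of_int b' * ii)"
    "of_int c + of_int d * ii = t * (of_int c' + of_int d' * ii)"
    "- of_int c + of_int d * ii = t * (- of_int c' + of_int d' * ii)"
    using assms by (simp_all add: mat_mult_mat2 mat2_eq_iff)
  have "of_int a = ((of_int a + of_int b * ii) + (of_int a - of_int b * ii)) / 2" by simp
  also have "\<dots> = t * of_int a'" unfolding e by (simp add: algebra_simps)
  finally show "of_int a = t * of_int a'" .
  have "of_int b = ((of_int a + of_int b * ii) - (of_int a - of_int b * ii)) / (2 * ii)" by simp
  also have "\<dots> = t * of_int b'" unfolding e by (simp add: field_simps)
  finally show "of_int b = t * of_int b'" .
  have "of_int c = ((of_int c + of_int d * ii) - (- of_int c + of_int d * ii)) / 2" by simp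
  also have "\<dots> = t * of_int c'" unfolding e by (simp add: algebra_simps)
  finally show "of_int c = t * of_int c'" .
  have "of_int d = ((of_int c + of_int d * ii) + (- of_int c + of_int d * ii)) / (2 * ii)" by simp
  also have "\<dots> = t * of_int d'" unfolding e by (simp add: field_simps)
  finally show "of_int d = t * of_int d'" .
qed

lemma qmat_inject: "qmat p = qmat q \<longleftrightarrow> p = q"
proof
  assume eq: "qmat p = qmat q"
  obtain a b c d where p: "p = (a, b, c, d)" by (rule prod_cases4)
  obtain a' b' c' d' where q: "q = (a', b', c', d')" by (rule prod_cases4)
  have "qmat (a, b, c, d) = mat 1 ** qmat (a', b', c', d')"
    using eq unfolding p q matrix_mul_lid .
  from qmat_eq_scaled[OF this] show "p = q" unfolding p q by simp
qed simp

abbreviation OQ :: "quat set" where "OQ \<equiv> set oct_list"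

lemma OQ_norm: "q \<in> OQ \<Longrightarrow> qnorm q = 1 \<or> qnorm q = 2 \<or> qnorm q = 4"
  by (auto simp: oct_list_def)

lemma OQ_invertible: "q \<in> OQ \<Longrightarrow> invertible (qmat q)"
  using OQ_norm[of q] by (auto simp: invertible_det_nz det_qmat)

lemma OQ_iff: "(a, b, c, d) \<in> OQ \<longleftrightarrow> {a, b, c, d} \<subseteq> {-1, 0, 1} \<and>
    (a * a + b * b + c * c + d * d = 1 \<or> a * a + b * b + c * c + d * d = 2 \<or> a * a + b * b + c * c + d * d = 4)"
  by (simp only: oct_list_def set_filter set_product mem_Collect_eq mem_Sigma_iff qnorm.simps insert_subset
      empty_subsetI list.set) blast

text \<open>Reduces a statement about the 48 quaternions to two generators. Products leave the list
  by a positive factor, so the property is needed for all quaternions on the way, and the last case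
  passes from a multiple back to the quaternion itself.\<close>

lemma OQ_induct [consumes 1, case_names gen1 gen2 mult scale]:
  assumes "q \<in> OQ" "P (1, 1, 0, 0)" "P (0, 1, 0, 1)" "\<And>p q. P p \<Longrightarrow> P q \<Longrightarrow> P (qmul p q)"
    "\<And>k q. k \<in> {1, 2, 4, 8} \<Longrightarrow> P (qscale k q) \<Longrightarrow> P q"
  shows "P q"
proof -
  have w: "w \<noteq> [] \<Longrightarrow> P (qword w)" for w
    using assms(2-4) by (induction w rule: qword.induct) auto
  have "q \<in> set (map fst oct_words)"
    using conjunct2[OF oct_words_ok] assms(1) unfolding list_all_iff by blast
  then obtain w where "(q, w) \<in> set oct_words" by force
  then have "w \<noteq> [] \<and> list_ex (\<lambda>k. qword w = qscale k q) [1, 2, 4, 8]"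
    using conjunct1[OF oct_words_ok] unfolding list_all_iff Let_def by blast
  then obtain k where "w \<noteq> []" "k \<in> set [1, 2, 4, 8]" "qword w = qscale k q"
    unfolding list_ex_iff by blast
  then show ?thesis using w[of w] assms(5)[of k q] by simp
qed

lemma OQ_mult:
  assumes "p \<in> OQ" "q \<in> OQ"
  obtains "qred (qmul p q) \<in> OQ" "qmul p q = qred (qmul p q)" "qnorm p * qnorm q = qnorm (qred (qmul p q))"
  | "qred (qmul p q) \<in> OQ" "qmul p q = qscale (-2) (qred (qmul p q))" "qnorm p * qnorm q = 4 * qnorm (qred (qmul p q))"
  | "qred (qmul p q) \<in> OQ" "qmul p q = qscale 4 (qred (qmul p q))" "qnorm p * qnorm q = 16 * qnorm (qred (qmul p q))"
proof -
  have ok: "qmul_ok p q" using qmul_ok_oct assms by (auto simp: list_all_iff)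
  obtain a b c d where r: "qred (qmul p q) = (a, b, c, d)" by (cases "qred (qmul p q)")
  have mod3: "(x + 1) mod 3 - 1 = - 1 \<or> (x + 1) mod 3 - 1 = 0 \<or> (x + 1) mod 3 - 1 = 1" for x :: int
    by presburger
  have "{a, b, c, d} \<subseteq> {-1, 0, 1}"
  proof -
    obtain x y z w where "qmul p q = (x, y, z, w)" by (cases "qmul p q")
    then show ?thesis using r mod3[of x] mod3[of y] mod3[of z] mod3[of w] by simp
  qed
  then have "qred (qmul p q) \<in> OQ"
    using ok unfolding qmul_ok_def Let_def r by (simp add: OQ_iff)
  then show thesis using ok that unfolding qmul_ok_def Let_def by blast
qed

section \<open>The permutation of the four diagonals\<close>

definition diag_mat :: "nat \<Rightarrow> 'a ^ 2 ^ 2" where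
  "diag_mat i = qmat (diagonal i)"

text \<open>A diagonal is an imaginary quaternion up to scalars, i.e. an axis; conjugation by
  \<open>B\<close> carries axis i to axis j. The free scalar makes the notion depend on the class of
  \<open>B\<close> in PGL only.\<close>

definition moves :: "'a ^ 2 ^ 2 \<Rightarrow> nat \<Rightarrow> nat \<Rightarrow> bool" where
  "moves B i j \<longleftrightarrow> (\<exists>c. c \<noteq> 0 \<and> B ** diag_mat i = mat c ** (diag_mat j ** B))"

lemma diag_mat_scaled:
  assumes "i \<in> {1..4}" "j \<in> {1..4}" "diag_mat i = mat c ** diag_mat j"
  shows "i = j \<and> c = 1"
proof -
  have ij: "i = 1 \<or> i = 2 \<or> i = 3 \<or> i = 4" "j = 1 \<or> j = 2 \<or> j = 3 \<or> j = 4" using assms by auto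
  have one: "(1::'a) \<noteq> - 1" by (simp add: eq_neg_iff_add_eq_0)
  obtain a b e d where q1: "diagonal i = (a, b, e, d)" by (rule prod_cases4)
  obtain a' b' e' d' where q2: "diagonal j = (a', b', e', d')" by (rule prod_cases4)
  note s = qmat_eq_scaled[OF assms(3)[unfolded diag_mat_def q1 q2]]
  from ij show ?thesis using s q1 q2 one by (elim disjE) (auto simp: diagonal_def)
qed

lemma moves_unique:
  assumes "invertible B" "moves B i j" "moves B i j'" "j \<in> {1..4}" "j' \<in> {1..4}"
  shows "j = j'"
proof -
  obtain c c' where c: "c \<noteq> 0" "B ** diag_mat i = mat c ** (diag_mat j ** B)"
    "B ** diag_mat i = mat c' ** (diag_mat j' ** B)"
    using assms(2,3) unfolding moves_def by blast
  then have "mat c ** diag_mat j = mat c' ** diag_mat j'"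
    using invertible_cancel_right[OF assms(1)] by (metis matrix_mul_assoc)
  then have "mat (inverse c) ** (mat c ** diag_mat j) = mat (inverse c) ** (mat c' ** diag_mat j')" by simp
  then have "diag_mat j = mat (inverse c * c') ** diag_mat j'" using c(1) by simp
  then show ?thesis using diag_mat_scaled assms(4,5) by blast
qed

lemma moves_unique':
  assumes "invertible B" "moves B i j" "moves B i' j" "i \<in> {1..4}" "i' \<in> {1..4}"
  shows "i = i'"
proof -
  obtain c c' where c: "c \<noteq> 0" "c' \<noteq> 0" "B ** diag_mat i = mat c ** (diag_mat j ** B)"
    "B ** diag_mat i' = mat c' ** (diag_mat j ** B)"
    using assms(2,3) unfolding moves_def by blast
  have "B ** diag_mat i = mat (c / c') ** (mat c' ** (diag_mat j ** B))" using c by simp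
  also have "\<dots> = B ** (mat (c / c') ** diag_mat i')" by (simp only: c(4)[symmetric] mat_mult_left_comm[of B])
  finally show ?thesis using invertible_cancel_left[OF assms(1)] diag_mat_scaled assms(4,5) by blast
qed

lemma moves_mult:
  assumes "moves B j k" "moves C i j" shows "moves (B ** C) i k"
proof -
  obtain c c' where c: "c \<noteq> 0" "c' \<noteq> 0" "B ** diag_mat j = mat c ** (diag_mat k ** B)"
    "C ** diag_mat i = mat c' ** (diag_mat j ** C)"
    using assms unfolding moves_def by blast
  have "B ** C ** diag_mat i = mat c' ** (B ** diag_mat j ** C)"
    by (metis c(4) mat_mult_left_comm matrix_mul_assoc)
  also have "\<dots> = mat (c' * c) ** (diag_mat k ** (B ** C))"
    using c(3) by (simp add: matrix_mul_assoc[symmetric])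
  finally show ?thesis using c(1,2) unfolding moves_def by (metis mult_eq_0_iff)
qed

lemma moves_scale: "k \<noteq> 0 \<Longrightarrow> moves (mat k ** B) i j \<longleftrightarrow> moves B i j"
proof -
  have *: "moves (mat k ** B) i j" if "k \<noteq> 0" "moves B i j" for k B
  proof -
    obtain c where c: "c \<noteq> 0" "B ** diag_mat i = mat c ** (diag_mat j ** B)"
      using \<open>moves B i j\<close> unfolding moves_def by blast
    have "mat k ** B ** diag_mat i = mat c ** (mat k ** (diag_mat j ** B))"
      by (simp only: matrix_mul_assoc[symmetric] c(2) mat_mult_left_assoc mult.commute)
    then show ?thesis using c(1) unfolding moves_def mat_mult_left_comm[of "diag_mat j"] by blast
  qed
  assume k: "k \<noteq> 0"
  have "mat (inverse k) ** (mat k ** B) = B" using k by simp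
  then have "moves B i j" if "moves (mat k ** B) i j" using *[OF _ that, of "inverse k"] k by simp
  then show ?thesis using *[OF k] by blast
qed

definition rotates :: "'a ^ 2 ^ 2 \<Rightarrow> bool" where
  "rotates B \<longleftrightarrow> invertible B \<and> (\<forall>i\<in>{1..4}. \<exists>j\<in>{1..4}. moves B i j)"

text \<open>Extended by the identity, because the elements of \<open>sym_group 4\<close> are
  permutations of all natural numbers that fix everything outside 1..4.\<close>

definition theta :: "'a ^ 2 ^ 2 \<Rightarrow> nat \<Rightarrow> nat" where
  "theta B i = (if i \<in> {1..4} then THE j. j \<in> {1..4} \<and> moves B i j else i)"

lemma theta_outside: "i \<notin> {1..4} \<Longrightarrow> theta B i = i"
  unfolding theta_def by (simp only: if_False)

lemma theta_eqI:
  assumes "rotates B" "i \<in> {1..4}" "j \<in> {1..4}" "moves B i j" shows "theta B i = j"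
  using assms moves_unique unfolding theta_def rotates_def by (auto intro!: the_equality)

lemma theta_moves:
  assumes "rotates B" "i \<in> {1..4}" shows "theta B i \<in> {1..4}" "moves B i (theta B i)"
proof -
  obtain j where "j \<in> {1..4}" "moves B i j" using assms unfolding rotates_def by blast
  then show "theta B i \<in> {1..4}" "moves B i (theta B i)" using theta_eqI assms by simp_all
qed

lemma rotates_mult: "rotates B \<Longrightarrow> rotates C \<Longrightarrow> rotates (B ** C)"
  unfolding rotates_def invertible_mult_iff by (meson moves_mult)

lemma theta_mult:
  assumes "rotates B" "rotates C" shows "theta (B ** C) = theta B \<circ> theta C"
proof
  fix i show "theta (B ** C) i = (theta B \<circ> theta C) i"
  proof (cases "i \<in> {1..4}")
    case True
    show ?thesis unfolding o_def
      using theta_moves[OF assms(2) True] theta_moves[OF assms(1)] moves_mult True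
      by (intro theta_eqI rotates_mult assms) blast+
  next
    case False
    then show ?thesis by (simp only: o_def theta_outside[OF False])
  qed
qed

lemma rotates_scale: "k \<noteq> 0 \<Longrightarrow> rotates (mat k ** B) \<longleftrightarrow> rotates B"
  by (simp add: rotates_def moves_scale invertible_mult_iff invertible_mat)

lemma theta_scale: "k \<noteq> 0 \<Longrightarrow> theta (mat k ** B) = theta B"
  by (rule ext) (simp add: theta_def moves_scale)

lemma theta_permutes:
  assumes "rotates B" shows "theta B permutes {1..4}"
proof (rule bij_imp_permutes)
  have "inj_on (theta B) {1..4}"
  proof (rule inj_onI)
    fix i i' assume i: "i \<in> {1..4}" "i' \<in> {1..4}" "theta B i = theta B i'"
    then show "i = i'"
      using moves_unique'[of B i "theta B i" i'] theta_moves[OF assms] assms unfolding rotates_def by metis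
  qed
  moreover have "theta B ` {1..4} \<subseteq> {1..4}" using theta_moves[OF assms] by blast
  ultimately show "bij_betw (theta B) {1..4} {1..4}"
    by (simp add: bij_betw_def endo_inj_surj)
qed (rule theta_outside)

lemma moves_qmat:
  assumes "qmul q (diagonal i) = qmul (diagonal j) q \<or> qmul q (diagonal i) = qscale (-1) (qmul (diagonal j) q)"
  shows "moves (qmat q) i j"
proof -
  have "qmat q ** diag_mat i = mat 1 ** (diag_mat j ** qmat q) \<or>
      qmat q ** diag_mat i = mat (of_int (- 1)) ** (diag_mat j ** qmat q)"
    using assms unfolding diag_mat_def by (metis qmat_mult qmat_scale matrix_mul_lid)
  then show ?thesis unfolding moves_def by (metis of_int_eq_0_iff one_neq_zero zero_neq_neg_one)
qed

lemma rotates_qmat: "q \<in> OQ \<Longrightarrow> rotates (qmat q)"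
proof -
  assume q: "q \<in> OQ"
  have "\<exists>j\<in>{1..4}. moves (qmat q) i j" if i: "i \<in> {1..4}" for i
  proof -
    have "i \<in> set [1, 2, 3, 4]" using i by auto
    then have "\<exists>j\<in>set [1, 2, 3, 4]. qmul q (diagonal i) = qmul (diagonal j) q \<or>
        qmul q (diagonal i) = qscale (-1) (qmul (diagonal j) q)"
      using oct_rotates_list q unfolding list_all_iff list_ex_iff by blast
    then obtain j where "j \<in> set [1, 2, 3, 4]" "moves (qmat q) i j" using moves_qmat by blast
    then show ?thesis by (intro bexI[of _ j]) auto
  qed
  then show ?thesis using OQ_invertible q by (auto simp: rotates_def)
qed

text \<open>Comparing determinants forces the scalars in \<open>moves\<close> to be 1 or -1. Thus q
  commutes or anticommutes with every diagonal, and this is a finite check.\<close>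

lemma theta_qmat_id:
  assumes q: "q \<in> OQ" and id: "theta (qmat q) = id"
  shows "q = (1, 0, 0, 0) \<or> q = (-1, 0, 0, 0)"
proof -
  have "qmul q (diagonal i) = qmul (diagonal i) q \<or> qmul q (diagonal i) = qscale (-1) (qmul (diagonal i) q)"
    if i: "i \<in> set [1, 2, 3, 4]" for i
  proof -
    have i': "i \<in> {1..4}" using i by auto
    then obtain c where c: "qmat q ** diag_mat i = mat c ** (diag_mat i ** qmat q)"
      using theta_moves(2)[OF rotates_qmat[OF q]] id unfolding moves_def by auto
    have "qnorm (diagonal i) = 3" using i by (auto simp: diagonal_def)
    then have d: "det (diag_mat i) \<noteq> 0" by (simp add: diag_mat_def det_qmat)
    have "det (qmat q) * det (diag_mat i) = c * c * (det (diag_mat i) * det (qmat q))"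
      using arg_cong[OF c, of det] by (simp add: det_mul det_mat2 mat_mat2)
    then have "c * c = 1" using d OQ_invertible[OF q] by (simp add: invertible_det_nz)
    then have "c = 1 \<or> c = - 1" by (metis square_eq_1_iff)
    then show ?thesis
    proof
      assume "c = 1"
      then show ?thesis using c by (simp add: diag_mat_def qmat_inject flip: qmat_mult)
    next
      assume "c = - 1"
      then have "qmat (qmul q (diagonal i)) = qmat (qscale (-1) (qmul (diagonal i) q))"
        using c by (simp add: diag_mat_def qmat_scale qmat_mult)
      then show ?thesis by (simp add: qmat_inject)
    qed
  qed
  then show ?thesis using oct_rotates_trivial_list q unfolding list_all_iff by blast
qed

end

section \<open>Stabilizers of forms in linear and projective groups\<close>

lemma GL_simps [simp]: "carrier GL = {A. invertible A}" "A \<otimes>\<^bsub>GL\<^esub> B = A ** B" "\<one>\<^bsub>GL\<^esub> = mat 1"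
  by (simp_all add: GL_def)

lemma group_GL: "group (GL :: ('a::comm_ring_1 ^ 'n ^ 'n) monoid)"
proof (rule groupI)
  fix A B :: "'a ^ 'n ^ 'n"
  assume "A \<in> carrier GL" "B \<in> carrier GL"
  then obtain A' B' where *: "A ** A' = mat 1" "A' ** A = mat 1" "B ** B' = mat 1" "B' ** B = mat 1" by (auto simp: invertible_def)
  then have "A ** B ** (B' ** A') = mat 1" "B' ** A' ** (A ** B) = mat 1"
    by (metis matrix_mul_assoc matrix_mul_rid)+
  then show "A \<otimes>\<^bsub>GL\<^esub> B \<in> carrier GL" by (auto simp: invertible_def)
next
  fix A :: "'a ^ 'n ^ 'n" assume "A \<in> carrier GL"
  then obtain B where "A ** B = mat 1" "B ** A = mat 1" by (auto simp: invertible_def)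
  then show "\<exists>B\<in>carrier GL. B \<otimes>\<^bsub>GL\<^esub> A = \<one>\<^bsub>GL\<^esub>" by (auto simp: invertible_def intro!: bexI[of _ B])
qed (auto simp: matrix_mul_assoc invertible_def intro!: exI[of _ "mat 1"])

lemma inv_GL:
  assumes "A ** B = mat 1" "B ** A = mat 1" shows "inv\<^bsub>GL\<^esub> A = (B :: 'a::field ^ 'n ^ 'n)"
  using assms by (intro group.inv_equality[OF group_GL]) (auto simp: invertible_def)

lemma scalar_subgroup: "subgroup scalar_matrices (GL :: ('a::field ^ 'n ^ 'n) monoid)"
proof (rule group.subgroupI[OF group_GL])
  fix A :: "'a ^ 'n ^ 'n" assume "A \<in> scalar_matrices"
  then obtain c where c: "c \<noteq> 0" "A = mat c" unfolding scalar_matrices_def by blast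
  then have "inv\<^bsub>GL\<^esub> A = mat (inverse c)" by (intro inv_GL) simp_all
  then show "inv\<^bsub>GL\<^esub> A \<in> scalar_matrices" using c unfolding scalar_matrices_def by auto
next
  have "mat 1 \<in> (scalar_matrices :: ('a ^ 'n ^ 'n) set)" unfolding scalar_matrices_def by force
  then show "(scalar_matrices :: ('a ^ 'n ^ 'n) set) \<noteq> {}" by blast
next
  fix A B :: "'a ^ 'n ^ 'n" assume "A \<in> scalar_matrices" "B \<in> scalar_matrices"
  then show "A \<otimes>\<^bsub>GL\<^esub> B \<in> scalar_matrices" unfolding scalar_matrices_def by force
qed (auto simp: scalar_matrices_def invertible_mat)

lemma pgl_eq: "pgl A = {mat c ** A | c. c \<noteq> 0}"
  unfolding pgl_def r_coset_def scalar_matrices_def by auto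

lemma scalar_normal: "scalar_matrices \<lhd> (GL :: ('a::field ^ 'n ^ 'n) monoid)"
proof (rule group.normalI[OF group_GL scalar_subgroup], intro ballI)
  fix A :: "'a ^ 'n ^ 'n" assume "A \<in> carrier GL"
  show "scalar_matrices #>\<^bsub>GL\<^esub> A = A <#\<^bsub>GL\<^esub> scalar_matrices"
    unfolding r_coset_def l_coset_def scalar_matrices_def by (auto simp: mat_mult_comm)
qed

lemma group_PGL: "group (PGL :: ('a::field ^ 'n ^ 'n) set monoid)"
  unfolding PGL_def by (rule normal.factorgroup_is_group[OF scalar_normal])

lemma carrier_PGL: "carrier PGL = {pgl A | A. invertible A}"
  unfolding PGL_def FactGroup_def RCOSETS_def pgl_def by auto

lemma pgl_in_carrier: "invertible A \<Longrightarrow> pgl A \<in> carrier PGL"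
  unfolding carrier_PGL by blast

lemma pgl_mult: "invertible A \<Longrightarrow> invertible B \<Longrightarrow> pgl A \<otimes>\<^bsub>PGL\<^esub> pgl B = pgl (A ** B)"
  unfolding PGL_def FactGroup_def pgl_def using normal.rcos_sum[OF scalar_normal, of A B] by simp

lemma pgl_self: "A \<in> pgl A"
  unfolding pgl_eq by (auto intro!: exI[of _ 1])

lemma pgl_eq_iff: "pgl A = pgl B \<longleftrightarrow> (\<exists>c. c \<noteq> 0 \<and> A = mat c ** B)"
proof
  assume "pgl A = pgl B"
  then show "\<exists>c. c \<noteq> 0 \<and> A = mat c ** B" using pgl_self[of A] unfolding pgl_eq by auto
next
  assume "\<exists>c. c \<noteq> 0 \<and> A = mat c ** B"
  then obtain c where c: "c \<noteq> 0" "A = mat c ** B" by blast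
  have "mat a ** B = mat (a / c) ** A" "a \<noteq> 0 \<Longrightarrow> a / c \<noteq> 0" "a \<noteq> 0 \<Longrightarrow> a * c \<noteq> 0" "mat a ** A = mat (a * c) ** B" for a
    using c by simp_all
  then show "pgl A = pgl B" unfolding pgl_eq by (intro subset_antisym subsetI) blast+
qed

lemma pgl_scale: "k \<noteq> 0 \<Longrightarrow> pgl (mat k ** A) = pgl A"
  unfolding pgl_eq_iff by blast

lemma one_PGL: "\<one>\<^bsub>PGL\<^esub> = pgl (mat 1)"
  unfolding PGL_def FactGroup_def pgl_eq scalar_matrices_def by simp

lemma inv_PGL:
  assumes "A ** B = mat 1" "B ** A = mat 1" shows "inv\<^bsub>PGL\<^esub> (pgl A) = pgl B"
proof (rule group.inv_equality[OF group_PGL])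
  have "invertible A" "invertible B" using assms by (auto simp: invertible_def)
  then show "pgl B \<otimes>\<^bsub>PGL\<^esub> pgl A = \<one>\<^bsub>PGL\<^esub>" "pgl A \<in> carrier PGL" "pgl B \<in> carrier PGL"
    by (simp_all add: pgl_mult assms one_PGL pgl_in_carrier)
qed

section \<open>Semi-invariance and stabilizers\<close>

definition semi_invariant :: "('a::field ^ 'n \<Rightarrow> 'a) \<Rightarrow> 'a ^ 'n ^ 'n \<Rightarrow> bool" where
  "semi_invariant f B \<longleftrightarrow> invertible B \<and> (\<exists>c. c \<noteq> 0 \<and> (\<forall>v. f (B *v v) = c * f v))"

lemma semi_invariant_mult: "semi_invariant f A \<Longrightarrow> semi_invariant f B \<Longrightarrow> semi_invariant f (A ** B)"
proof -
  assume "semi_invariant f A" "semi_invariant f B"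
  then obtain a b where "a \<noteq> 0" "b \<noteq> 0" "invertible A" "invertible B"
    "\<And>v. f (A *v v) = a * f v" "\<And>v. f (B *v v) = b * f v"
    unfolding semi_invariant_def by blast
  then show ?thesis unfolding semi_invariant_def
    by (auto simp: invertible_mult_iff simp flip: matrix_vector_mul_assoc intro!: exI[of _ "a * b"])
qed

lemma semi_invariant_inverse:
  assumes "semi_invariant f A" "A ** B = mat 1" "B ** A = mat 1" shows "semi_invariant f B"
proof -
  obtain c where c: "c \<noteq> 0" "\<forall>v. f (A *v v) = c * f v" using assms(1) unfolding semi_invariant_def by blast
  have "f (B *v v) = inverse c * f v" for v
  proof -
    have "f (A *v (B *v v)) = c * f (B *v v)" using c by blast
    then show ?thesis using c(1) by (simp add: matrix_vector_mul_assoc assms)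
  qed
  then show ?thesis using c assms unfolding semi_invariant_def invertible_def by (auto intro!: exI[of _ "inverse c"])
qed

definition proj_stab :: "('a::field ^ 'n \<Rightarrow> 'a) \<Rightarrow> ('a ^ 'n ^ 'n) set set" where
  "proj_stab f = {pgl B | B. semi_invariant f B}"

lemma semi_invariant_invertible: "semi_invariant f B \<Longrightarrow> invertible B"
  by (simp add: semi_invariant_def)

lemma proj_stab_subgroup: "subgroup (proj_stab f) PGL"
proof (rule group.subgroupI[OF group_PGL])
  show "proj_stab f \<subseteq> carrier PGL"
    unfolding proj_stab_def carrier_PGL using semi_invariant_invertible by blast
  have "semi_invariant f (mat 1)" by (auto simp: semi_invariant_def invertible_mat intro!: exI[of _ 1])
  then show "proj_stab f \<noteq> {}" unfolding proj_stab_def by blast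
next
  fix g assume "g \<in> proj_stab f"
  then obtain B where B: "g = pgl B" "semi_invariant f B" unfolding proj_stab_def by blast
  then obtain C where "B ** C = mat 1" "C ** B = mat 1"
    using semi_invariant_invertible unfolding invertible_def by blast
  then show "inv\<^bsub>PGL\<^esub> g \<in> proj_stab f"
    using semi_invariant_inverse B inv_PGL unfolding proj_stab_def by blast
next
  fix g h assume "g \<in> proj_stab f" "h \<in> proj_stab f"
  then obtain A B where "g = pgl A" "h = pgl B" "semi_invariant f A" "semi_invariant f B"
    unfolding proj_stab_def by blast
  then show "g \<otimes>\<^bsub>PGL\<^esub> h \<in> proj_stab f"
    using semi_invariant_mult[of f A B] by (auto simp: proj_stab_def pgl_mult semi_invariant_invertible)
qed

definition lin_stab :: "('a::field ^ 'n \<Rightarrow> 'a) \<Rightarrow> ('a ^ 'n ^ 'n) set" where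
  "lin_stab f = {B. invertible B \<and> (\<forall>v. f (B *v v) = f v)}"

lemma lin_stab_subgroup: "subgroup (lin_stab f) GL"
proof (rule group.subgroupI[OF group_GL])
  show "lin_stab f \<noteq> {}" unfolding lin_stab_def by (auto simp: invertible_mat intro!: exI[of _ "mat 1"])
next
  fix A assume A: "A \<in> lin_stab f"
  then obtain B where B: "A ** B = mat 1" "B ** A = mat 1" unfolding lin_stab_def invertible_def by blast
  have "f (A *v (B *v v)) = f (B *v v)" for v using A unfolding lin_stab_def by blast
  then have "f (B *v v) = f v" for v using B by (simp add: matrix_vector_mul_assoc)
  then show "inv\<^bsub>GL\<^esub> A \<in> lin_stab f" using B inv_GL[OF B] unfolding lin_stab_def invertible_def by auto
qed (auto simp: lin_stab_def invertible_mult_iff simp flip: matrix_vector_mul_assoc)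

text \<open>Conjugation by \<open>P\<close>; it allows the stabilizer to be studied after a change
  of coordinates.\<close>

lemma proj_stab_conj_iso:
  fixes P Q :: "'a::field ^ 'n ^ 'n"
  assumes P: "P ** Q = mat 1" "Q ** P = mat 1"
  shows "PGL\<lparr>carrier := proj_stab f\<rparr> \<cong> PGL\<lparr>carrier := proj_stab (\<lambda>v. f (P *v v))\<rparr>"
proof -
  let ?f' = "\<lambda>v. f (P *v v)"
  have inv: "invertible P" "invertible Q" using P by (auto simp: invertible_def)
  have 1: "semi_invariant ?f' (Q ** B ** P)" if B: "semi_invariant f B" for B
  proof -
    obtain c where c: "c \<noteq> 0" "\<forall>v. f (B *v v) = c * f v" using B unfolding semi_invariant_def by blast
    have "P ** (Q ** B ** P) = B ** P" by (simp add: matrix_mul_assoc P)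
    then have "f (P *v (Q ** B ** P *v v)) = c * f (P *v v)" for v
      using c(2)[rule_format, of "P *v v"] by (simp add: matrix_vector_mul_assoc)
    moreover have "invertible (Q ** B ** P)" using B inv by (simp add: semi_invariant_def invertible_mult_iff)
    ultimately show ?thesis using c(1) unfolding semi_invariant_def by blast
  qed
  have 2: "semi_invariant f (P ** B ** Q)" if B: "semi_invariant ?f' B" for B
  proof -
    obtain c where c: "c \<noteq> 0" "\<forall>v. f (P *v (B *v v)) = c * f (P *v v)" using B unfolding semi_invariant_def by blast
    have "f (P ** B ** Q *v v) = c * f v" for v
      using c(2)[rule_format, of "Q *v v"] by (simp add: matrix_vector_mul_assoc matrix_mul_assoc P)
    then show ?thesis using c(1) B inv unfolding semi_invariant_def by (auto simp: invertible_mult_iff)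
  qed
  define h where "h g = pgl Q \<otimes>\<^bsub>PGL\<^esub> g \<otimes>\<^bsub>PGL\<^esub> pgl P" for g
  have h: "h (pgl B) = pgl (Q ** B ** P)" if "invertible B" for B
    using that inv by (simp add: h_def pgl_mult invertible_mult_iff)
  have hin: "h x \<in> proj_stab ?f'" if "x \<in> proj_stab f" for x
  proof -
    obtain B where B: "x = pgl B" "semi_invariant f B" using \<open>x \<in> proj_stab f\<close> unfolding proj_stab_def by blast
    then show ?thesis using 1[OF B(2)] h[OF semi_invariant_invertible[OF B(2)]] unfolding proj_stab_def by auto
  qed
  have kin: "pgl P \<otimes>\<^bsub>PGL\<^esub> x \<otimes>\<^bsub>PGL\<^esub> pgl Q \<in> proj_stab f" if "x \<in> proj_stab ?f'" for x
  proof -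
    obtain B where B: "x = pgl B" "semi_invariant ?f' B" using \<open>x \<in> proj_stab ?f'\<close> unfolding proj_stab_def by blast
    then have "pgl P \<otimes>\<^bsub>PGL\<^esub> x \<otimes>\<^bsub>PGL\<^esub> pgl Q = pgl (P ** B ** Q)"
      using inv semi_invariant_invertible[OF B(2)] by (simp add: pgl_mult invertible_mult_iff)
    then show ?thesis using 2[OF B(2)] unfolding proj_stab_def by auto
  qed
  have "h \<in> iso (PGL\<lparr>carrier := proj_stab f\<rparr>) (PGL\<lparr>carrier := proj_stab ?f'\<rparr>)"
  proof (rule isoI)
    show "h \<in> hom (PGL\<lparr>carrier := proj_stab f\<rparr>) (PGL\<lparr>carrier := proj_stab ?f'\<rparr>)"
    proof (rule homI)
      fix x assume "x \<in> carrier (PGL\<lparr>carrier := proj_stab f\<rparr>)"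
      then show "h x \<in> carrier (PGL\<lparr>carrier := proj_stab ?f'\<rparr>)"
        using hin by simp
    next
      fix x y assume "x \<in> carrier (PGL\<lparr>carrier := proj_stab f\<rparr>)" "y \<in> carrier (PGL\<lparr>carrier := proj_stab f\<rparr>)"
      then obtain B C where B: "x = pgl B" "y = pgl C" "invertible B" "invertible C"
        using semi_invariant_invertible by (auto simp: proj_stab_def)
      have "Q ** (B ** C) ** P = (Q ** B ** P) ** (Q ** C ** P)"
        by (metis P(1) matrix_mul_assoc matrix_mul_rid)
      then show "h (x \<otimes>\<^bsub>PGL\<lparr>carrier := proj_stab f\<rparr>\<^esub> y) = h x \<otimes>\<^bsub>PGL\<lparr>carrier := proj_stab ?f'\<rparr>\<^esub> h y"
        using B inv by (simp add: h pgl_mult invertible_mult_iff)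
    qed
    show "bij_betw h (carrier (PGL\<lparr>carrier := proj_stab f\<rparr>)) (carrier (PGL\<lparr>carrier := proj_stab ?f'\<rparr>))"
    proof (rule bij_betw_byWitness[where f' = "\<lambda>g. pgl P \<otimes>\<^bsub>PGL\<^esub> g \<otimes>\<^bsub>PGL\<^esub> pgl Q"])
      have PBQ: "P ** (Q ** B ** P) ** Q = B" "Q ** (P ** B ** Q) ** P = B" for B
        by (metis P matrix_mul_assoc matrix_mul_rid matrix_mul_lid)+
      show "\<forall>g\<in>carrier (PGL\<lparr>carrier := proj_stab f\<rparr>). pgl P \<otimes>\<^bsub>PGL\<^esub> h g \<otimes>\<^bsub>PGL\<^esub> pgl Q = g"
      proof
        fix g assume "g \<in> carrier (PGL\<lparr>carrier := proj_stab f\<rparr>)"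
        then obtain B where "g = pgl B" "invertible B" using semi_invariant_invertible by (auto simp: proj_stab_def)
        then show "pgl P \<otimes>\<^bsub>PGL\<^esub> h g \<otimes>\<^bsub>PGL\<^esub> pgl Q = g" by (simp add: h pgl_mult inv invertible_mult_iff PBQ)
      qed
      show "\<forall>g\<in>carrier (PGL\<lparr>carrier := proj_stab ?f'\<rparr>). h (pgl P \<otimes>\<^bsub>PGL\<^esub> g \<otimes>\<^bsub>PGL\<^esub> pgl Q) = g"
      proof
        fix g assume "g \<in> carrier (PGL\<lparr>carrier := proj_stab ?f'\<rparr>)"
        then obtain B where "g = pgl B" "invertible B" using semi_invariant_invertible by (auto simp: proj_stab_def)
        then show "h (pgl P \<otimes>\<^bsub>PGL\<^esub> g \<otimes>\<^bsub>PGL\<^esub> pgl Q) = g" by (simp add: h pgl_mult inv invertible_mult_iff PBQ)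
      qed
      show "h ` carrier (PGL\<lparr>carrier := proj_stab f\<rparr>) \<subseteq> carrier (PGL\<lparr>carrier := proj_stab ?f'\<rparr>)"
        using hin by auto
      show "(\<lambda>g. pgl P \<otimes>\<^bsub>PGL\<^esub> g \<otimes>\<^bsub>PGL\<^esub> pgl Q) ` carrier (PGL\<lparr>carrier := proj_stab ?f'\<rparr>) \<subseteq> carrier (PGL\<lparr>carrier := proj_stab f\<rparr>)"
        using kin by auto
    qed
  qed
  then show ?thesis unfolding is_iso_def by blast
qed

context imaginary_unit
begin

declare qmat.simps [simp del]

section \<open>The octahedral group in PGL_2 and its isomorphism with S_4\<close>

text \<open>The full preimage of the octahedral group in GL_2, closed under nonzero scalars.\<close>

definition octset :: "('a ^ 2 ^ 2) set" where
  "octset = {mat k ** qmat q | k q. k \<noteq> 0 \<and> q \<in> OQ}"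

definition octgroup :: "('a ^ 2 ^ 2) set set" where
  "octgroup = pgl ` octset"

lemma octset_invertible: "B \<in> octset \<Longrightarrow> invertible B"
  using OQ_invertible by (auto simp: octset_def invertible_mult_iff invertible_mat)

lemma octset_rotates: "B \<in> octset \<Longrightarrow> rotates B"
  using rotates_qmat rotates_scale by (auto simp: octset_def)

lemma octset_qmat: "q \<in> OQ \<Longrightarrow> qmat q \<in> octset"
  unfolding octset_def by (metis (mono_tags, lifting) matrix_mul_lid mem_Collect_eq one_neq_zero)

lemma octset_scale: "k \<noteq> 0 \<Longrightarrow> B \<in> octset \<Longrightarrow> mat k ** B \<in> octset"
  unfolding octset_def by force

lemma octset_mult:
  assumes "A \<in> octset" "B \<in> octset" shows "A ** B \<in> octset"
proof -
  obtain k l p q where A: "A = mat k ** qmat p" "B = mat l ** qmat q" "k \<noteq> 0" "l \<noteq> 0" "p \<in> OQ" "q \<in> OQ"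
    using assms unfolding octset_def by blast
  have "\<exists>m. m \<noteq> 0 \<and> qmul p q = qscale m (qred (qmul p q)) \<and> qred (qmul p q) \<in> OQ"
    using A(5,6)
  proof (cases rule: OQ_mult)
    case 1
    have "qscale 1 r = r" for r by (cases r) simp
    then show ?thesis using 1 by (intro exI[of _ 1]) simp
  next
    case 2 then show ?thesis by (intro exI[of _ "-2"]) simp
  next
    case 3 then show ?thesis by (intro exI[of _ 4]) simp
  qed
  then obtain m r where m: "m \<noteq> 0" "qmul p q = qscale m r" "r \<in> OQ" by blast
  have "A ** B = mat (k * l) ** (qmat p ** qmat q)"
    unfolding A by (simp add: mat_mult_left_comm[of "qmat p"] flip: matrix_mul_assoc)
  also have "\<dots> = mat (k * l * of_int m) ** qmat r"
    unfolding qmat_mult[symmetric] m qmat_scale by simp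
  finally show ?thesis using octset_scale[OF _ octset_qmat[OF m(3)], of "k * l * of_int m"] A(3,4) m(1) by simp
qed

lemma qconj_OQ: "q \<in> OQ \<Longrightarrow> qconj q \<in> OQ"
  by (cases q) (auto simp: OQ_iff)

lemma qmat_qconj: "qmat q ** qmat (qconj q) = mat (of_int (qnorm q))" "qmat (qconj q) ** qmat q = mat (of_int (qnorm q))"
proof -
  have "qmul q (qconj q) = qscale (qnorm q) (1, 0, 0, 0)" "qmul (qconj q) q = qscale (qnorm q) (1, 0, 0, 0)"
    by (cases q, simp)+
  then show "qmat q ** qmat (qconj q) = mat (of_int (qnorm q))" "qmat (qconj q) ** qmat q = mat (of_int (qnorm q))"
    unfolding qmat_mult[symmetric] by (simp_all only: qmat_scale qmat_one mat_mult_mat mult_1_right)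
qed

lemma octgroup_subgroup: "subgroup octgroup PGL"
proof (rule group.subgroupI[OF group_PGL])
  show "octgroup \<subseteq> carrier PGL" using octset_invertible pgl_in_carrier by (auto simp: octgroup_def)
  have "(1, 0, 0, 0) \<in> OQ" by (simp add: OQ_iff)
  then show "octgroup \<noteq> {}" using octset_qmat unfolding octgroup_def by blast
next
  fix g assume "g \<in> octgroup"
  then obtain k q where g: "g = pgl (mat k ** qmat q)" "k \<noteq> 0" "q \<in> OQ" unfolding octgroup_def octset_def by blast
  define n where "n = (of_int (qnorm q) :: 'a)"
  have n: "n \<noteq> 0" using OQ_norm[OF g(3)] by (auto simp: n_def)
  have "qmat q ** (mat (inverse n) ** qmat (qconj q)) = mat 1" "mat (inverse n) ** qmat (qconj q) ** qmat q = mat 1"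
    using n by (simp_all add: mat_mult_left_comm[of "qmat q"] qmat_qconj flip: matrix_mul_assoc n_def)
  then have "inv\<^bsub>PGL\<^esub> g = pgl (mat (inverse n) ** qmat (qconj q))"
    using inv_PGL g pgl_scale by metis
  then show "inv\<^bsub>PGL\<^esub> g \<in> octgroup" using octset_scale[OF _ octset_qmat[OF qconj_OQ[OF g(3)]], of "inverse n"] n unfolding octgroup_def by simp
next
  fix g h assume "g \<in> octgroup" "h \<in> octgroup"
  then show "g \<otimes>\<^bsub>PGL\<^esub> h \<in> octgroup"
    unfolding octgroup_def using octset_mult octset_invertible pgl_mult by (metis (no_types, lifting) image_iff)
qed

lemma octgroup_half: "octgroup = (\<lambda>q. pgl (qmat q)) ` set oct_half"
proof
  show "(\<lambda>q. pgl (qmat q)) ` set oct_half \<subseteq> octgroup"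
    using octset_qmat by (auto simp: oct_half_def octgroup_def)
  show "octgroup \<subseteq> (\<lambda>q. pgl (qmat q)) ` set oct_half"
  proof
    fix g assume "g \<in> octgroup"
    then obtain k q where g: "g = pgl (mat k ** qmat q)" "k \<noteq> 0" "q \<in> OQ" unfolding octgroup_def octset_def by blast
    have "pgl (qmat (qscale (-1) q)) = pgl (qmat q)" unfolding qmat_scale by (rule pgl_scale) simp
    moreover have "q \<in> set oct_half \<or> qscale (-1) q \<in> set oct_half"
      using oct_half_list g(3) unfolding list_all_iff by blast
    ultimately show "g \<in> (\<lambda>q. pgl (qmat q)) ` set oct_half" using g pgl_scale by (metis image_eqI)
  qed
qed

text \<open>If p and q have the same class, then p times the conjugate of q is a scalar, hence real,
  and the finite check on \<open>oct_half\<close> gives p = q.\<close>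

lemma card_octgroup: "card octgroup = 24"
proof -
  have "inj_on (\<lambda>q. pgl (qmat q)) (set oct_half)"
  proof (rule inj_onI)
    fix p q assume p: "p \<in> set oct_half" "q \<in> set oct_half" "pgl (qmat p) = pgl (qmat q)"
    obtain c where c: "qmat p = mat c ** qmat q" using p(3) unfolding pgl_eq_iff by blast
    have "qmat (qmul p (qconj q)) = mat c ** (qmat q ** qmat (qconj q))"
      unfolding qmat_mult c matrix_mul_assoc ..
    also have "\<dots> = mat (c * of_int (qnorm q)) ** qmat (1, 0, 0, 0)"
      unfolding qmat_qconj qmat_one by simp
    finally have e: "qmat (qmul p (qconj q)) = mat (c * of_int (qnorm q)) ** qmat (1, 0, 0, 0)" .
    obtain x y z w where r: "qmul p (qconj q) = (x, y, z, w)" by (rule prod_cases4)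
    have "qreal (qmul p (qconj q))" using qmat_eq_scaled(2-4)[OF e[unfolded r]] by (simp add: r)
    then show "p = q" using oct_half_list p(1,2) unfolding list_all_iff by blast
  qed
  then have "card octgroup = card (set oct_half)" unfolding octgroup_half by (rule card_image)
  also have "\<dots> = 24" using oct_half_list by (simp only: distinct_card)
  finally show ?thesis .
qed

definition theta_class :: "('a ^ 2 ^ 2) set \<Rightarrow> nat \<Rightarrow> nat" where
  "theta_class g = theta (SOME B. B \<in> g)"

lemma theta_class_pgl: "theta_class (pgl B) = theta B"
proof -
  have "(SOME B'. B' \<in> pgl B) \<in> pgl B" using pgl_self by (rule someI)
  then show ?thesis unfolding theta_class_def pgl_eq by (auto simp: theta_scale)
qed

text \<open>The kernel is trivial since only 1 and -1 fix all diagonals; surjectivity follows from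
  the equality of orders 24 = 4!.\<close>

lemma theta_class_iso: "theta_class \<in> iso (PGL\<lparr>carrier := octgroup\<rparr>) (sym_group 4)"
proof -
  have hom: "theta_class \<in> hom (PGL\<lparr>carrier := octgroup\<rparr>) (sym_group 4)"
  proof (rule homI)
    fix x assume "x \<in> carrier (PGL\<lparr>carrier := octgroup\<rparr>)"
    then show "theta_class x \<in> carrier (sym_group 4)"
      using theta_permutes octset_rotates by (auto simp: octgroup_def theta_class_pgl sym_group_carrier)
  next
    fix x y assume "x \<in> carrier (PGL\<lparr>carrier := octgroup\<rparr>)" "y \<in> carrier (PGL\<lparr>carrier := octgroup\<rparr>)"
    then obtain A B where "x = pgl A" "y = pgl B" "A \<in> octset" "B \<in> octset" by (auto simp: octgroup_def)
    then show "theta_class (x \<otimes>\<^bsub>PGL\<lparr>carrier := octgroup\<rparr>\<^esub> y) = theta_class x \<otimes>\<^bsub>sym_group 4\<^esub> theta_class y"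
      by (simp add: pgl_mult octset_invertible theta_class_pgl theta_mult octset_rotates sym_group_mult)
  qed
  have gh: "group_hom (PGL\<lparr>carrier := octgroup\<rparr>) (sym_group 4) theta_class"
    unfolding group_hom_def group_hom_axioms_def
    using hom sym_group_is_group group.subgroup_imp_group[OF group_PGL octgroup_subgroup] by blast
  have "kernel (PGL\<lparr>carrier := octgroup\<rparr>) (sym_group 4) theta_class = {\<one>\<^bsub>PGL\<lparr>carrier := octgroup\<rparr>\<^esub>}"
  proof
    show "kernel (PGL\<lparr>carrier := octgroup\<rparr>) (sym_group 4) theta_class \<subseteq> {\<one>\<^bsub>PGL\<lparr>carrier := octgroup\<rparr>\<^esub>}"
    proof
      fix g assume "g \<in> kernel (PGL\<lparr>carrier := octgroup\<rparr>) (sym_group 4) theta_class"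
      then have "g \<in> octgroup" "theta_class g = id" by (auto simp: kernel_def sym_group_one)
      then obtain k q where g: "g = pgl (mat k ** qmat q)" "k \<noteq> 0" "q \<in> OQ" "theta (qmat q) = id"
        unfolding octgroup_def octset_def using theta_class_pgl theta_scale by auto
      then have "q = (1, 0, 0, 0) \<or> q = qscale (-1) (1, 0, 0, 0)" using theta_qmat_id by fastforce
      then have "qmat q = mat 1 \<or> qmat q = mat (- 1)"
        by (metis qmat_one qmat_scale mat_mult_mat mult_1_right of_int_1 of_int_minus)
      then have "qmat q = mat 1 ** mat 1 \<or> qmat q = mat (- 1) ** mat 1" by simp
      then have "pgl (qmat q) = pgl (mat 1)" unfolding pgl_eq_iff by (metis one_neq_zero neg_equal_0_iff_equal)
      then show "g \<in> {\<one>\<^bsub>PGL\<lparr>carrier := octgroup\<rparr>\<^esub>}" using pgl_scale[OF g(2), of "qmat q"] g(1) by (simp add: one_PGL)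
    qed
    show "{\<one>\<^bsub>PGL\<lparr>carrier := octgroup\<rparr>\<^esub>} \<subseteq> kernel (PGL\<lparr>carrier := octgroup\<rparr>) (sym_group 4) theta_class"
      using group_hom.hom_one[OF gh] subgroup.one_closed[OF octgroup_subgroup] by (auto simp: kernel_def)
  qed
  then have inj: "inj_on theta_class octgroup" using group_hom.inj_iff_trivial_ker[OF gh] by simp
  have sub: "theta_class ` octgroup \<subseteq> carrier (sym_group 4)" using hom by (auto simp: hom_def)
  have "card (theta_class ` octgroup) = card (carrier (sym_group 4))"
    using inj card_octgroup sym_group_card_carrier[of 4] by (simp add: card_image fact_numeral)
  then have "theta_class ` octgroup = carrier (sym_group 4)"
    using sub by (intro card_subset_eq) (auto simp: sym_group_def finite_permutations)
  then show ?thesis using hom inj by (intro isoI) (auto simp: bij_betw_def)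
qed

lemma octgroup_iso: "PGL\<lparr>carrier := octgroup\<rparr> \<cong> sym_group 4"
  using theta_class_iso unfolding is_iso_def by blast

end

section \<open>The octahedral forms\<close>

lemma eq_scaled_self: "z = c * z \<Longrightarrow> c \<noteq> 1 \<Longrightarrow> z = 0" for z :: "'a::field"
  by (metis mult_cancel_right1)

text \<open>With \<open>s8\<close> and \<open>s12\<close>, Klein's forms of the octahedron: their
  roots are the vertices, the face centres and the edge midpoints.\<close>

definition s6 :: "'a::comm_ring_1 \<Rightarrow> 'a \<Rightarrow> 'a" where
  "s6 x y = x * y * (x ^ 4 - y ^ 4)"

definition s8 :: "'a::comm_ring_1 \<Rightarrow> 'a \<Rightarrow> 'a" where
  "s8 x y = x ^ 8 + 14 * (x * y) ^ 4 + y ^ 8"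

definition s12 :: "'a::comm_ring_1 \<Rightarrow> 'a \<Rightarrow> 'a" where
  "s12 x y = x ^ 12 - 33 * (x * y) ^ 4 * (x ^ 4 + y ^ 4) + y ^ 12"

text \<open>The pencil spanned by s8^3 and s6^4. The shift 42 = 3 * 14 makes \<open>a\<close> the
  coefficient of X^20 Y^4. The value 42 gives s8^3, and -66 gives s12^2, by
  \<open>s12_square\<close>.\<close>

definition s24 :: "'a::comm_ring_1 \<Rightarrow> 'a \<Rightarrow> 'a \<Rightarrow> 'a" where
  "s24 a x y = s8 x y ^ 3 + (a - 42) * s6 x y ^ 4"

text \<open>These expressions depend on x^4 and y^4 only; with those as variables the identities
  below have low degree and can be checked by expansion.\<close>

lemma quartic_forms:
  "s8 x y = x ^ 4 * x ^ 4 + 14 * (x ^ 4 * y ^ 4) + y ^ 4 * y ^ 4"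
  "s6 x y ^ 4 = x ^ 4 * y ^ 4 * (x ^ 4 - y ^ 4) ^ 4"
  "s12 x y = x ^ 4 * x ^ 4 * x ^ 4 - 33 * (x ^ 4 * y ^ 4) * (x ^ 4 + y ^ 4) + y ^ 4 * y ^ 4 * y ^ 4"
  by (simp_all add: s8_def s6_def s12_def power_mult_distrib flip: power_add)

text \<open>The classical relation in degree 24 between the three octahedral forms.\<close>

lemma s12_square: "s12 x y ^ 2 = s8 x y ^ 3 - 108 * s6 x y ^ 4"
  for x y :: "'a::field"
proof -
  have "(P * P * P - 33 * (P * Q) * (P + Q) + Q * Q * Q) ^ 2 =
      (P * P + 14 * (P * Q) + Q * Q) ^ 3 - 108 * (P * Q * (P - Q) ^ 4)" for P Q :: 'a
    by (simp add: algebra_simps eval_nat_numeral)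
  then show ?thesis unfolding quartic_forms .
qed

lemma s24_expand: "s24 a x y = x ^ 24 + a * (x * y) ^ 4 * (x ^ 16 + y ^ 16) +
    (759 - 4 * a) * (x * y) ^ 8 * (x ^ 8 + y ^ 8) + (2576 + 6 * a) * (x * y) ^ 12 + y ^ 24"
  for x y :: "'a::field"
proof -
  have "(P * P + 14 * (P * Q) + Q * Q) ^ 3 + (a - 42) * (P * Q * (P - Q) ^ 4) =
      P ^ 6 + a * (P * Q) * (P ^ 4 + Q ^ 4) + (759 - 4 * a) * (P * Q) ^ 2 * (P ^ 2 + Q ^ 2) +
      (2576 + 6 * a) * (P * Q) ^ 3 + Q ^ 6" for P Q
    by (simp add: algebra_simps eval_nat_numeral)
  from this[of "x ^ 4" "y ^ 4"] show ?thesis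
    unfolding s24_def quartic_forms by (simp add: power_mult_distrib flip: power_mult)
qed

definition on_vec :: "('a \<Rightarrow> 'a \<Rightarrow> 'a) \<Rightarrow> 'a ^ 2 \<Rightarrow> 'a" where
  "on_vec f v = f (v $ 1) (v $ 2)"

lemma bform_s6: "bform 6 (on_vec s6 :: 'a::field ^ 2 \<Rightarrow> 'a)"
proof -
  have "on_vec s6 = (\<lambda>v :: 'a ^ 2. v $ 1 ^ 5 * v $ 2 ^ (6 - 5) + (- 1) * (v $ 1 ^ 1 * v $ 2 ^ (6 - 1)))"
    by (rule ext) (simp add: on_vec_def s6_def algebra_simps eval_nat_numeral)
  moreover have "bform 6 (\<lambda>v. v $ 1 ^ 5 * v $ 2 ^ (6 - 5) + (- 1) * (v $ 1 ^ 1 * v $ 2 ^ (6 - 1)) :: 'a)"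
    by (intro bform_add bform_scale bform_monom) auto
  ultimately show ?thesis by simp
qed

lemma bform_s8: "bform 8 (on_vec s8 :: 'a::field ^ 2 \<Rightarrow> 'a)"
proof -
  have "on_vec s8 = (\<lambda>v :: 'a ^ 2. v $ 1 ^ 8 * v $ 2 ^ (8 - 8) + 14 * (v $ 1 ^ 4 * v $ 2 ^ (8 - 4)) + v $ 1 ^ 0 * v $ 2 ^ (8 - 0))"
    by (rule ext) (simp add: on_vec_def s8_def power_mult_distrib)
  moreover have "bform 8 (\<lambda>v. v $ 1 ^ 8 * v $ 2 ^ (8 - 8) + 14 * (v $ 1 ^ 4 * v $ 2 ^ (8 - 4)) + v $ 1 ^ 0 * v $ 2 ^ (8 - 0) :: 'a)"
    by (intro bform_add bform_scale bform_monom) auto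
  ultimately show ?thesis by simp
qed

lemma bform_s12: "bform 12 (on_vec s12 :: 'a::field ^ 2 \<Rightarrow> 'a)"
proof -
  have "on_vec s12 = (\<lambda>v :: 'a ^ 2. v $ 1 ^ 12 * v $ 2 ^ (12 - 12) + (- 33) * (v $ 1 ^ 8 * v $ 2 ^ (12 - 8)) +
    (- 33) * (v $ 1 ^ 4 * v $ 2 ^ (12 - 4)) + v $ 1 ^ 0 * v $ 2 ^ (12 - 0))"
    by (rule ext) (simp add: on_vec_def s12_def power_mult_distrib algebra_simps flip: power_add)
  moreover have "bform 12 (\<lambda>v. v $ 1 ^ 12 * v $ 2 ^ (12 - 12) + (- 33) * (v $ 1 ^ 8 * v $ 2 ^ (12 - 8)) +
    (- 33) * (v $ 1 ^ 4 * v $ 2 ^ (12 - 4)) + v $ 1 ^ 0 * v $ 2 ^ (12 - 0) :: 'a)"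
    by (intro bform_add bform_scale bform_monom) auto
  ultimately show ?thesis by simp
qed

lemma bform_s24: "bform 24 (on_vec (s24 a) :: 'a::field ^ 2 \<Rightarrow> 'a)"
proof -
  have "bform 24 (\<lambda>v. on_vec s8 v ^ 3 + (a - 42) * on_vec s6 v ^ 4)"
    using bform_power[OF bform_s8, of 3] bform_power[OF bform_s6, of 4] by (intro bform_add bform_scale) simp_all
  then show ?thesis by (simp add: on_vec_def[abs_def] s24_def)
qed

section \<open>Square-freeness of the octahedral forms\<close>

lemma double_root_pderiv:
  fixes f :: "'a::field_char_0 ^ 2 \<Rightarrow> 'a"
  assumes M: "bform e M" and f: "\<And>v. f v = wedge v p ^ 2 * M v" and r: "\<And>t. f (p + t *s u) = poly r t"
  shows "poly r 0 = 0" "poly (pderiv r) 0 = 0"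
proof -
  obtain q where q: "\<And>t. M (p + t *s u) = poly q t" using bform_poly_line[OF M] by blast
  have "poly r t = poly ([:0, 0, (wedge u p)\<^sup>2:] * q) t" for t
    by (simp add: f q wedge_def power2_eq_square algebra_simps flip: r)
  then have "r = [:0, 0, (wedge u p)\<^sup>2:] * q" by (metis poly_eq_poly_eq_iff ext)
  then show "poly r 0 = 0" "poly (pderiv r) 0 = 0" by (simp_all add: pderiv_mult pderiv_pCons)
qed

lemma s6_partials:
  fixes x y :: "'a::field_char_0"
  shows "poly (pderiv (s6 [:x, 1:] [:y:])) 0 = y * (5 * x ^ 4 - y ^ 4)"
    "poly (pderiv (s6 [:x:] [:y, 1:])) 0 = x * (x ^ 4 - 5 * y ^ 4)"
  unfolding s6_def pderiv_mult pderiv_add pderiv_diff pderiv_power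
  by (simp_all add: pderiv_pCons algebra_simps eval_nat_numeral)

lemma s8_partials:
  fixes x y :: "'a::field_char_0"
  shows "poly (pderiv (s8 [:x, 1:] [:y:])) 0 = 8 * x ^ 3 * (x ^ 4 + 7 * y ^ 4)"
    "poly (pderiv (s8 [:x:] [:y, 1:])) 0 = 8 * y ^ 3 * (y ^ 4 + 7 * x ^ 4)"
  unfolding s8_def pderiv_mult pderiv_add pderiv_diff pderiv_power
  by (simp_all add: pderiv_pCons algebra_simps eval_nat_numeral)

lemma s12_partials:
  fixes x y :: "'a::field_char_0"
  shows "poly (pderiv (s12 [:x, 1:] [:y:])) 0 = 12 * x ^ 3 * (x ^ 8 - 22 * x ^ 4 * y ^ 4 - 11 * y ^ 8)"
    "poly (pderiv (s12 [:x:] [:y, 1:])) 0 = 12 * y ^ 3 * (y ^ 8 - 22 * x ^ 4 * y ^ 4 - 11 * x ^ 8)"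
  unfolding s12_def pderiv_mult pderiv_add pderiv_diff pderiv_power
  by (simp_all add: pderiv_pCons algebra_simps eval_nat_numeral)

text \<open>The left-hand side is the Jacobian determinant of \<open>s8\<close> and
  \<open>s6\<close>, written with the partial derivatives computed above.\<close>

lemma jacobian_s8_s6: "8 * x ^ 3 * (x ^ 4 + 7 * y ^ 4) * (x * (x ^ 4 - 5 * y ^ 4)) -
    8 * y ^ 3 * (y ^ 4 + 7 * x ^ 4) * (y * (5 * x ^ 4 - y ^ 4)) = 8 * s12 x y"
  for x y :: "'a::field"
  by (simp add: s12_def algebra_simps eval_nat_numeral)

text \<open>The first factor, as a form in (u,w), vanishes at the eight images of (x:y) under the
  dihedral group that preserves the pair 0, infinity. The other two are its analogues for (x+y :
  x-y) and (x+iy : x-iy), that is, for the other two axes of the octahedron. Together they vanish on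
  the whole octahedral orbit, as does the right-hand side.\<close>

lemma Phi_product:
  fixes x y u w :: "'a::field"
  defines "U \<equiv> u ^ 8 + w ^ 8" and "V \<equiv> u ^ 4 * w ^ 4"
  shows "(x ^ 4 * y ^ 4 * U - V * (x ^ 8 + y ^ 8)) *
    ((x ^ 2 - y ^ 2) ^ 4 * U - 2 * V * (x ^ 8 + 28 * x ^ 6 * y ^ 2 + 70 * x ^ 4 * y ^ 4 + 28 * x ^ 2 * y ^ 6 + y ^ 8)) *
    ((x ^ 2 + y ^ 2) ^ 4 * U - 2 * V * (x ^ 8 - 28 * x ^ 6 * y ^ 2 + 70 * x ^ 4 * y ^ 4 - 28 * x ^ 2 * y ^ 6 + y ^ 8)) =
    s8 u w ^ 3 * s6 x y ^ 4 - s8 x y ^ 3 * s6 u w ^ 4"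
proof -
  \<comment> \<open>Changing the sign of y^2 exchanges the second and third factors; in these
    variables it is the sign of \<open>n\<close>.\<close>
  define e n where "e = x ^ 4 + y ^ 4" "n = x ^ 2 * y ^ 2"
  have 1: "s8 u w = U + 14 * V" "s6 u w ^ 4 = V * (U - 2 * V) ^ 2"
    unfolding quartic_forms U_def V_def by (simp_all add: algebra_simps eval_nat_numeral)
  have 2: "s8 x y = e ^ 2 + 12 * n ^ 2" "s6 x y ^ 4 = n ^ 2 * (e ^ 2 - 4 * n ^ 2) ^ 2" "x ^ 4 * y ^ 4 = n ^ 2"
    "x ^ 8 + y ^ 8 = e ^ 2 - 2 * n ^ 2" "(x ^ 2 - y ^ 2) ^ 4 = (e - 2 * n) ^ 2" "(x ^ 2 + y ^ 2) ^ 4 = (e + 2 * n) ^ 2"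
    "x ^ 8 + 28 * x ^ 6 * y ^ 2 + 70 * x ^ 4 * y ^ 4 + 28 * x ^ 2 * y ^ 6 + y ^ 8 = e ^ 2 + 28 * e * n + 68 * n ^ 2"
    "x ^ 8 - 28 * x ^ 6 * y ^ 2 + 70 * x ^ 4 * y ^ 4 - 28 * x ^ 2 * y ^ 6 + y ^ 8 = e ^ 2 - 28 * e * n + 68 * n ^ 2"
    unfolding quartic_forms e_n_def by (simp_all add: algebra_simps eval_nat_numeral)
  show ?thesis unfolding 1 2 by (simp add: algebra_simps eval_nat_numeral)
qed


text \<open>\<open>F\<close> is the same expression as \<open>f\<close>, evaluated at polynomials,
  so that \<open>pderiv\<close> computes the two partial derivatives at a root.\<close>

lemma double_root_partials:
  fixes f :: "'a::field_char_0 \<Rightarrow> 'a \<Rightarrow> 'a"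
  assumes F: "\<And>P Q t. poly (F P Q) t = f (poly P t) (poly Q t)"
    and M: "bform e M" and eq: "\<And>v. on_vec f v = wedge v p ^ 2 * M v"
  shows "f (p $ 1) (p $ 2) = 0" "poly (pderiv (F [:p $ 1, 1:] [:p $ 2:])) 0 = 0"
    "poly (pderiv (F [:p $ 1:] [:p $ 2, 1:])) 0 = 0"
proof -
  have 1: "on_vec f (p + t *s vector [1, 0]) = poly (F [:p $ 1, 1:] [:p $ 2:]) t" for t
    by (simp add: F on_vec_def)
  have 2: "on_vec f (p + t *s vector [0, 1]) = poly (F [:p $ 1:] [:p $ 2, 1:]) t" for t
    by (simp add: F on_vec_def)
  show "f (p $ 1) (p $ 2) = 0" "poly (pderiv (F [:p $ 1, 1:] [:p $ 2:])) 0 = 0"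
    "poly (pderiv (F [:p $ 1:] [:p $ 2, 1:])) 0 = 0"
    using double_root_pderiv[OF M eq 1] double_root_pderiv[OF M eq 2] by (simp_all add: F)
qed

lemma s6_poly: "poly (s6 P Q) t = s6 (poly P t) (poly Q t)"
  by (simp add: s6_def)

lemma s8_poly: "poly (s8 P Q) t = s8 (poly P t) (poly Q t)"
  by (simp add: s8_def)

lemma s12_poly: "poly (s12 P Q) t = s12 (poly P t) (poly Q t)"
  by (simp add: s12_def)

lemma s6_s8_coprime:
  fixes x y :: "'a::field_char_0"
  assumes "s6 x y = 0" "s8 x y = 0" shows "x = 0 \<and> y = 0"
proof -
  have "x = 0 \<or> y = 0 \<or> x ^ 4 = y ^ 4" using assms(1) by (auto simp: s6_def)
  moreover have "y = 0" if "x = 0" using assms(2) that by (simp add: s8_def)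
  moreover have "x = 0" if "y = 0" using assms(2) that by (simp add: s8_def)
  moreover have "x = 0 \<and> y = 0" if "x ^ 4 = y ^ 4"
  proof -
    have "s8 x y = 16 * (x ^ 4 * x ^ 4)" unfolding quartic_forms that[symmetric] by simp
    then have "x = 0" using assms(2) by simp
    then show ?thesis using that by simp
  qed
  ultimately show ?thesis by blast
qed

lemma sqfree_s6: "sqfree (on_vec s6 :: 'a::field_char_0 ^ 2 \<Rightarrow> 'a)"
  unfolding sqfree_def
proof (intro allI impI notI)
  fix p M e assume p: "p \<noteq> 0" "bform e M" "\<forall>v :: 'a ^ 2. on_vec s6 v = (wedge v p)\<^sup>2 * M v"
  define x y where "x = p $ 1" "y = p $ 2"
  have "y * (5 * x ^ 4 - y ^ 4) = 0" "x * (x ^ 4 - 5 * y ^ 4) = 0"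
    using double_root_partials(2,3)[OF s6_poly p(2) p(3)[rule_format]] s6_partials x_y_def by metis+
  then have "y = 0 \<or> y ^ 4 = 5 * x ^ 4" "x = 0 \<or> x ^ 4 = 5 * y ^ 4" by auto
  moreover have "x ^ 4 = 0" if "y ^ 4 = 5 * x ^ 4" "x ^ 4 = 5 * y ^ 4"
  proof -
    have "x ^ 4 = 25 * x ^ 4" by (subst that(2), subst that(1)) simp
    then show ?thesis by (rule eq_scaled_self) simp
  qed
  ultimately have "x = 0 \<and> y = 0" by auto
  then show False using p(1) x_y_def by (simp add: vec2_eq_iff)
qed

lemma sqfree_s8: "sqfree (on_vec s8 :: 'a::field_char_0 ^ 2 \<Rightarrow> 'a)"
  unfolding sqfree_def
proof (intro allI impI notI)
  fix p M e assume p: "p \<noteq> 0" "bform e M" "\<forall>v :: 'a ^ 2. on_vec s8 v = (wedge v p)\<^sup>2 * M v"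
  define x y where "x = p $ 1" "y = p $ 2"
  have "8 * x ^ 3 * (x ^ 4 + 7 * y ^ 4) = 0" "8 * y ^ 3 * (y ^ 4 + 7 * x ^ 4) = 0"
    using double_root_partials(2,3)[OF s8_poly p(2) p(3)[rule_format]] s8_partials x_y_def by metis+
  then have "x = 0 \<or> x ^ 4 = - 7 * y ^ 4" "y = 0 \<or> y ^ 4 = - 7 * x ^ 4"
    using eq_neg_iff_add_eq_0[of "x ^ 4" "7 * y ^ 4"] eq_neg_iff_add_eq_0[of "y ^ 4" "7 * x ^ 4"] by simp_all
  moreover have "x ^ 4 = 0" if "x ^ 4 = - 7 * y ^ 4" "y ^ 4 = - 7 * x ^ 4"
  proof -
    have "x ^ 4 = 49 * x ^ 4" by (subst that(1), subst that(2)) simp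
    then show ?thesis by (rule eq_scaled_self) simp
  qed
  ultimately have "x = 0 \<and> y = 0" by auto
  then show False using p(1) x_y_def by (simp add: vec2_eq_iff)
qed

lemma sqfree_s12: "sqfree (on_vec s12 :: 'a::field_char_0 ^ 2 \<Rightarrow> 'a)"
  unfolding sqfree_def
proof (intro allI impI notI)
  fix p M e assume p: "p \<noteq> 0" "bform e M" "\<forall>v :: 'a ^ 2. on_vec s12 v = (wedge v p)\<^sup>2 * M v"
  define x y where "x = p $ 1" "y = p $ 2"
  have e: "12 * x ^ 3 * (x ^ 8 - 22 * x ^ 4 * y ^ 4 - 11 * y ^ 8) = 0"
    "12 * y ^ 3 * (y ^ 8 - 22 * x ^ 4 * y ^ 4 - 11 * x ^ 8) = 0"
    using double_root_partials(2,3)[OF s12_poly p(2) p(3)[rule_format]] s12_partials x_y_def by metis+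
  have "x = 0 \<and> y = 0"
  proof (cases "x = 0 \<or> y = 0")
    case True then show ?thesis using e by auto
  next
    case False
    define X Y where "X = x ^ 4" "Y = y ^ 4"
    have XY: "x ^ 8 = X * X" "y ^ 8 = Y * Y" by (simp_all add: X_Y_def flip: power_add)
    have 1: "X * X - 22 * X * Y - 11 * (Y * Y) = 0" "Y * Y - 22 * X * Y - 11 * (X * X) = 0"
      using e False by (simp_all add: XY flip: X_Y_def)
    \<comment> \<open>The difference of the two conditions factors; for X = Y and for X = -Y either
      of them then becomes a nonzero multiple of X^2.\<close>
    have "12 * ((X - Y) * (X + Y)) = (X * X - 22 * X * Y - 11 * (Y * Y)) - (Y * Y - 22 * X * Y - 11 * (X * X))"
      by (simp add: algebra_simps)
    then have "12 * ((X - Y) * (X + Y)) = 0" unfolding 1 by simp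
    then have "X = Y \<or> X = - Y" by (simp add: eq_neg_iff_add_eq_0)
    then have "X * X = 0" using 1 by (elim disjE) (simp_all add: algebra_simps)
    then show ?thesis using False X_Y_def by simp
  qed
  then show False using p(1) x_y_def by (simp add: vec2_eq_iff)
qed

text \<open>At a double root both partial derivatives of u^3 + (a - 42) v^4 vanish, with u = s8 and
  v = s6. Eliminating v leaves u^2 times the Jacobian, a multiple of s12. If u = 0, then v = 0 as a
  is not 42; if s12 = 0, the relation u^3 = 108 v^4 gives (a + 66) v^4 = 0. Either way u = v = 0,
  and the two forms have no common root.\<close>

lemma sqfree_s24:
  fixes a :: "'a::field_char_0"
  assumes a: "a \<noteq> 42" "a \<noteq> - 66" shows "sqfree (on_vec (s24 a))"
  unfolding sqfree_def
proof (intro allI impI notI)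
  fix p M e assume p: "p \<noteq> 0" "bform e M" "\<forall>v :: 'a ^ 2. on_vec (s24 a) v = (wedge v p)\<^sup>2 * M v"
  define x y where "x = p $ 1" "y = p $ 2"
  define F where "F P Q = s8 P Q ^ 3 + [:a - 42:] * s6 P Q ^ 4" for P Q :: "'a poly"
  have F: "poly (F P Q) t = s24 a (poly P t) (poly Q t)" for P Q t
    by (simp add: F_def s24_def s6_poly s8_poly)
  have dF: "poly (pderiv (F P Q)) 0 = 3 * s8 (poly P 0) (poly Q 0) ^ 2 * poly (pderiv (s8 P Q)) 0
      + 4 * (a - 42) * s6 (poly P 0) (poly Q 0) ^ 3 * poly (pderiv (s6 P Q)) 0" for P Q
    unfolding F_def pderiv_add pderiv_mult pderiv_power by (simp add: pderiv_pCons s6_poly s8_poly algebra_simps)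
  define u v ux uy vx vy where "u = s8 x y" "v = s6 x y"
    "ux = 8 * x ^ 3 * (x ^ 4 + 7 * y ^ 4)" "uy = 8 * y ^ 3 * (y ^ 4 + 7 * x ^ 4)"
    "vx = y * (5 * x ^ 4 - y ^ 4)" "vy = x * (x ^ 4 - 5 * y ^ 4)"
  note uv = this
  have 0: "u ^ 3 + (a - 42) * v ^ 4 = 0"
    using double_root_partials(1)[OF F p(2) p(3)[rule_format]] by (simp add: s24_def uv flip: x_y_def)
  have x: "3 * u ^ 2 * ux + 4 * (a - 42) * v ^ 3 * vx = 0"
    using double_root_partials(2)[OF F p(2) p(3)[rule_format]] unfolding dF s8_partials s6_partials
    by (simp add: uv flip: x_y_def)
  have y: "3 * u ^ 2 * uy + 4 * (a - 42) * v ^ 3 * vy = 0"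
    using double_root_partials(3)[OF F p(2) p(3)[rule_format]] unfolding dF s8_partials s6_partials
    by (simp add: uv flip: x_y_def)
  \<comment> \<open>Cramer's rule: this combination of the two derivative conditions cancels the
    terms with v^3.\<close>
  have "3 * u ^ 2 * (ux * vy - uy * vx) = (3 * u ^ 2 * ux + 4 * (a - 42) * v ^ 3 * vx) * vy -
      (3 * u ^ 2 * uy + 4 * (a - 42) * v ^ 3 * vy) * vx"
    by (simp add: algebra_simps)
  then have "3 * u ^ 2 * (ux * vy - uy * vx) = 0" unfolding x y by simp
  moreover have "ux * vy - uy * vx = 8 * s12 x y" unfolding uv by (rule jacobian_s8_s6)
  ultimately have "u = 0 \<or> s12 x y = 0" by simp
  then have "v = 0"
  proof
    assume "u = 0" then show ?thesis using 0 a by simp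
  next
    assume "s12 x y = 0"
    then have "u ^ 3 = 108 * v ^ 4" using s12_square[of x y] uv by simp
    then have "(a + 66) * v ^ 4 = 0" using 0 by (simp add: algebra_simps)
    then show ?thesis using a by (simp add: eq_neg_iff_add_eq_0)
  qed
  then have "u = 0" using 0 by simp
  then have "x = 0 \<and> y = 0" using s6_s8_coprime[of x y] \<open>v = 0\<close> uv(1,2) by simp
  then show False using p(1) x_y_def by (simp add: vec2_eq_iff)
qed

context imaginary_unit
begin

section \<open>The characters of the octahedral group on the forms\<close>

text \<open>One sign \<open>e\<close> governs \<open>s6\<close> and \<open>s12\<close>, while
  \<open>s8\<close> transforms without a sign. The powers of the determinant are half the degrees,
  so the condition is unchanged when \<open>B\<close> is multiplied by a scalar.\<close>

definition oct_char :: "'a ^ 2 ^ 2 \<Rightarrow> 'a \<Rightarrow> bool" where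
  "oct_char B e \<longleftrightarrow> (\<forall>v. on_vec s6 (B *v v) = e * det B ^ 3 * on_vec s6 v \<and>
     on_vec s8 (B *v v) = det B ^ 4 * on_vec s8 v \<and> on_vec s12 (B *v v) = e * det B ^ 6 * on_vec s12 v)"

lemma oct_char_mult: "oct_char A a \<Longrightarrow> oct_char B b \<Longrightarrow> oct_char (A ** B) (a * b)"
  unfolding oct_char_def
  by (simp add: det_mul power_mult_distrib mult_ac flip: matrix_vector_mul_assoc)

lemma det_mat_mult: "det (mat k ** B) = k ^ 2 * det B" for B :: "'a ^ 2 ^ 2"
  by (simp add: det_mul det_mat2 mat_mat2 power2_eq_square)

lemma oct_char_scale:
  assumes k: "k \<noteq> 0" shows "oct_char (mat k ** B) e \<longleftrightarrow> oct_char B e"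
proof -
  have "on_vec s6 (mat k ** B *v v) = k ^ 6 * on_vec s6 (B *v v)"
    "on_vec s8 (mat k ** B *v v) = k ^ 8 * on_vec s8 (B *v v)"
    "on_vec s12 (mat k ** B *v v) = k ^ 12 * on_vec s12 (B *v v)" for v
    using bform_homogeneous[OF bform_s6] bform_homogeneous[OF bform_s8] bform_homogeneous[OF bform_s12]
    by (simp_all flip: matrix_vector_mul_assoc)
  moreover have "det (mat k ** B) ^ 3 = k ^ 6 * det B ^ 3" "det (mat k ** B) ^ 4 = k ^ 8 * det B ^ 4"
    "det (mat k ** B) ^ 6 = k ^ 12 * det B ^ 6"
    by (simp_all add: det_mat_mult power_mult_distrib flip: power_mult)
  ultimately show ?thesis using k by (simp add: oct_char_def mult.left_commute mult.assoc)
qed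

lemma qmat_gens: "qmat (1, 1, 0, 0) = mat2 (1 + ii) 0 0 (1 - ii)" "qmat (0, 1, 0, 1) = mat2 ii ii ii (- ii)"
  by (simp_all add: qmat.simps)

lemma ii_powers: "ii ^ 2 = - 1" "ii ^ 3 = - ii" "ii ^ 4 = 1" "ii ^ 6 = - 1" "ii ^ 8 = 1" "ii ^ 12 = 1"
proof -
  show 2: "ii ^ 2 = - 1" by (simp add: power2_eq_square ii_sq)
  show "ii ^ 3 = - ii" by (simp add: power3_eq_cube ii_sq)
  have "ii ^ 4 = (ii ^ 2) ^ 2" "ii ^ 6 = (ii ^ 2) ^ 3" "ii ^ 8 = (ii ^ 2) ^ 4" "ii ^ 12 = (ii ^ 2) ^ 6"
    by (simp_all flip: power_mult)
  then show "ii ^ 4 = 1" "ii ^ 6 = - 1" "ii ^ 8 = 1" "ii ^ 12 = 1" unfolding 2 by simp_all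
qed

lemma oct_char_gen1: "oct_char (qmat (1, 1, 0, 0)) (- 1)"
proof -
  have 2: "(1 + ii) ^ 2 = 2 * ii" "(1 - ii) ^ 2 = - 2 * ii"
    by (simp_all add: power2_eq_square algebra_simps ii_sq)
  have "(1 + ii) ^ 4 = ((1 + ii) ^ 2) ^ 2" "(1 - ii) ^ 4 = ((1 - ii) ^ 2) ^ 2"
    by (simp_all flip: power_mult)
  then have 4: "(1 + ii) ^ 4 = - 4" "(1 - ii) ^ 4 = - 4"
    unfolding 2 by (simp_all add: power_mult_distrib ii_powers)
  have "(1 + ii) ^ 8 = ((1 + ii) ^ 4) ^ 2" "(1 - ii) ^ 8 = ((1 - ii) ^ 4) ^ 2"
    "(1 + ii) ^ 12 = ((1 + ii) ^ 4) ^ 3" "(1 - ii) ^ 12 = ((1 - ii) ^ 4) ^ 3"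
    by (simp_all flip: power_mult)
  then have 8: "(1 + ii) ^ 8 = 16" "(1 - ii) ^ 8 = 16" "(1 + ii) ^ 12 = - 64" "(1 - ii) ^ 12 = - 64"
    unfolding 4 by simp_all
  have p: "(1 + ii) * (1 - ii) = 2" by (simp add: algebra_simps ii_sq)
  have d: "det (mat2 (1 + ii) 0 0 (1 - ii)) = 2" by (simp add: det_mat2 p)
  show ?thesis
    unfolding qmat_gens oct_char_def on_vec_def mat2_vec d
  proof (intro allI conjI)
    fix v :: "'a ^ 2"
    define x y where "x = v $ 1" "y = v $ 2"
    have "s6 ((1 + ii) * x) ((1 - ii) * y) = ((1 + ii) * (1 - ii)) * (x * y) * ((1 + ii) ^ 4 * x ^ 4 - (1 - ii) ^ 4 * y ^ 4)"
      by (simp add: s6_def power_mult_distrib mult_ac)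
    also have "\<dots> = - 1 * 2 ^ 3 * s6 x y" unfolding p 4 s6_def by (simp add: algebra_simps)
    finally show "s6 ((1 + ii) * v $ 1 + 0 * v $ 2) (0 * v $ 1 + (1 - ii) * v $ 2) = - 1 * 2 ^ 3 * s6 (v $ 1) (v $ 2)"
      by (simp add: x_y_def)
    have "s8 ((1 + ii) * x) ((1 - ii) * y) = (1 + ii) ^ 8 * x ^ 8 + 14 * (((1 + ii) * (1 - ii)) ^ 4 * (x * y) ^ 4) + (1 - ii) ^ 8 * y ^ 8"
      by (simp add: s8_def power_mult_distrib mult_ac)
    also have "\<dots> = 2 ^ 4 * s8 x y" unfolding p 8 s8_def by (simp add: algebra_simps)
    finally show "s8 ((1 + ii) * v $ 1 + 0 * v $ 2) (0 * v $ 1 + (1 - ii) * v $ 2) = 2 ^ 4 * s8 (v $ 1) (v $ 2)"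
      by (simp add: x_y_def)
    have "s12 ((1 + ii) * x) ((1 - ii) * y) = (1 + ii) ^ 12 * x ^ 12 -
        33 * (((1 + ii) * (1 - ii)) ^ 4 * (x * y) ^ 4) * ((1 + ii) ^ 4 * x ^ 4 + (1 - ii) ^ 4 * y ^ 4) + (1 - ii) ^ 12 * y ^ 12"
      by (simp add: s12_def power_mult_distrib mult_ac)
    also have "\<dots> = - 1 * 2 ^ 6 * s12 x y" unfolding p 4 8 s12_def by (simp add: algebra_simps)
    finally show "s12 ((1 + ii) * v $ 1 + 0 * v $ 2) (0 * v $ 1 + (1 - ii) * v $ 2) = - 1 * 2 ^ 6 * s12 (v $ 1) (v $ 2)"
      by (simp add: x_y_def)
  qed
qed

lemma oct_char_gen2: "oct_char (qmat (0, 1, 0, 1)) (- 1)"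
proof -
  have "qmat (0, 1, 0, 1) = mat ii ** mat2 1 1 1 (- 1)" by (simp add: qmat_gens mat_mult_mat2)
  moreover have "oct_char (mat2 1 1 1 (- 1)) (- 1)"
    unfolding oct_char_def on_vec_def mat2_vec det_mat2
  proof (intro allI conjI)
    fix v :: "'a ^ 2"
    define x y where "x = v $ 1" "y = v $ 2"
    have "s6 (x + y) (x - y) = 8 * s6 x y" by (simp add: s6_def algebra_simps eval_nat_numeral)
    then show "s6 (1 * v $ 1 + 1 * v $ 2) (1 * v $ 1 + - 1 * v $ 2) = - 1 * (1 * - 1 - 1 * 1) ^ 3 * s6 (v $ 1) (v $ 2)"
      by (simp add: x_y_def)
    have "s8 (x + y) (x - y) = 16 * s8 x y" by (simp add: s8_def algebra_simps eval_nat_numeral)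
    then show "s8 (1 * v $ 1 + 1 * v $ 2) (1 * v $ 1 + - 1 * v $ 2) = (1 * - 1 - 1 * 1) ^ 4 * s8 (v $ 1) (v $ 2)"
      by (simp add: x_y_def)
    have "s12 (x + y) (x - y) = - 64 * s12 x y" by (simp add: s12_def algebra_simps eval_nat_numeral)
    then show "s12 (1 * v $ 1 + 1 * v $ 2) (1 * v $ 1 + - 1 * v $ 2) = - 1 * (1 * - 1 - 1 * 1) ^ 6 * s12 (v $ 1) (v $ 2)"
      by (simp add: x_y_def)
  qed
  ultimately show ?thesis by (simp add: oct_char_scale)
qed

lemma qnorm_mult: "qnorm (qmul p q) = qnorm p * qnorm q"
proof -
  obtain a b c d where "p = (a, b, c, d)" by (rule prod_cases4)
  moreover obtain a' b' c' d' where "q = (a', b', c', d')" by (rule prod_cases4)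
  ultimately show ?thesis by (simp add: algebra_simps)
qed

lemma qnorm_scale: "qnorm (qscale k q) = k * k * qnorm q"
  by (cases q) (simp add: algebra_simps)

text \<open>The character of the binary octahedral group with kernel the binary tetrahedral group is the
  Legendre symbol of the norm modulo 3.\<close>

definition oct_sign :: "quat \<Rightarrow> 'a" where
  "oct_sign q = (if qnorm q mod 3 = 1 then 1 else - 1)"

text \<open>Induction over words in the generators, both of which have sign -1. The norm has to stay
  prime to 3 along the induction, since only then is the Legendre symbol multiplicative in the form
  given by \<open>oct_sign\<close>.\<close>

lemma oct_char_qmat:
  assumes "q \<in> OQ" shows "oct_char (qmat q) (oct_sign q)"
proof -
  have "qnorm q mod 3 \<noteq> 0 \<and> oct_char (qmat q) (oct_sign q)"
    using assms
  proof (induction rule: OQ_induct)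
    case gen1
    then show ?case using oct_char_gen1 by (simp add: oct_sign_def)
  next
    case gen2
    then show ?case using oct_char_gen2 by (simp add: oct_sign_def)
  next
    case (mult p q)
    have "x mod 3 = 0 \<or> x mod 3 = 1 \<or> x mod 3 = 2" for x :: int by presburger
    then have m: "qnorm p mod 3 = 1 \<or> qnorm p mod 3 = 2" "qnorm q mod 3 = 1 \<or> qnorm q mod 3 = 2"
      using mult by blast+
    have "qnorm (qmul p q) mod 3 = ((qnorm p mod 3) * (qnorm q mod 3)) mod 3"
      by (simp add: qnorm_mult mod_mult_eq)
    then have "oct_sign (qmul p q) = oct_sign p * oct_sign q \<and> qnorm (qmul p q) mod 3 \<noteq> 0"
      using m by (elim disjE) (simp_all add: oct_sign_def)
    then show ?case using mult oct_char_mult by (simp add: qmat_mult)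
  next
    case (scale k q)
    have "k * k mod 3 = 1" using scale(1) by auto
    then have "qnorm (qscale k q) mod 3 = qnorm q mod 3"
      unfolding qnorm_scale by (metis mod_mult_left_eq mult_1)
    moreover have "of_int k \<noteq> (0 :: 'a)" using scale(1) by auto
    ultimately show ?case using scale(2) oct_char_scale by (simp add: oct_sign_def qmat_scale)
  qed
  then show ?thesis by blast
qed

lemma semi_invariant_mat: "bform d f \<Longrightarrow> k \<noteq> 0 \<Longrightarrow> semi_invariant f (mat k)"
  by (auto simp: semi_invariant_def invertible_mat bform_homogeneous intro!: exI[of _ "k ^ d"])

lemma octset_semi_invariant:
  assumes "bform d f" "\<And>q. q \<in> OQ \<Longrightarrow> semi_invariant f (qmat q)" "B \<in> octset"
  shows "semi_invariant f B"
  using assms semi_invariant_mult semi_invariant_mat unfolding octset_def by blast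

lemma octset_s6: "B \<in> octset \<Longrightarrow> semi_invariant (on_vec s6) B"
  and octset_s8: "B \<in> octset \<Longrightarrow> semi_invariant (on_vec s8) B"
  and octset_s12: "B \<in> octset \<Longrightarrow> semi_invariant (on_vec s12) B"
  and octset_s24: "B \<in> octset \<Longrightarrow> semi_invariant (on_vec (s24 a)) B"
proof -
  have *: "det (qmat q) \<noteq> 0" "oct_sign q \<noteq> 0" "invertible (qmat q)" if "q \<in> OQ" for q
    using OQ_invertible[OF that] by (auto simp: invertible_det_nz oct_sign_def)
  note ch = oct_char_qmat[unfolded oct_char_def, rule_format]
  show "B \<in> octset \<Longrightarrow> semi_invariant (on_vec s6) B"
    by (rule octset_semi_invariant[OF bform_s6])
      (use * ch in \<open>auto simp: semi_invariant_def intro!: exI[of _ "oct_sign _ * det (qmat _) ^ 3"]\<close>)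
  show "B \<in> octset \<Longrightarrow> semi_invariant (on_vec s8) B"
    by (rule octset_semi_invariant[OF bform_s8])
      (use * ch in \<open>auto simp: semi_invariant_def intro!: exI[of _ "det (qmat _) ^ 4"]\<close>)
  show "B \<in> octset \<Longrightarrow> semi_invariant (on_vec s12) B"
    by (rule octset_semi_invariant[OF bform_s12])
      (use * ch in \<open>auto simp: semi_invariant_def intro!: exI[of _ "oct_sign _ * det (qmat _) ^ 6"]\<close>)
  have "semi_invariant (on_vec (s24 a)) (qmat q)" if q: "q \<in> OQ" for q
  proof -
    have "oct_sign q ^ 4 = 1" by (simp add: oct_sign_def)
    then have "on_vec (s24 a) (qmat q *v v) = det (qmat q) ^ 12 * on_vec (s24 a) v" for v
      using ch[OF q, of v]
      by (simp add: on_vec_def s24_def power_mult_distrib distrib_left mult.left_commute flip: power_mult)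
    then show ?thesis using *[OF q] by (auto simp: semi_invariant_def intro!: exI[of _ "det (qmat q) ^ 12"])
  qed
  then show "B \<in> octset \<Longrightarrow> semi_invariant (on_vec (s24 a)) B"
    by (rule octset_semi_invariant[OF bform_s24])
qed

section \<open>Orbits on the projective line\<close>

lemma octset_diag: "mat2 1 0 0 1 \<in> octset" "mat2 ii 0 0 1 \<in> octset" "mat2 (- 1) 0 0 1 \<in> octset" "mat2 (- ii) 0 0 1 \<in> octset"
  and octset_swap: "mat2 0 1 1 0 \<in> octset" and octset_hadamard: "mat2 1 1 1 (- 1) \<in> octset"
proof -
  have n: "1 - ii \<noteq> 0" "1 + ii \<noteq> 0"
    using ii_sq by (metis add.inverse_inverse eq_iff_diff_eq_0 mult_1 one_neq_neg_one, metis add.inverse_inverse eq_neg_iff_add_eq_0 minus_mult_minus mult_1 one_neq_neg_one add.commute)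
  have e: "mat2 1 0 0 1 = mat 1 ** qmat (1, 0, 0, 0)" "mat2 ii 0 0 1 = mat (1 / (1 - ii)) ** qmat (1, 1, 0, 0)"
    "mat2 (- 1) 0 0 1 = mat ii ** qmat (0, 1, 0, 0)" "mat2 (- ii) 0 0 1 = mat (1 / (1 + ii)) ** qmat (1, -1, 0, 0)"
    "mat2 0 1 1 0 = mat (- ii) ** qmat (0, 0, 0, 1)" "mat2 1 1 1 (- 1) = mat (- ii) ** qmat (0, 1, 0, 1)"
    using n by (simp_all add: qmat.simps mat_mult_mat2 mat2_eq_iff field_simps ii_sq)
  show "mat2 1 0 0 1 \<in> octset" "mat2 ii 0 0 1 \<in> octset" "mat2 (- 1) 0 0 1 \<in> octset" "mat2 (- ii) 0 0 1 \<in> octset"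
    "mat2 0 1 1 0 \<in> octset" "mat2 1 1 1 (- 1) \<in> octset"
    unfolding e using n by (auto intro!: octset_scale octset_qmat simp: OQ_iff)
qed

lemma fourth_powers_eq:
  assumes "a ^ 4 = b ^ 4" shows "a = b \<or> a = ii * b \<or> a = - b \<or> a = - ii * b"
proof -
  have "(a - b) * (a + b) * ((a - ii * b) * (a + ii * b)) = a ^ 4 - b ^ 4"
    by (simp add: algebra_simps eval_nat_numeral ii_sq)
  then have "(a - b) * (a + b) * ((a - ii * b) * (a + ii * b)) = 0" using assms by simp
  then show ?thesis by (auto simp: eq_neg_iff_add_eq_0)
qed

text \<open>The two ratios differ by a fourth root of unity, i.e. by a rotation about the axis
  through 0 and infinity.\<close>

lemma fourth_power_orbit:
  fixes m q :: "'a ^ 2"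
  assumes "m \<noteq> 0" "q \<noteq> 0" "(q $ 1 * m $ 2) ^ 4 = (m $ 1 * q $ 2) ^ 4"
  shows "\<exists>B\<in>octset. q = B *v m"
proof -
  have ex: "\<exists>B\<in>octset. q = B *v m" if D: "mat2 c 0 0 1 \<in> octset" and c: "q $ 1 * m $ 2 = c * (m $ 1 * q $ 2)" for c
  proof -
    have Dm: "mat2 c 0 0 1 *v m \<noteq> 0"
      using assms(1) octset_invertible[OF D] by (simp add: invertible_det_nz det_mat2 vec2_eq_iff mat2_vec)
    have "wedge q (mat2 c 0 0 1 *v m) = 0" using c by (simp add: wedge_def mat2_vec algebra_simps)
    then obtain t where t: "q = t *s (mat2 c 0 0 1 *v m)" using wedge_zero_iff[OF Dm] by blast
    then have "t \<noteq> 0" using assms(2) by auto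
    have "q = (mat t ** mat2 c 0 0 1) *v m" using t by (simp flip: matrix_vector_mul_assoc)
    then show ?thesis using octset_scale[OF \<open>t \<noteq> 0\<close> D] by blast
  qed
  show ?thesis using fourth_powers_eq[OF assms(3)] octset_diag ex by (metis mult_1 mult_minus1)
qed

text \<open>The expression is a product of two differences of fourth powers, one for
  \<open>m\<close> and one for \<open>m\<close> with its coordinates exchanged.\<close>

lemma Phi_orbit:
  fixes m q :: "'a ^ 2"
  assumes m: "m \<noteq> 0" and q: "q \<noteq> 0"
    and Phi: "(m $ 1 * m $ 2) ^ 4 * (q $ 1 ^ 8 + q $ 2 ^ 8) - q $ 1 ^ 4 * q $ 2 ^ 4 * (m $ 1 ^ 8 + m $ 2 ^ 8) = 0"
  shows "\<exists>B\<in>octset. q = B *v m"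
proof -
  have "((u * y) ^ 4 - (x * w) ^ 4) * ((u * x) ^ 4 - (y * w) ^ 4) =
    (x * y) ^ 4 * (u ^ 8 + w ^ 8) - u ^ 4 * w ^ 4 * (x ^ 8 + y ^ 8)" for x y u w :: 'a
    by (simp add: algebra_simps eval_nat_numeral)
  from this[of "q $ 1" "m $ 2" "m $ 1" "q $ 2"] have "(q $ 1 * m $ 2) ^ 4 = (m $ 1 * q $ 2) ^ 4 \<or> (q $ 1 * m $ 1) ^ 4 = (m $ 2 * q $ 2) ^ 4"
    using Phi by simp
  then show ?thesis
  proof
    assume "(q $ 1 * m $ 2) ^ 4 = (m $ 1 * q $ 2) ^ 4"
    then show ?thesis using fourth_power_orbit m q by blast
  next
    assume a: "(q $ 1 * m $ 1) ^ 4 = (m $ 2 * q $ 2) ^ 4"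
    let ?m = "mat2 0 1 1 0 *v m"
    have "?m \<noteq> 0" using m by (auto simp: vec2_eq_iff mat2_vec)
    then obtain B where "B \<in> octset" "q = B *v ?m"
      using fourth_power_orbit[of ?m q] q a by (auto simp: mat2_vec)
    then show ?thesis using octset_mult octset_swap by (auto simp: matrix_vector_mul_assoc)
  qed
qed

text \<open>The hypothesis says that the invariant s8^3/s6^4 agrees at the two points, without
  division. By \<open>Phi_product\<close> one of three factors vanishes, and each says that q is in
  the dihedral orbit of p or of an image of p under an octahedral element.\<close>

lemma oct_orbit:
  assumes p: "p \<noteq> 0" and q: "q \<noteq> 0"
    and J: "on_vec s8 q ^ 3 * on_vec s6 p ^ 4 = on_vec s8 p ^ 3 * on_vec s6 q ^ 4"
  shows "\<exists>B\<in>octset. q = B *v p"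
proof -
  define x y u w where "x = p $ 1" "y = p $ 2" "u = q $ 1" "w = q $ 2"
  note xy = this
  have H: "(x + z) ^ 8 + (x - z) ^ 8 = 2 * (x ^ 8 + 28 * x ^ 6 * z ^ 2 + 70 * x ^ 4 * z ^ 4 + 28 * x ^ 2 * z ^ 6 + z ^ 8)"
    "((x + z) * (x - z)) ^ 4 = (x ^ 2 - z ^ 2) ^ 4" for z
    by (simp_all add: algebra_simps eval_nat_numeral)
  have iy: "(ii * y) ^ 2 = - (y ^ 2)" "(ii * y) ^ 4 = y ^ 4" "(ii * y) ^ 6 = - (y ^ 6)" "(ii * y) ^ 8 = y ^ 8"
    by (simp_all add: power_mult_distrib ii_powers)
  consider "x ^ 4 * y ^ 4 * (u ^ 8 + w ^ 8) - u ^ 4 * w ^ 4 * (x ^ 8 + y ^ 8) = 0"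
    | "(x ^ 2 - y ^ 2) ^ 4 * (u ^ 8 + w ^ 8) - 2 * (u ^ 4 * w ^ 4) *
        (x ^ 8 + 28 * x ^ 6 * y ^ 2 + 70 * x ^ 4 * y ^ 4 + 28 * x ^ 2 * y ^ 6 + y ^ 8) = 0"
    | "(x ^ 2 + y ^ 2) ^ 4 * (u ^ 8 + w ^ 8) - 2 * (u ^ 4 * w ^ 4) *
        (x ^ 8 - 28 * x ^ 6 * y ^ 2 + 70 * x ^ 4 * y ^ 4 - 28 * x ^ 2 * y ^ 6 + y ^ 8) = 0"
    using Phi_product[of x y u w] J by (auto simp: on_vec_def xy)
  then show ?thesis
  proof cases
    case 1
    then show ?thesis using Phi_orbit[OF p q] by (simp add: xy power_mult_distrib)
  next
    case 2
    let ?m = "mat2 1 1 1 (- 1) *v p"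
    have m: "?m \<noteq> 0" using p by (auto simp: vec2_eq_iff mat2_vec eq_neg_iff_add_eq_0)
    have "(?m $ 1 * ?m $ 2) ^ 4 * (u ^ 8 + w ^ 8) - u ^ 4 * w ^ 4 * (?m $ 1 ^ 8 + ?m $ 2 ^ 8) = 0"
      using 2 H[of y] by (simp add: mat2_vec flip: xy)
    then obtain B where "B \<in> octset" "q = B *v ?m" using Phi_orbit[OF m q] xy by auto
    then show ?thesis using octset_mult octset_hadamard by (auto simp: matrix_vector_mul_assoc)
  next
    case 3
    let ?M = "mat2 1 1 1 (- 1) ** (mat2 (- ii) 0 0 1)"
    \<comment> \<open>The scalar \<open>ii\<close> turns the coordinates into x + iy and x - iy, as
      the third factor requires.\<close>
    let ?m = "mat ii *v (?M *v p)"
    have M: "mat ii ** ?M \<in> octset" using octset_mult octset_hadamard octset_diag octset_scale by simp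
    have mm: "?m = (mat ii ** ?M) *v p" by (simp add: matrix_vector_mul_assoc)
    have m: "?m $ 1 = x + ii * y" "?m $ 2 = x - ii * y"
      by (simp_all add: mat2_mult mat2_vec xy algebra_simps ii_sq)
    have m0: "?m \<noteq> 0"
    proof
      assume "?m = 0"
      then have "x + ii * y = 0" "x - ii * y = 0" using m by simp_all
      then have "2 * x = 0" "2 * (ii * y) = 0" by (simp_all add: eq_neg_iff_add_eq_0)
      then show False using p xy by (simp add: vec2_eq_iff)
    qed
    have "(?m $ 1 * ?m $ 2) ^ 4 * (u ^ 8 + w ^ 8) - u ^ 4 * w ^ 4 * (?m $ 1 ^ 8 + ?m $ 2 ^ 8) = 0"
      using 3 H[of "ii * y"] unfolding m iy by simp
    then obtain B where "B \<in> octset" "q = B *v ?m" using Phi_orbit[OF m0 q] xy by auto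
    then show ?thesis using octset_mult M unfolding mm by (auto simp: matrix_vector_mul_assoc)
  qed
qed

end

section \<open>Forms that are semi-invariant under the octahedral group\<close>

text \<open>Every choice of images +-x, +-y of i and j, with x and y different among i, j, k, is
  conjugation by one of the 48: these are the 24 automorphisms of the quaternion group.\<close>

lemma oct_normalizer_list:
  "list_all (\<lambda>x. list_all (\<lambda>y. list_all (\<lambda>s. list_all (\<lambda>s'. x = y \<or>
     list_ex (\<lambda>q. qmul q (0, 1, 0, 0) = qscale s (qmul x q) \<and> qmul q (0, 0, 1, 0) = qscale s' (qmul y q)) oct_list)
     [1, -1]) [1, -1]) [(0, 1, 0, 0), (0, 0, 1, 0), (0, 0, 0, 1)]) [(0, 1, 0, 0), (0, 0, 1, 0), (0, 0, 0, 1)]"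
  by code_simp

text \<open>The octahedral group normalizes the four-group of the classes of 1, i, j, k.\<close>

lemma oct_four_group_list:
  "list_all (\<lambda>q. list_all (\<lambda>u. list_ex (\<lambda>x. qmul q u = qmul x q \<or> qmul q u = qscale (-1) (qmul x q))
     [(0, 1, 0, 0), (0, 0, 1, 0), (0, 0, 0, 1)]) [(0, 1, 0, 0), (0, 0, 1, 0)]) oct_list"
  by code_simp

context imaginary_unit
begin

definition oct_good :: "nat \<Rightarrow> ('a ^ 2 \<Rightarrow> 'a) \<Rightarrow> bool" where
  "oct_good d L \<longleftrightarrow> bform d L \<and> sqfree L \<and> (\<forall>B\<in>octset. semi_invariant L B)"

text \<open>The roots lie in a single octahedral orbit, so sharing one root with \<open>f\<close>
  means sharing all of them.\<close>

definition oct_transitive :: "('a ^ 2 \<Rightarrow> 'a) \<Rightarrow> bool" where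
  "oct_transitive f \<longleftrightarrow> (\<forall>p q. p \<noteq> 0 \<longrightarrow> q \<noteq> 0 \<longrightarrow> f p = 0 \<longrightarrow> f q = 0 \<longrightarrow> (\<exists>B\<in>octset. q = B *v p))"

definition coprime_forms :: "('a ^ 2 \<Rightarrow> 'a) \<Rightarrow> ('a ^ 2 \<Rightarrow> 'a) \<Rightarrow> bool" where
  "coprime_forms f g \<longleftrightarrow> (\<forall>p. p \<noteq> 0 \<longrightarrow> f p = 0 \<longrightarrow> g p \<noteq> 0)"

text \<open>The relation for the cofactor holds after multiplication by \<open>f\<close>, and
  \<open>f\<close> can be cancelled.\<close>

lemma semi_invariant_factor:
  fixes f g :: "'a ^ 2 \<Rightarrow> 'a"
  assumes f: "bform m f" "f u \<noteq> 0" and g: "bform e g"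
    and fB: "semi_invariant f B" and LB: "semi_invariant (\<lambda>v. f v * g v) B"
  shows "semi_invariant g B"
proof -
  obtain c where c: "c \<noteq> 0" "\<And>v. f (B *v v) = c * f v" using fB unfolding semi_invariant_def by blast
  obtain c' where c': "c' \<noteq> 0" "\<And>v. f (B *v v) * g (B *v v) = c' * (f v * g v)"
    using LB unfolding semi_invariant_def by blast
  have "c * g (B *v v) + (- c') * g v = 0" for v
  proof (rule bform_cancel[where g = "\<lambda>v. c * g (B *v v) + (- c') * g v" and w = v, OF f(1)])
    show "f u \<noteq> 0" by (rule f(2))
    show "bform e (\<lambda>v. c * g (B *v v) + (- c') * g v)"
      by (intro bform_add bform_scale bform_subst g)
    show "f v * (c * g (B *v v) + (- c') * g v) = 0" for v
      using c(2)[of v] c'(2)[of v] by (simp add: algebra_simps)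
  qed
  then have "g (B *v v) = (c' / c) * g v" for v
    using c(1) by (simp add: field_simps eq_neg_iff_add_eq_0 add.commute)
  then show ?thesis using c(1) c'(1) fB unfolding semi_invariant_def by (auto intro!: exI[of _ "c' / c"])
qed

text \<open>One common root yields, by transitivity and semi-invariance, all roots of
  \<open>f\<close>; as \<open>f\<close> is square-free it divides \<open>L\<close>. Square-freeness
  of \<open>L\<close> leaves a cofactor without further common roots.\<close>

lemma oct_extract:
  assumes f: "oct_good m f" "oct_transitive f" and L: "oct_good d L"
    and p: "p \<noteq> 0" "f p = 0" "L p = 0"
  shows "m \<le> d \<and> (\<exists>g. oct_good (d - m) g \<and> (\<forall>v. L v = f v * g v) \<and> coprime_forms f g)"
proof -
  have bf: "bform m f" "sqfree f" "\<And>B. B \<in> octset \<Longrightarrow> semi_invariant f B"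
    and bL: "bform d L" "sqfree L" "\<And>B. B \<in> octset \<Longrightarrow> semi_invariant L B"
    using f L unfolding oct_good_def by auto
  have roots: "L q = 0" if q: "q \<noteq> 0" "f q = 0" for q
  proof -
    obtain B where B: "B \<in> octset" "q = B *v p" using f(2) p q unfolding oct_transitive_def by blast
    obtain c where "\<forall>v. L (B *v v) = c * L v" using bL(3)[OF B(1)] unfolding semi_invariant_def by blast
    then show ?thesis using B p by simp
  qed
  obtain g where g: "m \<le> d" "bform (d - m) g" "\<forall>v. L v = f v * g v"
    using bform_dvd[OF bf(1) bL(1) bf(2) sqfree_nonzero[OF bL(2)] roots] by blast
  have Lfg: "L = (\<lambda>v. f v * g v)" using g(3) by auto
  obtain u where u: "f u \<noteq> 0" using sqfree_nonzero[OF bf(2)] by blast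
  have "oct_good (d - m) g"
    unfolding oct_good_def
    using g(2) sqfree_mult_left[OF bL(2)[unfolded Lfg] bf(1)]
      semi_invariant_factor[OF bf(1) u g(2) bf(3)] bL(3)[unfolded Lfg] by blast
  moreover have "coprime_forms f g"
    unfolding coprime_forms_def
    using sqfree_no_common_root[OF bL(2)[unfolded Lfg] bf(1) g(2)] by blast
  ultimately show ?thesis using g by blast
qed

lemma oct_extract_opt:
  assumes f: "oct_good m f" "oct_transitive f" and L: "oct_good d L"
  shows "\<exists>e\<in>{0, 1}. \<exists>d' g. oct_good d' g \<and> d = m * e + d' \<and> (\<forall>v. L v = f v ^ e * g v) \<and> coprime_forms f g"
proof (cases "coprime_forms f L")
  case True
  then show ?thesis using L by (intro bexI[of _ 0] exI[of _ d] exI[of _ L]) auto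
next
  case False
  then obtain p where "p \<noteq> 0" "f p = 0" "L p = 0" unfolding coprime_forms_def by blast
  then obtain g where "m \<le> d" "oct_good (d - m) g" "\<forall>v. L v = f v * g v" "coprime_forms f g"
    using oct_extract[OF f L] by blast
  then show ?thesis by (intro bexI[of _ 1] exI[of _ "d - m"] exI[of _ g]) auto
qed

lemma oct_good_forms: "oct_good 6 (on_vec s6)" "oct_good 8 (on_vec s8)" "oct_good 12 (on_vec s12)"
  "a \<noteq> 42 \<Longrightarrow> a \<noteq> - 66 \<Longrightarrow> oct_good 24 (on_vec (s24 a))"
  unfolding oct_good_def
  by (auto intro: bform_s6 bform_s8 bform_s12 bform_s24 sqfree_s6 sqfree_s8 sqfree_s12 sqfree_s24
      octset_s6 octset_s8 octset_s12 octset_s24)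

lemma oct_transitive_forms: "oct_transitive (on_vec s6)" "oct_transitive (on_vec s8)" "oct_transitive (on_vec s12)"
  "oct_transitive (on_vec (s24 a))"
proof -
  show "oct_transitive (on_vec s6)" "oct_transitive (on_vec s8)"
    unfolding oct_transitive_def using oct_orbit by auto
  have "on_vec s8 p ^ 3 = 108 * on_vec s6 p ^ 4" if "on_vec s12 p = 0" for p :: "'a ^ 2"
    using s12_square[of "p $ 1" "p $ 2"] that by (simp add: on_vec_def)
  then show "oct_transitive (on_vec s12)"
    unfolding oct_transitive_def by (auto intro!: oct_orbit)
  have "on_vec s8 p ^ 3 = - ((a - 42) * on_vec s6 p ^ 4)" if "on_vec (s24 a) p = 0" for p
    using that unfolding on_vec_def s24_def eq_neg_iff_add_eq_0 .
  then show "oct_transitive (on_vec (s24 a))"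
    unfolding oct_transitive_def by (auto intro!: oct_orbit)
qed

lemma coprime_forms_factor: "coprime_forms f L \<Longrightarrow> (\<And>v. L v = h v * g v) \<Longrightarrow> coprime_forms f g"
  unfolding coprime_forms_def by auto

text \<open>Each root lies on exactly one member of the pencil, and that member divides
  \<open>L\<close>. The new parameter differs from the others because the cofactor has no root in
  common with the member just removed.\<close>

lemma oct_generic_decomposition:
  assumes "oct_good d L" "coprime_forms (on_vec s6) L" "coprime_forms (on_vec s8) L" "coprime_forms (on_vec s12) L"
  shows "\<exists>t a k. k \<noteq> 0 \<and> d = 24 * t \<and> (\<forall>v. L v = k * (\<Prod>i=1..t. on_vec (s24 (a i)) v)) \<and>
    inj_on a {1..t} \<and> (\<forall>i\<in>{1..t}. a i \<noteq> 42 \<and> a i \<noteq> - 66)"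
  using assms
proof (induction d arbitrary: L rule: less_induct)
  case (less d)
  have L: "bform d L" "sqfree L" using less.prems(1) unfolding oct_good_def by auto
  show ?case
  proof (cases "d = 0")
    case True
    then obtain k where "L v = k" for v using L(1) unfolding bform_def by auto
    moreover have "k \<noteq> 0" using sqfree_nonzero[OF L(2)] calculation by auto
    ultimately show ?thesis using True by (intro exI[of _ 0] exI[of _ "\<lambda>_. 0"] exI[of _ k]) auto
  next
    case False
    then obtain p where p: "p \<noteq> 0" "L p = 0" using bform_root[OF L(1)] by blast
    have n: "on_vec s6 p \<noteq> 0" "on_vec s8 p \<noteq> 0" "on_vec s12 p \<noteq> 0"
      using less.prems(2-4) p unfolding coprime_forms_def by blast+
    \<comment> \<open>The parameter for which \<open>s24 b\<close> vanishes at p. It is not 42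
      because s8 does not vanish at p, and not -66 because s12 does not.\<close>
    define b where "b = 42 - on_vec s8 p ^ 3 / on_vec s6 p ^ 4"
    have fp: "on_vec (s24 b) p = 0" using n(1) by (simp add: on_vec_def s24_def b_def)
    have b1: "b \<noteq> 42" using n by (simp add: b_def)
    have b2: "b \<noteq> - 66"
    proof
      assume "b = - 66"
      then have "on_vec s12 p ^ 2 = on_vec (s24 b) p"
        using s12_square[of "p $ 1" "p $ 2"] by (simp add: on_vec_def s24_def)
      then show False using fp n(3) by simp
    qed
    obtain g where g: "24 \<le> d" "oct_good (d - 24) g" "\<And>v. L v = on_vec (s24 b) v * g v" "coprime_forms (on_vec (s24 b)) g"
      using oct_extract[OF oct_good_forms(4)[OF b1 b2] oct_transitive_forms(4) less.prems(1) p(1) fp p(2)] by blast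
    have "d - 24 < d" using g(1) by simp
    from less.IH[OF this g(2) coprime_forms_factor[OF less.prems(2) g(3)] coprime_forms_factor[OF less.prems(3) g(3)]
        coprime_forms_factor[OF less.prems(4) g(3)]] obtain t a k where t: "k \<noteq> 0" "d - 24 = 24 * t"
      "\<forall>v. g v = k * (\<Prod>i=1..t. on_vec (s24 (a i)) v)" "inj_on a {1..t}" "\<forall>i\<in>{1..t}. a i \<noteq> 42 \<and> a i \<noteq> - 66"
      by (elim exE conjE) (rule that)
    define a' where "a' = a(Suc t := b)"
    have prod: "(\<Prod>i=1..t. on_vec (s24 (a' i)) v) = (\<Prod>i=1..t. on_vec (s24 (a i)) v)" for v
      by (intro prod.cong) (auto simp: a'_def)
    have "b \<noteq> a i" if i: "i \<in> {1..t}" for i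
    proof
      assume "b = a i"
      then have "(\<Prod>i=1..t. on_vec (s24 (a i)) p) = 0" using fp i by (intro prod_zero) auto
      then have "g p = 0" using t(3) by simp
      then show False using g(4) p(1) fp unfolding coprime_forms_def by blast
    qed
    moreover have set: "{1..Suc t} = insert (Suc t) {1..t}" by auto
    moreover have a': "a' i = a i" if "i \<in> {1..t}" for i using that by (simp add: a'_def)
    moreover have "a' (Suc t) = b" by (simp add: a'_def)
    moreover have "inj_on a' {1..t}" using t(4) inj_on_cong[of "{1..t}" a' a] a' by blast
    ultimately have "inj_on a' {1..Suc t}" "\<forall>i\<in>{1..Suc t}. a' i \<noteq> 42 \<and> a' i \<noteq> - 66"
      unfolding set inj_on_insert using t(5) b1 b2 by (fastforce, simp)
    moreover have "\<forall>v. L v = k * (\<Prod>i=1..Suc t. on_vec (s24 (a' i)) v)"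
      using g(3) t(3) prod by (simp add: a'_def)
    moreover have "d = 24 * Suc t" using t(2) g(1) by simp
    ultimately show ?thesis using t(1) by (intro exI[of _ "Suc t"] exI[of _ a'] exI[of _ k]) blast
  qed
qed

definition oct_fun :: "nat \<Rightarrow> nat \<Rightarrow> nat \<Rightarrow> nat \<Rightarrow> (nat \<Rightarrow> 'a) \<Rightarrow> 'a ^ 2 \<Rightarrow> 'a" where
  "oct_fun \<epsilon> \<epsilon>' \<epsilon>'' t a v = on_vec s6 v ^ \<epsilon> * on_vec s12 v ^ \<epsilon>' * on_vec s8 v ^ \<epsilon>'' * (\<Prod>i=1..t. on_vec (s24 (a i)) v)"

lemma oct_decomposition:
  assumes "oct_good d L"
  shows "\<exists>\<epsilon> \<epsilon>' \<epsilon>'' t a k. k \<noteq> 0 \<and> octahedral_data d \<epsilon> \<epsilon>' \<epsilon>'' t a \<and> (\<forall>v. L v = k * oct_fun \<epsilon> \<epsilon>' \<epsilon>'' t a v)"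
proof -
  obtain e1 d1 g1 where 1: "e1 \<in> {0, 1}" "oct_good d1 g1" "d = 6 * e1 + d1" "\<And>v. L v = on_vec s6 v ^ e1 * g1 v"
    "coprime_forms (on_vec s6) g1"
    using oct_extract_opt[OF oct_good_forms(1) oct_transitive_forms(1) assms] by blast
  obtain e2 d2 g2 where 2: "e2 \<in> {0, 1}" "oct_good d2 g2" "d1 = 12 * e2 + d2" "\<And>v. g1 v = on_vec s12 v ^ e2 * g2 v"
    "coprime_forms (on_vec s12) g2"
    using oct_extract_opt[OF oct_good_forms(3) oct_transitive_forms(3) 1(2)] by blast
  obtain e3 d3 g3 where 3: "e3 \<in> {0, 1}" "oct_good d3 g3" "d2 = 8 * e3 + d3" "\<And>v. g2 v = on_vec s8 v ^ e3 * g3 v"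
    "coprime_forms (on_vec s8) g3"
    using oct_extract_opt[OF oct_good_forms(2) oct_transitive_forms(2) 2(2)] by blast
  have "coprime_forms (on_vec s6) g3" "coprime_forms (on_vec s12) g3"
    using coprime_forms_factor[OF coprime_forms_factor[OF 1(5) 2(4)] 3(4)] coprime_forms_factor[OF 2(5) 3(4)] by auto
  then obtain t a k where t: "k \<noteq> 0" "d3 = 24 * t" "\<forall>v. g3 v = k * (\<Prod>i=1..t. on_vec (s24 (a i)) v)"
    "inj_on a {1..t}" "\<forall>i\<in>{1..t}. a i \<noteq> 42 \<and> a i \<noteq> - 66"
    using oct_generic_decomposition[OF 3(2) _ 3(5)] by blast
  have "octahedral_data d e1 e2 e3 t a"
    unfolding octahedral_data_def using 1 2 3 t by auto
  moreover have "L v = k * oct_fun e1 e2 e3 t a v" for v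
    using 1(4) 2(4) 3(4) t(3) by (simp add: oct_fun_def mult_ac)
  ultimately show ?thesis using t(1) by blast
qed

section \<open>From an abstract S_4 to the octahedral group: normal form of a four-group\<close>

text \<open>Some q among the 48 conjugates i and j in the same way as \<open>g\<close>, signs
  included. Then q^(-1) g commutes with i and j, hence is a scalar.\<close>

lemma normalizer_octset:
  assumes g: "invertible g" and "c \<noteq> 0" "c' \<noteq> 0"
    and x: "x \<in> set [(0, 1, 0, 0), (0, 0, 1, 0), (0, 0, 0, 1)]" "g ** qmat (0, 1, 0, 0) = mat c ** (qmat x ** g)"
    and y: "y \<in> set [(0, 1, 0, 0), (0, 0, 1, 0), (0, 0, 0, 1)]" "g ** qmat (0, 0, 1, 0) = mat c' ** (qmat y ** g)"
  shows "g \<in> octset"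
proof -
  have nx: "qnorm x = 1" "qnorm y = 1" using x(1) y(1) by auto
  have dm: "det (mat k :: 'a ^ 2 ^ 2) = k * k" for k by (simp add: mat_mat2 det_mat2)
  have dg: "det g \<noteq> 0" using g by (simp add: invertible_det_nz)
  have "det g * 1 = c * c * (1 * det g)" "det g * 1 = c' * c' * (1 * det g)"
    using arg_cong[OF x(2), of det] arg_cong[OF y(2), of det] by (simp_all add: dm det_mul det_qmat nx)
  then have "c * c = 1" "c' * c' = 1" using dg by simp_all
  then have "c = 1 \<or> c = - 1" "c' = 1 \<or> c' = - 1" by (metis square_eq_1_iff)+
  then obtain s s' where s: "s \<in> set [1, -1]" "s' \<in> set [1, -1]" "c = of_int s" "c' = of_int s'"
    by (metis list.set_intros(1) list.set_intros(2) of_int_1 of_int_minus)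
  have "x \<noteq> y"
  proof
    assume xy: "x = y"
    have "g ** qmat (0, 1, 0, 0) = mat (c * inverse c') ** (mat c' ** (qmat y ** g))"
      using x(2) xy assms(3) by (simp add: mult.assoc)
    also have "\<dots> = g ** (mat (c * inverse c') ** qmat (0, 0, 1, 0))"
      using y(2) by (simp only: mat_mult_left_comm[of g])
    finally have "qmat (0, 1, 0, 0) = mat (c * inverse c') ** qmat (0, 0, 1, 0)"
      using invertible_cancel_left[OF g] by blast
    then show False using qmat_eq_scaled(2)[of 0 1 0 0] by fastforce
  qed
  moreover have "x = y \<or> list_ex (\<lambda>q. qmul q (0, 1, 0, 0) = qscale s (qmul x q) \<and>
      qmul q (0, 0, 1, 0) = qscale s' (qmul y q)) oct_list"
    using oct_normalizer_list x(1) y(1) s(1,2) unfolding list_all_iff by blast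
  ultimately obtain q where q: "q \<in> OQ" "qmul q (0, 1, 0, 0) = qscale s (qmul x q)"
    "qmul q (0, 0, 1, 0) = qscale s' (qmul y q)"
    unfolding list_ex_iff by blast
  have qE: "qmat q ** qmat (0, 1, 0, 0) = mat c ** (qmat x ** qmat q)"
    "qmat q ** qmat (0, 0, 1, 0) = mat c' ** (qmat y ** qmat q)"
    using q(2,3) s by (simp_all add: qmat_scale flip: qmat_mult)
  obtain r where r: "qmat q ** r = mat 1" "r ** qmat q = mat 1"
    using OQ_invertible[OF q(1)] unfolding invertible_def by blast
  \<comment> \<open>The quotient of \<open>g\<close> by the quaternion with the same action.
    Commuting with i makes it diagonal, commuting with j makes the two diagonal entries
    equal.\<close>
  define h where "h = r ** g"
  have gh: "g = qmat q ** h" by (simp add: h_def matrix_mul_assoc r)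
  have comm: "h ** E = E ** h" if "g ** E = mat k ** (X ** g)" "qmat q ** E = mat k ** (X ** qmat q)" for E X k
  proof -
    have "qmat q ** (h ** E) = mat k ** (X ** qmat q) ** h"
      using that(1) by (simp add: gh matrix_mul_assoc)
    also have "\<dots> = qmat q ** (E ** h)" using that(2) by (simp add: matrix_mul_assoc)
    finally show ?thesis using invertible_cancel_left[OF OQ_invertible[OF q(1)]] by blast
  qed
  obtain h1 h2 h3 h4 where h: "h = mat2 h1 h2 h3 h4" by (rule mat2_cases)
  have 1: "mat2 h1 h2 h3 h4 ** mat2 ii 0 0 (- ii) = mat2 ii 0 0 (- ii) ** mat2 h1 h2 h3 h4"
    using comm[OF x(2) qE(1)] by (simp add: h qmat.simps)
  have 2: "mat2 h1 h2 h3 h4 ** mat2 0 1 (- 1) 0 = mat2 0 1 (- 1) 0 ** mat2 h1 h2 h3 h4"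
    using comm[OF y(2) qE(2)] by (simp add: h qmat.simps)
  have 3: "h2 * - ii = ii * h2" "h3 * ii = - ii * h3"
    using 1 unfolding mat2_mult mat2_eq_iff by simp_all
  have 4: "2 * ii * h2 = ii * h2 - h2 * - ii" "2 * ii * h3 = h3 * ii - (- ii * h3)"
    by (simp_all add: algebra_simps)
  have "2 * ii * h2 = 0" "2 * ii * h3 = 0" by (simp_all only: 4(1) 4(2)) (simp_all only: 3(1) 3(2) diff_self)
  then have "h2 = 0" "h3 = 0" by simp_all
  moreover have "h1 * 1 + h2 * 0 = 0 * h2 + 1 * h4" using 2 unfolding mat2_mult mat2_eq_iff by (elim conjE)
  ultimately have "h = mat h1" by (simp add: h mat_mat2 mat2_eq_iff)
  then have "g = mat h1 ** qmat q" using gh by (simp add: mat_mult_comm)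
  moreover have "h1 \<noteq> 0" using dg calculation by (auto simp: det_mat_mult)
  ultimately show ?thesis using octset_scale octset_qmat[OF q(1)] by simp
qed

text \<open>By Cayley-Hamilton, A^2 is trace times A minus a scalar; if A is not scalar, the trace
  must vanish.\<close>

lemma square_scalar_trace:
  fixes A :: "'a ^ 2 ^ 2"
  assumes "A ** A = mat \<alpha>" "\<And>k. A \<noteq> mat k"
  obtains a b c where "A = mat2 a b c (- a)"
proof -
  obtain a b c d where A: "A = mat2 a b c d" by (rule mat2_cases)
  have "b * (a + d) = 0" "c * (a + d) = 0" "a * a = d * d"
    using assms(1) by (auto simp: A mat2_mult mat_mat2 mat2_eq_iff algebra_simps)
  moreover have "(a - d) * (a + d) = a * a - d * d" by (simp add: algebra_simps)
  ultimately have "a + d = 0 \<or> b = 0 \<and> c = 0 \<and> a = d" by auto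
  then have "d = - a" using assms(2)[of a] by (auto simp: A mat_mat2 mat2_eq_iff eq_neg_iff_add_eq_0 add.commute)
  then show thesis using that A by blast
qed

text \<open>If u is an eigenvector of A for \<open>ii\<close>, then B u is one for
  -\<open>ii\<close>, since A and B anticommute. In a basis formed from the two, A and B become i
  and j.\<close>

lemma anticommuting_normal_form:
  fixes A B :: "'a ^ 2 ^ 2"
  assumes A: "A ** A = mat (- 1)" "\<And>k. A \<noteq> mat k" and B: "B ** B = mat (- 1)"
    and AB: "A ** B = mat (- 1) ** (B ** A)"
  shows "\<exists>P. invertible P \<and> A ** P = P ** qmat (0, 1, 0, 0) \<and> B ** P = P ** qmat (0, 0, 1, 0)"
proof -
  have "\<exists>w. A *v w + ii *s w \<noteq> 0"
  proof (rule ccontr)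
    assume "\<not> ?thesis"
    then have "A *v w = mat (- ii) *v w" for w by (simp add: vec2_eq_iff eq_neg_iff_add_eq_0)
    then have "A = mat (- ii)" by (simp add: matrix_eq)
    then show False using A(2) by blast
  qed
  then obtain w where w: "A *v w + ii *s w \<noteq> 0" by blast
  \<comment> \<open>(A - ii)(A + ii) = A^2 + 1 = 0, so the image of A + ii consists of eigenvectors
    for \<open>ii\<close>.\<close>
  define u where "u = A *v w + ii *s w"
  have AA: "A *v (A *v v) = - v" "B *v (B *v v) = - v" "A *v (B *v v) = - (B *v (A *v v))" for v
  proof -
    show "A *v (A *v v) = - v" "B *v (B *v v) = - v"
      using arg_cong[OF A(1), of "\<lambda>M. M *v v"] arg_cong[OF B, of "\<lambda>M. M *v v"]
      by (simp_all add: vec2_eq_iff flip: matrix_vector_mul_assoc)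
    show "A *v (B *v v) = - (B *v (A *v v))"
      using arg_cong[OF AB, of "\<lambda>M. M *v v"] by (simp add: vec2_eq_iff flip: matrix_vector_mul_assoc)
  qed
  have Au: "A *v u = ii *s u"
    unfolding u_def by (simp add: matrix_vector_right_distrib AA vec.scale vec2_eq_iff distrib_left ii_sq)
  define z where "z = B *v u"
  have Az: "A *v z = - (ii *s z)" "B *v z = - u"
    unfolding z_def AA Au by (simp_all add: vec.scale)
  have z0: "z \<noteq> 0" using Az(2) w unfolding u_def[symmetric] by auto
  have "wedge u z \<noteq> 0"
  proof
    assume "wedge u z = 0"
    then obtain t where t: "u = t *s z" using wedge_zero_iff[OF z0] by blast
    then have "t *s (- (ii *s z)) = ii *s (t *s z)" using Au Az(1) by (metis vec.scale)
    then have "2 * (t * ii) * z $ 1 = 0 \<and> 2 * (t * ii) * z $ 2 = 0"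
      by (simp add: vec2_eq_iff algebra_simps eq_neg_iff_add_eq_0)
    then have "t = 0" using z0 by (auto simp: vec2_eq_iff)
    then show False using t w unfolding u_def[symmetric] by simp
  qed
  \<comment> \<open>The columns are u and -z. The sign comes from the matrix of j, which sends the
    first basis vector to minus the second.\<close>
  define P where "P = mat2 (u $ 1) (- z $ 1) (u $ 2) (- z $ 2)"
  have invP: "invertible P" using \<open>wedge u z \<noteq> 0\<close> by (simp add: invertible_det_nz P_def det_mat2 wedge_def algebra_simps)
  obtain a b c d where Am: "A = mat2 a b c d" by (rule mat2_cases)
  obtain a' b' c' d' where Bm: "B = mat2 a' b' c' d'" by (rule mat2_cases)
  have az: "a * z $ 1 + b * z $ 2 = - (ii * z $ 1)" "c * z $ 1 + d * z $ 2 = - (ii * z $ 2)"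
    using Az(1) by (simp_all add: Am vec2_eq_iff mat2_vec)
  have "a * - z $ 1 + b * - z $ 2 = - (a * z $ 1 + b * z $ 2)" "c * - z $ 1 + d * - z $ 2 = - (c * z $ 1 + d * z $ 2)"
    by simp_all
  then have "a * - z $ 1 + b * - z $ 2 = ii * z $ 1" "c * - z $ 1 + d * - z $ 2 = ii * z $ 2"
    unfolding az by simp_all
  then have AP: "A ** P = P ** qmat (0, 1, 0, 0)"
    using Au by (simp add: P_def Am qmat.simps mat2_mult mat2_eq_iff vec2_eq_iff mat2_vec mult.commute[of ii])
  have bz: "a' * z $ 1 + b' * z $ 2 = - u $ 1" "c' * z $ 1 + d' * z $ 2 = - u $ 2"
    using Az(2) by (simp_all add: Bm vec2_eq_iff mat2_vec)
  have "a' * - z $ 1 + b' * - z $ 2 = - (a' * z $ 1 + b' * z $ 2)" "c' * - z $ 1 + d' * - z $ 2 = - (c' * z $ 1 + d' * z $ 2)"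
    by simp_all
  then have "a' * - z $ 1 + b' * - z $ 2 = u $ 1" "c' * - z $ 1 + d' * - z $ 2 = u $ 2"
    unfolding bz by simp_all
  moreover have "a' * u $ 1 + b' * u $ 2 = z $ 1" "c' * u $ 1 + d' * u $ 2 = z $ 2"
    by (simp_all add: z_def Bm mat2_vec)
  ultimately have "B ** P = P ** qmat (0, 0, 1, 0)"
    unfolding P_def Bm qmat.simps mat2_mult by simp
  with invP AP show ?thesis by blast
qed

lemma square_root_exists: "\<exists>x. x * x = (c :: 'a)"
proof -
  have "\<exists>x. (\<Sum>k\<le>2. (if k = 0 then - c else if k = 1 then 0 else 1) * x ^ k) = 0"
    by (rule alg_closed) auto
  then show ?thesis by (auto simp: numeral_2_eq_2 eq_neg_iff_add_eq_0 add.commute)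
qed

text \<open>A, B and AB are nonscalar with scalar square, hence of trace zero. For traceless 2x2
  matrices AB + BA is the scalar tr(AB), so A and B anticommute; dividing by square roots of
  -\<alpha> and -\<beta> makes their squares -1.\<close>

lemma four_group_normal_form:
  fixes A B :: "'a ^ 2 ^ 2"
  assumes inv: "invertible A" "invertible B"
    and A: "A ** A = mat \<alpha>" "\<And>k. A \<noteq> mat k" and B: "B ** B = mat \<beta>" "\<And>k. B \<noteq> mat k"
    and AB: "A ** B = mat \<gamma> ** (B ** A)" "\<And>k. A ** B \<noteq> mat k"
  shows "\<exists>P a b. invertible P \<and> a \<noteq> 0 \<and> b \<noteq> 0 \<and> A ** P = mat a ** (P ** qmat (0, 1, 0, 0)) \<and>
    B ** P = mat b ** (P ** qmat (0, 0, 1, 0))"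
proof -
  have "A ** B ** (A ** B) = mat \<gamma> ** (B ** (A ** A) ** B)"
    by (subst AB(1)) (simp add: matrix_mul_assoc)
  also have "\<dots> = mat (\<gamma> * \<alpha> * \<beta>)"
    by (simp add: A(1) mat_mult_left_comm[of B] B(1) mult_ac flip: matrix_mul_assoc)
  finally have sq: "A ** B ** (A ** B) = mat (\<gamma> * \<alpha> * \<beta>)" .
  obtain a1 a2 a3 where Am: "A = mat2 a1 a2 a3 (- a1)" using square_scalar_trace[OF A] .
  obtain b1 b2 b3 where Bm: "B = mat2 b1 b2 b3 (- b1)" using square_scalar_trace[OF B] .
  obtain c1 c2 c3 where "A ** B = mat2 c1 c2 c3 (- c1)" using square_scalar_trace[OF sq AB(2)] .
  then have "a1 * b1 + a2 * b3 = - (a3 * b2 + a1 * b1)"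
    by (auto simp: Am Bm mat2_mult mat2_eq_iff algebra_simps)
  then have anti: "A ** B = mat (- 1) ** (B ** A)"
    by (simp add: Am Bm mat2_mult mat_mult_mat2 mat2_eq_iff algebra_simps)
  obtain a where a: "a * a = - \<alpha>" using square_root_exists by blast
  obtain b where b: "b * b = - \<beta>" using square_root_exists by blast
  have "\<alpha> \<noteq> 0" "\<beta> \<noteq> 0"
    using inv A(1) B(1) invertible_mult_iff invertible_mat by metis+
  then have ab0: "a \<noteq> 0" "b \<noteq> 0" using a b by auto
  have "\<exists>P. invertible P \<and> mat (inverse a) ** A ** P = P ** qmat (0, 1, 0, 0) \<and>
      mat (inverse b) ** B ** P = P ** qmat (0, 0, 1, 0)"
  proof (rule anticommuting_normal_form)
    have "mat (inverse a) ** A ** (mat (inverse a) ** A) = mat (inverse a * inverse a) ** (A ** A)"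
      by (simp add: mat_mult_left_comm[of A] flip: matrix_mul_assoc)
    also have "\<dots> = mat (inverse (a * a) * \<alpha>)" by (simp add: A(1))
    also have "inverse (a * a) * \<alpha> = - 1" unfolding a using \<open>\<alpha> \<noteq> 0\<close> by simp
    finally show "mat (inverse a) ** A ** (mat (inverse a) ** A) = mat (- 1)" .
    have "mat (inverse b) ** B ** (mat (inverse b) ** B) = mat (inverse b * inverse b) ** (B ** B)"
      by (simp add: mat_mult_left_comm[of B] flip: matrix_mul_assoc)
    also have "\<dots> = mat (inverse (b * b) * \<beta>)" by (simp add: B(1))
    also have "inverse (b * b) * \<beta> = - 1" unfolding b using \<open>\<beta> \<noteq> 0\<close> by simp
    finally show "mat (inverse b) ** B ** (mat (inverse b) ** B) = mat (- 1)" .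
    fix k show "mat (inverse a) ** A \<noteq> mat k"
    proof
      assume "mat (inverse a) ** A = mat k"
      then have "mat a ** (mat (inverse a) ** A) = mat (a * k)" by simp
      then show False using A(2) ab0 by simp
    qed
  next
    have "mat (inverse a) ** A ** (mat (inverse b) ** B) = mat (inverse a * inverse b) ** (A ** B)"
      by (simp add: mat_mult_left_comm[of A] flip: matrix_mul_assoc)
    moreover have "mat (inverse b) ** B ** (mat (inverse a) ** A) = mat (inverse a * inverse b) ** (B ** A)"
      by (simp add: mat_mult_left_comm[of B] mult.commute flip: matrix_mul_assoc)
    ultimately show "mat (inverse a) ** A ** (mat (inverse b) ** B) = mat (- 1) ** (mat (inverse b) ** B ** (mat (inverse a) ** A))"
      using anti by (simp add: mult.commute)
  qed
  then obtain P where P: "invertible P" "mat (inverse a) ** A ** P = P ** qmat (0, 1, 0, 0)"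
      "mat (inverse b) ** B ** P = P ** qmat (0, 0, 1, 0)" by blast
  have "A ** P = mat a ** (mat (inverse a) ** A ** P)" "B ** P = mat b ** (mat (inverse b) ** B ** P)"
    using ab0 by (simp_all flip: matrix_mul_assoc)
  then show ?thesis using P ab0 by metis
qed

end

lemma semi_invariant_conj:
  fixes P Q :: "'a::field ^ 'n ^ 'n"
  assumes P: "P ** Q = mat 1" "Q ** P = mat 1"
  shows "semi_invariant (\<lambda>v. f (P *v v)) B \<longleftrightarrow> semi_invariant f (P ** B ** Q)"
proof -
  have inv: "invertible P" "invertible Q" using P by (auto simp: invertible_def)
  have 1: "f (P *v (B *v v)) = f (P ** B ** Q *v (P *v v))" for v
    by (simp add: matrix_vector_mul_assoc flip: matrix_mul_assoc) (simp add: matrix_mul_assoc P)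
  have all: "(\<forall>v. h (P *v v)) \<longleftrightarrow> (\<forall>v. h v)" for h
  proof -
    have "P *v (Q *v v) = v" for v by (simp add: matrix_vector_mul_assoc P)
    then show ?thesis by metis
  qed
  show ?thesis
    unfolding semi_invariant_def 1 all[of "\<lambda>v. f (P ** B ** Q *v v) = _ * f v"]
    by (simp add: invertible_mult_iff inv)
qed

context imaginary_unit
begin

lemma octgroup_eq: "octgroup = {pgl (qmat q) | q. q \<in> OQ}"
  unfolding octgroup_def octset_def using pgl_scale octset_qmat octset_def by fastforce

text \<open>The four-group is taken as the image of the classes of 1, i, j, k under an isomorphism
  \<open>\<psi>\<close> from the octahedral group. Normality is then inherited along
  \<open>\<psi>\<close>, without any study of the subgroups of S_4.\<close>

lemma S4_conjugate:
  assumes L: "bform d L" and iso: "PGL\<lparr>carrier := proj_stab L\<rparr> \<cong> sym_group 4"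
  shows "\<exists>P. invertible P \<and> (\<forall>B\<in>octset. semi_invariant (\<lambda>v. L (P *v v)) B)"
proof -
  let ?O = "PGL\<lparr>carrier := octgroup\<rparr>" and ?G = "PGL\<lparr>carrier := proj_stab L\<rparr>"
  have gG: "group ?G" and gO: "group ?O"
    using group.subgroup_imp_group[OF group_PGL] proj_stab_subgroup octgroup_subgroup by blast+
  have "?O \<cong> ?G" using iso_trans[OF octgroup_iso group.iso_sym[OF gG iso]] .
  then obtain \<psi> where "\<psi> \<in> iso ?O ?G" unfolding is_iso_def by blast
  then have hom: "\<psi> \<in> hom ?O ?G" and bij: "bij_betw \<psi> octgroup (proj_stab L)"
    unfolding iso_def by auto
  have mult: "\<psi> (x \<otimes>\<^bsub>PGL\<^esub> y) = \<psi> x \<otimes>\<^bsub>PGL\<^esub> \<psi> y" if "x \<in> octgroup" "y \<in> octgroup" for x y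
    using hom that unfolding hom_def by auto
  have one: "\<psi> (pgl (mat 1)) = pgl (mat 1)"
    using group_hom.hom_one[of ?O ?G \<psi>] gG gO hom unfolding group_hom_def group_hom_axioms_def by (simp add: one_PGL)
  have e_in: "pgl (qmat q) \<in> octgroup" if "q \<in> OQ" for q using that unfolding octgroup_eq by blast
  have e_mult: "pgl (qmat p) \<otimes>\<^bsub>PGL\<^esub> pgl (qmat q) = pgl (qmat (qmul p q))" if "p \<in> OQ" "q \<in> OQ" for p q
    using that by (simp add: pgl_mult OQ_invertible qmat_mult)
  have e_scale: "pgl (qmat (qscale (-1) q)) = pgl (qmat q)" for q
    unfolding qmat_scale by (rule pgl_scale) simp
  have inO: "(0, 1, 0, 0) \<in> OQ" "(0, 0, 1, 0) \<in> OQ" "(0, 0, 0, 1) \<in> OQ" "(1, 0, 0, 0) \<in> OQ" by (simp_all add: OQ_iff)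
  have obt: "\<exists>A. semi_invariant L A \<and> \<psi> (pgl (qmat q)) = pgl A" if "q \<in> OQ" for q
    using bij_betwE[OF bij] e_in[OF that] unfolding proj_stab_def by blast
  obtain A where A: "semi_invariant L A" "\<psi> (pgl (qmat (0, 1, 0, 0))) = pgl A" using obt inO(1) by blast
  obtain B where B: "semi_invariant L B" "\<psi> (pgl (qmat (0, 0, 1, 0))) = pgl B" using obt inO(2) by blast
  note inv = semi_invariant_invertible[OF A(1)] semi_invariant_invertible[OF B(1)]
  have AB3: "\<psi> (pgl (qmat (0, 0, 0, 1))) = pgl (A ** B)"
    using mult[OF e_in[OF inO(1)] e_in[OF inO(2)]] e_mult[OF inO(1,2)] A(2) B(2) inv by (simp add: pgl_mult)
  have e_m1: "pgl (qmat (- 1, 0, 0, 0)) = pgl (mat 1)"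
    using e_scale[of "(1, 0, 0, 0)"] by (simp add: qmat_one)
  have "pgl (A ** A) = pgl (mat 1)"
    using mult[OF e_in[OF inO(1)] e_in[OF inO(1)]] e_mult[OF inO(1,1)] A(2) inv one e_m1 by (simp add: pgl_mult)
  then obtain \<alpha> where \<alpha>: "A ** A = mat \<alpha>" unfolding pgl_eq_iff by auto
  have "pgl (B ** B) = pgl (mat 1)"
    using mult[OF e_in[OF inO(2)] e_in[OF inO(2)]] e_mult[OF inO(2,2)] B(2) inv one e_m1 by (simp add: pgl_mult)
  then obtain \<beta> where \<beta>: "B ** B = mat \<beta>" unfolding pgl_eq_iff by auto
  have "pgl (A ** B) = pgl (B ** A)"
    using mult[OF e_in[OF inO(2)] e_in[OF inO(1)]] e_mult[OF inO(2,1)] A(2) B(2) AB3 inv e_scale[of "(0, 0, 0, 1)"]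
    by (simp add: pgl_mult)
  then obtain \<gamma> where \<gamma>: "A ** B = mat \<gamma> ** (B ** A)" unfolding pgl_eq_iff by auto
  \<comment> \<open>Injectivity of \<open>\<psi>\<close>: a scalar image would force q to be trivial
    in PGL_2.\<close>
  have nonscalar: "M \<noteq> mat k" if M: "\<psi> (pgl (qmat q)) = pgl M" "invertible M"
      and q: "q \<in> OQ" "q \<noteq> (1, 0, 0, 0)" "q \<noteq> (-1, 0, 0, 0)" for M k q
  proof
    assume Mk: "M = mat k"
    then have "k \<noteq> 0" using M(2) by (simp add: invertible_mat)
    then have "pgl M = pgl (mat 1)" unfolding pgl_eq_iff Mk by (intro exI[of _ k]) simp
    then have "\<psi> (pgl (qmat q)) = \<psi> (pgl (qmat (1, 0, 0, 0)))" using M(1) one by (simp add: qmat_one)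
    then have "pgl (qmat q) = pgl (qmat (1, 0, 0, 0))"
      using bij_betw_imp_inj_on[OF bij] e_in[OF q(1)] e_in[OF inO(4)] by (simp add: inj_on_eq_iff)
    then obtain c where c: "qmat q = mat c ** qmat (1, 0, 0, 0)" unfolding pgl_eq_iff by blast
    obtain x y z w where r: "q = (x, y, z, w)" by (rule prod_cases4)
    have "y = 0" "z = 0" "w = 0" using qmat_eq_scaled[OF c[unfolded r]] by simp_all
    then show False using q unfolding r by (auto simp: OQ_iff)
  qed
  obtain P a b where P: "invertible P" "a \<noteq> 0" "b \<noteq> 0" "A ** P = mat a ** (P ** qmat (0, 1, 0, 0))"
    "B ** P = mat b ** (P ** qmat (0, 0, 1, 0))"
    using four_group_normal_form[OF inv \<alpha> nonscalar[OF A(2) inv(1) inO(1)] \<beta> nonscalar[OF B(2) inv(2) inO(2)]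
        \<gamma> nonscalar[OF AB3 _ inO(3)]] inv by (auto simp: invertible_mult_iff)
  have ABP: "A ** B ** P = mat (b * a) ** (P ** qmat (0, 0, 0, 1))"
  proof -
    have "A ** B ** P = mat b ** (A ** P ** qmat (0, 0, 1, 0))"
      by (simp add: P(5) mat_mult_left_comm[of A] flip: matrix_mul_assoc)
    also have "\<dots> = mat (b * a) ** (P ** qmat (qmul (0, 1, 0, 0) (0, 0, 1, 0)))"
      unfolding qmat_mult by (simp add: P(4) flip: matrix_mul_assoc)
    finally show ?thesis by simp
  qed
  obtain Q where Q: "P ** Q = mat 1" "Q ** P = mat 1" using P(1) unfolding invertible_def by blast
  let ?L = "\<lambda>v. L (P *v v)"
  have sub: "D \<in> octset" if D: "semi_invariant ?L D" for D
  proof -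
    define C where "C = P ** D ** Q"
    have C: "semi_invariant L C" using D unfolding C_def semi_invariant_conj[OF Q] .
    have CP: "C ** P = P ** D" by (simp add: C_def Q flip: matrix_mul_assoc)
    have invD: "invertible D" using D by (rule semi_invariant_invertible)
    have invC: "invertible C" using C by (rule semi_invariant_invertible)
    have "pgl C \<in> \<psi> ` octgroup" using bij C unfolding bij_betw_def proj_stab_def by blast
    then obtain q where q: "q \<in> OQ" "pgl C = \<psi> (pgl (qmat q))" unfolding octgroup_eq by blast
    \<comment> \<open>\<open>C\<close> is the image of the class of some q, and q permutes i, j, k
      up to sign. Applying \<open>\<psi>\<close> and conjugating by \<open>P\<close> gives the same
      permutation for \<open>D\<close>, up to scalars.\<close>
    have key: "\<exists>x c. c \<noteq> 0 \<and> x \<in> set [(0, 1, 0, 0), (0, 0, 1, 0), (0, 0, 0, 1)] \<and> D ** qmat u = mat c ** (qmat x ** D)"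
      if u: "u \<in> set [(0, 1, 0, 0), (0, 0, 1, 0)]" and U: "\<psi> (pgl (qmat u)) = pgl U" "invertible U"
        and UP: "m \<noteq> 0" "U ** P = mat m ** (P ** qmat u)" for u U m
    proof -
      obtain x where x: "x \<in> set [(0, 1, 0, 0), (0, 0, 1, 0), (0, 0, 0, 1)]"
        "qmul q u = qmul x q \<or> qmul q u = qscale (-1) (qmul x q)"
        using oct_four_group_list q(1) u unfolding list_all_iff list_ex_iff by blast
      have xO: "x \<in> OQ" "u \<in> OQ" using x(1) u inO by auto
      obtain X l where X: "\<psi> (pgl (qmat x)) = pgl X" "l \<noteq> 0" "X ** P = mat l ** (P ** qmat x)" "invertible X"
      proof -
        consider "x = (0, 1, 0, 0)" | "x = (0, 0, 1, 0)" | "x = (0, 0, 0, 1)" using x(1) by auto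
        then show thesis
        proof cases
          case 1 then show thesis using that[of A a] A(2) P inv by simp
        next
          case 2 then show thesis using that[of B b] B(2) P inv by simp
        next
          case 3 then show thesis using that[of "A ** B" "b * a"] AB3 ABP P inv by (simp add: invertible_mult_iff)
        qed
      qed
      have "pgl (qmat (qmul q u)) = pgl (qmat (qmul x q))" using x(2) e_scale by metis
      then have "pgl (qmat q) \<otimes>\<^bsub>PGL\<^esub> pgl (qmat u) = pgl (qmat x) \<otimes>\<^bsub>PGL\<^esub> pgl (qmat q)"
        using e_mult q(1) xO by simp
      then have "pgl (C ** U) = pgl (X ** C)"
        using mult e_in q xO U X invC by (metis pgl_mult)
      then obtain c where c: "c \<noteq> 0" "C ** U = mat c ** (X ** C)" unfolding pgl_eq_iff by blast
      have "P ** (mat m ** (D ** qmat u)) = mat m ** (C ** P ** qmat u)"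
        by (simp only: CP mat_mult_left_comm[of P]) (simp only: matrix_mul_assoc)
      also have "\<dots> = C ** U ** P" by (simp add: UP mat_mult_left_comm[of C] flip: matrix_mul_assoc)
      also have "\<dots> = mat c ** (X ** P ** D)" by (simp add: c(2) CP flip: matrix_mul_assoc)
      also have "\<dots> = P ** (mat (c * l) ** (qmat x ** D))"
        by (simp add: X(3) mat_mult_left_comm[of P] flip: matrix_mul_assoc)
      finally have e: "mat m ** (D ** qmat u) = mat (c * l) ** (qmat x ** D)"
        using invertible_cancel_left[OF P(1)] by blast
      have "D ** qmat u = mat (inverse m) ** (mat m ** (D ** qmat u))" using UP(1) by simp
      also have "\<dots> = mat (inverse m * (c * l)) ** (qmat x ** D)" unfolding e by simp
      finally show ?thesis using x(1) c(1) X(2) UP(1)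
        by (intro exI[of _ x] exI[of _ "inverse m * (c * l)"]) simp
    qed
    have k1: "\<exists>x c. c \<noteq> 0 \<and> x \<in> set [(0, 1, 0, 0), (0, 0, 1, 0), (0, 0, 0, 1)] \<and> D ** qmat (0, 1, 0, 0) = mat c ** (qmat x ** D)"
      by (rule key[OF _ A(2) inv(1) P(2,4)]) simp
    have k2: "\<exists>x c. c \<noteq> 0 \<and> x \<in> set [(0, 1, 0, 0), (0, 0, 1, 0), (0, 0, 0, 1)] \<and> D ** qmat (0, 0, 1, 0) = mat c ** (qmat x ** D)"
      by (rule key[OF _ B(2) inv(2) P(3,5)]) simp
    show ?thesis using k1 k2 normalizer_octset[OF invD] by blast
  qed
  \<comment> \<open>The normalizer yields one inclusion only; equality follows since both groups
    have order 24.\<close>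
  have sub': "proj_stab ?L \<subseteq> octgroup" using sub unfolding proj_stab_def octgroup_def by blast
  have "card (proj_stab ?L) = card (proj_stab L)"
    using iso_same_card[OF proj_stab_conj_iso[OF Q, of L]] by simp
  also have "\<dots> = card octgroup" using bij_betw_same_card[OF bij] by simp
  finally have "proj_stab ?L = octgroup"
    using sub' card_octgroup by (metis card.infinite card_subset_eq zero_neq_numeral)
  then have "semi_invariant ?L C" if "C \<in> octset" for C
  proof -
    have "pgl C \<in> proj_stab ?L" using that \<open>proj_stab ?L = octgroup\<close> unfolding octgroup_def by blast
    then obtain D c where "semi_invariant ?L D" "c \<noteq> 0" "C = mat c ** D"
      unfolding proj_stab_def using pgl_eq_iff by blast
    then show ?thesis using semi_invariant_mult semi_invariant_mat[OF bform_subst[OF L]] by blast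
  qed
  then show ?thesis using P(1) by blast
qed

end

section \<open>Maximality of the octahedral group\<close>

text \<open>The condition is 1/e1 + 1/e2 + 1/e3 = 1 + 2/n. The dihedral solution with e2 = e3 = 2
  would give o1 = 2, which is excluded by 6 <= o1; with e1 >= 4 only (4,2,3) and (5,2,3)
  remain.\<close>

lemma burnside_arith:
  fixes n :: nat
  assumes n: "n = e1 * o1" "n = e2 * o2" "n = e3 * o3"
    and e: "4 \<le> e1" "6 \<le> o1" "2 \<le> e2" "2 \<le> e3" and sum: "o1 + o2 + o3 = n + 2" and le: "o3 \<le> o2" and dvd: "24 dvd n"
  shows "n = 24"
proof -
  have 1: "4 * o1 \<le> n" unfolding n(1) using e(1) by (rule mult_le_mono1)
  have "e2 < 3"
  proof (rule ccontr)
    assume "\<not> e2 < 3"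
    then have "3 * o2 \<le> n" unfolding n(2) by (intro mult_le_mono1) simp
    then show False using 1 sum le by linarith
  qed
  then have "e2 = 2" using e(3) by simp
  then have 2: "n = 2 * o2" using n(2) by simp
  have "e3 < 4"
  proof (rule ccontr)
    assume "\<not> e3 < 4"
    then have "4 * o3 \<le> n" unfolding n(3) by (intro mult_le_mono1) simp
    then show False using 1 2 sum by linarith
  qed
  then have "e3 = 2 \<or> e3 = 3" using e(4) by auto
  then have 3: "n = 3 * o3"
  proof
    assume "e3 = 2"
    then have "n = 2 * o3" using n(3) by simp
    then show ?thesis using 2 sum e(2) by linarith
  qed (use n(3) in simp)
  have "e1 < 6"
  proof (rule ccontr)
    assume "\<not> e1 < 6"
    then have "6 * o1 \<le> n" unfolding n(1) by (intro mult_le_mono1) simp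
    then show False using 2 3 sum by linarith
  qed
  then have "e1 = 4 \<or> e1 = 5" using e(1) by auto
  then show ?thesis
  proof
    assume "e1 = 4"
    then have "n = 4 * o1" using n(1) by simp
    then show ?thesis using 2 3 sum by linarith
  next
    \<comment> \<open>The icosahedral solution, of order 60, which 24 does not divide.\<close>
    assume "e1 = 5"
    then have "n = 5 * o1" using n(1) by simp
    then have "n = 60" using 2 3 sum by linarith
    then show ?thesis using dvd by simp
  qed
qed

text \<open>Orbit counting on the set \<open>E\<close> of poles: there are exactly three orbits, of sizes \<open>n/e\<close> with
  \<open>\<Sum>(1 - 1/e) = 2 - 2/n\<close>.\<close>

lemma (in group_action) order_from_poles:
  assumes fin: "finite (carrier G)" "finite E"
    and fix2: "\<And>g. g \<in> carrier G \<Longrightarrow> g \<noteq> \<one> \<Longrightarrow> card (invariants E \<phi> g) = 2"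
    and stab2: "\<And>x. x \<in> E \<Longrightarrow> card (stabilizer G \<phi> x) \<ge> 2"
    and x0: "x0 \<in> E" "card (orbit G \<phi> x0) \<ge> 6" "card (stabilizer G \<phi> x0) \<ge> 4"
    and dvd: "24 dvd order G"
  shows "order G = 24"
proof -
  interpret group G using group_hom group_hom.axioms(1) by auto
  define n where "n = order G"
  define \<Omega> where "\<Omega> = orbits G E \<phi>"
  have n0: "n > 0" unfolding n_def using fin(1) order_gt_0_iff_finite by blast
  have orbE: "w \<subseteq> E" if "w \<in> \<Omega>" for w
    using that element_image unfolding \<Omega>_def orbits_def orbit_def by blast
  have finO: "finite \<Omega>" using orbE fin(2) by (meson Sup_le_iff finite_UnionD finite_subset)
  have os: "\<exists>e\<ge>2. n = e * card w" if "w \<in> \<Omega>" for w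
  proof -
    obtain x where x: "x \<in> E" "w = orbit G \<phi> x" using \<open>w \<in> \<Omega>\<close> unfolding \<Omega>_def orbits_def by blast
    then show ?thesis using orbit_stabilizer_theorem[OF x(1)] stab2[OF x(1)]
      by (intro exI[of _ "card (stabilizer G \<phi> x)"]) (simp add: n_def mult.commute)
  qed
  have "\<phi> \<one> x = x" if "x \<in> E" for x using id_eq_one that by (metis restrict_apply')
  then have "invariants E \<phi> \<one> = E" unfolding invariants_def by blast
  moreover have "(\<Sum>g\<in>carrier G. card (invariants E \<phi> g)) =
      card (invariants E \<phi> \<one>) + (\<Sum>g\<in>carrier G - {\<one>}. card (invariants E \<phi> g))"
    by (rule sum.remove[OF fin(1) one_closed])
  moreover have "(\<Sum>g\<in>carrier G - {\<one>}. card (invariants E \<phi> g)) = (n - 1) * 2"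
    using fix2 fin(1) by (simp add: n_def order_def)
  \<comment> \<open>Burnside's count: the identity fixes every pole, each other element exactly
    two.\<close>
  ultimately have B: "card \<Omega> * n = card E + (n - 1) * 2"
    using burnside[OF fin] by (simp add: n_def \<Omega>_def)
  have S: "card E = (\<Sum>w\<in>\<Omega>. card w)"
    using disjoint_sum[OF fin(2), of "\<lambda>_. 1 :: nat"] by (simp add: \<Omega>_def)
  define O1 where "O1 = orbit G \<phi> x0"
  have O1: "O1 \<in> \<Omega>" unfolding O1_def \<Omega>_def orbits_def using x0(1) by blast
  have n1: "n = card (stabilizer G \<phi> x0) * card O1"
    using orbit_stabilizer_theorem[OF x0(1)] by (simp add: n_def O1_def mult.commute)
  have o1: "4 * card O1 \<le> n" unfolding n1 using x0(3) by (rule mult_le_mono1)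
  have o6: "6 \<le> card O1" using x0(2) by (simp add: O1_def)
  have S1: "card E = card O1 + (\<Sum>w\<in>\<Omega> - {O1}. card w)" unfolding S using finO O1 by (simp add: sum.remove)
  have "2 * (\<Sum>w\<in>\<Omega> - {O1}. card w) = (\<Sum>w\<in>\<Omega> - {O1}. 2 * card w)" by (simp add: sum_distrib_left)
  also have "\<dots> \<le> (\<Sum>w\<in>\<Omega> - {O1}. n)"
  proof (rule sum_mono)
    fix w assume "w \<in> \<Omega> - {O1}"
    then obtain e where "e \<ge> 2" "n = e * card w" using os by blast
    then show "2 * card w \<le> n" by (simp add: mult_le_mono1)
  qed
  also have "\<dots> = (card \<Omega> - 1) * n" using finO O1 by simp
  finally have S2: "2 * (\<Sum>w\<in>\<Omega> - {O1}. card w) \<le> (card \<Omega> - 1) * n" .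
  have r0: "card \<Omega> > 0" using finO O1 by (auto simp: card_gt_0_iff)
  \<comment> \<open>The number of orbits besides that of \<open>x0\<close>. Since the latter has at
    most n/4 elements and every other orbit at most n/2, the count gives r < 3; its having at least
    6 elements excludes r = 1.\<close>
  define r where "r = card \<Omega> - 1"
  have r: "card \<Omega> = Suc r" using r0 by (simp add: r_def)
  have B': "r * n + n + 2 = card O1 + (\<Sum>w\<in>\<Omega> - {O1}. card w) + 2 * n"
    using B n0 unfolding r S1 by simp
  have "2 * (r * n) + 4 \<le> r * n + 2 * card O1 + 2 * n"
  proof -
    have "2 * (\<Sum>w\<in>\<Omega> - {O1}. card w) \<le> r * n" using S2 unfolding r by simp
    then show ?thesis using B' by linarith
  qed
  then have "2 * (r * n) < 5 * n" using o1 by linarith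
  have "r < 3"
  proof (rule ccontr)
    assume "\<not> r < 3"
    then have "3 * n \<le> r * n" by (intro mult_le_mono1) simp
    then show False using \<open>2 * (r * n) < 5 * n\<close> n0 by linarith
  qed
  moreover have "r \<noteq> 0"
  proof
    assume "r = 0"
    then have "card (\<Omega> - {O1}) = 0" using r finO O1 by simp
    then have "\<Omega> - {O1} = {}" using finO by simp
    then show False using B' o6 \<open>r = 0\<close> n0 by simp
  qed
  moreover have "r \<noteq> 1"
  proof
    assume "r = 1"
    then show False using B' o6 by simp
  qed
  ultimately have "r = 2" by simp
  then have "card (\<Omega> - {O1}) = 2" using r finO O1 by simp
  then obtain O2 O3 where O23: "\<Omega> - {O1} = {O2, O3}" "O2 \<noteq> O3" by (auto simp: card_2_iff)
  have sum: "card O1 + card O2 + card O3 = n + 2" using B' \<open>r = 2\<close> O23 by simp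
  obtain e2 where e2: "e2 \<ge> 2" "n = e2 * card O2" using os O23 by blast
  obtain e3 where e3: "e3 \<ge> 2" "n = e3 * card O3" using os O23 by blast
  show ?thesis
  proof (cases "card O3 \<le> card O2")
    case True
    then show ?thesis using burnside_arith[OF n1 e2(2) e3(2) x0(3) o6 e2(1) e3(1) sum] dvd n_def by simp
  next
    case False
    then show ?thesis using burnside_arith[OF n1 e3(2) e2(2) x0(3) o6 e3(1) e2(1)] sum dvd n_def by simp
  qed
qed


section \<open>Projectivities of the line and their fixed points\<close>

lemma line_scale: "c \<noteq> 0 \<Longrightarrow> p \<noteq> 0 \<Longrightarrow> line (c *s p) = line p"
  by (subst line_eq_iff) (auto simp: wedge_def vec2_eq_iff)

lemma line_image: "(\<lambda>v. B *v v) ` line p = line (B *v p)" for B :: "'a::field ^ 2 ^ 2"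
proof -
  have "line p = (\<lambda>t. t *s p) ` {t. t \<noteq> 0}" for p :: "'a ^ 2" unfolding line_def by auto
  then show ?thesis by (simp add: image_image vec.scale)
qed

lemma invertible_mult_vec_eq_0: "invertible B \<Longrightarrow> B *v p = 0 \<longleftrightarrow> p = 0" for B :: "'a::field ^ 'n ^ 'n"
  by (metis invertible_def matrix_vector_mul_assoc matrix_vector_mul_lid matrix_vector_mult_0_right)

text \<open>An arbitrary representative is used; on punctured lines the choice does not
  matter.\<close>

definition line_act :: "('a::field ^ 2 ^ 2) set \<Rightarrow> ('a ^ 2) set \<Rightarrow> ('a ^ 2) set" where
  "line_act g l = (\<lambda>v. (SOME B. B \<in> g) *v v) ` l"

lemma line_act_pgl:
  assumes "invertible B" "p \<noteq> 0" shows "line_act (pgl B) (line p) = line (B *v p)"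
proof -
  have "(SOME B'. B' \<in> pgl B) \<in> pgl B" using pgl_self by (rule someI)
  then obtain c where c: "c \<noteq> 0" "(SOME B'. B' \<in> pgl B) = mat c ** B" unfolding pgl_eq by blast
  have "line_act (pgl B) (line p) = line (mat c ** B *v p)"
    unfolding line_act_def c line_image ..
  also have "mat c ** B *v p = c *s (B *v p)" by (simp flip: matrix_vector_mul_assoc)
  finally show ?thesis using line_scale[OF c(1)] invertible_mult_vec_eq_0[OF assms(1)] assms(2) by simp
qed

lemma all_lines_fixed:
  fixes M :: "'a::field ^ 2 ^ 2"
  assumes "\<And>v. wedge (M *v v) v = 0" shows "\<exists>a. M = mat a"
proof -
  obtain a b c d where M: "M = mat2 a b c d" by (rule mat2_cases)
  have "c = 0" using assms[of "vector [1, 0]"] by (simp add: M wedge_def mat2_vec)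
  moreover have "b = 0" using assms[of "vector [0, 1]"] by (simp add: M wedge_def mat2_vec)
  moreover have "a = d" using assms[of "vector [1, 1]"] calculation by (simp add: M wedge_def mat2_vec)
  ultimately show ?thesis by (auto simp: M mat_mat2)
qed

text \<open>The fixed points of a projectivity are the roots of a quadratic form.\<close>

lemma bform_fixed_lines: "bform (Suc (Suc 0)) (\<lambda>v. wedge (M *v v) v)" for M :: "'a::field ^ 2 ^ 2"
proof -
  obtain a b c d where M: "M = mat2 a b c d" by (rule mat2_cases)
  show ?thesis unfolding bform_def
    by (intro exI[of _ "\<lambda>i. if i = 0 then b else if i = 1 then a - d else - c"])
      (simp add: M wedge_def mat2_vec atMost_Suc algebra_simps power2_eq_square)
qed

lemma fixed_lines_product:
  fixes M :: "'a::field ^ 2 ^ 2"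
  assumes "p \<noteq> 0" "wedge (M *v p) p = 0"
  obtains h where "bform (Suc 0) h" "\<And>v. wedge (M *v v) v = wedge v p * h v"
  using bform_factor[OF bform_fixed_lines assms] that by blast

lemma three_fixed_lines:
  fixes M :: "'a::field ^ 2 ^ 2"
  assumes p: "p \<noteq> 0" "q \<noteq> 0" "wedge p q \<noteq> 0" "wedge p r \<noteq> 0" "wedge q r \<noteq> 0"
    and M: "wedge (M *v p) p = 0" "wedge (M *v q) q = 0" "wedge (M *v r) r = 0"
  shows "\<exists>a. M = mat a"
proof -
  obtain h where h: "bform (Suc 0) h" "\<And>v. wedge (M *v v) v = wedge v p * h v"
    using fixed_lines_product[OF p(1) M(1)] by blast
  have w: "wedge q p \<noteq> 0" "wedge r p \<noteq> 0" "wedge r q \<noteq> 0" using p(3-5) by (auto simp: wedge_def algebra_simps)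
  have "h q = 0" using h(2)[of q] M(2) w by simp
  then obtain g where g: "bform 0 g" "\<And>v. h v = wedge v q * g v" using bform_factor[OF h(1) p(2)] by blast
  obtain k where k: "\<And>v. g v = k" using g(1) unfolding bform_def by auto
  have "k = 0" using h(2)[of r] g(2)[of r] k M(3) w by simp
  then have "wedge (M *v v) v = 0" for v using h(2) g(2) k by simp
  then show ?thesis by (rule all_lines_fixed)
qed

lemma vec2_basis:
  fixes u p w :: "'a::field ^ 2"
  assumes "wedge u p \<noteq> 0"
  shows "\<exists>\<mu> \<alpha>. w = \<mu> *s u + \<alpha> *s p"
proof -
  have "w = (wedge w p / wedge u p) *s u + (wedge u w / wedge u p) *s p"
    using assms by (simp add: vec2_eq_iff field_simps) (simp add: wedge_def algebra_simps)
  then show ?thesis by blast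
qed

text \<open>Elements of the stabilizer permute the finitely many roots, and two of them that agree
  on three roots are equal, as a projectivity with three fixed points is trivial.\<close>

lemma finite_proj_stab:
  fixes L :: "'a::{alg_closed_field,field_char_0} ^ 2 \<Rightarrow> 'a"
  assumes L: "bform d L" "sqfree L" "d \<ge> 3"
  shows "finite (proj_stab L)"
proof -
  define R where "R = {line p | p. p \<noteq> 0 \<and> L p = 0}"
  have R: "finite R" unfolding R_def using finite_root_lines[OF L(1) sqfree_nonzero[OF L(2)]] .
  obtain p q r where p: "p \<noteq> 0" "q \<noteq> 0" "r \<noteq> 0" "L p = 0" "L q = 0" "L r = 0"
    "wedge p q \<noteq> 0" "wedge p r \<noteq> 0" "wedge q r \<noteq> 0"
    using sqfree_three_roots[OF L] by blast
  define F where "F g = (line_act g (line p), line_act g (line q), line_act g (line r))" for g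
  have img: "line_act (pgl B) (line v) \<in> R" if B: "semi_invariant L B" "v \<noteq> 0" "L v = 0" for B v
  proof -
    obtain c where "\<forall>v. L (B *v v) = c * L v" using B(1) unfolding semi_invariant_def by blast
    then have "L (B *v v) = 0" using B(3) by simp
    then show ?thesis
      using line_act_pgl[OF semi_invariant_invertible[OF B(1)] B(2)] invertible_mult_vec_eq_0[OF semi_invariant_invertible[OF B(1)]] B(2)
      unfolding R_def by auto
  qed
  have "F ` proj_stab L \<subseteq> R \<times> R \<times> R"
    using img p unfolding F_def proj_stab_def by auto
  then have "finite (F ` proj_stab L)" using R by (meson finite_SigmaI finite_subset)
  moreover have "inj_on F (proj_stab L)"
  proof (rule inj_onI)
    fix g h assume g: "g \<in> proj_stab L" "h \<in> proj_stab L" "F g = F h"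
    then obtain B C where B: "g = pgl B" "h = pgl C" "invertible B" "invertible C"
      unfolding proj_stab_def using semi_invariant_invertible by blast
    obtain D where D: "C ** D = mat 1" "D ** C = mat 1" using B(4) unfolding invertible_def by blast
    then have iD: "invertible D" by (auto simp: invertible_def)
    have fx: "wedge (D ** B *v v) v = 0" if v: "v \<noteq> 0" "line_act g (line v) = line_act h (line v)" for v
    proof -
      have "line (B *v v) = line (C *v v)" using v B by (simp add: line_act_pgl)
      then have "(\<lambda>v. D *v v) ` line (B *v v) = (\<lambda>v. D *v v) ` line (C *v v)" by simp
      then have "line (D ** B *v v) = line v" by (simp add: line_image matrix_vector_mul_assoc D)
      then show ?thesis using line_eq_iff[of "D ** B *v v" v] v(1) invertible_mult_vec_eq_0[of "D ** B" v] iD B(3)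
        by (simp add: invertible_mult_iff)
    qed
    have "\<exists>a. D ** B = mat a"
      using g(3) p by (intro three_fixed_lines[of p q r]) (auto simp: F_def fx)
    then obtain a where a: "D ** B = mat a" by blast
    have "a \<noteq> 0" using a iD B(3) invertible_mult_iff[of D B] by (simp add: invertible_mat)
    have "B = C ** (D ** B)" by (simp add: matrix_mul_assoc D)
    also have "\<dots> = mat a ** C" unfolding a by (simp add: mat_mult_comm)
    finally show "g = h" using \<open>a \<noteq> 0\<close> B(1,2) pgl_scale by metis
  qed
  ultimately show ?thesis using finite_imageD by blast
qed

text \<open>The quadratic form of the fixed points has two roots. If they coincided, the matrix
  would be a scalar times a nontrivial unipotent one, which has infinite order in characteristic 0,
  against the finiteness of the stabilizer.\<close>

lemma card_fixed_lines:
  fixes L :: "'a::{alg_closed_field,field_char_0} ^ 2 \<Rightarrow> 'a"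
  assumes L: "bform d L" "finite (proj_stab L)" and B: "semi_invariant L B" "\<And>k. B \<noteq> mat k"
  shows "card {line v | v. v \<noteq> 0 \<and> line (B *v v) = line v} = 2"
proof -
  have inv: "invertible B" using B(1) by (rule semi_invariant_invertible)
  obtain p where p: "p \<noteq> 0" "wedge (B *v p) p = 0" using bform_root[OF bform_fixed_lines] by blast
  obtain h where h: "bform (Suc 0) h" "\<And>v. wedge (B *v v) v = wedge v p * h v"
    using fixed_lines_product[OF p] by blast
  obtain r where r: "r \<noteq> 0" "h r = 0" using bform_root[OF h(1)] by blast
  obtain g where g: "bform 0 g" "\<And>v. h v = wedge v r * g v" using bform_factor[OF h(1) r] by blast
  obtain k where k: "\<And>v. g v = k" using g(1) unfolding bform_def by auto
  have k0: "k \<noteq> 0" using h(2) g(2) k all_lines_fixed[of B] B(2) by fastforce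
  have fixed: "line (B *v v) = line v \<longleftrightarrow> line v = line p \<or> line v = line r" if "v \<noteq> 0" for v
    using that p(1) r(1) invertible_mult_vec_eq_0[OF inv] h(2)[of v] g(2)[of v] k k0 by (simp add: line_eq_iff)
  have set: "{line v | v. v \<noteq> 0 \<and> line (B *v v) = line v} = {line p, line r}"
    using fixed p(1) r(1) by blast
  have "wedge p r \<noteq> 0"
  proof
    assume pr: "wedge p r = 0"
    have eig: "wedge v p = 0" if "wedge (B *v v) v = 0" for v
    proof -
      obtain t where "p = t *s r" using pr wedge_zero_iff[OF r(1)] by blast
      moreover have "wedge v p * wedge v r = 0" using that h(2)[of v] g(2)[of v] k k0 by simp
      ultimately show ?thesis by (auto simp: wedge_def)
    qed
    obtain l where l: "B *v p = l *s p" using p wedge_zero_iff[OF p(1)] by blast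
    have "l \<noteq> 0" using l invertible_mult_vec_eq_0[OF inv, of p] p(1) by auto
    obtain u where u: "wedge u p \<noteq> 0"
    proof (cases "p $ 1 = 0")
      case True
      then show thesis using p(1) that[of "vector [1, 0]"] by (auto simp: wedge_def vec2_eq_iff)
    next
      case False
      then show thesis using that[of "vector [0, 1]"] by (auto simp: wedge_def vec2_eq_iff)
    qed
    obtain \<mu> \<alpha> where \<mu>: "B *v u = \<mu> *s u + \<alpha> *s p" using vec2_basis[OF u] by blast
    \<comment> \<open>Otherwise \<open>u + s *s p\<close>, with \<open>s\<close> solving \<alpha> +
      s l = s \<mu>, would be an eigenvector outside the only fixed line.\<close>
    have "\<mu> = l"
    proof (rule ccontr)
      assume ne: "\<mu> \<noteq> l"
      define s where "s = \<alpha> / (\<mu> - l)"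
      have s: "\<alpha> + s * l = s * \<mu>" using ne by (simp add: s_def field_simps)
      have "B *v (u + s *s p) = \<mu> *s u + (\<alpha> + s * l) *s p"
        by (simp add: matrix_vector_right_distrib vec.scale l \<mu> vec2_eq_iff algebra_simps)
      also have "\<dots> = \<mu> *s (u + s *s p)" unfolding s by (simp add: vec2_eq_iff algebra_simps)
      finally have "wedge (B *v (u + s *s p)) (u + s *s p) = 0" by (simp add: wedge_def algebra_simps)
      then have "wedge (u + s *s p) p = 0" by (rule eig)
      then show False using u by (simp add: wedge_def algebra_simps)
    qed
    have "\<alpha> \<noteq> 0"
    proof
      assume "\<alpha> = 0"
      have "wedge (B *v v) v = 0" for v
      proof -
        obtain x y where v: "v = x *s u + y *s p" using vec2_basis[OF u] by blast
        have "B *v v = l *s v"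
          unfolding v using l \<mu> \<open>\<mu> = l\<close> \<open>\<alpha> = 0\<close>
          by (simp add: matrix_vector_right_distrib vec.scale vec2_eq_iff algebra_simps)
        then show ?thesis by (simp add: wedge_def)
      qed
      then show False using all_lines_fixed[of B] B(2) by blast
    qed
    \<comment> \<open>The unipotent normalization: D fixes p and sends u to u + \<beta> p, so its
      n-th power adds n \<beta> p, and the powers have distinct classes.\<close>
    define D where "D = mat (inverse l) ** B"
    have D: "semi_invariant L D"
      unfolding D_def using \<open>l \<noteq> 0\<close> by (intro semi_invariant_mult B(1)) (auto simp: semi_invariant_def invertible_mat bform_homogeneous[OF L(1)] intro!: exI[of _ "inverse l ^ d"])
    define \<beta> where "\<beta> = \<alpha> / l"
    have Dp: "D *v p = p" and Du: "D *v u = u + \<beta> *s p"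
      using \<open>l \<noteq> 0\<close> \<open>\<mu> = l\<close> unfolding D_def \<beta>_def
      by (simp_all add: l \<mu> vec2_eq_iff field_simps flip: matrix_vector_mul_assoc)
    have "\<beta> \<noteq> 0" using \<open>\<alpha> \<noteq> 0\<close> \<open>l \<noteq> 0\<close> by (simp add: \<beta>_def)
    define C where "C n = ((\<lambda>M. D ** M) ^^ n) (mat 1)" for n
    have C: "semi_invariant L (C n) \<and> C n *v p = p \<and> C n *v u = u + (of_nat n * \<beta>) *s p" for n
    proof (induction n)
      case 0
      then show ?case by (auto simp: C_def semi_invariant_def invertible_mat intro!: exI[of _ 1])
    next
      case (Suc n)
      have S: "C (Suc n) = D ** C n" by (simp add: C_def)
      have "D ** C n *v p = p" using Suc Dp by (simp flip: matrix_vector_mul_assoc)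
      moreover have "D ** C n *v u = u + (of_nat (Suc n) * \<beta>) *s p"
        using Suc Dp Du by (simp flip: matrix_vector_mul_assoc)
          (simp add: matrix_vector_right_distrib vec.scale Dp Du vec2_eq_iff algebra_simps)
      ultimately show ?case using Suc D semi_invariant_mult unfolding S by blast
    qed
    have "inj (\<lambda>n. pgl (C n))"
    proof (rule injI)
      fix m n assume "pgl (C m) = pgl (C n)"
      then obtain c where c: "C m = mat c ** C n" unfolding pgl_eq_iff by blast
      have "p = c *s p" "u + (of_nat m * \<beta>) *s p = c *s (u + (of_nat n * \<beta>) *s p)"
        using arg_cong[OF c, of "\<lambda>M. M *v p"] arg_cong[OF c, of "\<lambda>M. M *v u"] C
        by (simp_all flip: matrix_vector_mul_assoc)
      moreover from this(1) have "c = 1" using p(1) by (auto simp: vec2_eq_iff)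
      ultimately have "of_nat m * \<beta> = of_nat n * \<beta>" using p(1) by (auto simp: vec2_eq_iff)
      then show "m = n" using \<open>\<beta> \<noteq> 0\<close> by simp
    qed
    then have "infinite (range (\<lambda>n. pgl (C n)))" by (simp add: range_inj_infinite)
    moreover have "range (\<lambda>n. pgl (C n)) \<subseteq> proj_stab L" using C unfolding proj_stab_def by blast
    ultimately show False using L(2) finite_subset by blast
  qed
  then show ?thesis unfolding set using line_eq_iff[OF p(1) r(1)] by (simp add: card_insert_if)
qed

context imaginary_unit
begin

lemma ii_neq [simp]: "ii \<noteq> 1" "ii \<noteq> - 1" "ii \<noteq> - ii"
proof -
  have two: "(2 :: 'a) \<noteq> 0" by simp
  have one: "(1 :: 'a) \<noteq> - 1" using two by (metis add.right_inverse one_add_one)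
  show "ii \<noteq> 1" "ii \<noteq> - 1" using ii_sq one by auto
  show "ii \<noteq> - ii" using ii_nonzero two by (metis add.right_inverse mult_2 mult_eq_0_iff)
qed

lemma card_unit_four: "card {1, - 1, ii, - ii} = 4"
proof -
  have one: "(1 :: 'a) \<noteq> - 1" using one_neq_neg_one by blast
  have "1 \<noteq> ii" "1 \<noteq> - ii" "- 1 \<noteq> ii" "- 1 \<noteq> - ii"
    using ii_neq by (metis, metis minus_minus, metis, metis minus_minus)
  then show ?thesis using one ii_neq(3) by (simp add: card_insert_if)
qed

section \<open>The action on poles and the maximality of the octahedral group\<close>

definition poles :: "('a ^ 2 \<Rightarrow> 'a) \<Rightarrow> ('a ^ 2) set set" where
  "poles L = {line p | p. p \<noteq> 0 \<and> (\<exists>B. semi_invariant L B \<and> (\<forall>k. B \<noteq> mat k) \<and> line (B *v p) = line p)}"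

lemma line_act_poles:
  assumes B: "semi_invariant L B" and l: "l \<in> poles L"
  shows "line_act (pgl B) l \<in> poles L"
proof -
  obtain p C where p: "l = line p" "p \<noteq> 0" "semi_invariant L C" "\<And>k. C \<noteq> mat k" "line (C *v p) = line p"
    using l unfolding poles_def by blast
  have inv: "invertible B" using B by (rule semi_invariant_invertible)
  obtain D where D: "B ** D = mat 1" "D ** B = mat 1" using inv unfolding invertible_def by blast
  have "semi_invariant L (B ** C ** D)"
    using semi_invariant_mult semi_invariant_inverse[OF B D] B p(3) by blast
  moreover have "B ** C ** D \<noteq> mat k" for k
  proof
    assume "B ** C ** D = mat k"
    then have "D ** (B ** C ** D) ** B = D ** mat k ** B" by simp
    then have "C = mat k ** (D ** B)" using D
      by (metis matrix_mul_assoc matrix_mul_lid matrix_mul_rid mat_mult_comm)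
    then show False using p(4) D by simp
  qed
  moreover have "line (B ** C ** D *v (B *v p)) = line (B *v p)"
  proof -
    have "B ** C ** D *v (B *v p) = B *v (C *v p)"
      using D by (metis matrix_mul_assoc matrix_mul_rid matrix_vector_mul_assoc)
    then have "line (B ** C ** D *v (B *v p)) = (\<lambda>v. B *v v) ` line (C *v p)" by (simp add: line_image)
    then show ?thesis by (simp add: p(5) line_image)
  qed
  moreover have "B *v p \<noteq> 0" using invertible_mult_vec_eq_0[OF inv] p(2) by simp
  ultimately show ?thesis using line_act_pgl[OF inv p(2)] unfolding poles_def p(1) by blast
qed

lemma line_act_mult:
  assumes "invertible B" "invertible C" "l \<in> poles L"
  shows "line_act (pgl (B ** C)) l = line_act (pgl B) (line_act (pgl C) l)"
proof -
  obtain p where p: "l = line p" "p \<noteq> 0" using assms(3) unfolding poles_def by blast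
  have "C *v p \<noteq> 0" using invertible_mult_vec_eq_0[OF assms(2)] p(2) by simp
  then show ?thesis using assms(1,2) p by (simp add: line_act_pgl invertible_mult_iff matrix_vector_mul_assoc)
qed

lemma line_act_one: "l \<in> poles L \<Longrightarrow> line_act (pgl (mat 1)) l = l"
  unfolding poles_def by (auto simp: line_act_pgl invertible_mat)

text \<open>The restriction to the poles is there because the elements of \<open>BijGroup\<close>
  are extensional functions.\<close>

lemma poles_action:
  "group_action (PGL\<lparr>carrier := proj_stab L\<rparr>) (poles L) (\<lambda>g. restrict (line_act g) (poles L))"
proof -
  let ?G = "PGL\<lparr>carrier := proj_stab L\<rparr>" and ?\<phi> = "\<lambda>g. restrict (line_act g) (poles L)"
  have gG: "group ?G" using group.subgroup_imp_group[OF group_PGL proj_stab_subgroup] .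
  have comp: "line_act (g \<otimes>\<^bsub>PGL\<^esub> h) l = line_act g (line_act h l)"
    if gh: "g \<in> proj_stab L" "h \<in> proj_stab L" "l \<in> poles L" for g h l
  proof -
    obtain B C where "g = pgl B" "h = pgl C" "invertible B" "invertible C"
      using gh(1,2) semi_invariant_invertible unfolding proj_stab_def by blast
    then show ?thesis using line_act_mult[OF _ _ gh(3)] by (simp add: pgl_mult)
  qed
  have closed: "line_act g l \<in> poles L" if "g \<in> proj_stab L" "l \<in> poles L" for g l
    using that line_act_poles by (auto simp: proj_stab_def)
  have bij: "?\<phi> g \<in> Bij (poles L)" if g: "g \<in> proj_stab L" for g
  proof -
    have gi: "inv\<^bsub>PGL\<^esub> g \<in> proj_stab L" using subgroup.m_inv_closed[OF proj_stab_subgroup g] .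
    have gc: "g \<in> carrier PGL" using subgroup.mem_carrier[OF proj_stab_subgroup g] .
    have "inv\<^bsub>PGL\<^esub> g \<otimes>\<^bsub>PGL\<^esub> g = pgl (mat 1)" "g \<otimes>\<^bsub>PGL\<^esub> inv\<^bsub>PGL\<^esub> g = pgl (mat 1)"
      using group.l_inv[OF group_PGL gc] group.r_inv[OF group_PGL gc] one_PGL by metis+
    then have "line_act (inv\<^bsub>PGL\<^esub> g) (line_act g l) = l" "line_act g (line_act (inv\<^bsub>PGL\<^esub> g) l) = l"
      if "l \<in> poles L" for l
      using comp[OF gi g that] comp[OF g gi that] line_act_one[OF that] by simp_all
    then have "bij_betw (line_act g) (poles L) (poles L)"
      using closed[OF g] closed[OF gi]
      by (intro bij_betw_byWitness[where f' = "line_act (inv\<^bsub>PGL\<^esub> g)"]) auto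
    then show ?thesis unfolding Bij_def by (auto cong: bij_betw_cong)
  qed
  have "?\<phi> \<in> hom ?G (BijGroup (poles L))"
  proof (rule homI)
    fix x assume "x \<in> carrier ?G" then show "?\<phi> x \<in> carrier (BijGroup (poles L))"
      using bij by (simp add: BijGroup_def)
  next
    fix x y assume xy: "x \<in> carrier ?G" "y \<in> carrier ?G"
    have "?\<phi> (x \<otimes>\<^bsub>PGL\<^esub> y) = compose (poles L) (?\<phi> x) (?\<phi> y)"
      using xy comp closed by (auto simp: compose_def fun_eq_iff)
    then show "?\<phi> (x \<otimes>\<^bsub>?G\<^esub> y) = ?\<phi> x \<otimes>\<^bsub>BijGroup (poles L)\<^esub> ?\<phi> y"
      using xy bij by (simp add: BijGroup_def)
  qed
  then show ?thesis
    unfolding group_action_def group_hom_def group_hom_axioms_def using gG group_BijGroup by blast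
qed

lemma octset_semi_subset: "oct_good d L \<Longrightarrow> octgroup \<subseteq> proj_stab L"
  unfolding oct_good_def octgroup_def proj_stab_def by blast

text \<open>The octahedron supplies the numerical input for the orbit count: the pole (1:0), a
  vertex, has at least four elements in its stabilizer and at least six images, and 24 divides the
  order by Lagrange.\<close>

theorem octset_maximal:
  assumes good: "oct_good d L" and d: "d \<ge> 3" and C: "semi_invariant L C"
  shows "C \<in> octset"
proof -
  let ?G = "PGL\<lparr>carrier := proj_stab L\<rparr>" and ?E = "poles L" and ?\<phi> = "\<lambda>g. restrict (line_act g) (poles L)"
  have L: "bform d L" "sqfree L" and semi: "\<And>B. B \<in> octset \<Longrightarrow> semi_invariant L B"
    using good unfolding oct_good_def by auto
  interpret act: group_action ?G ?E ?\<phi> by (rule poles_action)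
  have fin: "finite (proj_stab L)" using finite_proj_stab[OF L d] .
  have pgl_one: "\<one>\<^bsub>?G\<^esub> = pgl (mat 1)" by (simp add: one_PGL)
  have nonscalar: "\<And>k. B \<noteq> mat k" if "semi_invariant L B" "pgl B \<noteq> \<one>\<^bsub>?G\<^esub>" for B
  proof
    fix k assume "B = mat k"
    moreover have "k \<noteq> 0" using semi_invariant_invertible[OF that(1)] calculation by (simp add: invertible_mat)
    ultimately have "pgl B = pgl (mat 1)" unfolding pgl_eq_iff by (intro exI[of _ k]) simp
    then show False using that(2) pgl_one by simp
  qed
  have inv_eq: "invariants ?E ?\<phi> (pgl B) = {line v | v. v \<noteq> 0 \<and> line (B *v v) = line v}"
    if B: "semi_invariant L B" "\<And>k. B \<noteq> mat k" for B
  proof -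
    have "line_act (pgl B) (line v) = line (B *v v)" if "v \<noteq> 0" for v
      using line_act_pgl[OF semi_invariant_invertible[OF B(1)] that] .
    moreover have "line v \<in> ?E" if "v \<noteq> 0" "line (B *v v) = line v" for v
      unfolding poles_def using that B by blast
    moreover have "\<exists>v. l = line v \<and> v \<noteq> 0" if "l \<in> ?E" for l
      using that unfolding poles_def by blast
    ultimately show ?thesis unfolding invariants_def
      by (intro subset_antisym subsetI) (auto, metis)
  qed
  have fix2: "card (invariants ?E ?\<phi> g) = 2" if g: "g \<in> proj_stab L" "g \<noteq> \<one>\<^bsub>?G\<^esub>" for g
  proof -
    obtain B where B: "g = pgl B" "semi_invariant L B" using g(1) unfolding proj_stab_def by blast
    then show ?thesis
      using inv_eq[OF B(2) nonscalar] card_fixed_lines[OF L(1) fin B(2) nonscalar] g(2) by simp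
  qed
  have finE: "finite ?E"
  proof -
    have "?E \<subseteq> (\<Union>g\<in>proj_stab L - {\<one>\<^bsub>?G\<^esub>}. invariants ?E ?\<phi> g)"
    proof
      fix l assume l: "l \<in> ?E"
      then obtain p B where p: "l = line p" "p \<noteq> 0" "semi_invariant L B" "\<And>k. B \<noteq> mat k" "line (B *v p) = line p"
        unfolding poles_def by blast
      have "pgl B \<noteq> \<one>\<^bsub>?G\<^esub>"
        using p(4) unfolding pgl_one pgl_eq_iff by auto
      moreover have "pgl B \<in> proj_stab L" using p(3) unfolding proj_stab_def by blast
      moreover have "l \<in> invariants ?E ?\<phi> (pgl B)" using inv_eq[OF p(3,4)] p(1,2,5) by blast
      ultimately show "l \<in> (\<Union>g\<in>proj_stab L - {\<one>\<^bsub>?G\<^esub>}. invariants ?E ?\<phi> g)" by blast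
    qed
    moreover have "finite (invariants ?E ?\<phi> g)" if "g \<in> proj_stab L - {\<one>\<^bsub>?G\<^esub>}" for g
      using fix2[of g] that by (intro card_ge_0_finite) simp
    ultimately show ?thesis using fin by (meson finite_Diff finite_UN_I finite_subset)
  qed
  have stab_one: "\<one>\<^bsub>?G\<^esub> \<in> stabilizer ?G ?\<phi> l" if "l \<in> ?E" for l
    using act.stabilizer_one_closed[OF that] .
  have finS: "finite (stabilizer ?G ?\<phi> l)" for l
    using fin by (auto simp: stabilizer_def)
  have stab2: "card (stabilizer ?G ?\<phi> l) \<ge> 2" if l: "l \<in> ?E" for l
  proof -
    obtain p B where p: "l = line p" "p \<noteq> 0" "semi_invariant L B" "\<And>k. B \<noteq> mat k" "line (B *v p) = line p"
      using l unfolding poles_def by blast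
    have "pgl B \<noteq> \<one>\<^bsub>?G\<^esub>" using p(4) unfolding pgl_one pgl_eq_iff by auto
    moreover have "pgl B \<in> stabilizer ?G ?\<phi> l"
      using l p line_act_pgl[OF semi_invariant_invertible[OF p(3)] p(2)] unfolding stabilizer_def proj_stab_def by auto
    ultimately have "card {\<one>\<^bsub>?G\<^esub>, pgl B} = 2" "{\<one>\<^bsub>?G\<^esub>, pgl B} \<subseteq> stabilizer ?G ?\<phi> l"
      using stab_one[OF l] by auto
    then show ?thesis using card_mono[OF finS] by metis
  qed
  \<comment> \<open>A vertex of the octahedron; the matrices diag(c,1), with c a fourth root of
    unity, fix it.\<close>
  define e where "e = (vector [1, 0] :: 'a ^ 2)"
  have e0: "e \<noteq> 0" by (simp add: e_def vec2_eq_iff)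
  have D: "mat2 c 0 0 1 \<in> octset" if "c \<in> {1, - 1, ii, - ii}" for c
    using that octset_diag by auto
  have De: "line (mat2 c 0 0 1 *v e) = line e" if "c \<in> {1, - 1, ii, - ii}" for c
  proof -
    have "c \<noteq> 0" using that by auto
    moreover have "mat2 c 0 0 1 *v e = c *s e" by (simp add: e_def vec2_eq_iff mat2_vec)
    ultimately show ?thesis using line_scale e0 by simp
  qed
  have poleE: "line e \<in> ?E"
  proof -
    have "mat2 ii 0 0 1 \<noteq> mat k" for k using ii_neq(1) by (auto simp: mat_mat2 mat2_eq_iff)
    then show ?thesis using semi[OF D[of ii]] De[of ii] e0 unfolding poles_def by auto
  qed
  have stab4: "card (stabilizer ?G ?\<phi> (line e)) \<ge> 4"
  proof -
    have "inj_on (\<lambda>c. pgl (mat2 c 0 0 1)) {1, - 1, ii, - ii}"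
      by (rule inj_onI) (auto simp: pgl_eq_iff mat_mult_mat2 mat2_eq_iff)
    then have "card ((\<lambda>c. pgl (mat2 c 0 0 1)) ` {1, - 1, ii, - ii}) = 4"
      using card_unit_four by (simp only: card_image)
    moreover have "(\<lambda>c. pgl (mat2 c 0 0 1)) ` {1, - 1, ii, - ii} \<subseteq> stabilizer ?G ?\<phi> (line e)"
    proof
      fix g assume "g \<in> (\<lambda>c. pgl (mat2 c 0 0 1)) ` {1, - 1, ii, - ii}"
      then obtain c where c: "c \<in> {1, - 1, ii, - ii}" "g = pgl (mat2 c 0 0 1)" by blast
      then show "g \<in> stabilizer ?G ?\<phi> (line e)"
        using semi[OF D[OF c(1)]] De[OF c(1)] line_act_pgl[OF octset_invertible[OF D[OF c(1)]] e0] poleE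
        unfolding stabilizer_def proj_stab_def by auto
    qed
    ultimately show ?thesis using card_mono[OF finS] by metis
  qed
  have orb6: "card (orbit ?G ?\<phi> (line e)) \<ge> 6"
  proof -
    \<comment> \<open>The vertices other than (1:0) are (c:1) with c = 0 or a fourth root of unity,
      six in all.\<close>
    define f where "f c = line (vector [c, 1] :: 'a ^ 2)" for c
    have in_orb: "line (B *v e) \<in> orbit ?G ?\<phi> (line e)" if "B \<in> octset" for B
      using line_act_pgl[OF octset_invertible[OF that] e0] poleE semi[OF that]
      unfolding orbit_def proj_stab_def by force
    have "f c \<in> orbit ?G ?\<phi> (line e)" if c: "c \<in> {1, - 1, ii, - ii}" for c
    proof -
      have "mat2 c 0 0 1 ** mat2 1 1 1 (- 1) *v e = vector [c, 1]"
        by (simp add: e_def mat2_mult vec2_eq_iff mat2_vec)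
      then show ?thesis using in_orb[OF octset_mult[OF D[OF c] octset_hadamard]] by (simp add: f_def)
    qed
    moreover have "f 0 \<in> orbit ?G ?\<phi> (line e)"
    proof -
      have "mat2 0 1 1 0 *v e = vector [0, 1]" by (simp add: e_def vec2_eq_iff mat2_vec)
      then show ?thesis using in_orb[OF octset_swap] by (simp add: f_def)
    qed
    moreover have "line e \<in> orbit ?G ?\<phi> (line e)" using act.orbit_refl[OF poleE] .
    ultimately have sub: "insert (line e) (f ` insert 0 {1, - 1, ii, - ii}) \<subseteq> orbit ?G ?\<phi> (line e)" by auto
    have nz: "(vector [c, 1] :: 'a ^ 2) \<noteq> 0" for c by (simp add: vec2_eq_iff)
    have "inj f" by (rule injI) (simp add: f_def line_eq_iff[OF nz nz] wedge_def)
    then have "card (f ` insert 0 {1, - 1, ii, - ii}) = card (insert 0 {1, - 1, ii, - ii})"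
      by (meson card_image inj_on_subset subset_UNIV)
    also have "\<dots> = 5" using card_unit_four by (subst card_insert_disjoint) auto
    finally have "card (f ` insert 0 {1, - 1, ii, - ii}) = 5" .
    moreover have "line e \<notin> f ` insert 0 {1, - 1, ii, - ii}"
      using line_eq_iff[OF e0 nz] by (auto simp: f_def e_def wedge_def)
    ultimately have "card (insert (line e) (f ` insert 0 {1, - 1, ii, - ii})) = 6"
      by (subst card_insert_disjoint) auto
    moreover have "finite (orbit ?G ?\<phi> (line e))"
    proof -
      have "orbit ?G ?\<phi> (line e) = (\<lambda>g. ?\<phi> g (line e)) ` proj_stab L" unfolding orbit_def by auto
      then show ?thesis using fin by simp
    qed
    ultimately show ?thesis using card_mono sub by metis
  qed
  have gG: "group ?G" using group.subgroup_imp_group[OF group_PGL proj_stab_subgroup] .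
  have subO: "octgroup \<subseteq> proj_stab L" using octset_semi_subset[OF good] .
  have "subgroup octgroup ?G"
    using group.subgroup_incl[OF group_PGL octgroup_subgroup proj_stab_subgroup subO] .
  then have "card (rcosets\<^bsub>?G\<^esub> octgroup) * card octgroup = order ?G"
    using group.lagrange[OF gG] by blast
  then have dvd: "24 dvd order ?G" using card_octgroup by (metis dvd_triv_right)
  have "order ?G = 24"
    using act.order_from_poles[OF _ finE _ stab2 poleE orb6 stab4 dvd] fin fix2 by simp
  then have "octgroup = proj_stab L"
    using card_subset_eq[OF fin subO] card_octgroup by (simp add: order_def)
  then have "pgl C \<in> octgroup" using C unfolding proj_stab_def by blast
  then obtain B c where "B \<in> octset" "c \<noteq> 0" "C = mat c ** B" unfolding octgroup_def using pgl_eq_iff by blast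
  then show ?thesis using octset_scale by blast
qed

end

section \<open>Galois points under changes of coordinates\<close>

text \<open>Induction along the line extensions that define the dimension; injectivity keeps each
  added vector outside the image of the previous space.\<close>

lemma dimension_image:
  assumes E: "field E" and \<Psi>: "\<Psi> \<in> ring_iso E E" and dim: "ring.dimension E n K V" and K: "K \<subseteq> carrier E"
  shows "V \<subseteq> carrier E \<and> ring.dimension E n (\<Psi> ` K) (\<Psi> ` V)"
proof -
  interpret field E by (rule E)
  have hom: "\<Psi> \<in> ring_hom E E" and inj: "inj_on \<Psi> (carrier E)"
    using \<Psi> unfolding ring_iso_def bij_betw_def by auto
  interpret h: ring_hom_ring E E \<Psi> by (intro ring_hom_ringI2 ring_axioms hom)
  show ?thesis using dim K
  proof (induction rule: dimension.induct)
    case (zero_dim K)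
    have "\<Psi> ` {\<zero>\<^bsub>E\<^esub>} = {\<zero>\<^bsub>E\<^esub>}" by simp
    then show ?case by (metis dimension.zero_dim empty_subsetI insert_subset zero_closed)
  next
    case (Suc_dim v V n K)
    then have V: "V \<subseteq> carrier E" and IH: "dimension n (\<Psi> ` K) (\<Psi> ` V)" by auto
    have "\<Psi> v \<in> carrier E" using Suc_dim.hyps(1) by simp
    moreover have "\<Psi> v \<notin> \<Psi> ` V" using inj Suc_dim.hyps(1,2) V by (meson inj_on_image_mem_iff)
    ultimately have "dimension (Suc n) (\<Psi> ` K) (line_extension (\<Psi> ` K) (\<Psi> v) (\<Psi> ` V))"
      using IH by (rule dimension.Suc_dim)
    moreover have "line_extension (\<Psi> ` K) (\<Psi> v) (\<Psi> ` V) = \<Psi> ` line_extension K v V"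
    proof
      show "line_extension (\<Psi> ` K) (\<Psi> v) (\<Psi> ` V) \<subseteq> \<Psi> ` line_extension K v V"
      proof
        fix u assume "u \<in> line_extension (\<Psi> ` K) (\<Psi> v) (\<Psi> ` V)"
        then obtain k w where "k \<in> K" "w \<in> V" "u = \<Psi> k \<otimes>\<^bsub>E\<^esub> \<Psi> v \<oplus>\<^bsub>E\<^esub> \<Psi> w"
          unfolding line_extension_mem_iff by blast
        moreover from this have "u = \<Psi> (k \<otimes>\<^bsub>E\<^esub> v \<oplus>\<^bsub>E\<^esub> w)"
          using Suc_dim.prems Suc_dim.hyps(1) V by (simp add: subset_iff)
        moreover have "k \<otimes>\<^bsub>E\<^esub> v \<oplus>\<^bsub>E\<^esub> w \<in> line_extension K v V"
          unfolding line_extension_mem_iff using \<open>k \<in> K\<close> \<open>w \<in> V\<close> by blast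
        ultimately show "u \<in> \<Psi> ` line_extension K v V" by blast
      qed
      show "\<Psi> ` line_extension K v V \<subseteq> line_extension (\<Psi> ` K) (\<Psi> v) (\<Psi> ` V)"
      proof
        fix u assume "u \<in> \<Psi> ` line_extension K v V"
        then obtain k w where kw: "k \<in> K" "w \<in> V" "u = \<Psi> (k \<otimes>\<^bsub>E\<^esub> v \<oplus>\<^bsub>E\<^esub> w)"
          by (auto simp: line_extension_mem_iff)
        then have "u = \<Psi> k \<otimes>\<^bsub>E\<^esub> \<Psi> v \<oplus>\<^bsub>E\<^esub> \<Psi> w"
          using Suc_dim.prems Suc_dim.hyps(1) V by (simp add: subset_iff)
        then show "u \<in> line_extension (\<Psi> ` K) (\<Psi> v) (\<Psi> ` V)" using kw unfolding line_extension_mem_iff by blast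
      qed
    qed
    ultimately show ?case
      using line_extension_in_carrier[OF Suc_dim.prems Suc_dim.hyps(1) V] by simp
  qed
qed

text \<open>One inclusion is minimality of the generated field; the other is the same inclusion for
  the inverse automorphism.\<close>

lemma generate_field_image:
  assumes E: "field E" and \<Psi>: "\<Psi> \<in> ring_iso E E" and S: "S \<subseteq> carrier E"
  shows "\<Psi> ` generate_field E S = generate_field E (\<Psi> ` S)"
proof -
  interpret field E by (rule E)
  have sub: "generate_field E (\<Phi> ` S) \<subseteq> \<Phi> ` generate_field E S" if \<Phi>: "\<Phi> \<in> ring_iso E E" and S: "S \<subseteq> carrier E" for \<Phi> S
  proof -
    have hom: "\<Phi> \<in> ring_hom E E" using \<Phi> unfolding ring_iso_def by auto
    interpret h: ring_hom_ring E E \<Phi> by (intro ring_hom_ringI2 ring_axioms hom)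
    have "subfield (\<Phi> ` generate_field E S) E"
      using h.img_is_subfield(2)[OF generate_field_is_subfield[OF S]] by simp
    moreover have "\<Phi> ` S \<subseteq> \<Phi> ` generate_field E S" by (intro image_mono subsetI generate_field.incl)
    moreover have "\<Phi> ` S \<subseteq> carrier E" using S by auto
    ultimately show ?thesis using generate_field_min_subfield1 by blast
  qed
  have bij: "bij_betw \<Psi> (carrier E) (carrier E)" and cl: "\<And>x. x \<in> carrier E \<Longrightarrow> \<Psi> x \<in> carrier E"
    by (rule ring_iso_memE(5)[OF \<Psi>], rule ring_iso_memE(1)[OF \<Psi>])
  define \<Phi> where "\<Phi> = inv_into (carrier E) \<Psi>"
  have \<Phi>: "\<Phi> \<in> ring_iso E E" unfolding \<Phi>_def using ring_iso_set_sym[OF ring_axioms \<Psi>] .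
  have \<Phi>\<Psi>: "\<Phi> (\<Psi> x) = x" if "x \<in> carrier E" for x
    using bij that unfolding \<Phi>_def by (simp add: bij_betw_inv_into_left)
  have \<Psi>\<Phi>: "\<Psi> (\<Phi> x) = x" if "x \<in> carrier E" for x
    using bij that unfolding \<Phi>_def by (simp add: bij_betw_inv_into_right)
  have S': "\<Psi> ` S \<subseteq> carrier E" using cl S by blast
  have "\<Phi> ` \<Psi> ` S = (\<lambda>x. x) ` S"
    unfolding image_image by (rule image_cong) (use S \<Phi>\<Psi> in auto)
  then have "\<Phi> ` \<Psi> ` S = S" by simp
  then have "generate_field E S \<subseteq> \<Phi> ` generate_field E (\<Psi> ` S)" using sub[OF \<Phi> S'] by simp
  then have "\<Psi> ` generate_field E S \<subseteq> \<Psi> ` \<Phi> ` generate_field E (\<Psi> ` S)" by blast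
  also have "\<dots> = (\<lambda>x. x) ` generate_field E (\<Psi> ` S)"
    unfolding image_image by (rule image_cong) (use generate_field_in_carrier[OF S'] \<Psi>\<Phi> in auto)
  also have "\<dots> = generate_field E (\<Psi> ` S)" by simp
  finally show ?thesis using sub[OF \<Psi> S] by blast
qed

text \<open>Conjugation by \<open>\<Psi>\<close> carries the automorphisms over \<open>k\<close> to
  those over the image of \<open>k\<close>, so the fixed field is carried along.\<close>

lemma galois_extension_image:
  assumes gal: "galois_extension E k" and \<Psi>: "\<Psi> \<in> ring_iso E E"
  shows "galois_extension E (\<Psi> ` k)"
proof -
  have E: "field E" and k: "subfield k E" and fd: "ring.finite_dimension E k (carrier E)"
    and fx: "{x \<in> carrier E. \<forall>\<sigma>\<in>ring_iso E E. (\<forall>y\<in>k. \<sigma> y = y) \<longrightarrow> \<sigma> x = x} = k"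
    using gal unfolding galois_extension_def by blast+
  interpret field E by (rule E)
  have bij: "bij_betw \<Psi> (carrier E) (carrier E)" and hom: "\<Psi> \<in> ring_hom E E"
    using \<Psi> unfolding ring_iso_def by auto
  interpret h: ring_hom_ring E E \<Psi> by (intro ring_hom_ringI2 ring_axioms hom)
  have kc: "k \<subseteq> carrier E" using subfieldE(3)[OF k] .
  have surj: "\<Psi> ` carrier E = carrier E" using bij by (simp add: bij_betw_def)
  have 1: "subfield (\<Psi> ` k) E" using h.img_is_subfield(2)[OF k] by simp
  have 2: "ring.finite_dimension E (\<Psi> ` k) (carrier E)"
  proof -
    obtain n where "dimension n k (carrier E)" using fd unfolding finite_dimension_def by blast
    then have "dimension n (\<Psi> ` k) (carrier E)" using dimension_image[OF E \<Psi> _ kc, of n "carrier E"] surj by simp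
    then show ?thesis unfolding finite_dimension_def by blast
  qed
  define \<Phi> where "\<Phi> = inv_into (carrier E) \<Psi>"
  have \<Phi>: "\<Phi> \<in> ring_iso E E" unfolding \<Phi>_def using ring_iso_set_sym[OF ring_axioms \<Psi>] .
  have \<Phi>\<Psi>: "\<Phi> (\<Psi> x) = x" if "x \<in> carrier E" for x
    using bij that unfolding \<Phi>_def by (simp add: bij_betw_inv_into_left)
  have "x \<in> \<Psi> ` k" if x: "x \<in> carrier E" "\<forall>\<sigma>\<in>ring_iso E E. (\<forall>y\<in>\<Psi> ` k. \<sigma> y = y) \<longrightarrow> \<sigma> x = x" for x
  proof -
    obtain x' where x': "x' \<in> carrier E" "x = \<Psi> x'" using x(1) surj by blast
    have "\<tau> x' = x'" if \<tau>: "\<tau> \<in> ring_iso E E" "\<forall>y\<in>k. \<tau> y = y" for \<tau>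
    proof -
      have "\<Psi> \<circ> (\<tau> \<circ> \<Phi>) \<in> ring_iso E E" using ring_iso_set_trans \<Phi> \<tau>(1) \<Psi> by blast
      moreover have "\<forall>y\<in>\<Psi> ` k. (\<Psi> \<circ> (\<tau> \<circ> \<Phi>)) y = y" using \<tau>(2) \<Phi>\<Psi> kc by auto
      ultimately have "(\<Psi> \<circ> (\<tau> \<circ> \<Phi>)) x = x" using x(2) by blast
      then have "\<Psi> (\<tau> x') = \<Psi> x'" using \<Phi>\<Psi>[OF x'(1)] x'(2) by simp
      then show ?thesis
        using inj_onD[OF bij_betw_imp_inj_on[OF bij]] x'(1) ring_iso_memE(1)[OF \<tau>(1) x'(1)] by blast
    qed
    then have "x' \<in> k" using fx x'(1) by blast
    then show ?thesis using x'(2) by blast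
  qed
  moreover have "\<Psi> ` k \<subseteq> carrier E" using kc surj by blast
  ultimately have "{x \<in> carrier E. \<forall>\<sigma>\<in>ring_iso E E. (\<forall>y\<in>\<Psi> ` k. \<sigma> y = y) \<longrightarrow> \<sigma> x = x} = \<Psi> ` k" by blast
  then show ?thesis unfolding galois_extension_def using E 1 2 by blast
qed

section \<open>Homogeneity and linear substitution\<close>

lemma homogeneous_0 [simp]: "homogeneous n 0"
  by (simp add: homogeneous_def)

lemma homogeneous_add: "homogeneous n F \<Longrightarrow> homogeneous n G \<Longrightarrow> homogeneous n (F + G)"
  unfolding homogeneous_def using keys_add[of F G] by blast

lemma homogeneous_mult:
  assumes "homogeneous m F" "homogeneous n G" shows "homogeneous (m + n) (F * G)"
  unfolding homogeneous_def
proof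
  fix k assume "k \<in> Poly_Mapping.keys (F * G)"
  then obtain a b where "k = a + b" "a \<in> Poly_Mapping.keys F" "b \<in> Poly_Mapping.keys G"
    using keys_mult[of F G] by blast
  then show "(\<Sum>i\<in>UNIV. Poly_Mapping.lookup k i) = m + n"
    using assms unfolding homogeneous_def by (simp add: lookup_add sum.distrib)
qed

lemma homogeneous_Const: "homogeneous 0 (Const c)"
  by (simp add: homogeneous_def Const_def)

lemma homogeneous_Var: "homogeneous 1 (Var i)"
  by (simp add: homogeneous_def Var_def lookup_single when_def sum.delta)

lemma homogeneous_sum: "(\<And>i. i \<in> I \<Longrightarrow> homogeneous n (f i)) \<Longrightarrow> homogeneous n (sum f I)"
  by (induction I rule: infinite_finite_induct) (auto intro: homogeneous_add)

lemma homogeneous_power: "homogeneous n F \<Longrightarrow> homogeneous (k * n) (F ^ k)"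
  by (induction k) (use homogeneous_Const[of 1] in \<open>auto simp: Const_def intro: homogeneous_mult\<close>)

lemma homogeneous_prod:
  "finite I \<Longrightarrow> (\<And>i. i \<in> I \<Longrightarrow> homogeneous (n i) (f i)) \<Longrightarrow> homogeneous (sum n I) (prod f I)"
  by (induction I rule: finite_induct) (use homogeneous_Const[of 1] in \<open>auto simp: Const_def intro: homogeneous_mult\<close>)

lemma homogeneous_lin_form: "homogeneous 1 (lin_form a)"
  unfolding lin_form_def using homogeneous_mult[OF homogeneous_Const homogeneous_Var] by (intro homogeneous_sum) simp

lemma homogeneous_subst_form:
  assumes "homogeneous n F" shows "homogeneous n (subst_form A F)"
  unfolding subst_form_def
proof (rule homogeneous_sum)
  fix m assume "m \<in> Poly_Mapping.keys F"
  then have n: "(\<Sum>i\<in>UNIV. Poly_Mapping.lookup m i) = n" using assms unfolding homogeneous_def by blast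
  have "homogeneous (\<Sum>i\<in>UNIV. Poly_Mapping.lookup m i * 1) (\<Prod>i\<in>UNIV. lin_form (A $ i) ^ Poly_Mapping.lookup m i)"
    by (intro homogeneous_prod homogeneous_power homogeneous_lin_form) simp
  then show "homogeneous n (Const (Poly_Mapping.lookup F m) * (\<Prod>i\<in>UNIV. lin_form (A $ i) ^ Poly_Mapping.lookup m i))"
    using homogeneous_mult[OF homogeneous_Const] n by fastforce
qed

lemma subst_form_simps:
  fixes F G :: "'a::field_char_0 form" and a :: "'a ^ 3"
  shows "subst_form A (F + G) = subst_form A F + subst_form A G"
    "subst_form A (F * G) = subst_form A F * subst_form A G"
    "subst_form A 0 = (0 :: 'a form)" "subst_form A 1 = (1 :: 'a form)" "subst_form A (Const c) = Const (c :: 'a)"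
    "subst_form A (subst_form B F) = subst_form (B ** A) F" "subst_form (mat 1) F = F"
    "subst_form A (lin_form a) = lin_form (transpose A *v a)"
proof -
  have "(\<Sum>j\<in>UNIV. a $ j * (A *v v) $ j) = (\<Sum>j\<in>UNIV. (transpose A *v a) $ j * v $ j)" for v :: "'a ^ 3"
    by (simp add: sum_3 matrix_vector_mult_def transpose_def algebra_simps)
  then show "subst_form A (lin_form a) = lin_form (transpose A *v a)"
    by (intro eval_form_inject) simp
qed (auto intro!: eval_form_inject simp: matrix_vector_mul_assoc)

lemma subst_form_eq_0_iff:
  fixes F :: "'a::field_char_0 form"
  assumes "A ** B = mat 1" shows "subst_form A F = 0 \<longleftrightarrow> F = 0"
proof
  assume "subst_form A F = 0"
  then have "subst_form B (subst_form A F) = subst_form B 0" by simp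
  then show "F = 0" by (simp add: subst_form_simps assms)
qed (simp add: subst_form_simps)

section \<open>Automorphisms of the function field induced by projectivities\<close>

text \<open>Given by a description over all fraction representations; for an invertible substitution
  the value is independent of the representation.\<close>

definition fract_subst :: "'a::field_char_0 ^ 3 ^ 3 \<Rightarrow> 'a form fract \<Rightarrow> 'a form fract" where
  "fract_subst A x = (THE y. \<exists>G H. H \<noteq> 0 \<and> x = Fract G H \<and> y = Fract (subst_form A G) (subst_form A H))"

lemma fract_subst_Fract:
  fixes A B :: "'a::field_char_0 ^ 3 ^ 3"
  assumes AB: "A ** B = mat 1"
  shows "fract_subst A (Fract G H) = Fract (subst_form A G) (subst_form A H)"
proof -
  have *: "fract_subst A (Fract G H) = Fract (subst_form A G) (subst_form A H)" if H: "H \<noteq> 0" for G H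
    unfolding fract_subst_def
  proof (rule the_equality)
    fix y assume "\<exists>G' H'. H' \<noteq> 0 \<and> Fract G H = Fract G' H' \<and> y = Fract (subst_form A G') (subst_form A H')"
    then obtain G' H' where y: "H' \<noteq> 0" "Fract G H = Fract G' H'" "y = Fract (subst_form A G') (subst_form A H')" by blast
    then have "G * H' = G' * H" using H by (simp add: eq_fract)
    then have "subst_form A G * subst_form A H' = subst_form A G' * subst_form A H"
      by (metis subst_form_simps(2))
    then show "y = Fract (subst_form A G) (subst_form A H)"
      using y H by (simp add: eq_fract subst_form_eq_0_iff[OF AB])
  qed (use H in blast)
  show ?thesis
  proof (cases "H = 0")
    case True
    \<comment> \<open>A fraction with denominator 0 equals 0, and the substituted fraction again has
      denominator 0.\<close>
    then have "fract_subst A (Fract G H) = fract_subst A (Fract 0 1)" by (simp only: eq_fract(2))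
    also have "\<dots> = Fract 0 1" using *[of 1 0] by (simp add: subst_form_simps)
    finally show ?thesis using True by (simp add: subst_form_simps eq_fract(2))
  qed (rule *)
qed

lemma fract_subst_hom:
  fixes A B :: "'a::field_char_0 ^ 3 ^ 3"
  assumes AB: "A ** B = mat 1"
  shows "fract_subst A (x + y) = fract_subst A x + fract_subst A y"
    "fract_subst A (x * y) = fract_subst A x * fract_subst A y" "fract_subst A 1 = 1"
proof -
  obtain a b where x: "x = Fract a b" "b \<noteq> 0" by (cases x)
  obtain c d where y: "y = Fract c d" "d \<noteq> 0" by (cases y)
  show "fract_subst A (x + y) = fract_subst A x + fract_subst A y"
    "fract_subst A (x * y) = fract_subst A x * fract_subst A y"
    using x y by (simp_all add: fract_subst_Fract[OF AB] subst_form_eq_0_iff[OF AB] subst_form_simps)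
  show "fract_subst A 1 = 1" by (simp add: One_fract_def fract_subst_Fract[OF AB] subst_form_simps)
qed

lemma fract_subst_inverse:
  fixes A B :: "'a::field_char_0 ^ 3 ^ 3"
  assumes "A ** B = mat 1" "B ** A = mat 1"
  shows "fract_subst A (fract_subst B x) = x"
proof -
  obtain a b where x: "x = Fract a b" "b \<noteq> 0" by (cases x)
  then show ?thesis using assms by (simp add: fract_subst_Fract[OF assms(1)] fract_subst_Fract[OF assms(2)] subst_form_simps)
qed

lemma Const_mult_inverse: "c \<noteq> 0 \<Longrightarrow> Const (inverse c) * (Const c * F) = F" for F :: "'a::field_char_0 form"
  by (rule eval_form_inject) simp

text \<open>The inverse substitution also multiplies \<open>F\<close> by a constant, hence both
  directions.\<close>

lemma subst_form_dvd_iff: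
  fixes F :: "'a::field_char_0 form"
  assumes AB: "A ** B = mat 1" "B ** A = mat 1" and F: "subst_form A F = Const c * F" and c: "c \<noteq> 0"
  shows "F dvd subst_form A H \<longleftrightarrow> F dvd H"
proof
  assume "F dvd H"
  then obtain K where "H = F * K" by blast
  then have "subst_form A H = F * (Const c * subst_form A K)" by (simp add: subst_form_simps F mult_ac)
  then show "F dvd subst_form A H" by simp
next
  assume "F dvd subst_form A H"
  then obtain K where "subst_form A H = F * K" by blast
  then have "subst_form B (subst_form A H) = subst_form B F * subst_form B K" by (simp add: subst_form_simps)
  moreover have "subst_form B F = Const (inverse c) * F"
  proof -
    have "subst_form B (Const c * F) = F" unfolding F[symmetric] by (simp add: subst_form_simps AB)
    then have "Const c * subst_form B F = F" by (simp add: subst_form_simps)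
    then show ?thesis using Const_mult_inverse[OF c, of "subst_form B F"] by simp
  qed
  ultimately have "H = F * (Const (inverse c) * subst_form B K)" by (simp add: subst_form_simps AB mult_ac)
  then show "F dvd H" by simp
qed

lemma fract_subst_local_ring:
  fixes F :: "'a::field_char_0 form"
  assumes AB: "A ** B = mat 1" "B ** A = mat 1" and F: "subst_form A F = Const c * F" and c: "c \<noteq> 0"
  shows "fract_subst A ` carrier (local_ring F) \<subseteq> carrier (local_ring F)"
    "fract_subst A ` curve_ideal F \<subseteq> curve_ideal F"
  unfolding local_ring_def curve_ideal_def
  using homogeneous_subst_form subst_form_dvd_iff[OF assms]
  by (auto simp: fract_subst_Fract[OF AB(1)]) blast+

lemma coset_image:
  assumes "\<And>x y. \<phi> (x + y) = \<phi> x + \<phi> y" "\<phi> ` curve_ideal F = curve_ideal F"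
  shows "\<phi> ` (curve_ideal F +>\<^bsub>local_ring F\<^esub> x) = curve_ideal F +>\<^bsub>local_ring F\<^esub> \<phi> x"
proof -
  have coset: "curve_ideal F +>\<^bsub>local_ring F\<^esub> x = (\<lambda>h. h + x) ` curve_ideal F" for x
    unfolding a_r_coset_def r_coset_def by (auto simp: local_ring_def)
  have "\<phi> ` (\<lambda>h. h + x) ` curve_ideal F = (\<lambda>h. h + \<phi> x) ` \<phi> ` curve_ideal F"
    by (simp add: image_image assms(1))
  then show ?thesis unfolding coset assms(2) .
qed

text \<open>The substitution preserves divisibility by \<open>F\<close>, hence the local ring and
  its ideal; the inverse matrix turns the inclusions into equalities, so that cosets go to
  cosets.\<close>

lemma subst_ring_iso:
  fixes F :: "'a::field_char_0 form"
  assumes AB: "A ** B = mat 1" "B ** A = mat 1" and F: "subst_form A F = Const c * F" and c: "c \<noteq> 0"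
  shows "(\<lambda>X. fract_subst A ` X) \<in> ring_iso (function_field F) (function_field F)"
    and "fract_subst A ` rat_fun F G H = rat_fun F (subst_form A G) (subst_form A H)"
proof -
  have FB: "subst_form B F = Const (inverse c) * F"
  proof -
    have "subst_form B (Const c * F) = F" unfolding F[symmetric] by (simp add: subst_form_simps AB)
    then have "Const c * subst_form B F = F" by (simp add: subst_form_simps)
    then show ?thesis using Const_mult_inverse[OF c, of "subst_form B F"] by simp
  qed
  note subA = fract_subst_local_ring[OF AB F c]
  note subB = fract_subst_local_ring[OF AB(2,1) FB]
  have AiB: "fract_subst A ` fract_subst B ` X = X" "fract_subst B ` fract_subst A ` X = X" for X
    by (simp_all add: image_image fract_subst_inverse AB)
  have c': "inverse c \<noteq> 0" using c by simp
  have IA: "fract_subst A ` curve_ideal F = curve_ideal F"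
    using subA(2) subB(2)[OF c'] AiB by (metis image_mono subset_antisym)
  have IB: "fract_subst B ` curve_ideal F = curve_ideal F" using IA AiB by metis
  note cosA = coset_image[OF fract_subst_hom(1)[OF AB(1)] IA]
  note cosB = coset_image[OF fract_subst_hom(1)[OF AB(2)] IB]
  show "fract_subst A ` rat_fun F G H = rat_fun F (subst_form A G) (subst_form A H)"
    unfolding rat_fun_def cosA by (simp add: fract_subst_Fract[OF AB(1)])
  have carr: "carrier (function_field F) = {curve_ideal F +>\<^bsub>local_ring F\<^esub> x | x. x \<in> carrier (local_ring F)}"
    unfolding function_field_def FactRing_def A_RCOSETS_def' by auto
  have clA: "fract_subst A ` X \<in> carrier (function_field F)" if "X \<in> carrier (function_field F)" for X
  proof -
    obtain x where x: "x \<in> carrier (local_ring F)" "X = curve_ideal F +>\<^bsub>local_ring F\<^esub> x"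
      using \<open>X \<in> carrier (function_field F)\<close> unfolding carr by blast
    then have "fract_subst A x \<in> carrier (local_ring F)" using subA(1) by blast
    then show ?thesis unfolding x(2) cosA carr by blast
  qed
  have clB: "fract_subst B ` X \<in> carrier (function_field F)" if "X \<in> carrier (function_field F)" for X
  proof -
    obtain x where x: "x \<in> carrier (local_ring F)" "X = curve_ideal F +>\<^bsub>local_ring F\<^esub> x"
      using \<open>X \<in> carrier (function_field F)\<close> unfolding carr by blast
    then have "fract_subst B x \<in> carrier (local_ring F)" using subB(1)[OF c'] by blast
    then show ?thesis unfolding x(2) cosB carr by blast
  qed
  show "(\<lambda>X. fract_subst A ` X) \<in> ring_iso (function_field F) (function_field F)"
  proof (rule ring_iso_memI)
    fix X Y
    have "fract_subst A ` rcoset_mult (local_ring F) (curve_ideal F) X Y =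
        rcoset_mult (local_ring F) (curve_ideal F) (fract_subst A ` X) (fract_subst A ` Y)"
    proof -
      have m: "x \<otimes>\<^bsub>local_ring F\<^esub> y = x * y" for x y by (simp add: local_ring_def)
      show ?thesis unfolding rcoset_mult_def m
        by (simp add: image_UN cosA fract_subst_hom[OF AB(1)])
    qed
    then show "fract_subst A ` (X \<otimes>\<^bsub>function_field F\<^esub> Y) = fract_subst A ` X \<otimes>\<^bsub>function_field F\<^esub> fract_subst A ` Y"
      by (simp add: function_field_def FactRing_def)
    have "fract_subst A ` (X <+>\<^bsub>local_ring F\<^esub> Y) = fract_subst A ` X <+>\<^bsub>local_ring F\<^esub> fract_subst A ` Y"
    proof -
      have m: "x \<oplus>\<^bsub>local_ring F\<^esub> y = x + y" for x y by (simp add: local_ring_def)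
      show ?thesis unfolding set_add_def' m
        by (simp add: image_UN fract_subst_hom[OF AB(1)])
    qed
    then show "fract_subst A ` (X \<oplus>\<^bsub>function_field F\<^esub> Y) = fract_subst A ` X \<oplus>\<^bsub>function_field F\<^esub> fract_subst A ` Y"
      by (simp add: function_field_def FactRing_def)
  next
    show "fract_subst A ` \<one>\<^bsub>function_field F\<^esub> = \<one>\<^bsub>function_field F\<^esub>"
      by (simp add: function_field_def FactRing_def cosA) (simp add: local_ring_def fract_subst_hom[OF AB(1)])
  next
    show "bij_betw (\<lambda>X. fract_subst A ` X) (carrier (function_field F)) (carrier (function_field F))"
      using clA clB AiB by (intro bij_betw_byWitness[where f' = "\<lambda>X. fract_subst B ` X"]) auto
  qed (rule clA)
qed

text \<open>If a and b vanish at p, then a o A and b o A vanish at q. So the induced automorphism of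
  the function field maps the subfield of the projection from p onto that of the projection from
  q.\<close>

lemma outer_galois_transport:
  fixes F :: "'a::field_char_0 form"
  assumes A: "invertible A" and F: "subst_form A F = Const c * F" and c: "c \<noteq> 0"
    and p: "outer_galois F p" and q: "A *v q = p"
  shows "outer_galois F q"
proof -
  obtain B where AB: "A ** B = mat 1" "B ** A = mat 1" using A unfolding invertible_def by blast
  let ?E = "function_field F" and ?\<Psi> = "\<lambda>X. fract_subst A ` X"
  obtain a b where p0: "p \<noteq> 0" "eval_form F p \<noteq> 0" and ind: "\<forall>r s. r *s a + s *s b = 0 \<longrightarrow> r = 0 \<and> s = 0"
    and ab: "eval_form (lin_form a) p = 0" "eval_form (lin_form b) p = 0"
    and gal: "galois_extension ?E (generate_field ?E
       (insert (rat_fun F (lin_form a) (lin_form b)) (range (\<lambda>c. rat_fun F (Const c) 1))))"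
    using p unfolding outer_galois_def by blast
  define S where "S = insert (rat_fun F (lin_form a) (lin_form b)) (range (\<lambda>c. rat_fun F (Const c) 1))"
  note \<Psi> = subst_ring_iso[OF AB F c]
  have E: "field ?E" and sub: "subfield (generate_field ?E S) ?E"
    using gal unfolding galois_extension_def S_def by blast+
  have "S \<subseteq> generate_field ?E S" by (intro subsetI generate_field.incl)
  then have S: "S \<subseteq> carrier ?E" using subfieldE(3)[OF sub] by (rule order_trans)
  have "?\<Psi> ` S = insert (rat_fun F (lin_form (transpose A *v a)) (lin_form (transpose A *v b))) (range (\<lambda>c. rat_fun F (Const c) 1))"
    unfolding S_def by (simp add: \<Psi>(2) subst_form_simps image_image)
  then have "galois_extension ?E (generate_field ?E
      (insert (rat_fun F (lin_form (transpose A *v a)) (lin_form (transpose A *v b))) (range (\<lambda>c. rat_fun F (Const c) 1))))"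
    using galois_extension_image[OF gal \<Psi>(1)] generate_field_image[OF E \<Psi>(1) S] unfolding S_def by simp
  moreover have "eval_form (lin_form (transpose A *v x)) q = eval_form (lin_form x) p" for x
    using eval_subst_form[of A "lin_form x" q] q by (simp only: subst_form_simps)
  moreover have "\<forall>r s. r *s (transpose A *v a) + s *s (transpose A *v b) = 0 \<longrightarrow> r = 0 \<and> s = 0"
  proof (intro allI impI)
    fix r s assume "r *s (transpose A *v a) + s *s (transpose A *v b) = 0"
    then have "transpose A *v (r *s a + s *s b) = 0" by (simp add: matrix_vector_right_distrib vec.scale)
    moreover have "transpose B ** transpose A = mat 1"
      unfolding matrix_transpose_mul[symmetric] AB transpose_mat ..
    then have "transpose B *v (transpose A *v x) = x" for x
      by (simp only: matrix_vector_mul_assoc matrix_vector_mul_lid)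
    ultimately have "r *s a + s *s b = 0" by (metis matrix_vector_mult_0_right)
    then show "r = 0 \<and> s = 0" using ind by blast
  qed
  moreover have "q \<noteq> 0" using p0(1) q by auto
  moreover have "eval_form F q \<noteq> 0"
    using arg_cong[OF F, of "\<lambda>G. eval_form G q"] p0(2) q by auto
  ultimately show ?thesis unfolding outer_galois_def using ab
    by (intro conjI exI[of _ "transpose A *v a"] exI[of _ "transpose A *v b"]) simp_all
qed

section \<open>Curves with a unique outer Galois point\<close>

lemma nth_root_exists: "n > 0 \<Longrightarrow> \<exists>x. x ^ n = (c :: 'a::alg_closed_field)"
proof -
  assume n: "n > 0"
  obtain x where x: "(\<Sum>k\<le>n. (if k = 0 then - c else if k = n then 1 else 0) * x ^ k) = 0"
    using alg_closed[of n "\<lambda>k. if k = 0 then - c else if k = n then 1 else 0"] n by auto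
  have "(\<Sum>k\<le>n. (if k = 0 then - c else if k = n then 1 else 0) * x ^ k) =
      (\<Sum>k\<le>n. (if k = 0 then - c else 0) + (if k = n then x ^ n else 0))"
    using n by (intro sum.cong) auto
  also have "\<dots> = x ^ n - c" by (simp add: sum.distrib)
  finally show ?thesis using x by auto
qed

lemma roots_of_unity_inj:
  assumes "compatible_roots_of_unity \<zeta>" "n > 0" shows "inj_on (\<lambda>k. \<zeta> n ^ k) {..<n}"
proof (rule linorder_inj_onI)
  fix j k assume jk: "j < k" "j \<in> {..<n}" "k \<in> {..<n}"
  have z: "\<zeta> n ^ n = 1" "\<And>k. 0 < k \<Longrightarrow> k < n \<Longrightarrow> \<zeta> n ^ k \<noteq> 1"
    using assms unfolding compatible_roots_of_unity_def by blast+
  have "\<zeta> n \<noteq> 0" using z(1) assms(2) by (metis power_0_left not_gr_zero zero_neq_one)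
  show "\<zeta> n ^ j \<noteq> \<zeta> n ^ k"
  proof
    assume "\<zeta> n ^ j = \<zeta> n ^ k"
    then have "\<zeta> n ^ (k - j) = 1" using jk(1) \<open>\<zeta> n \<noteq> 0\<close> by (simp add: power_diff)
    then show False using z(2)[of "k - j"] jk by (simp add: less_imp_diff_less)
  qed
qed auto

text \<open>The right-hand side has derivative 0 at z = 0 because n is at least 2; the left-hand
  side has derivative n a r^(n-1).\<close>

lemma shifted_power_eq:
  fixes r a c m :: "'a::field_char_0"
  assumes "\<And>z. (r + a * z) ^ n = c * z ^ n + m" "a \<noteq> 0" "n \<ge> 2"
  shows "r = 0"
proof -
  have "poly ([:r, a:] ^ n) z = poly (Polynomial.monom c n + [:m:]) z" for z
    using assms(1)[of z] by (simp add: poly_monom mult.commute)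
  then have "[:r, a:] ^ n = Polynomial.monom c n + [:m:]" by (metis poly_eq_poly_eq_iff ext)
  then have "poly (pderiv ([:r, a:] ^ n)) 0 = poly (pderiv (Polynomial.monom c n + [:m:])) 0" by simp
  then have "of_nat n * a * r ^ (n - 1) = 0"
    using assms(3) by (simp add: pderiv_power pderiv_add pderiv_monom pderiv_pCons poly_monom power_0_left)
  then show ?thesis using assms(2,3) by auto
qed

section \<open>Block diagonal matrices\<close>

definition block :: "'a::field ^ 2 ^ 2 \<Rightarrow> 'a \<Rightarrow> 'a ^ 3 ^ 3" where
  "block B a = vector [vector [B $ 1 $ 1, B $ 1 $ 2, 0], vector [B $ 2 $ 1, B $ 2 $ 2, 0], vector [0, 0, a]]"

lemma block_nth [simp]:
  "block B a $ 1 $ 1 = B $ 1 $ 1" "block B a $ 1 $ 2 = B $ 1 $ 2" "block B a $ 1 $ 3 = 0"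
  "block B a $ 2 $ 1 = B $ 2 $ 1" "block B a $ 2 $ 2 = B $ 2 $ 2" "block B a $ 2 $ 3 = 0"
  "block B a $ 3 $ 1 = 0" "block B a $ 3 $ 2 = 0" "block B a $ 3 $ 3 = a"
  by (simp_all add: block_def)

definition xy :: "'a::zero ^ 3 \<Rightarrow> 'a ^ 2" where
  "xy v = vector [v $ 1, v $ 2]"

lemma xy_nth [simp]: "xy v $ 1 = v $ 1" "xy v $ 2 = v $ 2"
  by (simp_all add: xy_def)

lemma block_vec: "xy (block B a *v v) = B *v xy v" "(block B a *v v) $ 3 = a * v $ 3"
  by (simp_all add: vec2_eq_iff matrix_vector_mult_def sum_3 sum_2)

lemma block_mult: "block B a ** block C b = block (B ** C) (a * b)"
  by (simp add: vec3_eq_iff matrix_matrix_mult_def sum_3 sum_2)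

lemma block_scale: "mat c ** block B a = block (mat c ** B) (c * a)"
  by (simp add: vec3_eq_iff)

lemma block_one: "block (mat 1) 1 = mat 1"
  by (simp add: vec3_eq_iff mat_def)

lemma block_eq_iff: "block B a = block C b \<longleftrightarrow> B = C \<and> a = b"
  by (auto simp: vec3_eq_iff vec2_eq_iff)

lemma det_block: "det (block B a) = a * det B"
  by (simp add: det_3 det_2 algebra_simps)

lemma invertible_block: "invertible (block B a) \<longleftrightarrow> invertible B \<and> a \<noteq> 0"
  by (auto simp: invertible_det_nz det_block)

lemma upper_left_block: "upper_left (block B a) = B"
  by (simp add: upper_left_def vec2_eq_iff)

lemma Lambda_block: "Lambda (pgl (block B a)) = pgl B"
  unfolding Lambda_def pgl_eq block_scale by (auto simp: upper_left_block image_iff) (metis upper_left_block)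

lemma block_iff:
  "(\<exists>B a. A = block B a) \<longleftrightarrow> A $ 1 $ 3 = 0 \<and> A $ 2 $ 3 = 0 \<and> A $ 3 $ 1 = 0 \<and> A $ 3 $ 2 = 0"
proof
  assume z: "A $ 1 $ 3 = 0 \<and> A $ 2 $ 3 = 0 \<and> A $ 3 $ 1 = 0 \<and> A $ 3 $ 2 = 0"
  have "A = block (mat2 (A $ 1 $ 1) (A $ 1 $ 2) (A $ 2 $ 1) (A $ 2 $ 2)) (A $ 3 $ 3)"
    using z by (simp add: vec3_eq_iff)
  then show "\<exists>B a. A = block B a" by blast
qed auto

abbreviation (input) e3 :: "'a::field ^ 3" where "e3 \<equiv> vector [0, 0, 1]"

lemma xy_e3: "xy e3 = 0"
  by (simp add: vec2_eq_iff)

lemma mult_e3: "(A *v e3) $ i = A $ i $ 3" for A :: "'a::field ^ 3 ^ 3"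
  by (simp add: matrix_vector_mult_def sum_3)

text \<open>A substitution that fixes the point \<open>(0:0:1)\<close> and turns \<open>Z\<^sup>d + f\<close> into a multiple of
  \<open>Z\<^sup>d + g\<close> is block diagonal: otherwise the coefficient of \<open>Z\<^bsup>d-1\<^esup>\<close> does not vanish.\<close>

lemma block_of_substitution:
  fixes A :: "'a::field_char_0 ^ 3 ^ 3"
  assumes A: "invertible A" "A $ 1 $ 3 = 0" "A $ 2 $ 3 = 0" and d: "d \<ge> 2"
    and f: "bform d f" and g: "bform d g"
    and eq: "\<And>v. (A *v v) $ 3 ^ d + f (xy (A *v v)) = c * (v $ 3 ^ d + g (xy v))"
  shows "\<exists>B a. A = block B a \<and> invertible B \<and> a \<noteq> 0 \<and> c = a ^ d \<and> (\<forall>v. f (B *v v) = c * g v)"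
proof -
  have z0: "h 0 = 0" if "bform d h" for h :: "'a ^ 2 \<Rightarrow> 'a"
    using bform_homogeneous[OF that, of 0 0] d by (simp add: power_0_left)
  have a: "A $ 3 $ 3 \<noteq> 0"
  proof
    assume "A $ 3 $ 3 = 0"
    then have "A *v e3 = 0" using A(2,3) by (simp add: vec3_eq_iff mult_e3)
    then show False using A(1) invertible_mult_vec_eq_0[of A e3] by (simp add: vec3_eq_iff)
  qed
  have xyA: "xy (A *v v) = mat2 (A $ 1 $ 1) (A $ 1 $ 2) (A $ 2 $ 1) (A $ 2 $ 2) *v xy v" for v
    using A(2,3) by (simp add: vec2_eq_iff mat2_vec) (simp add: matrix_vector_mult_def sum_3)
  have "A $ 3 $ 1 * x + A $ 3 $ 2 * y = 0" for x y
  proof (rule shifted_power_eq[OF _ a d])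
    fix z
    have "(A *v vector [x, y, z]) $ 3 = A $ 3 $ 1 * x + A $ 3 $ 2 * y + A $ 3 $ 3 * z"
      by (simp add: matrix_vector_mult_def sum_3)
    moreover have "xy (vector [x, y, z]) = vector [x, y]" by (simp add: vec2_eq_iff)
    ultimately show "(A $ 3 $ 1 * x + A $ 3 $ 2 * y + A $ 3 $ 3 * z) ^ d = c * z ^ d + (c * g (vector [x, y]) -
        f (mat2 (A $ 1 $ 1) (A $ 1 $ 2) (A $ 2 $ 1) (A $ 2 $ 2) *v vector [x, y]))"
      using eq[of "vector [x, y, z]"] unfolding xyA by (simp add: algebra_simps)
  qed
  from this[of 1 0] this[of 0 1] have "A $ 3 $ 1 = 0" "A $ 3 $ 2 = 0" by simp_all
  then obtain B b where AB: "A = block B b" using block_iff A(2,3) by blast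
  have "b ^ d = c" using eq[of e3] z0[OF f] z0[OF g] unfolding AB block_vec xy_e3 by simp
  moreover have "f (B *v v) = c * g v" for v
  proof -
    have "xy (vector [v $ 1, v $ 2, 0]) = v" by (simp add: vec2_eq_iff)
    then show ?thesis using eq[of "vector [v $ 1, v $ 2, 0]"] d by (simp add: AB block_vec power_0_left)
  qed
  ultimately show ?thesis using AB A(1) invertible_block by metis
qed

section \<open>Automorphisms of a curve with a unique outer Galois point\<close>

locale unique_galois_curve =
  fixes d :: nat and L :: "'a::{alg_closed_field,field_char_0} form" and \<zeta> :: "nat \<Rightarrow> 'a"
  assumes d4: "d \<ge> 4" and bin: "binary_form d L" and smooth: "smooth_plane_curve d (Var 3 ^ d + L)"
    and unique: "outer_galois_points (Var 3 ^ d + L) = {proj_point (vector [0, 0, 1])}"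
    and comp: "compatible_roots_of_unity \<zeta>"
begin

abbreviation F where "F \<equiv> Var 3 ^ d + L"
abbreviation f where "f \<equiv> restr L"

lemma bform_f: "bform d f" using bform_restr[OF bin] .
lemma sqfree_f: "sqfree f" using smooth_sqfree[OF _ bin smooth] d4 by simp

lemma eval_F: "eval_form F v = v $ 3 ^ d + f (xy v)"
  by (simp add: eval_binary_restr[OF bin, of v] xy_def)

lemma eval_F_homogeneous: "eval_form F (t *s v) = t ^ d * eval_form F v"
proof -
  have "xy (t *s v) = t *s xy v" by (simp add: vec2_eq_iff)
  then show ?thesis using bform_homogeneous[OF bform_f] unfolding eval_F by (simp add: power_mult_distrib distrib_left)
qed

text \<open>The preimage of a Galois point under a symmetry of the equation is a Galois point. By
  uniqueness both are (0:0:1), which clears the first two entries of the third column.\<close>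

lemma substitution_block:
  assumes A: "invertible A" and c: "c \<noteq> 0" and eq: "\<And>v. eval_form F (A *v v) = c * eval_form F v"
  shows "\<exists>B a. A = block B a \<and> invertible B \<and> a \<noteq> 0 \<and> (\<forall>v. f (B *v v) = a ^ d * f v)"
proof -
  have S: "subst_form A F = Const c * F" by (rule eval_form_inject) (simp only: eval_subst_form eval_form_mult eval_form_Const eq)
  have pp: "\<exists>c. c \<noteq> 0 \<and> q = c *s e3" if "outer_galois F q" for q
  proof -
    have "proj_point q = proj_point e3"
      using unique \<open>outer_galois F q\<close> unfolding outer_galois_points_def by blast
    moreover have "q \<in> proj_point q" unfolding proj_point_def by (auto intro!: exI[of _ 1])
    ultimately show ?thesis unfolding proj_point_def by auto
  qed
  obtain p where p: "outer_galois F p"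
    using unique unfolding outer_galois_points_def by blast
  obtain k where k: "k \<noteq> 0" "p = k *s e3" using pp[OF p] by blast
  obtain B where B: "A ** B = mat 1" using A unfolding invertible_def by blast
  define q where "q = B *v p"
  have q: "A *v q = p" by (simp add: q_def matrix_vector_mul_assoc B)
  obtain l where l: "l \<noteq> 0" "q = l *s e3" using pp[OF outer_galois_transport[OF A S c p q]] by blast
  have "l *s (A *v e3) = k *s e3" using q unfolding l(2) k(2) by (simp add: vec.scale)
  then have "l * A $ 1 $ 3 = 0" "l * A $ 2 $ 3 = 0" by (simp_all add: vec3_eq_iff mult_e3)
  then have A0: "A $ 1 $ 3 = 0" "A $ 2 $ 3 = 0" using l(1) by simp_all
  show ?thesis
    using block_of_substitution[OF A A0 _ bform_f bform_f eq[unfolded eval_F]] d4 by auto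
qed

text \<open>A Nullstellensatz for this equation, proved on lines through (0:0:1). Along (tx, ty, 1)
  the equation is 1 + f(x,y) t^d, with d distinct roots when f(x,y) is not 0. All of them are roots
  of F o A, so F o A - c F vanishes at these and at t = 0, too often for its degree.\<close>

lemma cone_substitution:
  assumes A: "invertible A" and cone: "(\<lambda>v. A *v v) ` curve_cone F = curve_cone F"
  shows "\<exists>c. c \<noteq> 0 \<and> (\<forall>v. eval_form F (A *v v) = c * eval_form F v)"
proof -
  \<comment> \<open>The only possible factor, since F has the value 1 at (0,0,1).\<close>
  define c where "c = eval_form F (A *v e3)"
  obtain b where b: "\<And>v. f v = (\<Sum>i\<le>d. b i * v $ 1 ^ i * v $ 2 ^ (d - i))"
    using bform_f unfolding bform_def by blast
  have aff: "eval_form F (A *v vector [x, y, 1]) = c * eval_form F (vector [x, y, 1])" if l: "f (vector [x, y]) \<noteq> 0" for x y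
  proof -
    define ell where "ell = f (vector [x, y])"
    define u where "u i = A $ i $ 1 * x + A $ i $ 2 * y" for i
    define w where "w i = A $ i $ 3" for i
    define P where "P = [:w 3, u 3:] ^ d + (\<Sum>i\<le>d. Polynomial.smult (b i) ([:w 1, u 1:] ^ i * [:w 2, u 2:] ^ (d - i)))"
    define R where "R = P - Polynomial.smult c (1 + Polynomial.monom ell d)"
    have xyv: "xy (vector [t * x, t * y, 1]) = t *s vector [x, y]" for t by (simp add: vec2_eq_iff)
    have Av: "(A *v vector [t * x, t * y, 1]) $ i = w i + t * u i" for t i
      by (simp add: matrix_vector_mult_def sum_3 u_def w_def algebra_simps)
    have evP: "poly P t = eval_form F (A *v vector [t * x, t * y, 1])" for t
      unfolding eval_F b xy_nth Av P_def by (simp add: poly_sum mult.assoc)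
    have evG: "eval_form F (vector [t * x, t * y, 1]) = 1 + ell * t ^ d" for t
      unfolding eval_F xyv using bform_homogeneous[OF bform_f] by (simp add: ell_def)
    have evR: "poly R t = eval_form F (A *v vector [t * x, t * y, 1]) - c * eval_form F (vector [t * x, t * y, 1])" for t
      unfolding R_def evG by (simp add: evP poly_monom)
    have lin: "degree ([:p, q:] ^ n) \<le> n" for p q :: 'a and n
    proof -
      have "degree [:p, q:] * n \<le> 1 * n" by (intro mult_le_mono1) simp
      then show ?thesis using order_trans[OF degree_power_le[of "[:p, q:]" n]] by (simp only: mult_1)
    qed
    have "degree P \<le> d"
      unfolding P_def
    proof (intro degree_add_le degree_sum_le)
      fix i assume "i \<in> {..d}"
      have "degree ([:w 1, u 1:] ^ i * [:w 2, u 2:] ^ (d - i)) \<le> i + (d - i)"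
        using degree_mult_le[of "[:w 1, u 1:] ^ i" "[:w 2, u 2:] ^ (d - i)"] lin[of "w 1" "u 1" i] lin[of "w 2" "u 2" "d - i"] by linarith
      then show "degree (Polynomial.smult (b i) ([:w 1, u 1:] ^ i * [:w 2, u 2:] ^ (d - i))) \<le> d"
        using \<open>i \<in> {..d}\<close> degree_smult_le le_trans by fastforce
    qed (use lin in auto)
    moreover have "degree (Polynomial.smult c (1 + Polynomial.monom ell d)) \<le> d"
      by (intro order_trans[OF degree_smult_le] degree_add_le) (auto simp: degree_monom_le)
    ultimately have degR: "degree R \<le> d" unfolding R_def by (rule degree_diff_le)
    obtain t0 where t0: "t0 ^ d = - (1 / ell)" using nth_root_exists[of d] d4 by auto
    have ell: "ell \<noteq> 0" using l by (simp add: ell_def)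
    have t00: "t0 \<noteq> 0" using t0 ell d4 by (auto simp: power_0_left)
    have zd: "\<zeta> d ^ d = 1" using comp d4 unfolding compatible_roots_of_unity_def by simp
    then have z0: "\<zeta> d \<noteq> 0" using d4 by (auto simp: power_0_left)
    \<comment> \<open>The d roots of 1 + ell t^d together with 0: one more than the degree of
      \<open>R\<close> allows.\<close>
    define S where "S = insert 0 ((\<lambda>k. t0 * \<zeta> d ^ k) ` {..<d})"
    have "inj_on (\<lambda>k. t0 * \<zeta> d ^ k) {..<d}"
      using roots_of_unity_inj[OF comp, of d] d4 t00 unfolding inj_on_def by auto
    then have cardS: "card S = Suc d" unfolding S_def using t00 z0 by (subst card_insert_disjoint) (auto simp: card_image)
    have "poly R t = 0" if "t \<in> S" for t
      using that unfolding S_def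
    proof
      assume "t = 0"
      have "eval_form F e3 = 1" using evG[of 0] d4 by (simp add: power_0_left)
      then show ?thesis unfolding evR \<open>t = 0\<close> by (simp add: c_def)
    next
      assume "t \<in> (\<lambda>k. t0 * \<zeta> d ^ k) ` {..<d}"
      then obtain k where "t = t0 * \<zeta> d ^ k" by blast
      then have "t ^ d = t0 ^ d * (\<zeta> d ^ d) ^ k" by (simp add: power_mult_distrib mult.commute flip: power_mult)
      then have "eval_form F (vector [t * x, t * y, 1]) = 0" unfolding evG using t0 zd ell by simp
      moreover from this have "eval_form F (A *v vector [t * x, t * y, 1]) = 0"
      proof -
        assume 0: "eval_form F (vector [t * x, t * y, 1]) = 0"
        have "(vector [t * x, t * y, 1] :: 'a ^ 3) \<noteq> 0" by (simp add: vec3_eq_iff)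
        then have "A *v vector [t * x, t * y, 1] \<in> curve_cone F" using cone 0 unfolding curve_cone_def by blast
        then show ?thesis unfolding curve_cone_def by simp
      qed
      ultimately show ?thesis by (simp add: evR)
    qed
    then have sub: "S \<subseteq> {t. poly R t = 0}" by blast
    have "R = 0"
    proof (rule ccontr)
      assume "R \<noteq> 0"
      then have "card S \<le> degree R"
        using card_mono[OF poly_roots_finite sub] card_poly_roots_bound[of R] by linarith
      then show False using cardS degR by simp
    qed
    then show ?thesis using evR[of 1] by simp
  qed
  have gen: "eval_form F (A *v v) = c * eval_form F v" if v: "v $ 3 \<noteq> 0" "f (xy v) \<noteq> 0" for v
  proof -
    define z where "z = v $ 3"
    define x y where "x = v $ 1 / z" "y = v $ 2 / z"
    have vz: "v = z *s vector [x, y, 1]" using v(1) by (simp add: vec3_eq_iff z_def x_y_def)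
    have "xy v = z *s vector [x, y]" using vz by (simp add: vec2_eq_iff)
    then have "f (vector [x, y]) \<noteq> 0" using v(2) bform_homogeneous[OF bform_f] by auto
    then show ?thesis
      using aff[of x y] unfolding vz vec.scale eval_F_homogeneous by simp
  qed
  \<comment> \<open>So far the identity is known where Z and L do not vanish; it extends because
    forms have no zero divisors.\<close>
  have "Var 3 * (L * (subst_form A F - Const c * F)) = 0"
  proof (rule eval_form_eq_0)
    fix v
    have "eval_form L v = f (xy v)" using eval_binary_restr[OF bin, of v] by (simp add: xy_def)
    then show "eval_form (Var 3 * (L * (subst_form A F - Const c * F))) v = 0"
      using gen[of v] by auto
  qed
  moreover have "Var 3 \<noteq> (0 :: 'a form)" using eval_form_Var[of 3 "e3 :: 'a ^ 3"] by (metis eval_form_0 vector_3(3) zero_neq_one)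
  moreover have "L \<noteq> 0" using sqfree_nonzero[OF sqfree_f] by (auto simp: restr_def)
  ultimately have S: "subst_form A F = Const c * F" by simp
  have ev: "eval_form F (A *v v) = c * eval_form F v" for v
    using arg_cong[OF S, of "\<lambda>G. eval_form G v"] by simp
  have "c \<noteq> 0"
  proof
    assume "c = 0"
    obtain B where B: "A ** B = mat 1" using A unfolding invertible_def by blast
    have "eval_form F e3 = 0" using ev[of "B *v e3"] \<open>c = 0\<close> by (simp add: matrix_vector_mul_assoc B)
    then show False using bform_homogeneous[OF bform_f, of 0 0] d4 unfolding eval_F xy_e3 by (simp add: power_0_left)
  qed
  then show ?thesis using ev by blast
qed

lemma cone_image:
  assumes A: "invertible A" and c: "c \<noteq> 0" and eq: "\<And>v. eval_form F (A *v v) = c * eval_form F v"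
  shows "(\<lambda>v. A *v v) ` curve_cone F = curve_cone F"
proof
  show "(\<lambda>v. A *v v) ` curve_cone F \<subseteq> curve_cone F"
  proof
    fix w assume "w \<in> (\<lambda>v. A *v v) ` curve_cone F"
    then obtain v where v: "w = A *v v" "v \<noteq> 0" "eval_form F v = 0" unfolding curve_cone_def by blast
    have "eval_form F w = c * eval_form F v" unfolding v(1) by (rule eq)
    then have "eval_form F w = 0" unfolding v(3) mult_zero_right .
    moreover have "w \<noteq> 0" unfolding v(1) using v(2) invertible_mult_vec_eq_0[OF A, of v] by simp
    ultimately show "w \<in> curve_cone F" unfolding curve_cone_def by (intro CollectI conjI)
  qed
  show "curve_cone F \<subseteq> (\<lambda>v. A *v v) ` curve_cone F"
  proof
    fix v assume v: "v \<in> curve_cone F"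
    obtain B where B: "A ** B = mat 1" using A unfolding invertible_def by blast
    then have AB: "A *v (B *v v) = v" by (simp add: matrix_vector_mul_assoc)
    have v': "v \<noteq> 0" "eval_form F v = 0" using v unfolding curve_cone_def by blast+
    have "c * eval_form F (B *v v) = 0" using eq[of "B *v v"] v'(2) unfolding AB by (rule subst)
    then have "eval_form F (B *v v) = 0" using c by (metis mult_eq_0_iff)
    moreover have "B *v v \<noteq> 0" using v'(1) AB by (metis matrix_vector_mult_0_right)
    ultimately have "B *v v \<in> curve_cone F" unfolding curve_cone_def by (intro CollectI conjI)
    then show "v \<in> (\<lambda>v. A *v v) ` curve_cone F" using AB by (metis imageI)
  qed
qed

lemma Aut_F: "Aut F = {pgl (block B a) | B a. invertible B \<and> a \<noteq> 0 \<and> (\<forall>v. f (B *v v) = a ^ d * f v)}"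
proof (intro subset_antisym subsetI)
  fix g assume "g \<in> Aut F"
  then obtain A where A: "g = pgl A" "invertible A" "(\<lambda>v. A *v v) ` curve_cone F = curve_cone F"
    unfolding Aut_def carrier_PGL using pgl_self by blast
  obtain c where "c \<noteq> 0" "\<And>v. eval_form F (A *v v) = c * eval_form F v" using cone_substitution[OF A(2,3)] by blast
  then show "g \<in> {pgl (block B a) | B a. invertible B \<and> a \<noteq> 0 \<and> (\<forall>v. f (B *v v) = a ^ d * f v)}"
    using substitution_block[OF A(2)] A(1) by blast
next
  fix g assume "g \<in> {pgl (block B a) | B a. invertible B \<and> a \<noteq> 0 \<and> (\<forall>v. f (B *v v) = a ^ d * f v)}"
  then obtain B a where B: "g = pgl (block B a)" "invertible B" "a \<noteq> 0" "\<And>v. f (B *v v) = a ^ d * f v" by blast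
  have "(\<lambda>v. A *v v) ` curve_cone F = curve_cone F" if "A \<in> g" for A
  proof -
    obtain c where c: "c \<noteq> 0" "A = mat c ** block B a" using \<open>A \<in> g\<close> B(1) unfolding pgl_eq by blast
    show ?thesis
    proof (rule cone_image)
      show "invertible A" using B c by (simp add: invertible_mult_iff invertible_mat invertible_block)
      show "c ^ d * a ^ d \<noteq> 0" using B c by simp
      show "eval_form F (A *v v) = c ^ d * a ^ d * eval_form F v" for v
      proof -
        have "eval_form F (A *v v) = eval_form F (c *s (block B a *v v))"
          unfolding c(2) by (simp flip: matrix_vector_mul_assoc)
        also have "\<dots> = c ^ d * a ^ d * eval_form F v"
          unfolding eval_F_homogeneous unfolding eval_F block_vec B(4) by (simp add: power_mult_distrib algebra_simps)
        finally show ?thesis .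
      qed
    qed
  qed
  then show "g \<in> Aut F" unfolding Aut_def using B by (auto intro!: pgl_in_carrier simp: invertible_block)
qed

text \<open>Every nonzero multiplier of f is a d-th power, so every semi-invariance matrix extends
  to an automorphism of the curve.\<close>

lemma Lambda_Aut: "Lambda ` Aut F = proj_stab f"
proof -
  have "semi_invariant f B \<longleftrightarrow> invertible B \<and> (\<exists>a. a \<noteq> 0 \<and> (\<forall>v. f (B *v v) = a ^ d * f v))" for B
  proof -
    have "\<exists>a. a \<noteq> 0 \<and> c = a ^ d" if "c \<noteq> 0" for c :: 'a
      using nth_root_exists[of d c] d4 that by (metis bot_nat_0.extremum_strict gr_zeroI le_zero_eq numeral_le_iff power_0_left semiring_norm(69) zero_neq_numeral)
    then show ?thesis unfolding semi_invariant_def by (metis power_not_zero)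
  qed
  note semi = this
  show ?thesis
  proof (intro subset_antisym subsetI)
    fix g assume "g \<in> Lambda ` Aut F"
    then obtain B a where "g = Lambda (pgl (block B a))" "invertible B" "a \<noteq> 0" "\<forall>v. f (B *v v) = a ^ d * f v"
      unfolding Aut_F by blast
    then show "g \<in> proj_stab f" using semi[of B] unfolding proj_stab_def Lambda_block by blast
  next
    fix g assume "g \<in> proj_stab f"
    then obtain B a where "g = Lambda (pgl (block B a))" "invertible B" "a \<noteq> 0" "\<forall>v. f (B *v v) = a ^ d * f v"
      using semi unfolding proj_stab_def Lambda_block by blast
    then show "g \<in> Lambda ` Aut F" unfolding Aut_F by blast
  qed
qed

definition aut_of :: "'a ^ 2 ^ 2 \<Rightarrow> ('a ^ 3 ^ 3) set" where
  "aut_of B = pgl (block B 1)"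

text \<open>Normalizing the corner entry to 1 turns the condition f o B = a^d f into plain
  invariance of f.\<close>

lemma Aut_lin_stab: "Aut F = aut_of ` lin_stab f"
proof (intro subset_antisym subsetI)
  fix g assume "g \<in> Aut F"
  then obtain B a where B: "g = pgl (block B a)" "invertible B" "a \<noteq> 0" "\<And>v. f (B *v v) = a ^ d * f v" unfolding Aut_F by blast
  have "f (mat (inverse a) ** B *v v) = f v" for v
    using bform_homogeneous[OF bform_f] B(3,4) by (simp add: power_inverse flip: matrix_vector_mul_assoc)
  then have "mat (inverse a) ** B \<in> lin_stab f"
    using B by (simp add: lin_stab_def invertible_mult_iff invertible_mat)
  moreover have "g = aut_of (mat (inverse a) ** B)"
  proof -
    have "block B a = mat a ** block (mat (inverse a) ** B) 1" using B(3) by (simp add: block_scale)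
    then show ?thesis unfolding B(1) aut_of_def using pgl_scale[OF B(3)] by metis
  qed
  ultimately show "g \<in> aut_of ` lin_stab f" by blast
next
  fix g assume "g \<in> aut_of ` lin_stab f"
  then obtain B where "g = pgl (block B 1)" "invertible B" "\<forall>v. f (B *v v) = 1 ^ d * f v"
    unfolding aut_of_def lin_stab_def by auto
  then show "g \<in> Aut F" unfolding Aut_F using one_neq_zero by blast
qed

end

lemma wedge_mult: "wedge (Q *v v) (Q *v p) = det Q * wedge v p" for Q :: "'a::field ^ 2 ^ 2"
proof -
  obtain a b c d where "Q = mat2 a b c d" by (rule mat2_cases)
  then show ?thesis by (simp add: wedge_def mat2_vec det_mat2 algebra_simps)
qed

lemma sqfree_subst:
  fixes f :: "'a::field ^ 2 \<Rightarrow> 'a"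
  assumes f: "sqfree f" and P: "invertible P" shows "sqfree (\<lambda>v. f (P *v v))"
  unfolding sqfree_def
proof (intro allI impI notI)
  fix p M e assume p: "p \<noteq> 0" and M: "bform e M" and eq: "\<forall>v. f (P *v v) = (wedge v p)\<^sup>2 * M v"
  obtain Q where Q: "P ** Q = mat 1" "Q ** P = mat 1" using P unfolding invertible_def by blast
  have "f v = (wedge v (P *v p))\<^sup>2 * ((det Q)\<^sup>2 * M (Q *v v))" for v
  proof -
    have "f v = (wedge (Q *v v) p)\<^sup>2 * M (Q *v v)"
      using eq[rule_format, of "Q *v v"] by (simp add: matrix_vector_mul_assoc Q)
    also have "wedge (Q *v v) p = det Q * wedge v (P *v p)"
      using wedge_mult[of Q v "P *v p"] by (simp add: matrix_vector_mul_assoc Q)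
    finally show ?thesis by (simp add: power_mult_distrib)
  qed
  moreover have "P *v p \<noteq> 0" using invertible_mult_vec_eq_0[OF P] p by simp
  ultimately show False using sqfreeD[OF f _ bform_scale[OF bform_subst[OF M]]] by blast
qed

lemma semi_invariant_const: "invertible B \<Longrightarrow> semi_invariant (\<lambda>v. k) B"
  unfolding semi_invariant_def by (auto intro!: exI[of _ 1])

lemma semi_invariant_times:
  assumes "semi_invariant f B" "semi_invariant g B" shows "semi_invariant (\<lambda>v. f v * g v) B"
proof -
  obtain a b where "a \<noteq> 0" "b \<noteq> 0" "\<And>v. f (B *v v) = a * f v" "\<And>v. g (B *v v) = b * g v"
    using assms unfolding semi_invariant_def by blast
  then show ?thesis using assms(1) unfolding semi_invariant_def by (auto intro!: exI[of _ "a * b"])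
qed

lemma semi_invariant_power: "semi_invariant f B \<Longrightarrow> semi_invariant (\<lambda>v. f v ^ n) B"
  by (induction n) (auto intro: semi_invariant_const semi_invariant_times semi_invariant_invertible)

lemma semi_invariant_prod:
  "invertible B \<Longrightarrow> finite I \<Longrightarrow> (\<And>i. i \<in> I \<Longrightarrow> semi_invariant (f i) B) \<Longrightarrow> semi_invariant (\<lambda>v. \<Prod>i\<in>I. f i v) B"
  by (rotate_tac, induction I rule: finite_induct) (auto intro: semi_invariant_const semi_invariant_times)

context imaginary_unit
begin

lemma eval_octahedral_form: "eval_form (octahedral_form \<epsilon> \<epsilon>' \<epsilon>'' t a) v = oct_fun \<epsilon> \<epsilon>' \<epsilon>'' t a (xy v)"
proof -
  have "eval_form S6 v = on_vec s6 (xy v)"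
    by (simp add: S6_def on_vec_def s6_def Let_def)
  moreover have "eval_form (S12 (-34)) v = on_vec s12 (xy v)"
    by (simp add: S12_def on_vec_def s12_def Let_def)
  moreover have "eval_form (S8 14) v = on_vec s8 (xy v)"
    by (simp add: S8_def on_vec_def s8_def Let_def)
  moreover have "eval_form (S24 b) v = on_vec (s24 b) (xy v)" for b
    by (simp add: S24_def on_vec_def s24_expand Let_def)
  ultimately show ?thesis by (simp add: octahedral_form_def oct_fun_def)
qed

lemma bform_oct_fun:
  assumes "octahedral_data d \<epsilon> \<epsilon>' \<epsilon>'' t a" shows "bform d (oct_fun \<epsilon> \<epsilon>' \<epsilon>'' t a)"
proof -
  have "bform (\<epsilon> * 6 + \<epsilon>' * 12 + \<epsilon>'' * 8 + card {1..t} * 24) (oct_fun \<epsilon> \<epsilon>' \<epsilon>'' t a)"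
    unfolding oct_fun_def[abs_def]
    by (intro bform_mult bform_power bform_prod bform_s6 bform_s8 bform_s12 bform_s24) simp
  then show ?thesis using assms by (simp add: octahedral_data_def mult.commute)
qed

lemma semi_invariant_oct_fun:
  assumes "B \<in> octset" shows "semi_invariant (oct_fun \<epsilon> \<epsilon>' \<epsilon>'' t a) B"
  unfolding oct_fun_def[abs_def]
  using assms by (intro semi_invariant_times semi_invariant_power semi_invariant_prod octset_s6 octset_s8 octset_s12 octset_s24
      octset_invertible) auto

end

context unique_galois_curve
begin

lemma zeta_power: "0 < n \<Longrightarrow> \<zeta> n ^ n = 1" "0 < k \<Longrightarrow> k < n \<Longrightarrow> \<zeta> n ^ k \<noteq> 1"
  "0 < m \<Longrightarrow> 0 < n \<Longrightarrow> \<zeta> (m * n) ^ m = \<zeta> n"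
  using comp unfolding compatible_roots_of_unity_def by auto

sublocale imaginary_unit "\<zeta> 4"
proof
  have "(\<zeta> 4 ^ 2) ^ 2 = 1" using zeta_power(1)[of 4] by (simp flip: power_mult)
  then have "\<zeta> 4 ^ 2 = 1 \<or> \<zeta> 4 ^ 2 = - 1" by (metis power2_eq_1_iff)
  then show "\<zeta> 4 * \<zeta> 4 = - 1" using zeta_power(2)[of 2 4] by (simp add: power2_eq_square)
qed

text \<open>If the substitution moves \<open>(0:0:1)\<close>, the conjugate of \<open>diag(1,1,\<zeta>\<^sub>d)\<close> is a homology of the
  curve with another center; this makes the curve a Fermat curve, which has automorphisms moving
  the Galois point.\<close>

lemma K_equivalent_forms:
  assumes K: "K_equivalent F (Var 3 ^ d + G)" and G: "\<And>v. eval_form G v = g (xy v)" and g: "bform d g"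
  shows "\<exists>B c. invertible B \<and> c \<noteq> 0 \<and> (\<forall>v. f (B *v v) = c * g v)"
proof -
  obtain A c where A: "invertible A" "c \<noteq> 0" "subst_form A F = Const c * (Var 3 ^ d + G)"
    using K unfolding K_equivalent_def by blast
  have eq: "eval_form F (A *v v) = c * (v $ 3 ^ d + g (xy v))" for v
    using arg_cong[OF A(3), of "\<lambda>G. eval_form G v"] unfolding eval_subst_form by (simp add: G)
  show ?thesis
  proof (cases "A $ 1 $ 3 = 0 \<and> A $ 2 $ 3 = 0")
    case True
    then show ?thesis
      using block_of_substitution[OF A(1) _ _ _ bform_f g eq[unfolded eval_F]] d4 A(2) by force
  next
    case False
    obtain A' where A': "A ** A' = mat 1" "A' ** A = mat 1" using A(1) unfolding invertible_def by blast
    define \<omega> where "\<omega> = \<zeta> d"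
    have \<omega>: "\<omega> ^ d = 1" "\<And>i. 0 < i \<Longrightarrow> i < d \<Longrightarrow> \<omega> ^ i \<noteq> 1" using zeta_power d4 by (auto simp: \<omega>_def)
    have \<omega>1: "\<omega> \<noteq> 1" using \<omega>(2)[of 1] d4 by simp
    \<comment> \<open>The homology diag(1,1,\<omega>) of the second curve, carried over to the
      first.\<close>
    define h where "h = A ** block (mat 1) \<omega> ** A'"
    have "\<omega> \<noteq> 0" using \<omega>(1) d4 by (auto simp: power_0_left)
    then have invh: "invertible h" unfolding h_def using A(1) A'
      by (auto simp: invertible_mult_iff invertible_block invertible_mat) (auto simp: invertible_def)
    have Fh: "eval_form F (h *v v) = 1 * eval_form F v" for v
    proof -
      have "h *v v = A *v (block (mat 1) \<omega> *v (A' *v v))"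
        by (simp add: h_def matrix_vector_mul_assoc matrix_mul_assoc)
      then have "eval_form F (h *v v) = c * ((A' *v v) $ 3 ^ d + g (xy (A' *v v)))"
        unfolding eq block_vec by (simp add: eq block_vec power_mult_distrib \<omega>(1) del: eval_form_add)
      also have "\<dots> = eval_form F (A *v (A' *v v))" unfolding eq ..
      finally show ?thesis by (simp add: matrix_vector_mul_assoc A' del: eval_form_add)
    qed
    obtain B a where B: "h = block B a" "\<And>v. f (B *v v) = a ^ d * f v"
      using substitution_block[OF invh one_neq_zero Fh] by blast
    \<comment> \<open>h - 1 has rank one: (\<omega> - 1) times the third column of A times the third
      row of its inverse.\<close>
    have hij: "h $ i $ j = (mat 1 :: 'a ^ 3 ^ 3) $ i $ j + (\<omega> - 1) * A $ i $ 3 * A' $ 3 $ j" for i j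
    proof -
      have "(mat 1 :: 'a ^ 3 ^ 3) $ i $ j = A $ i $ 1 * A' $ 1 $ j + A $ i $ 2 * A' $ 2 $ j + A $ i $ 3 * A' $ 3 $ j"
        unfolding A'(1)[symmetric] by (simp add: matrix_matrix_mult_def sum_3)
      moreover have "h $ i $ j = A $ i $ 1 * A' $ 1 $ j + A $ i $ 2 * A' $ 2 $ j + A $ i $ 3 * \<omega> * A' $ 3 $ j"
        by (simp add: h_def matrix_matrix_mult_def sum_3 mat_def)
      ultimately show ?thesis by (simp add: algebra_simps)
    qed
    define q1 q2 \<phi>1 \<phi>2 where "q1 = A $ 1 $ 3" "q2 = A $ 2 $ 3" "\<phi>1 = A' $ 3 $ 1" "\<phi>2 = A' $ 3 $ 2"
    note defs = this
    \<comment> \<open>As a symmetry of F, h is block diagonal; since q1 or q2 is nonzero, the corner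
      entry of the inverse matrix vanishes.\<close>
    have "(\<omega> - 1) * q1 * A' $ 3 $ 3 = 0" "(\<omega> - 1) * q2 * A' $ 3 $ 3 = 0"
      using hij[of 1 3] hij[of 2 3] unfolding B(1) by (simp_all add: mat_def defs)
    then have A33: "A' $ 3 $ 3 = 0" using False \<omega>1 by (auto simp: defs)
    have "(A' ** A) $ 3 $ 3 = \<phi>1 * q1 + \<phi>2 * q2 + A' $ 3 $ 3 * A $ 3 $ 3"
      by (simp add: matrix_matrix_mult_def sum_3 defs)
    then have one: "\<phi>1 * q1 + \<phi>2 * q2 = 1" unfolding A'(2) A33 by (simp add: mat_def)
    have a1: "a = 1" using hij[of 3 3] A33 unfolding B(1) by (simp add: mat_def)
    have Bm: "B = mat2 (1 + (\<omega> - 1) * q1 * \<phi>1) ((\<omega> - 1) * q1 * \<phi>2) ((\<omega> - 1) * q2 * \<phi>1) (1 + (\<omega> - 1) * q2 * \<phi>2)"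
      using hij[of 1 1] hij[of 1 2] hij[of 2 1] hij[of 2 2] unfolding B(1) by (simp add: vec2_eq_iff mat_def defs)
    \<comment> \<open>The columns are the centre (q1,q2) of the homology and a vector on its axis;
      they diagonalize B.\<close>
    define P where "P = mat2 q1 (- \<phi>2) q2 \<phi>1"
    define R where "R = mat2 \<phi>1 \<phi>2 (- q2) q1"
    have RP: "R ** P = mat 1" "P ** R = mat 1"
      using one by (simp_all add: P_def R_def mat2_mult mat_mat2 mat2_eq_iff algebra_simps)
    have BP: "B ** P = P ** mat2 \<omega> 0 0 1"
    proof -
      have "(1 + (\<omega> - 1) * q1 * \<phi>1) * q1 + (\<omega> - 1) * q1 * \<phi>2 * q2 = q1 + (\<omega> - 1) * q1 * (\<phi>1 * q1 + \<phi>2 * q2)"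
        "(\<omega> - 1) * q2 * \<phi>1 * q1 + (1 + (\<omega> - 1) * q2 * \<phi>2) * q2 = q2 + (\<omega> - 1) * q2 * (\<phi>1 * q1 + \<phi>2 * q2)"
        by (simp_all add: algebra_simps)
      then show ?thesis unfolding one by (simp add: Bm P_def mat2_mult mat2_eq_iff algebra_simps)
    qed
    obtain m where m: "\<And>v. f (P *v v) = (\<Sum>i\<le>d. m i * v $ 1 ^ i * v $ 2 ^ (d - i))"
      using bform_subst[OF bform_f, of P] unfolding bform_def by blast
    \<comment> \<open>Invariance under X -> \<omega> X kills X^i Y^(d-i) for 0 < i < d, so f becomes
      a binary Fermat form. Both remaining coefficients are nonzero because f is
      square-free.\<close>
    have m0: "m i = 0" if i: "0 < i" "i < d" for i
    proof -
      define p where "p = (\<Sum>i\<le>d. Polynomial.monom (m i * (\<omega> ^ i - 1)) i)"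
      have "poly p x = 0" for x
      proof -
        have "f (P *v (mat2 \<omega> 0 0 1 *v vector [x, 1])) = f (B *v (P *v vector [x, 1]))"
          by (simp add: matrix_vector_mul_assoc BP)
        then have "f (P *v (mat2 \<omega> 0 0 1 *v vector [x, 1])) = f (P *v vector [x, 1])" unfolding B(2) a1 by simp
        then show ?thesis unfolding m mat2_vec
          by (simp add: p_def poly_sum poly_monom power_mult_distrib algebra_simps sum_subtractf)
      qed
      then have "p = 0" by (simp add: poly_all_0_iff_0[symmetric])
      moreover have "poly.coeff p i = m i * (\<omega> ^ i - 1)"
        using i unfolding p_def coeff_sum by (simp add: sum.delta)
      ultimately show ?thesis using \<omega>(2)[OF i] by simp
    qed
    have fP: "f (P *v v) = m 0 * v $ 2 ^ d + m d * v $ 1 ^ d" for v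
    proof -
      have "f (P *v v) = (\<Sum>i\<in>{0, d}. m i * v $ 1 ^ i * v $ 2 ^ (d - i))"
        unfolding m by (rule sum.mono_neutral_right) (use m0 in auto)
      then show ?thesis using d4 by simp
    qed
    have d2: "2 + (d - 2) = d" using d4 by simp
    have pw: "x ^ 2 * (k * x ^ (d - 2)) = k * x ^ d" for x k :: 'a
      by (metis d2 mult.left_commute power_add)
    have fv: "f v = m 0 * (R *v v) $ 2 ^ d + m d * (R *v v) $ 1 ^ d" for v
      using fP[of "R *v v"] by (simp add: matrix_vector_mul_assoc RP)
    have nz: "vector [- \<phi>2, \<phi>1] \<noteq> (0 :: 'a ^ 2)" "vector [q1, q2] \<noteq> (0 :: 'a ^ 2)"
      using one by (auto simp: vec2_eq_iff)
    have "m 0 \<noteq> 0"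
    proof
      assume "m 0 = 0"
      then have "f v = wedge v (vector [- \<phi>2, \<phi>1]) ^ 2 * (m d * wedge v (vector [- \<phi>2, \<phi>1]) ^ (d - 2))" for v
        unfolding pw fv by (simp add: R_def mat2_vec wedge_def algebra_simps)
      then show False using sqfreeD[OF sqfree_f nz(1) bform_scale[OF bform_power[OF bform_wedge]]] by blast
    qed
    have "m d \<noteq> 0"
    proof
      assume "m d = 0"
      then have "f v = wedge v (vector [q1, q2]) ^ 2 * ((m 0 * (- 1) ^ d) * wedge v (vector [q1, q2]) ^ (d - 2))" for v
        unfolding pw fv by (simp add: R_def mat2_vec wedge_def algebra_simps flip: power_mult_distrib)
      then show False using sqfreeD[OF sqfree_f nz(2) bform_scale[OF bform_power[OF bform_wedge]]] by blast
    qed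
    obtain \<alpha> where \<alpha>: "\<alpha> ^ d = m d" using nth_root_exists[of d] d4 by auto
    then have \<alpha>0: "\<alpha> \<noteq> 0" using \<open>m d \<noteq> 0\<close> d4 by (auto simp: power_0_left)
    \<comment> \<open>With \<alpha>^d = m_d the equation is Z^d + (\<alpha> X)^d + m_0 Y^d.
      \<open>S\<close> exchanges Z and \<alpha> X, hence preserves it, but moves (0:0:1).\<close>
    define S where "S = (vector [vector [0, 0, 1 / \<alpha>], vector [0, 1, 0], vector [\<alpha>, 0, 0]] :: 'a ^ 3 ^ 3)"
    have Sv: "(S *v u) $ 1 = u $ 3 / \<alpha>" "(S *v u) $ 2 = u $ 2" "(S *v u) $ 3 = \<alpha> * u $ 1" for u
      by (simp_all add: S_def matrix_vector_mult_def sum_3)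
    define C where "C = block P 1 ** S ** block R 1"
    have invC: "invertible C"
    proof -
      have "det S \<noteq> 0" using \<alpha>0 by (simp add: S_def det_3)
      moreover have "invertible P" "invertible R" using RP by (auto simp: invertible_def)
      ultimately show ?thesis unfolding C_def by (simp add: invertible_mult_iff invertible_block) (simp add: invertible_det_nz)
    qed
    have Cv: "C *v v = block P 1 *v (S *v (block R 1 *v v))" for v by (simp add: C_def matrix_vector_mul_assoc matrix_mul_assoc)
    have "eval_form F (C *v v) = 1 * eval_form F v" for v
    proof -
      define u where "u = block R 1 *v v"
      have "v = block P 1 *v u" by (simp add: u_def matrix_vector_mul_assoc block_mult RP block_one)
      then have v: "xy v = P *v xy u" "v $ 3 = u $ 3" by (simp_all add: block_vec)
      show ?thesis unfolding Cv u_def[symmetric] eval_F block_vec fP v xy_nth Sv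
        using \<alpha>0 by (simp add: power_mult_distrib power_divide \<alpha> \<open>m d \<noteq> 0\<close>)
    qed
    then obtain B' a' where C: "C = block B' a'" using substitution_block[OF invC one_neq_zero] by blast
    have "(C *v e3) $ 1 = q1 / \<alpha>" "(C *v e3) $ 2 = q2 / \<alpha>"
    proof -
      have "block R 1 *v e3 = e3" by (simp add: vec3_eq_iff mult_e3)
      then have "xy (C *v e3) = P *v xy (S *v e3)" unfolding Cv by (simp add: block_vec)
      moreover have "xy (S *v e3) = vector [1 / \<alpha>, 0]" by (simp add: vec2_eq_iff Sv)
      ultimately show "(C *v e3) $ 1 = q1 / \<alpha>" "(C *v e3) $ 2 = q2 / \<alpha>"
        by (simp_all add: P_def mat2_vec flip: xy_nth)
    qed
    then have "q1 = 0" "q2 = 0" using \<alpha>0 unfolding C mult_e3 by simp_all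
    then show ?thesis using one by simp
  qed
qed

lemma oct_good_octahedral:
  assumes data: "octahedral_data d \<epsilon> \<epsilon>' \<epsilon>'' t a" and B: "invertible B" "c \<noteq> 0"
    and eq: "\<And>v. f (B *v v) = c * oct_fun \<epsilon> \<epsilon>' \<epsilon>'' t a v"
  shows "oct_good d (\<lambda>v. f (B *v v))"
proof -
  have "semi_invariant (\<lambda>v. c * oct_fun \<epsilon> \<epsilon>' \<epsilon>'' t a v) C" if "C \<in> octset" for C
    by (intro semi_invariant_times semi_invariant_const semi_invariant_oct_fun octset_invertible that)
  then show ?thesis
    using bform_subst[OF bform_f, of B] sqfree_subst[OF sqfree_f B(1)] unfolding oct_good_def eq by blast
qed

lemma proj_stab_oct_good:
  assumes "oct_good d g" shows "proj_stab g = octgroup"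
  using octset_maximal[OF assms] assms d4 unfolding proj_stab_def octgroup_def oct_good_def by auto

theorem Aut_red_iff:
  "Aut_red_group F \<cong> sym_group 4 \<longleftrightarrow>
    (\<exists>\<epsilon> \<epsilon>' \<epsilon>'' t a. octahedral_data d \<epsilon> \<epsilon>' \<epsilon>'' t a \<and>
      K_equivalent F (Var 3 ^ d + octahedral_form \<epsilon> \<epsilon>' \<epsilon>'' t a))"
  unfolding Lambda_Aut
proof
  assume "PGL\<lparr>carrier := proj_stab f\<rparr> \<cong> sym_group 4"
  then obtain P where P: "invertible P" "\<forall>B\<in>octset. semi_invariant (\<lambda>v. f (P *v v)) B"
    using S4_conjugate[OF bform_f] by blast
  then have "oct_good d (\<lambda>v. f (P *v v))"
    unfolding oct_good_def using bform_subst[OF bform_f] sqfree_subst[OF sqfree_f P(1)] by blast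
  then obtain \<epsilon> \<epsilon>' \<epsilon>'' t a k where k: "k \<noteq> 0" "octahedral_data d \<epsilon> \<epsilon>' \<epsilon>'' t a"
    "\<forall>v. f (P *v v) = k * oct_fun \<epsilon> \<epsilon>' \<epsilon>'' t a v"
    using oct_decomposition by blast
  \<comment> \<open>The constant k is absorbed by rescaling Z, which is possible over an
    algebraically closed field.\<close>
  obtain b where b: "b ^ d = k" using nth_root_exists[of d] d4 by auto
  then have "b \<noteq> 0" using k(1) d4 by (auto simp: power_0_left)
  have "subst_form (block P b) F = Const k * (Var 3 ^ d + octahedral_form \<epsilon> \<epsilon>' \<epsilon>'' t a)"
  proof (rule eval_form_inject)
    fix v
    show "eval_form (subst_form (block P b) F) v = eval_form (Const k * (Var 3 ^ d + octahedral_form \<epsilon> \<epsilon>' \<epsilon>'' t a)) v"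
      unfolding eval_subst_form eval_F block_vec
      by (simp add: eval_octahedral_form k(3) b power_mult_distrib distrib_left)
  qed
  then have "K_equivalent F (Var 3 ^ d + octahedral_form \<epsilon> \<epsilon>' \<epsilon>'' t a)"
    unfolding K_equivalent_def using P(1) \<open>b \<noteq> 0\<close> k(1) invertible_block by blast
  then show "\<exists>\<epsilon> \<epsilon>' \<epsilon>'' t a. octahedral_data d \<epsilon> \<epsilon>' \<epsilon>'' t a \<and>
      K_equivalent F (Var 3 ^ d + octahedral_form \<epsilon> \<epsilon>' \<epsilon>'' t a)" using k(2) by blast
next
  assume "\<exists>\<epsilon> \<epsilon>' \<epsilon>'' t a. octahedral_data d \<epsilon> \<epsilon>' \<epsilon>'' t a \<and>
      K_equivalent F (Var 3 ^ d + octahedral_form \<epsilon> \<epsilon>' \<epsilon>'' t a)"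
  then obtain \<epsilon> \<epsilon>' \<epsilon>'' t a where o: "octahedral_data d \<epsilon> \<epsilon>' \<epsilon>'' t a"
      "K_equivalent F (Var 3 ^ d + octahedral_form \<epsilon> \<epsilon>' \<epsilon>'' t a)" by blast
  obtain B c where B: "invertible B" "c \<noteq> 0" "\<forall>v. f (B *v v) = c * oct_fun \<epsilon> \<epsilon>' \<epsilon>'' t a v"
    using K_equivalent_forms[OF o(2) eval_octahedral_form bform_oct_fun[OF o(1)]] by blast
  obtain C where C: "B ** C = mat 1" "C ** B = mat 1" using B(1) unfolding invertible_def by blast
  have "proj_stab (\<lambda>v. f (B *v v)) = octgroup"
    using proj_stab_oct_good[OF oct_good_octahedral[OF o(1) B(1,2)]] B(3) by blast
  then show "PGL\<lparr>carrier := proj_stab f\<rparr> \<cong> sym_group 4"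
    using iso_trans[OF proj_stab_conj_iso[OF C, of f]] octgroup_iso by simp
qed

end

section \<open>The automorphism group of an octahedral curve\<close>

locale octahedral_curve = unique_galois_curve +
  fixes \<epsilon> \<epsilon>' \<epsilon>'' t :: nat and a :: "nat \<Rightarrow> 'a" and s :: 'a
  assumes data: "octahedral_data d \<epsilon> \<epsilon>' \<epsilon>'' t a" and L: "L = octahedral_form \<epsilon> \<epsilon>' \<epsilon>'' t a" and s2: "s ^ 2 = 2"
begin

abbreviation i where "i \<equiv> \<zeta> 4"

text \<open>This is d/2: the exponent of the determinant by which a form of degree d is
  multiplied.\<close>

definition half where "half = 3 * \<epsilon> + 6 * \<epsilon>' + 4 * \<epsilon>'' + 12 * t"

lemma d_half: "d = 2 * half"
  using data by (simp add: octahedral_data_def half_def)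

lemma half_pos: "half > 0" using d4 d_half by simp

lemma eps: "\<epsilon> = 0 \<or> \<epsilon> = 1" "\<epsilon>' = 0 \<or> \<epsilon>' = 1" "\<epsilon>'' = 0 \<or> \<epsilon>'' = 1"
  using data by (auto simp: octahedral_data_def)

lemma f_oct: "f = oct_fun \<epsilon> \<epsilon>' \<epsilon>'' t a"
proof
  fix v :: "'a ^ 2"
  have "xy (vector [v $ 1, v $ 2, 0]) = v" by (simp add: vec2_eq_iff)
  then show "f v = oct_fun \<epsilon> \<epsilon>' \<epsilon>'' t a v" unfolding restr_def L by (simp add: eval_octahedral_form)
qed

text \<open>The multiplier of f under \<open>qmat q\<close>. The sign enters once for each of the
  factors S6 and S12.\<close>

definition \<kappa> :: "quat \<Rightarrow> 'a" where
  "\<kappa> q = oct_sign q ^ (\<epsilon> + \<epsilon>') * of_int (qnorm q) ^ half"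

lemma f_qmat:
  assumes "q \<in> OQ" shows "f (qmat q *v v) = \<kappa> q * f v"
proof -
  note ch = oct_char_qmat[OF assms, unfolded oct_char_def, rule_format]
  have "oct_sign q ^ 4 = 1" by (simp add: oct_sign_def)
  then have 24: "on_vec (s24 b) (qmat q *v v) = det (qmat q) ^ 12 * on_vec (s24 b) v" for b v
    using ch[of v]
    by (simp add: on_vec_def s24_def power_mult_distrib distrib_left mult.left_commute flip: power_mult)
  have "(x ^ n) ^ k = x ^ (n * k)" for x :: 'a and n k by (simp only: power_mult)
  then show ?thesis
    unfolding f_oct oct_fun_def
    by (simp add: ch 24 prod.distrib power_mult_distrib \<kappa>_def half_def det_qmat power_add mult.commute mult.left_commute)
qed

lemma chi_nonzero: "q \<in> OQ \<Longrightarrow> \<kappa> q \<noteq> 0"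
  using OQ_norm[of q] by (auto simp: \<kappa>_def oct_sign_def)

lemma oct_good_f: "oct_good d f"
  using oct_good_octahedral[OF data, of "mat 1" 1] by (simp add: f_oct invertible_mat)

lemma semi_invariant_octset: "semi_invariant f B \<Longrightarrow> B \<in> octset"
  using octset_maximal[OF oct_good_f] d4 by simp

definition oct_aut :: "quat \<Rightarrow> 'a \<Rightarrow> ('a ^ 3 ^ 3) set" where
  "oct_aut q c = pgl (block (qmat q) c)"

lemma pgl_block_scale: "k \<noteq> 0 \<Longrightarrow> pgl (block (mat k ** B) c) = pgl (block B (c / k))"
  using pgl_scale[of k "block B (c / k)"] by (simp add: block_scale)

lemma pgl_block_octset:
  assumes "k \<noteq> 0" shows "pgl (block (mat k ** qmat q) c) = oct_aut q (c / k)"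
  using assms by (simp add: oct_aut_def pgl_block_scale)

lemma oct_aut_scale: "m \<noteq> 0 \<Longrightarrow> oct_aut (qscale m q) c = oct_aut q (c / of_int m)"
  by (simp add: oct_aut_def qmat_scale pgl_block_scale)

lemma oct_aut_mult:
  assumes "p \<in> OQ" "q \<in> OQ" "b \<noteq> 0" "c \<noteq> 0"
  shows "oct_aut p b \<otimes>\<^bsub>PGL\<^esub> oct_aut q c = oct_aut (qmul p q) (b * c)"
  using assms by (simp add: oct_aut_def pgl_mult invertible_block OQ_invertible block_mult qmat_mult)

text \<open>The block of an automorphism is a scalar multiple of some \<open>qmat q\<close>;
  dividing by the scalar moves it into the corner, which must then be a d-th root of the
  multiplier.\<close>

lemma Aut_octahedral: "Aut F = {oct_aut q c | q c. q \<in> OQ \<and> c ^ d = \<kappa> q}"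
proof (intro subset_antisym subsetI)
  fix g assume "g \<in> Aut F"
  then obtain B c where B: "g = pgl (block B c)" "invertible B" "c \<noteq> 0" "\<And>v. f (B *v v) = c ^ d * f v"
    unfolding Aut_F by blast
  then have "B \<in> octset" using d4 by (intro semi_invariant_octset) (auto simp: semi_invariant_def intro!: exI[of _ "c ^ d"])
  then obtain k q where k: "k \<noteq> 0" "q \<in> OQ" "B = mat k ** qmat q" unfolding octset_def by blast
  obtain v where v: "f v \<noteq> 0" using sqfree_nonzero[OF sqfree_f] by blast
  have "c ^ d * f v = k ^ d * (\<kappa> q * f v)"
    using B(4)[of v] bform_homogeneous[OF bform_f, of k] f_qmat[OF k(2), of v] unfolding k(3)
    by (simp only: matrix_vector_mul_assoc[symmetric] mat_mult_vec)
  then have "(c / k) ^ d = \<kappa> q" using v k(1) by (simp add: power_divide field_simps)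
  then show "g \<in> {oct_aut q c | q c. q \<in> OQ \<and> c ^ d = \<kappa> q}"
    unfolding B(1) k(3) pgl_block_octset[OF k(1)] using k(2) by blast
next
  fix g assume "g \<in> {oct_aut q c | q c. q \<in> OQ \<and> c ^ d = \<kappa> q}"
  then obtain q c where q: "g = oct_aut q c" "q \<in> OQ" "c ^ d = \<kappa> q" by blast
  then have "c \<noteq> 0" using chi_nonzero[OF q(2)] d4 by (auto simp: power_0_left)
  moreover have "f (qmat q *v v) = c ^ d * f v" for v using f_qmat[OF q(2)] q(3) by simp
  ultimately show "g \<in> Aut F" using q(1) OQ_invertible[OF q(2)] unfolding Aut_F oct_aut_def by blast
qed

lemma oct_aut_in_Aut: "q \<in> OQ \<Longrightarrow> c ^ d = \<kappa> q \<Longrightarrow> oct_aut q c \<in> Aut F"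
  unfolding Aut_octahedral by blast

text \<open>The automorphisms are the image of the linear stabilizer under a homomorphism.\<close>

lemma Aut_subgroup: "subgroup (Aut F) PGL"
proof -
  have "group_hom (GL\<lparr>carrier := lin_stab f\<rparr>) PGL aut_of"
  proof (intro group_hom.intro group_hom_axioms.intro homI)
    show "group (GL\<lparr>carrier := lin_stab f\<rparr>)"
      using group.subgroup_imp_group[OF group_GL lin_stab_subgroup] .
    fix A assume A: "A \<in> carrier (GL\<lparr>carrier := lin_stab f\<rparr>)"
    then show "aut_of A \<in> carrier PGL"
      by (auto simp: aut_of_def lin_stab_def intro!: pgl_in_carrier simp: invertible_block)
    fix B assume "B \<in> carrier (GL\<lparr>carrier := lin_stab f\<rparr>)"
    then show "aut_of (A \<otimes>\<^bsub>GL\<lparr>carrier := lin_stab f\<rparr>\<^esub> B) = aut_of A \<otimes>\<^bsub>PGL\<^esub> aut_of B"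
      using A by (auto simp: aut_of_def lin_stab_def pgl_mult invertible_block block_mult)
  qed (rule group_PGL)
  then show ?thesis using group_hom.img_is_subgroup by (fastforce simp: Aut_lin_stab)
qed

text \<open>The powers of \<open>\<zeta> d\<close> already exhaust the at most d roots of X^d -
  1.\<close>

lemma root_of_unity_power:
  assumes "z ^ d = 1" shows "\<exists>k<d. z = \<zeta> d ^ k"
proof -
  have d: "d > 0" using d4 by simp
  have sub: "(\<lambda>k. \<zeta> d ^ k) ` {..<d} \<subseteq> {z. z ^ d = 1}"
  proof clarsimp
    fix k show "(\<zeta> d ^ k) ^ d = 1" using zeta_power(1)[OF d] by (simp add: power_commutes[symmetric] mult.commute flip: power_mult) (simp add: power_mult)
  qed
  have "card ((\<lambda>k. \<zeta> d ^ k) ` {..<d}) = d"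
    using roots_of_unity_inj[OF comp d] by (simp add: card_image)
  moreover have "finite {z :: 'a. z ^ d = 1}" "card {z :: 'a. z ^ d = 1} \<le> d"
  proof -
    define p where "p = Polynomial.monom (1::'a) d + [:- 1:]"
    have "poly.coeff p d = 1" using d by (cases d) (simp_all add: p_def)
    then have p0: "p \<noteq> 0" by auto
    have S: "{z :: 'a. z ^ d = 1} = {z. poly p z = 0}" by (auto simp: p_def poly_monom)
    have "degree p \<le> d" unfolding p_def by (intro degree_add_le) (auto simp: degree_monom_le)
    then show "finite {z :: 'a. z ^ d = 1}" "card {z :: 'a. z ^ d = 1} \<le> d"
      unfolding S using poly_roots_finite[OF p0] card_poly_roots_bound[OF p0] by auto
  qed
  ultimately have "(\<lambda>k. \<zeta> d ^ k) ` {..<d} = {z. z ^ d = 1}"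
    using sub by (intro card_seteq) auto
  then show ?thesis using assms by blast
qed

lemma quat_unit: "(1, 0, 0, 0) \<in> OQ" "\<kappa> (1, 0, 0, 0) = 1"
  by (simp_all add: OQ_iff \<kappa>_def oct_sign_def)

text \<open>Two lifts of the same quaternion differ by a d-th root of unity in the corner, i.e. by a
  power of \<open>rho\<close>.\<close>

lemma oct_aut_quotient:
  assumes "q \<in> OQ" "b ^ d = \<kappa> q" "c ^ d = \<kappa> q"
  obtains k where "k < d" "oct_aut q b = oct_aut (1, 0, 0, 0) (\<zeta> d ^ k) \<otimes>\<^bsub>PGL\<^esub> oct_aut q c"
proof -
  have c0: "c \<noteq> 0" "b \<noteq> 0" using assms chi_nonzero[OF assms(1)] d4 by (auto simp: power_0_left)
  have "(b / c) ^ d = 1" using assms chi_nonzero by (simp add: power_divide)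
  then obtain k where k: "k < d" "b / c = \<zeta> d ^ k" using root_of_unity_power by blast
  have "qmul (1, 0, 0, 0) q = q" by (cases q) simp
  then have "oct_aut (1, 0, 0, 0) (\<zeta> d ^ k) \<otimes>\<^bsub>PGL\<^esub> oct_aut q c = oct_aut q b"
    unfolding k(2)[symmetric] using c0 by (simp add: oct_aut_mult[OF quat_unit(1) assms(1)])
  then show thesis using that k(1) by metis
qed

text \<open>The upper block of each generator is a scalar times a quaternion; dividing the matrix by
  that scalar gives the corner stated here.\<close>

lemma generators:
  "pgl (rho \<zeta> d) = oct_aut (1, 0, 0, 0) (\<zeta> d)" "pgl (rho' \<zeta>) = oct_aut (0, 1, 0, 0) (- 1)"
  "pgl (tau \<zeta>) = oct_aut (0, 0, 0, 1) (- 1)"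
  "pgl (sigma1 \<zeta> \<epsilon>'') = oct_aut (1, 1, -1, 1) (2 * i * (\<zeta> 12 * inverse (\<zeta> 3 ^ \<epsilon>'')))"
  "pgl (sigma2 \<zeta> s \<epsilon> \<epsilon>') = oct_aut (0, 1, 0, 1) (i * s * (if \<epsilon> = 0 \<and> \<epsilon>' = 1 then \<zeta> 8 else i ^ \<epsilon>'))"
proof -
  have i2: "2 \<noteq> (0::'a)" "1 - i \<noteq> 0" using ii_neq by auto
  have "rho \<zeta> d = block (mat 1 ** qmat (1, 0, 0, 0)) (\<zeta> d)"
    by (simp add: vec3_eq_iff rho_def diag3_def qmat.simps)
  then show "pgl (rho \<zeta> d) = oct_aut (1, 0, 0, 0) (\<zeta> d)" by (simp only: pgl_block_octset[OF one_neq_zero] div_by_1)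
  have "rho' \<zeta> = block (mat (- i) ** qmat (0, 1, 0, 0)) i"
    by (simp add: vec3_eq_iff rho'_def diag3_def qmat.simps ii_sq)
  moreover have "i / (- i) = - 1" by simp
  ultimately show "pgl (rho' \<zeta>) = oct_aut (0, 1, 0, 0) (- 1)" using pgl_block_octset[of "- i"] by simp
  have "tau \<zeta> = block (mat (- i) ** qmat (0, 0, 0, 1)) i"
    by (simp add: vec3_eq_iff tau_def qmat.simps ii_sq)
  then show "pgl (tau \<zeta>) = oct_aut (0, 0, 0, 1) (- 1)" using pgl_block_octset[of "- i"] by simp
  have "sigma1 \<zeta> \<epsilon>'' = block (mat ((1 - i) / 2) ** qmat (1, 1, -1, 1)) ((1 + i) * (\<zeta> 12 * inverse (\<zeta> 3 ^ \<epsilon>'')))"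
    by (simp add: vec3_eq_iff sigma1_def qmat.simps ii_sq algebra_simps add_divide_distrib diff_divide_distrib)
  moreover have "((1 + i) * x) / ((1 - i) / 2) = 2 * i * x" for x
    using i2 by (simp add: field_simps ii_sq)
  ultimately show "pgl (sigma1 \<zeta> \<epsilon>'') = oct_aut (1, 1, -1, 1) (2 * i * (\<zeta> 12 * inverse (\<zeta> 3 ^ \<epsilon>'')))"
    using pgl_block_octset[of "(1 - i) / 2"] i2 by simp
  have "sigma2 \<zeta> s \<epsilon> \<epsilon>' = block (mat (- i) ** qmat (0, 1, 0, 1)) (s * (if \<epsilon> = 0 \<and> \<epsilon>' = 1 then \<zeta> 8 else i ^ \<epsilon>'))"
    by (simp add: vec3_eq_iff sigma2_def qmat.simps ii_sq)
  moreover have "x / (- i) = i * x" for x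
    by (simp add: field_simps ii_sq)
  ultimately show "pgl (sigma2 \<zeta> s \<epsilon> \<epsilon>') = oct_aut (0, 1, 0, 1) (i * s * (if \<epsilon> = 0 \<and> \<epsilon>' = 1 then \<zeta> 8 else i ^ \<epsilon>'))"
    using pgl_block_octset[of "- i"] by (simp add: mult.assoc)
qed

text \<open>i^d = (-1)^(d/2), and in d/2 only the summand 3\<epsilon> can be odd.\<close>

lemma i_power_d: "i ^ d = (- 1) ^ \<epsilon>"
proof -
  have "i ^ d = (- 1) ^ half" unfolding d_half power_mult ii_powers ..
  also have "\<dots> = ((- 1) ^ 3) ^ \<epsilon> * (((- 1) ^ 6) ^ \<epsilon>' * (((- 1) ^ 4) ^ \<epsilon>'' * ((- 1) ^ 12) ^ t))"
    unfolding half_def power_add power_mult mult.assoc ..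
  finally show ?thesis by simp
qed

lemma generators_Aut:
  "{pgl (rho \<zeta> d), pgl (rho' \<zeta>), pgl (tau \<zeta>), pgl (sigma1 \<zeta> \<epsilon>''), pgl (sigma2 \<zeta> s \<epsilon> \<epsilon>')} \<subseteq> Aut F"
proof -
  have "\<zeta> d ^ d = 1" using zeta_power(1) d4 by simp
  then have "pgl (rho \<zeta> d) \<in> Aut F"
    unfolding generators by (intro oct_aut_in_Aut) (simp_all add: quat_unit)
  moreover have "pgl (rho' \<zeta>) \<in> Aut F" "pgl (tau \<zeta>) \<in> Aut F"
    unfolding generators by (intro oct_aut_in_Aut; simp add: OQ_iff \<kappa>_def oct_sign_def d_half)+
  moreover have "pgl (sigma1 \<zeta> \<epsilon>'') \<in> Aut F"
    unfolding generators
  proof (intro oct_aut_in_Aut)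
    \<comment> \<open>By compatibility i \<zeta>(12) = \<zeta>(12)^4 = \<zeta>(3), so the corner is
      2 \<zeta>(3)^(1-\<epsilon>''). For \<epsilon>'' = 0 the root of unity disappears in the d-th
      power because 3 divides d.\<close>
    have "\<zeta> 12 ^ 3 = i" "\<zeta> 12 ^ 4 = \<zeta> 3" using zeta_power(3)[of 3 4] zeta_power(3)[of 4 3] by simp_all
    moreover have "\<zeta> 12 ^ 4 = \<zeta> 12 ^ 3 * \<zeta> 12" by (simp flip: power_Suc2)
    ultimately have "i * \<zeta> 12 = \<zeta> 3" by simp
    then have z: "2 * i * (\<zeta> 12 * inverse (\<zeta> 3 ^ \<epsilon>'')) = 2 * (\<zeta> 3 * inverse (\<zeta> 3 ^ \<epsilon>''))"
      by (metis mult.assoc)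
    have z3: "\<zeta> 3 ^ 3 = 1" using zeta_power(1)[of 3] by simp
    then have "\<zeta> 3 \<noteq> 0" by auto
    have "(\<zeta> 3 * inverse (\<zeta> 3 ^ \<epsilon>'')) ^ d = 1"
    proof (cases "\<epsilon>'' = 0")
      case True
      have "d = 3 * (2 * \<epsilon> + 4 * \<epsilon>' + 8 * t)" using True data by (simp add: octahedral_data_def)
      then have "\<zeta> 3 ^ d = (\<zeta> 3 ^ 3) ^ (2 * \<epsilon> + 4 * \<epsilon>' + 8 * t)" by (simp only: power_mult)
      then show ?thesis using True z3 by simp
    next
      case False
      then have "\<epsilon>'' = 1" using eps by simp
      then show ?thesis using \<open>\<zeta> 3 \<noteq> 0\<close> by simp
    qed
    then show "(2 * i * (\<zeta> 12 * inverse (\<zeta> 3 ^ \<epsilon>''))) ^ d = \<kappa> (1, 1, -1, 1)"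
      unfolding z power_mult_distrib by (simp add: \<kappa>_def oct_sign_def d_half power_mult)
  qed (simp add: OQ_iff)
  moreover have "pgl (sigma2 \<zeta> s \<epsilon> \<epsilon>') \<in> Aut F"
    unfolding generators
  proof (intro oct_aut_in_Aut)
    \<comment> \<open>For \<epsilon> = 0 and \<epsilon>' = 1, d/2 is 2 modulo 4, so \<zeta>(8)^d =
      i^(d/2) = -1, whereas i^d = 1 would give the wrong sign.\<close>
    have "(if \<epsilon> = 0 \<and> \<epsilon>' = 1 then \<zeta> 8 else i ^ \<epsilon>') ^ d = (- 1) ^ \<epsilon>'"
    proof (cases "\<epsilon> = 0 \<and> \<epsilon>' = 1")
      case True
      have "\<zeta> 8 ^ 2 = i" using zeta_power(3)[of 2 4] by simp
      then have "\<zeta> 8 ^ d = i ^ half" unfolding d_half power_mult by simp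
      also have "half = 2 + 4 * (1 + \<epsilon>'' + 3 * t)" unfolding half_def using True by simp
      also have "i ^ \<dots> = - 1" unfolding power_add power_mult by (simp add: ii_powers)
      finally show ?thesis using True by simp
    next
      case False
      then have "\<epsilon>' = 0 \<or> \<epsilon> = 1 \<and> \<epsilon>' = 1" using eps by auto
      moreover have "(i ^ \<epsilon>') ^ d = ((- 1) ^ \<epsilon>) ^ \<epsilon>'" using i_power_d by (metis power_mult mult.commute)
      ultimately show ?thesis using False by auto
    qed
    moreover have "s ^ d = 2 ^ half" unfolding d_half power_mult s2 ..
    ultimately show "(i * s * (if \<epsilon> = 0 \<and> \<epsilon>' = 1 then \<zeta> 8 else i ^ \<epsilon>')) ^ d = \<kappa> (0, 1, 0, 1)"
      by (simp add: power_mult_distrib i_power_d \<kappa>_def oct_sign_def power_add)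
  qed (simp add: OQ_iff)
  ultimately show ?thesis by blast
qed

text \<open>It suffices to generate one lift of every quaternion, since the others differ from it by
  powers of \<open>rho\<close>.\<close>

lemma Aut_generated:
  "Aut F = generate PGL {pgl (rho \<zeta> d), pgl (rho' \<zeta>), pgl (tau \<zeta>), pgl (sigma1 \<zeta> \<epsilon>''), pgl (sigma2 \<zeta> s \<epsilon> \<epsilon>')}"
    (is "_ = generate PGL ?S")
proof
  show sub: "generate PGL ?S \<subseteq> Aut F"
    using group.generate_subgroup_incl[OF group_PGL generators_Aut Aut_subgroup] .
  have E: "subgroup (generate PGL ?S) PGL"
    using generators_Aut subgroup.subset[OF Aut_subgroup] by (intro group.generate_is_subgroup[OF group_PGL]) (rule order_trans)
  note mul = subgroup.m_closed[OF E]
  have gen: "g \<in> generate PGL ?S" if "g \<in> ?S" for g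
    using that by (rule generate.incl)
  have lift: "\<exists>c. c \<noteq> 0 \<and> oct_aut q c \<in> generate PGL ?S" if "q \<in> OQ" for q
  proof -
    have z: "\<zeta> n \<noteq> 0" if "n > 0" for n using zeta_power(1)[OF that] that by (auto simp: power_0_left)
    have "s \<noteq> 0" using s2 by auto
    have "invertible (qmat q) \<and> (\<exists>c. c \<noteq> 0 \<and> oct_aut q c \<in> generate PGL ?S)"
      using \<open>q \<in> OQ\<close>
    proof (induction rule: OQ_induct)
      case gen1
      define c2 where "c2 = i * s * (if \<epsilon> = 0 \<and> \<epsilon>' = 1 then \<zeta> 8 else i ^ \<epsilon>')"
      define c1 where "c1 = 2 * i * (\<zeta> 12 * inverse (\<zeta> 3 ^ \<epsilon>''))"
      have c0: "c1 \<noteq> 0" "c2 \<noteq> 0" using z[of 8] z[of 3] z[of 12] \<open>s \<noteq> 0\<close> by (auto simp: c1_def c2_def)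
      have OQ: "(0, 1, 0, 0) \<in> OQ" "(0, 1, 0, 1) \<in> OQ" "(1, 1, -1, 1) \<in> OQ" "(-1, 0, -1, 0) \<in> OQ" "(1, 1, 0, 0) \<in> OQ" by (simp_all add: OQ_iff)
      have in': "oct_aut (0, 1, 0, 0) (- 1) \<in> generate PGL ?S" "oct_aut (0, 1, 0, 1) c2 \<in> generate PGL ?S"
        "oct_aut (1, 1, -1, 1) c1 \<in> generate PGL ?S"
        unfolding c1_def c2_def generators[symmetric] by (intro gen; simp)+
      \<comment> \<open>i (i + k) (1 + i - j + k) = -2 (1 + i): the generator 1 + i of the word list
        as a product of given automorphisms.\<close>
      have "oct_aut (0, 1, 0, 0) (- 1) \<otimes>\<^bsub>PGL\<^esub> oct_aut (0, 1, 0, 1) c2 = oct_aut (-1, 0, -1, 0) (- c2)"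
        using c0 by (simp add: oct_aut_mult[OF OQ(1,2)])
      then have "oct_aut (0, 1, 0, 0) (- 1) \<otimes>\<^bsub>PGL\<^esub> oct_aut (0, 1, 0, 1) c2 \<otimes>\<^bsub>PGL\<^esub> oct_aut (1, 1, -1, 1) c1
          = oct_aut (qscale (- 2) (1, 1, 0, 0)) (- c2 * c1)"
        using c0 by (simp add: oct_aut_mult[OF OQ(4,3)])
      also have "\<dots> = oct_aut (1, 1, 0, 0) (- c2 * c1 / of_int (- 2))" by (rule oct_aut_scale) simp
      finally have "oct_aut (1, 1, 0, 0) (- c2 * c1 / of_int (- 2)) \<in> generate PGL ?S"
        using mul[OF mul[OF in'(1,2)] in'(3)] by simp
      moreover have "- c2 * c1 / of_int (- 2) \<noteq> 0" using c0 by simp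
      ultimately show ?case using OQ_invertible[OF OQ(5)] by blast
    next
      case gen2
      have OQ: "(0, 1, 0, 1) \<in> OQ" by (simp add: OQ_iff)
      have "oct_aut (0, 1, 0, 1) (i * s * (if \<epsilon> = 0 \<and> \<epsilon>' = 1 then \<zeta> 8 else i ^ \<epsilon>')) \<in> generate PGL ?S"
        unfolding generators[symmetric] by (intro gen) simp
      moreover have "i * s * (if \<epsilon> = 0 \<and> \<epsilon>' = 1 then \<zeta> 8 else i ^ \<epsilon>') \<noteq> 0" using \<open>s \<noteq> 0\<close> z[of 8] by simp
      ultimately show ?case using OQ_invertible[OF OQ] by blast
    next
      case (mult p q)
      then obtain b c where b: "b \<noteq> 0" "c \<noteq> 0" "oct_aut p b \<in> generate PGL ?S" "oct_aut q c \<in> generate PGL ?S" by blast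
      have "oct_aut p b \<otimes>\<^bsub>PGL\<^esub> oct_aut q c = oct_aut (qmul p q) (b * c)"
        using mult b by (simp add: oct_aut_def pgl_mult invertible_block block_mult qmat_mult)
      then have "oct_aut (qmul p q) (b * c) \<in> generate PGL ?S" using mul[OF b(3,4)] by simp
      moreover have "b * c \<noteq> 0" using b by simp
      ultimately show ?case using mult unfolding qmat_mult invertible_mult_iff by blast
    next
      case (scale k q)
      then have k: "k \<noteq> 0" by auto
      then have k': "(of_int k :: 'a) \<noteq> 0" by simp
      obtain c where "c \<noteq> 0" "oct_aut (qscale k q) c \<in> generate PGL ?S" using scale by blast
      then have "oct_aut q (c / of_int k) \<in> generate PGL ?S" "c / of_int k \<noteq> 0" using k' by (simp_all add: oct_aut_scale[OF k])
      then show ?case using scale unfolding qmat_scale invertible_mult_iff by blast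
    qed
    then show ?thesis by blast
  qed
  show "Aut F \<subseteq> generate PGL ?S"
  proof
    fix g assume "g \<in> Aut F"
    then obtain q b where q: "g = oct_aut q b" "q \<in> OQ" "b ^ d = \<kappa> q" unfolding Aut_octahedral by blast
    obtain c where c: "c \<noteq> 0" "oct_aut q c \<in> generate PGL ?S" using lift[OF q(2)] by blast
    \<comment> \<open>Membership in \<open>Aut F\<close> only gives some presentation by another
      quaternion q'; comparing the multipliers of f shows that the given corner is admissible for
      q.\<close>
    have "c ^ d = \<kappa> q"
    proof -
      obtain q' c' where q': "oct_aut q c = oct_aut q' c'" "q' \<in> OQ" "c' ^ d = \<kappa> q'"
        using c(2) sub unfolding Aut_octahedral by blast
      then obtain k where k: "k \<noteq> 0" "block (qmat q) c = mat k ** block (qmat q') c'" unfolding oct_aut_def pgl_eq_iff by blast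
      then have k': "qmat q = mat k ** qmat q'" "c = k * c'" unfolding block_scale block_eq_iff by simp_all
      obtain v where v: "f v \<noteq> 0" using sqfree_nonzero[OF sqfree_f] by blast
      have "\<kappa> q * f v = f (mat k ** qmat q' *v v)" unfolding f_qmat[OF q(2), symmetric] k'(1) ..
      also have "\<dots> = k ^ d * (\<kappa> q' * f v)"
        using bform_homogeneous[OF bform_f] f_qmat[OF q'(2)] by (simp flip: matrix_vector_mul_assoc)
      finally show ?thesis using v q'(3) by (simp add: k'(2) power_mult_distrib)
    qed
    then obtain k where k: "g = oct_aut (1, 0, 0, 0) (\<zeta> d ^ k) \<otimes>\<^bsub>PGL\<^esub> oct_aut q c"
      using oct_aut_quotient q by metis
    have "oct_aut (1, 0, 0, 0) (\<zeta> d ^ k) \<in> generate PGL ?S"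
    proof (induction k)
      case 0
      have "oct_aut (1, 0, 0, 0) 1 = \<one>\<^bsub>PGL\<^esub>" by (simp add: oct_aut_def qmat_one block_one one_PGL)
      then show ?case using subgroup.one_closed[OF E] by simp
    next
      case (Suc k)
      have "\<zeta> d \<noteq> 0" using zeta_power(1)[of d] d4 by (auto simp: power_0_left)
      then have "oct_aut (1, 0, 0, 0) (\<zeta> d ^ Suc k) = pgl (rho \<zeta> d) \<otimes>\<^bsub>PGL\<^esub> oct_aut (1, 0, 0, 0) (\<zeta> d ^ k)"
        by (simp add: generators oct_aut_mult quat_unit)
      moreover have "pgl (rho \<zeta> d) \<in> generate PGL ?S" by (intro gen) simp
      ultimately show ?case using mul Suc by simp
    qed
    then show "g \<in> generate PGL ?S" unfolding k using mul c(2) by blast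
  qed
qed

end

context octahedral_curve
begin

text \<open>Addition in \<open>integer_mod_group d\<close> reduces modulo d, which a d-th root of
  unity does not notice.\<close>

lemma zeta_add:
  assumes "x \<ge> 0" "y \<ge> 0" shows "\<zeta> d ^ nat ((x + y) mod int d) = \<zeta> d ^ nat x * \<zeta> d ^ nat y"
proof -
  have d: "d > 0" using d4 by simp
  have "\<zeta> d ^ n = \<zeta> d ^ (n mod d)" for n
  proof -
    have "\<zeta> d ^ n = \<zeta> d ^ (d * (n div d) + n mod d)" by simp
    also have "\<dots> = \<zeta> d ^ (n mod d)" unfolding power_add power_mult zeta_power(1)[OF d] by simp
    finally show ?thesis .
  qed
  moreover have "nat ((x + y) mod int d) = (nat x + nat y) mod d"
    using assms by (simp add: nat_mod_distrib nat_add_distrib)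
  ultimately show ?thesis by (metis power_add)
qed

lemma zeta_d_nonzero: "\<zeta> d \<noteq> 0"
  using zeta_power(1)[of d] d4 by (auto simp: power_0_left)

lemma carrier_C: "carrier (integer_mod_group d) = {0..<int d}"
  using d4 by (simp add: carrier_integer_mod_group)

lemma oct_aut_eq_scaled:
  assumes "oct_aut p b = oct_aut q c"
  obtains k where "k \<noteq> 0" "qmat p = mat k ** qmat q" "b = k * c"
  using assms unfolding oct_aut_def pgl_eq_iff by (auto simp: block_scale block_eq_iff)

lemma scalar_quat:
  assumes "p \<in> OQ" "qmat p = mat k" shows "p = (1, 0, 0, 0) \<and> k = 1 \<or> p = (- 1, 0, 0, 0) \<and> k = - 1"
proof -
  obtain x y z w where p: "p = (x, y, z, w)" by (rule prod_cases4)
  have "qmat (x, y, z, w) = mat k ** qmat (1, 0, 0, 0)" using assms(2) by (simp add: p qmat_one)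
  note e = qmat_eq_scaled[OF this]
  have "y = 0" "z = 0" "w = 0" using e by simp_all
  then have "x = 1 \<or> x = - 1" using assms(1) by (auto simp: p OQ_iff)
  then show ?thesis using e(1) \<open>y = 0\<close> \<open>z = 0\<close> \<open>w = 0\<close> p by auto
qed

lemma oct_aut_one: "oct_aut (1, 0, 0, 0) 1 = \<one>\<^bsub>PGL\<^esub>"
  by (simp add: oct_aut_def qmat_one block_one one_PGL)

lemma Aut_group: "group (Aut_group F)"
  using group.subgroup_imp_group[OF group_PGL Aut_subgroup] .

lemma rho_power_in_Aut: "oct_aut (1, 0, 0, 0) (\<zeta> d ^ k) \<in> Aut F"
proof (rule oct_aut_in_Aut)
  have "(\<zeta> d ^ k) ^ d = (\<zeta> d ^ d) ^ k" by (simp add: mult.commute flip: power_mult)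
  then show "(\<zeta> d ^ k) ^ d = \<kappa> (1, 0, 0, 0)" using zeta_power(1) d4 by (simp add: quat_unit)
qed (rule quat_unit)

text \<open>The projection is \<open>Lambda\<close> followed by the action on the diagonals. Its
  kernel comes from the quaternions 1 and -1, and -1 with corner c is the same class as 1 with
  corner -c, where (-c)^d = c^d since d is even.\<close>

theorem central_extension: "is_central_extension (Aut_group F) (sym_group 4) (integer_mod_group d)"
proof -
  define \<iota> where "\<iota> x = oct_aut (1, 0, 0, 0) (\<zeta> d ^ nat x)" for x
  define p where "p g = theta_class (Lambda g)" for g :: "('a ^ 3 ^ 3) set"
  have hom_\<iota>: "\<iota> \<in> hom (integer_mod_group d) (Aut_group F)"
  proof (rule homI)
    fix x y assume "x \<in> carrier (integer_mod_group d)" "y \<in> carrier (integer_mod_group d)"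
    then have "x \<ge> 0" "y \<ge> 0" by (auto simp: carrier_C)
    then show "\<iota> (x \<otimes>\<^bsub>integer_mod_group d\<^esub> y) = \<iota> x \<otimes>\<^bsub>Aut_group F\<^esub> \<iota> y"
      using zeta_d_nonzero by (simp add: \<iota>_def zeta_add oct_aut_mult[OF quat_unit(1) quat_unit(1)])
  qed (simp add: \<iota>_def rho_power_in_Aut)
  have p_oct: "p (oct_aut q c) = theta (qmat q)" for q c
    by (simp add: p_def oct_aut_def Lambda_block theta_class_pgl)
  have Lam: "Lambda ` Aut F = octgroup"
    unfolding Lambda_Aut using proj_stab_oct_good[OF oct_good_f] .
  have hom_p: "p \<in> hom (Aut_group F) (sym_group 4)"
  proof (rule homI)
    fix g assume "g \<in> carrier (Aut_group F)"
    then have "Lambda g \<in> octgroup" unfolding Lam[symmetric] by simp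
    then show "p g \<in> carrier (sym_group 4)"
      using theta_class_iso unfolding p_def iso_def hom_def by auto
  next
    fix g h assume "g \<in> carrier (Aut_group F)" "h \<in> carrier (Aut_group F)"
    then obtain q c q' c' where q: "g = oct_aut q c" "h = oct_aut q' c'" "q \<in> OQ" "q' \<in> OQ" "c ^ d = \<kappa> q" "c' ^ d = \<kappa> q'"
      using Aut_octahedral by auto
    then have "c \<noteq> 0" "c' \<noteq> 0" using chi_nonzero[OF q(3)] chi_nonzero[OF q(4)] d4 by (auto simp: power_0_left)
    then show "p (g \<otimes>\<^bsub>Aut_group F\<^esub> h) = p g \<otimes>\<^bsub>sym_group 4\<^esub> p h"
      using q by (simp add: oct_aut_mult p_oct qmat_mult theta_mult rotates_qmat sym_group_mult)
  qed
  have "p ` Aut F = theta_class ` octgroup" unfolding Lam[symmetric] by (simp add: p_def image_image)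
  then have onto: "p ` carrier (Aut_group F) = carrier (sym_group 4)"
    using theta_class_iso unfolding iso_def bij_betw_def by simp
  have inj: "inj_on \<iota> (carrier (integer_mod_group d))"
  proof (rule inj_onI)
    fix x y assume x: "x \<in> carrier (integer_mod_group d)" "y \<in> carrier (integer_mod_group d)" "\<iota> x = \<iota> y"
    obtain k where k: "qmat (1, 0, 0, 0) = mat k ** qmat (1, 0, 0, 0)" "\<zeta> d ^ nat x = k * \<zeta> d ^ nat y"
      using oct_aut_eq_scaled[OF x(3)[unfolded \<iota>_def]] by metis
    have "k = 1" using scalar_quat[OF quat_unit(1), of k] k(1) by (simp add: qmat_one)
    then have "\<zeta> d ^ nat x = \<zeta> d ^ nat y" using k by simp
    then have "nat x = nat y"
      using roots_of_unity_inj[OF comp, of d] d4 x(1,2) unfolding carrier_C inj_on_def by (auto simp: nat_less_iff)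
    then show "x = y" using x(1,2) eq_nat_nat_iff[of x y] by (auto simp: carrier_C)
  qed
  have img: "\<iota> ` carrier (integer_mod_group d) = {oct_aut (1, 0, 0, 0) z | z. z ^ d = 1}"
  proof (intro subset_antisym subsetI)
    fix g assume "g \<in> \<iota> ` carrier (integer_mod_group d)"
    moreover have "(\<zeta> d ^ k) ^ d = 1" for k
      using zeta_power(1)[of d] d4 by (metis mult.commute not_numeral_le_zero not_gr_zero power_mult power_one)
    ultimately show "g \<in> {oct_aut (1, 0, 0, 0) z | z. z ^ d = 1}" by (auto simp: \<iota>_def)
  next
    fix g assume "g \<in> {oct_aut (1, 0, 0, 0) z | z. z ^ d = 1}"
    then obtain z where z: "g = oct_aut (1, 0, 0, 0) z" "z ^ d = 1" by blast
    then obtain k where "k < d" "z = \<zeta> d ^ k" using root_of_unity_power by blast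
    then show "g \<in> \<iota> ` carrier (integer_mod_group d)"
      using z(1) by (intro image_eqI[of _ _ "int k"]) (auto simp: \<iota>_def carrier_C)
  qed
  have ker: "kernel (Aut_group F) (sym_group 4) p = {oct_aut (1, 0, 0, 0) z | z. z ^ d = 1}"
  proof (intro subset_antisym subsetI)
    fix g assume "g \<in> kernel (Aut_group F) (sym_group 4) p"
    then obtain q c where q: "g = oct_aut q c" "q \<in> OQ" "c ^ d = \<kappa> q" "theta (qmat q) = id"
      using Aut_octahedral p_oct by (auto simp: kernel_def sym_group_one)
    have "q = (1, 0, 0, 0) \<or> q = qscale (- 1) (1, 0, 0, 0)" using theta_qmat_id[OF q(2,4)] by simp
    then show "g \<in> {oct_aut (1, 0, 0, 0) z | z. z ^ d = 1}"
    proof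
      assume "q = (1, 0, 0, 0)"
      then show ?thesis using q quat_unit(2) by auto
    next
      assume a: "q = qscale (- 1) (1, 0, 0, 0)"
      have "oct_aut (qscale (- 1) (1, 0, 0, 0)) c = oct_aut (1, 0, 0, 0) (- c)"
        using oct_aut_scale[of "- 1" "(1, 0, 0, 0)" c] by simp
      moreover have "(- c) ^ d = 1" using q(3) a by (simp add: \<kappa>_def oct_sign_def d_half)
      ultimately show ?thesis using q(1) a by blast
    qed
  next
    fix g assume "g \<in> {oct_aut (1, 0, 0, 0) z | z. z ^ d = 1}"
    then obtain z where z: "g = oct_aut (1, 0, 0, 0) z" "z ^ d = 1" by blast
    have "theta (qmat (1, 0, 0, 0)) = id"
    proof -
      interpret gh: group_hom "Aut_group F" "sym_group 4" p
        using hom_p Aut_group sym_group_is_group unfolding group_hom_def group_hom_axioms_def by blast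
      show ?thesis using gh.hom_one p_oct[of "(1, 0, 0, 0)" 1] by (simp add: oct_aut_one sym_group_one)
    qed
    then show "g \<in> kernel (Aut_group F) (sym_group 4) p"
      using oct_aut_in_Aut[OF quat_unit(1), of z] z by (simp add: kernel_def quat_unit p_oct sym_group_one)
  qed
  have cen: "\<iota> ` carrier (integer_mod_group d) \<subseteq> center (Aut_group F)"
  proof
    fix g assume "g \<in> \<iota> ` carrier (integer_mod_group d)"
    then obtain z where z: "g = oct_aut (1, 0, 0, 0) z" "z ^ d = 1" unfolding img by blast
    then have z0: "z \<noteq> 0" using d4 by (auto simp: power_0_left)
    have "g \<otimes>\<^bsub>PGL\<^esub> h = h \<otimes>\<^bsub>PGL\<^esub> g" if h: "h \<in> Aut F" for h
    proof -
      obtain q c where q: "h = oct_aut q c" "q \<in> OQ" "c ^ d = \<kappa> q" using h Aut_octahedral by blast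
      then have "c \<noteq> 0" using chi_nonzero[OF q(2)] d4 by (auto simp: power_0_left)
      moreover have "qmul (1, 0, 0, 0) q = q" "qmul q (1, 0, 0, 0) = q" by (cases q, simp)+
      ultimately show ?thesis
        using z0 by (simp add: z(1) q(1) oct_aut_mult[OF quat_unit(1) q(2)] oct_aut_mult[OF q(2) quat_unit(1)] mult.commute)
    qed
    moreover have "g \<in> Aut F" using oct_aut_in_Aut[OF quat_unit(1)] z by (simp add: quat_unit)
    ultimately show "g \<in> center (Aut_group F)" by (simp add: center_def)
  qed
  show ?thesis
    unfolding is_central_extension_def
    using hom_\<iota> hom_p inj onto cen by (intro bexI[of _ \<iota>] bexI[of _ p] conjI) (simp_all add: img ker)
qed

text \<open>\<open>\<beta>\<close> models the 48 quaternions as a group of matrices, and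
  \<open>u\<close> picks a lift for each norm. The product hypothesis says that q with corner
  u(N(q)) multiplies like \<open>\<beta>\<close>: the factor \<open>m\<close> lost in reducing a
  product is the one by which the corners differ.\<close>

theorem central_product_2:
  fixes H :: "('k::comm_ring_1 ^ 2 ^ 2) monoid" and \<beta> :: "quat \<Rightarrow> 'k ^ 2 ^ 2" and u :: "int \<Rightarrow> 'a"
  assumes H: "group H" "\<And>x y. x \<otimes>\<^bsub>H\<^esub> y = x ** y" "\<one>\<^bsub>H\<^esub> = mat 1"
    and \<beta>: "bij_betw \<beta> OQ (carrier H)" "\<beta> (1, 0, 0, 0) = mat 1" "\<beta> (- 1, 0, 0, 0) = mat (- 1)"
    and mult: "\<And>p q. p \<in> OQ \<Longrightarrow> q \<in> OQ \<Longrightarrow> \<exists>r\<in>OQ. \<exists>m. m \<noteq> 0 \<and> qmul p q = qscale m r \<and>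
      \<beta> p ** \<beta> q = \<beta> r \<and> u (qnorm p) * u (qnorm q) = of_int m * u (qnorm r)"
    and u: "u 1 = 1" "\<And>q. q \<in> OQ \<Longrightarrow> u (qnorm q) ^ d = \<kappa> q"
  shows "is_central_product_2 (Aut_group F) (integer_mod_group d) H"
proof -
  let ?C = "integer_mod_group d"
  \<comment> \<open>The subgroup of order 2. Since \<zeta>(d)^(d/2) = -1, the element d/2 of C_d and
    the matrix -1 have the same image; together with the identity this is the whole kernel.\<close>
  define Z where "Z = {0, int half}"
  define \<phi> where "\<phi> x = (if x = 0 then mat 1 else mat (- 1) :: 'k ^ 2 ^ 2)" for x :: int
  define \<gamma> where "\<gamma> = inv_into OQ \<beta>"
  define \<Psi> where "\<Psi> = (\<lambda>(x, h). oct_aut (\<gamma> h) (\<zeta> d ^ nat x * u (qnorm (\<gamma> h))))"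
  have OQ1: "(1, 0, 0, 0) \<in> OQ" "(- 1, 0, 0, 0) \<in> OQ" by (simp_all add: OQ_iff)
  have u0: "u (qnorm q) \<noteq> 0" if "q \<in> OQ" for q
    using u(2)[OF that] chi_nonzero[OF that] d4 by (auto simp: power_0_left)
  have \<gamma>: "\<gamma> h \<in> OQ" "\<beta> (\<gamma> h) = h" if "h \<in> carrier H" for h
    using \<beta>(1) that inv_into_into f_inv_into_f unfolding \<gamma>_def bij_betw_def by metis+
  have \<gamma>\<beta>: "\<gamma> (\<beta> q) = q" if "q \<in> OQ" for q
    using \<beta>(1) that unfolding \<gamma>_def bij_betw_def by (metis inv_into_f_f)
  have mat_H: "mat 1 \<in> carrier H" "mat (- 1) \<in> carrier H"
    using \<beta> OQ1 unfolding bij_betw_def by (metis imageI)+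
  have neq: "mat 1 \<noteq> (mat (- 1) :: 'k ^ 2 ^ 2)"
    using \<gamma>\<beta>[OF OQ1(1)] \<gamma>\<beta>[OF OQ1(2)] \<beta>(2,3) by auto
  have half: "int half \<noteq> 0" "int d = 2 * int half" "half < d" using d_half half_pos by simp_all
  have \<zeta>half: "\<zeta> d ^ half = - 1"
  proof -
    have "(\<zeta> d ^ half) ^ 2 = 1" using zeta_power(1)[of d] d4 d_half by (simp add: mult.commute flip: power_mult)
    moreover have "\<zeta> d ^ half \<noteq> 1" using zeta_power(2)[OF half_pos half(3)] .
    ultimately show ?thesis by (simp add: power2_eq_1_iff)
  qed
  have ZC: "Z \<subseteq> carrier ?C" using half by (auto simp: Z_def carrier_C)
  have Zmod: "x \<in> Z \<Longrightarrow> y \<in> Z \<Longrightarrow> (x + y) mod int d \<in> Z" "x \<in> Z \<Longrightarrow> (- x) mod int d = x" for x y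
    using half by (auto simp: Z_def zmod_zminus1_eq_if)
  have 1: "subgroup Z ?C"
  proof (rule group.subgroupI[OF group_integer_mod_group ZC])
    fix x assume "x \<in> Z" then show "inv\<^bsub>?C\<^esub> x \<in> Z" using ZC Zmod(2)[of x] by (auto simp: subset_iff)
  qed (use Zmod in \<open>auto simp: Z_def\<close>)
  have 2: "card Z = 2" using half by (simp add: Z_def)
  have 3: "Z \<subseteq> center ?C" using ZC by (auto simp: center_def add.commute)
  have 4: "\<phi> \<in> hom (?C\<lparr>carrier := Z\<rparr>) H"
  proof (rule homI)
    fix x assume "x \<in> carrier (?C\<lparr>carrier := Z\<rparr>)" then show "\<phi> x \<in> carrier H" by (simp add: \<phi>_def mat_H)
  next
    fix x y assume "x \<in> carrier (?C\<lparr>carrier := Z\<rparr>)" "y \<in> carrier (?C\<lparr>carrier := Z\<rparr>)"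
    then show "\<phi> (x \<otimes>\<^bsub>?C\<lparr>carrier := Z\<rparr>\<^esub> y) = \<phi> x \<otimes>\<^bsub>H\<^esub> \<phi> y"
      using half by (auto simp: Z_def H(2) \<phi>_def)
  qed
  have 5: "inj_on \<phi> Z" using neq half by (auto simp: inj_on_def Z_def \<phi>_def)
  have 6: "\<phi> ` Z \<subseteq> center H"
    using mat_H by (auto simp: center_def \<phi>_def H(2) mat_mult_comm[of "- 1"])
  have \<Psi>_in: "\<Psi> y \<in> Aut F" if yc: "y \<in> carrier (?C \<times>\<times> H)" for y
  proof -
    obtain x h where y: "y = (x, h)" "h \<in> carrier H" using yc by auto
    have "(\<zeta> d ^ nat x) ^ d = (\<zeta> d ^ d) ^ nat x" by (simp add: mult.commute flip: power_mult)
    then have "(\<zeta> d ^ nat x) ^ d = 1" using zeta_power(1)[of d] d4 by simp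
    then show ?thesis using \<gamma>[OF y(2)] u(2) by (simp add: y(1) \<Psi>_def oct_aut_in_Aut power_mult_distrib)
  qed
  have hom: "\<Psi> \<in> hom (?C \<times>\<times> H) (Aut_group F)"
  proof (rule homI)
    fix y y' assume "y \<in> carrier (?C \<times>\<times> H)" "y' \<in> carrier (?C \<times>\<times> H)"
    then obtain x h x' h' where y: "y = (x, h)" "y' = (x', h')" "x \<ge> 0" "x' \<ge> 0" "h \<in> carrier H" "h' \<in> carrier H"
      by (auto simp: carrier_C)
    obtain r m where r: "r \<in> OQ" "m \<noteq> 0" "qmul (\<gamma> h) (\<gamma> h') = qscale m r" "h ** h' = \<beta> r"
      "u (qnorm (\<gamma> h)) * u (qnorm (\<gamma> h')) = of_int m * u (qnorm r)"
      using mult[OF \<gamma>(1)[OF y(5)] \<gamma>(1)[OF y(6)]] \<gamma>(2)[OF y(5)] \<gamma>(2)[OF y(6)] by auto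
    have "\<Psi> y \<otimes>\<^bsub>PGL\<^esub> \<Psi> y' = oct_aut (qscale m r) ((\<zeta> d ^ nat x * \<zeta> d ^ nat x') * (u (qnorm (\<gamma> h)) * u (qnorm (\<gamma> h'))))"
      using zeta_d_nonzero u0 \<gamma> y(5,6) by (simp add: \<Psi>_def y(1,2) oct_aut_mult r(3) mult_ac)
    also have "\<dots> = oct_aut r ((\<zeta> d ^ nat x * \<zeta> d ^ nat x') * u (qnorm r))"
      unfolding r(5) oct_aut_scale[OF r(2)] using r(2) by (simp add: mult.assoc)
    also have "\<dots> = \<Psi> (y \<otimes>\<^bsub>?C \<times>\<times> H\<^esub> y')"
      using y(3,4) by (simp add: \<Psi>_def y(1,2) H(2) r(4) \<gamma>\<beta>[OF r(1)] zeta_add)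
    finally show "\<Psi> (y \<otimes>\<^bsub>?C \<times>\<times> H\<^esub> y') = \<Psi> y \<otimes>\<^bsub>Aut_group F\<^esub> \<Psi> y'" by simp
  qed (simp add: \<Psi>_in)
  interpret gh: group_hom "?C \<times>\<times> H" "Aut_group F" \<Psi>
    using hom Aut_group DirProd_group[OF group_integer_mod_group H(1)] unfolding group_hom_def group_hom_axioms_def by blast
  have onto: "\<Psi> ` carrier (?C \<times>\<times> H) = carrier (Aut_group F)"
  proof (intro subset_antisym subsetI)
    fix g assume "g \<in> carrier (Aut_group F)"
    then obtain q b where q: "g = oct_aut q b" "q \<in> OQ" "b ^ d = \<kappa> q" using Aut_octahedral by auto
    obtain k where k: "k < d" "g = oct_aut (1, 0, 0, 0) (\<zeta> d ^ k) \<otimes>\<^bsub>PGL\<^esub> oct_aut q (u (qnorm q))"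
      using oct_aut_quotient[OF q(2,3) u(2)[OF q(2)]] q(1) by metis
    have "qmul (1, 0, 0, 0) q = q" by (cases q) simp
    then have "g = \<Psi> (int k, \<beta> q)"
      using k(2) zeta_d_nonzero u0[OF q(2)] by (simp add: \<Psi>_def \<gamma>\<beta>[OF q(2)] oct_aut_mult quat_unit q(2))
    moreover have "\<beta> q \<in> carrier H" using \<beta>(1) q(2) by (auto simp: bij_betw_def)
    ultimately show "g \<in> \<Psi> ` carrier (?C \<times>\<times> H)" using k(1) by (intro image_eqI) (auto simp: carrier_C)
  qed (use \<Psi>_in in auto)
  have ker: "kernel (?C \<times>\<times> H) (Aut_group F) \<Psi> = {(z, inv\<^bsub>H\<^esub> (\<phi> z)) | z. z \<in> Z}"
  proof -
    have inv\<phi>: "inv\<^bsub>H\<^esub> (\<phi> z) = \<phi> z" for z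
      by (intro group.inv_equality[OF H(1)]) (auto simp: \<phi>_def H(2,3) mat_H)
    have "kernel (?C \<times>\<times> H) (Aut_group F) \<Psi> = {(0, mat 1), (int half, mat (- 1))}"
    proof (intro subset_antisym subsetI)
      fix y assume "y \<in> kernel (?C \<times>\<times> H) (Aut_group F) \<Psi>"
      then obtain x h where y: "y = (x, h)" "x \<ge> 0" "x < int d" "h \<in> carrier H" "\<Psi> (x, h) = \<one>\<^bsub>PGL\<^esub>"
        by (auto simp: kernel_def carrier_C)
      then obtain k where k: "qmat (\<gamma> h) = mat k" "\<zeta> d ^ nat x * u (qnorm (\<gamma> h)) = k"
        using oct_aut_eq_scaled[of "\<gamma> h" _ "(1, 0, 0, 0)" 1] unfolding \<Psi>_def oct_aut_one[symmetric] by (auto simp: qmat_one)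
      have inj: "x = int n" if "\<zeta> d ^ nat x = \<zeta> d ^ n" "n < d" for n
      proof -
        have "nat x < d" "d > 0" using y(2,3) d4 by (simp_all add: nat_less_iff)
        then have "nat x = n" using inj_onD[OF roots_of_unity_inj[OF comp] that(1)] that(2) by simp
        then show ?thesis using y(2) by simp
      qed
      from scalar_quat[OF \<gamma>(1)[OF y(4)] k(1)] show "y \<in> {(0, mat 1), (int half, mat (- 1))}"
      proof (elim disjE conjE)
        assume a: "\<gamma> h = (1, 0, 0, 0)" "k = 1"
        then have "h = mat 1" "x = int 0" using \<gamma>(2)[OF y(4)] \<beta>(2) k(2) inj[of 0] u(1) d4 by simp_all
        then show ?thesis by (simp add: y(1))
      next
        assume a: "\<gamma> h = (- 1, 0, 0, 0)" "k = - 1"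
        then have "h = mat (- 1)" "x = int half"
          using \<gamma>(2)[OF y(4)] \<beta>(3) k(2) inj[OF _ half(3)] u(1) \<zeta>half by simp_all
        then show ?thesis by (simp add: y(1))
      qed
    next
      fix y assume "y \<in> {(0, mat 1), (int half, mat (- 1) :: 'k ^ 2 ^ 2)}"
      moreover have "\<Psi> (0, mat 1) = \<one>\<^bsub>PGL\<^esub>"
        using \<gamma>\<beta>[OF OQ1(1)] by (simp add: \<Psi>_def \<beta> u oct_aut_one)
      moreover have "\<Psi> (int half, mat (- 1)) = \<one>\<^bsub>PGL\<^esub>"
        using \<gamma>\<beta>[OF OQ1(2)] oct_aut_scale[of "- 1" "(1, 0, 0, 0)" "- 1"] by (simp add: \<Psi>_def \<beta> u \<zeta>half oct_aut_one)
      ultimately show "y \<in> kernel (?C \<times>\<times> H) (Aut_group F) \<Psi>"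
        using mat_H half d4 by (auto simp: kernel_def carrier_C)
    qed
    also have "\<dots> = (\<lambda>z. (z, \<phi> z)) ` Z"
      using half(1) by (simp add: Z_def \<phi>_def)
    also have "\<dots> = {(z, inv\<^bsub>H\<^esub> (\<phi> z)) | z. z \<in> Z}"
      unfolding inv\<phi> image_def by blast
    finally show ?thesis .
  qed
  have "central_product ?C H Z \<phi> \<cong> Aut_group F"
    unfolding central_product_def ker[symmetric] by (rule gh.FactGroup_iso[OF onto])
  moreover have "group (central_product ?C H Z \<phi>)"
    unfolding central_product_def ker[symmetric] by (rule normal.factorgroup_is_group[OF gh.normal_kernel])
  ultimately have "Aut_group F \<cong> central_product ?C H Z \<phi>" using group.iso_sym by metis
  then show ?thesis unfolding is_central_product_2_def using 1 2 3 4 5 6 by (intro exI[of _ Z] exI[of _ \<phi>] conjI)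
qed

end

section \<open>Reduction of quaternions modulo 3\<close>

lemma three_f3 [simp]: "(3 :: 3) = 0" by simp

lemma f3_cases: "x = 0 \<or> x = 1 \<or> x = - 1" for x :: 3
  using exhaust_3[of x] by auto

lemma of_int_f3_eq_0_iff: "of_int z = (0 :: 3) \<longleftrightarrow> z mod 3 = 0"
proof -
  have "of_int z = of_int (3 * (z div 3) + z mod 3)" by simp
  also have "\<dots> = (of_int (z mod 3) :: 3)" unfolding of_int_add of_int_mult by simp
  finally have "of_int z = (of_int (z mod 3) :: 3)" .
  moreover have "z mod 3 = 0 \<or> z mod 3 = 1 \<or> z mod 3 = 2" by presburger
  ultimately show ?thesis by auto
qed

lemma of_int_f3_eq_iff: "of_int z = (of_int w :: 3) \<longleftrightarrow> z mod 3 = w mod 3"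
  using of_int_f3_eq_0_iff[of "z - w"] by (simp add: mod_eq_dvd_iff dvd_eq_mod_eq_0)

lemma of_int_f3_mod [simp]: "of_int (z mod 3) = (of_int z :: 3)"
  by (simp add: of_int_f3_eq_iff)

text \<open>The octahedral quaternions have coordinates -1, 0, 1, so these are the residues to lift
  to.\<close>

definition lift3 :: "3 \<Rightarrow> int" where
  "lift3 x = (if x = 0 then 0 else if x = 1 then 1 else - 1)"

lemma of_int_lift3 [simp]: "of_int (lift3 x) = x"
  using f3_cases[of x] by (auto simp: lift3_def)

lemma lift3_range: "lift3 x \<in> {-1, 0, 1}"
  by (simp add: lift3_def)

lemma of_int_f3_inject: "of_int z = (of_int w :: 3) \<Longrightarrow> z \<in> {-1, 0, 1} \<Longrightarrow> w \<in> {-1, 0, 1} \<Longrightarrow> z = w"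
  by (auto simp: of_int_f3_eq_iff)

text \<open>The quaternion algebra splits over the field of three elements: i, j, k go to the
  matrices with rows (0,-1),(1,0), then (1,1),(1,-1), then (-1,1),(1,1). The squares of the last two
  are 2 = -1.\<close>

fun gl_quat :: "quat \<Rightarrow> 3 ^ 2 ^ 2" where
  "gl_quat (a, b, c, d) = mat2 (of_int a + of_int c - of_int d) (of_int c + of_int d - of_int b)
     (of_int b + of_int c + of_int d) (of_int a - of_int c + of_int d)"

lemma gl_quat_mult: "gl_quat (qmul p q) = gl_quat p ** gl_quat q"
  by (cases p; cases q) (simp add: mat2_mult mat2_eq_iff algebra_simps)

lemma det_gl_quat: "det (gl_quat q) = of_int (qnorm q)"
  by (cases q) (simp add: det_mat2 algebra_simps)

lemma gl_quat_red: "gl_quat (qred q) = gl_quat q"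
  by (cases q) simp

text \<open>The inverse of \<open>gl_quat\<close>, using 2 = -1 and 4 = 1; for instance the trace is
  2a = -a.\<close>

definition gl_lift :: "3 ^ 2 ^ 2 \<Rightarrow> quat" where
  "gl_lift M = (lift3 (- (M $ 1 $ 1 + M $ 2 $ 2)), lift3 (M $ 1 $ 2 - M $ 2 $ 1),
     lift3 (M $ 1 $ 1 - M $ 2 $ 2 + M $ 1 $ 2 + M $ 2 $ 1), lift3 (M $ 1 $ 2 + M $ 2 $ 1 - M $ 1 $ 1 + M $ 2 $ 2))"

lemma gl_quat_lift: "gl_quat (gl_lift M) = M"
  by (simp add: gl_lift_def vec2_eq_iff algebra_simps)

lemma gl_quat_components:
  assumes "gl_quat (a, b, c, d) = M"
  shows "of_int a = - (M $ 1 $ 1 + M $ 2 $ 2)" "of_int b = M $ 1 $ 2 - M $ 2 $ 1"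
    "of_int c = M $ 1 $ 1 - M $ 2 $ 2 + M $ 1 $ 2 + M $ 2 $ 1" "of_int d = M $ 1 $ 2 + M $ 2 $ 1 - M $ 1 $ 1 + M $ 2 $ 2"
  unfolding assms[symmetric] by (simp_all add: algebra_simps)

text \<open>The formula of \<open>qmat\<close> over the field of nine elements.\<close>

fun f9_quat :: "quat \<Rightarrow> gf9 ^ 2 ^ 2" where
  "f9_quat (a, b, c, d) = mat2 (GF9 (of_int a) (of_int b)) (GF9 (of_int c) (of_int d))
     (GF9 (- of_int c) (of_int d)) (GF9 (of_int a) (- of_int b))"

lemma gf9_numerals [simp]: "GF9 2 0 = GF9 (- 1) 0" "GF9 4 0 = GF9 1 0" "GF9 (- 2) 0 = GF9 1 0"
  by simp_all

lemmas gf9_simps = zero_gf9_def one_gf9_def plus_gf9_def minus_gf9_def uminus_gf9_def times_gf9_def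

lemma f9_quat_mult: "f9_quat (qmul p q) = f9_quat p ** f9_quat q"
  by (cases p; cases q) (simp add: mat2_mult mat2_eq_iff gf9_simps algebra_simps)

lemma det_f9_quat: "det (f9_quat q) = GF9 (of_int (qnorm q)) 0"
  by (cases q) (simp add: det_mat2 gf9_simps algebra_simps)

lemma f9_quat_red: "f9_quat (qred q) = f9_quat q"
  by (cases q) simp

lemma cube_gf9: "GF9 x y ^ 3 = GF9 x (- y)"
  using f3_cases[of x] f3_cases[of y] by (auto simp: power3_eq_cube gf9_simps)

abbreviation j9 :: gf9 where "j9 \<equiv> GF9 0 1"

text \<open>The norms 1 and 4 of the octahedral quaternions are \<open>1\<close> modulo 3, the norm 2 is \<open>-1\<close>; the
  factor of square \<open>-1\<close> makes all determinants 1.\<close>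

definition csu_quat :: "quat \<Rightarrow> gf9 ^ 2 ^ 2" where
  "csu_quat q = (if qnorm q = 2 then mat j9 ** f9_quat q else f9_quat q)"

lemma conj_transpose_mat2: "conj_transpose (mat2 x y z w) = mat2 (x ^ 3) (z ^ 3) (y ^ 3) (w ^ 3)"
  by (simp add: vec2_eq_iff conj_transpose_def)

lemma f9_quat_conj: "f9_quat q ** conj_transpose (f9_quat q) = mat (GF9 (of_int (qnorm q)) 0)"
  by (cases q) (simp add: conj_transpose_mat2 cube_gf9 mat_mat2 mat2_mult mat2_eq_iff gf9_simps algebra_simps)

lemma j9_f9_quat_conj: "(mat j9 ** f9_quat q) ** conj_transpose (mat j9 ** f9_quat q) = mat (GF9 (of_int (qnorm q)) 0)"
  by (cases q) (simp add: mat_mult_mat2 conj_transpose_mat2 cube_gf9 mat_mat2 mat2_mult mat2_eq_iff gf9_simps algebra_simps)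

lemma f9_quat_scale: "f9_quat (qscale (- 1) q) = mat (- 1) ** f9_quat q"
  by (cases q) (simp add: mat_mult_mat2 mat2_eq_iff gf9_simps)

text \<open>For determinant 1 the inverse is the adjugate, so the conjugate transpose is c times the
  adjugate.\<close>

lemma conj_transpose_det_1:
  assumes "det (mat2 x y z w) = 1" "mat2 x y z w ** conj_transpose (mat2 x y z w) = mat c"
  shows "x ^ 3 = c * w" "y ^ 3 = - (c * z)"
proof -
  have "mat2 w (- y) (- z) x ** mat2 x y z w = mat 1"
    using assms(1) by (simp add: det_mat2 mat2_mult mat_mat2 mat2_eq_iff algebra_simps)
  then have "conj_transpose (mat2 x y z w) = mat2 w (- y) (- z) x ** mat c"
    unfolding assms(2)[symmetric] by (simp add: matrix_mul_assoc)
  then show "x ^ 3 = c * w" "y ^ 3 = - (c * z)"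
    by (simp_all add: conj_transpose_mat2 mat_mat2 mat2_mult mat2_eq_iff mult.commute)
qed

context imaginary_unit
begin

text \<open>With coordinates -1, 0, 1 the norm is the number of nonzero coordinates, and 0 and 3 are
  the excluded values. So the list consists of all 48 invertible quaternions modulo 3.\<close>

lemma OQ_iff_mod_3: "(a, b, c, d) \<in> OQ \<longleftrightarrow> {a, b, c, d} \<subseteq> {-1, 0, 1} \<and> qnorm (a, b, c, d) mod 3 \<noteq> 0"
proof (cases "{a, b, c, d} \<subseteq> {-1, 0, 1}")
  case True
  then have "a * a = 0 \<or> a * a = 1" "b * b = 0 \<or> b * b = 1" "c * c = 0 \<or> c * c = 1" "d * d = 0 \<or> d * d = 1" by auto
  then show ?thesis using True unfolding OQ_iff qnorm.simps by (elim disjE) simp_all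
qed (simp only: OQ_iff simp_thms)

lemma OQ_neg: "q \<in> OQ \<Longrightarrow> qscale (- 1) q \<in> OQ" "qnorm (qscale (- 1) q) = qnorm q"
  by (cases q; auto simp: OQ_iff)+

lemma gl_lift_OQ: "gl_lift M \<in> OQ \<longleftrightarrow> det M \<noteq> 0"
proof -
  obtain a b c d where q: "gl_lift M = (a, b, c, d)" by (rule prod_cases4)
  have "{a, b, c, d} \<subseteq> {-1, 0, 1}" using q lift3_range unfolding gl_lift_def by (auto simp del: insert_iff)
  moreover have "det M = of_int (qnorm (gl_lift M))" using det_gl_quat[of "gl_lift M"] by (simp add: gl_quat_lift)
  ultimately show ?thesis unfolding q OQ_iff_mod_3 by (simp add: of_int_f3_eq_0_iff del: qnorm.simps)
qed

lemma gl_quat_bij: "bij_betw gl_quat OQ (carrier GL2_F3)"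
proof (rule bij_betw_byWitness[where f' = gl_lift])
  show "\<forall>q\<in>OQ. gl_lift (gl_quat q) = q"
  proof
    fix q assume "q \<in> OQ"
    obtain a b c d where q: "q = (a, b, c, d)" by (rule prod_cases4)
    obtain a' b' c' d' where q': "gl_lift (gl_quat q) = (a', b', c', d')" by (rule prod_cases4)
    have r: "{a', b', c', d'} \<subseteq> {-1, 0, 1}" using q' lift3_range unfolding gl_lift_def by (auto simp del: insert_iff)
    have r': "{a, b, c, d} \<subseteq> {-1, 0, 1}" using \<open>q \<in> OQ\<close> unfolding q OQ_iff by blast
    have e: "gl_quat (a', b', c', d') = gl_quat q" unfolding q'[symmetric] gl_quat_lift ..
    note c = gl_quat_components[OF e] gl_quat_components[OF q[symmetric, THEN arg_cong, of gl_quat]]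
    have "of_int a' = (of_int a :: 3)" "of_int b' = (of_int b :: 3)" "of_int c' = (of_int c :: 3)" "of_int d' = (of_int d :: 3)"
      by (simp_all only: c)
    then have "a' = a" "b' = b" "c' = c" "d' = d" using r r' by (blast intro: of_int_f3_inject)+
    then show "gl_lift (gl_quat q) = q" unfolding q' by (simp only: q)
  qed
  show "\<forall>M\<in>carrier GL2_F3. gl_quat (gl_lift M) = M" by (simp add: gl_quat_lift)
  show "gl_quat ` OQ \<subseteq> carrier GL2_F3"
  proof (rule image_subsetI)
    fix q :: quat assume q: "q \<in> OQ"
    define n where "n = (of_int (qnorm q) :: 3)"
    have "n * n = 1" using OQ_norm[OF q] by (auto simp: n_def)
    have g: "gl_quat (qscale k (1, 0, 0, 0)) = mat (of_int k)" for k by (simp add: mat_mat2)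
    have "qmul q (qconj q) = qscale (qnorm q) (1, 0, 0, 0)" "qmul (qconj q) q = qscale (qnorm q) (1, 0, 0, 0)"
      by (cases q, simp)+
    then have "gl_quat q ** gl_quat (qconj q) = mat n" "gl_quat (qconj q) ** gl_quat q = mat n"
      unfolding n_def by (metis g gl_quat_mult)+
    then have "gl_quat q ** (mat n ** gl_quat (qconj q)) = mat 1" "mat n ** gl_quat (qconj q) ** gl_quat q = mat 1"
      using \<open>n * n = 1\<close> by (simp_all add: mat_mult_left_comm[of "gl_quat q"] flip: matrix_mul_assoc)
    then show "gl_quat q \<in> carrier GL2_F3" by (auto simp: GL2_F3_def invertible_def)
  qed
  show "gl_lift ` carrier GL2_F3 \<subseteq> OQ"
  proof (rule image_subsetI)
    fix M assume "M \<in> carrier GL2_F3"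
    then obtain N where "M ** N = mat 1" by (auto simp: GL2_F3_def invertible_def)
    then have "det M * det N = 1" by (metis det_I det_mul)
    then show "gl_lift M \<in> OQ" unfolding gl_lift_OQ by auto
  qed
qed

lemma csu_quat_conj:
  assumes "q \<in> OQ" shows "csu_quat q ** conj_transpose (csu_quat q) = mat (if qnorm q = 2 then - 1 else 1)"
  using OQ_norm[OF assms] f9_quat_conj[of q] j9_f9_quat_conj[of q] by (auto simp: csu_quat_def gf9_simps)

lemma det_csu_quat: "q \<in> OQ \<Longrightarrow> det (csu_quat q) = 1"
  using OQ_norm[of q] det_f9_quat[of q] by (auto simp: csu_quat_def det_mul mat_mat2 det_mat2 gf9_simps)

text \<open>The scalar of the Hermitian form tells norm 2 from the other norms. Conversely, a matrix
  with scalar 1 has the shape of a quaternion, and one with scalar -1 is \<open>j9\<close> times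
  such a matrix.\<close>

lemma csu_quat_bij: "bij_betw csu_quat OQ (carrier CSU2_F3)"
proof -
  have inj9: "p = q" if p: "p \<in> OQ" "q \<in> OQ" "f9_quat p = f9_quat q" for p q
  proof -
    obtain a b c d where p': "p = (a, b, c, d)" by (rule prod_cases4)
    obtain a' b' c' d' where q': "q = (a', b', c', d')" by (rule prod_cases4)
    have "{a, b, c, d} \<subseteq> {-1, 0, 1}" "{a', b', c', d'} \<subseteq> {-1, 0, 1}" using p(1,2) unfolding p' q' OQ_iff by blast+
    moreover have "of_int a = (of_int a' :: 3)" "of_int b = (of_int b' :: 3)" "of_int c = (of_int c' :: 3)" "of_int d = (of_int d' :: 3)"
      using p(3) unfolding p' q' by (simp_all add: mat2_eq_iff)
    ultimately have "a = a'" "b = b'" "c = c'" "d = d'" by (blast intro: of_int_f3_inject)+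
    then show ?thesis unfolding p' q' by simp
  qed
  have jj: "mat j9 ** (mat j9 ** A) = mat (- 1) ** A" for A by (simp add: gf9_simps)
  have inj: "inj_on csu_quat OQ"
  proof (rule inj_onI)
    fix p q assume p: "p \<in> OQ" "q \<in> OQ" "csu_quat p = csu_quat q"
    have "(mat (- 1) :: gf9 ^ 2 ^ 2) \<noteq> mat 1" by (simp add: mat_mat2 mat2_eq_iff gf9_simps)
    then have n: "qnorm p = 2 \<longleftrightarrow> qnorm q = 2"
      using csu_quat_conj[OF p(1)] csu_quat_conj[OF p(2)] p(3) by (auto split: if_splits)
    have "f9_quat p = f9_quat q"
    proof (cases "qnorm p = 2")
      case True
      then have "mat j9 ** (mat j9 ** f9_quat p) = mat j9 ** (mat j9 ** f9_quat q)" using p(3) n by (simp add: csu_quat_def)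
      then have "mat (- 1) ** (mat (- 1) ** f9_quat p) = mat (- 1) ** (mat (- 1) ** f9_quat q)" unfolding jj by simp
      then show ?thesis by simp
    qed (use p(3) n in \<open>simp add: csu_quat_def\<close>)
    then show "p = q" using inj9 p by blast
  qed
  have "carrier CSU2_F3 \<subseteq> csu_quat ` OQ"
  proof
    fix A assume "A \<in> carrier CSU2_F3"
    then obtain e where A: "det A = 1" "e = 1 \<or> e = - 1" "A ** conj_transpose A = mat e" by (auto simp: CSU2_F3_def)
    obtain x y z w where A': "A = mat2 x y z w" by (rule mat2_cases)
    obtain x1 x2 y1 y2 z1 z2 w1 w2 where c: "x = GF9 x1 x2" "y = GF9 y1 y2" "z = GF9 z1 z2" "w = GF9 w1 w2"
      by (metis gf9.exhaust)
    note e = conj_transpose_det_1[OF A(1)[unfolded A'] A(3)[unfolded A']]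
    \<comment> \<open>For scalar -1 the first row is divided by \<open>j9\<close>: -j9 (x1 + x2 j9)
      = x2 - x1 j9.\<close>
    define q where "q = (if e = 1 then (lift3 x1, lift3 x2, lift3 y1, lift3 y2) else (lift3 x2, lift3 (- x1), lift3 y2, lift3 (- y1)))"
    have ne: "(1 :: gf9) \<noteq> - 1" by (simp add: gf9_simps)
    have Aq: "A = (if e = 1 then f9_quat q else mat j9 ** f9_quat q)"
      using A(2) e ne unfolding A' c by (auto simp: q_def mat_mult_mat2 mat2_eq_iff cube_gf9 gf9_simps)
    have dq: "of_int (qnorm q) = (if e = 1 then 1 else - 1 :: 3)"
    proof (cases "e = 1")
      case True
      then show ?thesis using A(1) det_f9_quat[of q] unfolding Aq by (simp add: gf9_simps)
    next
      case False
      then have "j9 * j9 * GF9 (of_int (qnorm q)) 0 = 1"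
        using A(1) det_f9_quat[of q] unfolding Aq by (simp add: det_mul mat_mat2 det_mat2 gf9_simps)
      then show ?thesis using False by (simp add: gf9_simps minus_equation_iff[of _ 1])
    qed
    obtain a b c' d where q': "q = (a, b, c', d)" by (rule prod_cases4)
    have r: "{a, b, c', d} \<subseteq> {-1, 0, 1}" using q' lift3_range unfolding q_def by (auto simp del: insert_iff split: if_splits)
    have "of_int (qnorm q) \<noteq> (0 :: 3)" unfolding dq by simp
    then have OQ: "q \<in> OQ" using r unfolding q' OQ_iff_mod_3 of_int_f3_eq_0_iff by simp
    have "qnorm q = 2 \<longleftrightarrow> e \<noteq> 1" using OQ_norm[OF OQ] dq by (auto split: if_splits)
    then have "A = csu_quat q" unfolding Aq csu_quat_def by simp
    then show "A \<in> csu_quat ` OQ" using OQ by blast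
  qed
  moreover have "csu_quat ` OQ \<subseteq> carrier CSU2_F3"
    using det_csu_quat csu_quat_conj by (auto simp: CSU2_F3_def)
  ultimately show ?thesis using inj by (simp add: bij_betw_def)
qed

text \<open>Tabulates the values compatible with N(p) N(q) = m^2 N(r) and m in {1, -2, 4}. All these
  m are 1 modulo 3, so r has the same reduction as the product.\<close>

lemma OQ_product:
  assumes p: "p \<in> OQ" and q: "q \<in> OQ"
  obtains r m where "r = qred (qmul p q)" "r \<in> OQ" "qmul p q = qscale m r" "m \<noteq> 0"
    "(qnorm p, qnorm q, qnorm r, m) \<in> {(1, 1, 1, 1), (1, 2, 2, 1), (2, 1, 2, 1), (1, 4, 4, 1), (4, 1, 4, 1), (2, 2, 4, 1),
      (1, 4, 1, -2), (4, 1, 1, -2), (2, 2, 1, -2), (2, 4, 2, -2), (4, 2, 2, -2), (4, 4, 4, -2), (4, 4, 1, 4)}"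
proof -
  define r where "r = qred (qmul p q)"
  have scale_1: "qscale 1 r = r" by (cases r) simp
  have "r \<in> OQ \<and> (\<exists>m. qmul p q = qscale m r \<and> qnorm p * qnorm q = m * m * qnorm r \<and> (m = 1 \<or> m = - 2 \<or> m = 4))"
    using p q
  proof (cases rule: OQ_mult)
    case 1
    then show ?thesis using scale_1 unfolding r_def[symmetric] by (intro conjI exI[of _ 1]) auto
  next
    case 2
    then show ?thesis unfolding r_def[symmetric] by (intro conjI exI[of _ "- 2"]) auto
  next
    case 3
    then show ?thesis unfolding r_def[symmetric] by (intro conjI exI[of _ 4]) auto
  qed
  then obtain m where r: "r \<in> OQ" and m: "qmul p q = qscale m r" "qnorm p * qnorm q = m * m * qnorm r" "m = 1 \<or> m = - 2 \<or> m = 4"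
    by blast
  show thesis
  proof (rule that[OF r_def r m(1)])
    show "m \<noteq> 0" using m(3) by auto
  qed (use OQ_norm[OF p] OQ_norm[OF q] OQ_norm[OF r] m(2,3) in \<open>elim disjE; simp\<close>)
qed

text \<open>The table dictates the corners: two quaternions of norm 2 may multiply to one of norm 4
  with m = 1, or of norm 1 with m = -2, so u(2)^2 = u(4) = -2.\<close>

lemma gl_quat_product:
  assumes p: "p \<in> OQ" and q: "q \<in> OQ" and u: "u 1 = 1" "u 2 * u 2 = - 2" "u 4 = (- 2 :: 'a)"
  shows "\<exists>r\<in>OQ. \<exists>m. m \<noteq> 0 \<and> qmul p q = qscale m r \<and> gl_quat p ** gl_quat q = gl_quat r \<and>
    u (qnorm p) * u (qnorm q) = of_int m * u (qnorm r)"
proof (rule OQ_product[OF p q], intro bexI exI conjI)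
  fix r m
  assume r: "r = qred (qmul p q)" "r \<in> OQ" "qmul p q = qscale m r" "m \<noteq> 0"
    "(qnorm p, qnorm q, qnorm r, m) \<in> {(1, 1, 1, 1), (1, 2, 2, 1), (2, 1, 2, 1), (1, 4, 4, 1), (4, 1, 4, 1), (2, 2, 4, 1),
      (1, 4, 1, -2), (4, 1, 1, -2), (2, 2, 1, -2), (2, 4, 2, -2), (4, 2, 2, -2), (4, 4, 4, -2), (4, 4, 1, 4)}"
  show "m \<noteq> 0" "qmul p q = qscale m r" "r \<in> OQ" by fact+
  show "gl_quat p ** gl_quat q = gl_quat r" unfolding r(1) gl_quat_red gl_quat_mult ..
  show "u (qnorm p) * u (qnorm q) = of_int m * u (qnorm r)"
    using r(5) u unfolding insert_iff prod.inject empty_iff by (elim disjE conjE FalseE) simp_all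
qed

text \<open>For two factors of norm 2 the square of \<open>j9\<close> is -1, so the product
  corresponds to -r and m changes its sign; therefore u(2)^2 = 2 here.\<close>

lemma csu_quat_product:
  assumes p: "p \<in> OQ" and q: "q \<in> OQ" and u: "u 1 = 1" "u 2 * u 2 = 2" "u 4 = (- 2 :: 'a)"
  shows "\<exists>r\<in>OQ. \<exists>m. m \<noteq> 0 \<and> qmul p q = qscale m r \<and> csu_quat p ** csu_quat q = csu_quat r \<and>
    u (qnorm p) * u (qnorm q) = of_int m * u (qnorm r)"
proof (rule OQ_product[OF p q])
  fix r m
  assume r: "r = qred (qmul p q)" "r \<in> OQ" "qmul p q = qscale m r" "m \<noteq> 0"
    "(qnorm p, qnorm q, qnorm r, m) \<in> {(1, 1, 1, 1), (1, 2, 2, 1), (2, 1, 2, 1), (1, 4, 4, 1), (4, 1, 4, 1), (2, 2, 4, 1),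
      (1, 4, 1, -2), (4, 1, 1, -2), (2, 2, 1, -2), (2, 4, 2, -2), (4, 2, 2, -2), (4, 4, 4, -2), (4, 4, 1, 4)}"
  note n = r(5)[unfolded insert_iff prod.inject empty_iff]
  have g: "f9_quat p ** f9_quat q = f9_quat r" unfolding r(1) f9_quat_red f9_quat_mult ..
  show ?thesis
  proof (cases "qnorm p = 2 \<and> qnorm q = 2")
    case True
    then have nr: "qnorm r = 4 \<and> m = 1 \<or> qnorm r = 1 \<and> m = - 2" using n by (elim disjE conjE FalseE) simp_all
    have "csu_quat p ** csu_quat q = mat j9 ** (mat j9 ** (f9_quat p ** f9_quat q))"
      using True by (simp add: csu_quat_def mat_mult_left_comm[of "f9_quat p"] flip: matrix_mul_assoc)
    also have "\<dots> = f9_quat (qscale (- 1) r)" unfolding g f9_quat_scale by (simp add: gf9_simps)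
    also have "\<dots> = csu_quat (qscale (- 1) r)" using nr OQ_neg(2)[of r] by (auto simp: csu_quat_def)
    finally have "csu_quat p ** csu_quat q = csu_quat (qscale (- 1) r)" .
    moreover have "qscale m r = qscale (- m) (qscale (- 1) r)" by (cases r) simp
    moreover have "u (qnorm p) * u (qnorm q) = of_int (- m) * u (qnorm (qscale (- 1) r))"
      using True nr u OQ_neg(2)[of r] by auto
    ultimately show ?thesis using OQ_neg(1)[OF r(2)] r(3,4) by (intro bexI[of _ "qscale (- 1) r"] exI[of _ "- m"]) auto
  next
    case False
    then have "u (qnorm p) * u (qnorm q) = of_int m * u (qnorm r)" "qnorm r = 2 \<longleftrightarrow> qnorm p = 2 \<or> qnorm q = 2"
      using n u by (elim disjE conjE FalseE; simp)+
    moreover from this(2) have "csu_quat p ** csu_quat q = csu_quat r"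
      using False g by (auto simp: csu_quat_def mat_mult_left_comm[of "f9_quat p"] simp flip: matrix_mul_assoc)
    ultimately show ?thesis using r(2-4) by (intro bexI[of _ r] exI[of _ m]) auto
  qed
qed

lemma csu_quat_unit: "csu_quat (1, 0, 0, 0) = mat 1" "csu_quat (- 1, 0, 0, 0) = mat (- 1)"
  by (simp_all add: csu_quat_def mat_mat2 mat2_eq_iff gf9_simps)

lemma csu_quat_qconj: "q \<in> OQ \<Longrightarrow> csu_quat q ** csu_quat (qconj q) = mat 1"
proof -
  assume q: "q \<in> OQ"
  have "qmul q (qconj q) = qscale (qnorm q) (1, 0, 0, 0)" by (cases q) simp
  then have "f9_quat q ** f9_quat (qconj q) = mat (GF9 (of_int (qnorm q)) 0)"
    unfolding f9_quat_mult[symmetric] by (simp add: mat_mat2 mat2_eq_iff gf9_simps)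
  moreover have "qnorm (qconj q) = qnorm q" by (cases q) simp
  ultimately show ?thesis using OQ_norm[OF q]
    by (auto simp: csu_quat_def mat_mult_left_comm[of "f9_quat q"] gf9_simps simp flip: matrix_mul_assoc)
qed

lemma group_CSU2_F3: "group CSU2_F3"
proof -
  have car: "carrier CSU2_F3 = csu_quat ` OQ" using csu_quat_bij by (simp add: bij_betw_def)
  have inv: "csu_quat (qconj q) ** csu_quat q = mat 1" if "q \<in> OQ" for q
  proof -
    have "qconj (qconj q) = q" by (cases q) simp
    then show ?thesis using csu_quat_qconj[OF qconj_OQ[OF that]] by simp
  qed
  have OQ1: "(1, 0, 0, 0) \<in> OQ" by (simp add: OQ_iff)
  \<comment> \<open>\<open>csu_quat_product\<close> refers to corners in the ground field; a square
    root of 2 provides them.\<close>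
  obtain w :: 'a where w: "w * w = 2" using square_root_exists by blast
  have "subgroup (carrier CSU2_F3) GL"
    unfolding car
  proof (rule group.subgroupI[OF group_GL])
    show "csu_quat ` OQ \<subseteq> carrier GL" 
    proof (rule image_subsetI)
      fix q assume "q \<in> OQ"
      then have "csu_quat q ** csu_quat (qconj q) = mat 1" "csu_quat (qconj q) ** csu_quat q = mat 1"
        using csu_quat_qconj inv by blast+
      then show "csu_quat q \<in> carrier GL" unfolding GL_simps invertible_def by blast
    qed
    show "csu_quat ` OQ \<noteq> {}" by (metis OQ1 empty_iff image_is_empty)
  next
    fix A assume "A \<in> csu_quat ` OQ"
    then obtain q where q: "q \<in> OQ" "A = csu_quat q" by blast
    have "inv\<^bsub>GL\<^esub> A = csu_quat (qconj q)"
      unfolding q(2) using csu_quat_qconj[OF q(1)] inv[OF q(1)]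
      by (intro group.inv_equality[OF group_GL]) (auto simp: invertible_def)
    then show "inv\<^bsub>GL\<^esub> A \<in> csu_quat ` OQ" using qconj_OQ[OF q(1)] by simp
  next
    fix A B assume "A \<in> csu_quat ` OQ" "B \<in> csu_quat ` OQ"
    then obtain p q where p: "p \<in> OQ" "q \<in> OQ" "A = csu_quat p" "B = csu_quat q" by blast
    define u where "u n = (if n = 1 then 1 else if n = 2 then w else - 2)" for n :: int
    have "u 1 = 1" "u 2 * u 2 = 2" "u 4 = - 2" using w by (simp_all add: u_def)
    from csu_quat_product[OF p(1,2) this] obtain r where "r \<in> OQ" "csu_quat p ** csu_quat q = csu_quat r" by blast
    then show "A \<otimes>\<^bsub>GL\<^esub> B \<in> csu_quat ` OQ" unfolding p(3,4) GL_simps by blast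
  qed
  then have "group (GL\<lparr>carrier := carrier CSU2_F3\<rparr>)" by (rule group.subgroup_imp_group[OF group_GL])
  then show ?thesis by (simp add: CSU2_F3_def)
qed

end

context octahedral_curve
begin

text \<open>For \<epsilon>' = 0 the sign of the multiplier at norm 2 is (-1)^\<epsilon>, which
  equals (-1)^(d/2). So a square root of -2 is an admissible corner.\<close>

lemma central_product_GL:
  assumes "\<epsilon>' = 0" shows "is_central_product_2 (Aut_group F) (integer_mod_group d) GL2_F3"
proof -
  obtain w :: 'a where w: "w * w = - 2" using square_root_exists by blast
  define u where "u n = (if n = 1 then 1 else if n = 2 then w else - 2)" for n :: int
  have u: "u 1 = 1" "u 2 * u 2 = - 2" "u 4 = - 2" using w by (simp_all add: u_def)
  have "(- 1) ^ half = (- 1 :: 'a) ^ \<epsilon>" using i_power_d unfolding d_half power_mult ii_powers .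
  then have "(- 2) ^ half = (- 1) ^ \<epsilon> * (2 :: 'a) ^ half" using power_mult_distrib[of "- 1 :: 'a" 2 half] by simp
  then have w2: "u 2 ^ d = (- 1) ^ \<epsilon> * 2 ^ half" unfolding d_half power_mult by (simp add: power2_eq_square u)
  show ?thesis
  proof (rule central_product_2[where \<beta> = gl_quat and u = u])
    show "u (qnorm q) ^ d = \<kappa> q" if "q \<in> OQ" for q
    proof -
      have "oct_sign q ^ (\<epsilon> + \<epsilon>') = oct_sign q ^ \<epsilon>" by (simp add: assms)
      moreover have "u 4 ^ d = 4 ^ half" unfolding d_half power_mult u by simp
      ultimately show ?thesis
        using OQ_norm[OF that] w2 u(1) unfolding \<kappa>_def by (elim disjE) (simp_all add: oct_sign_def)
    qed
  qed (auto simp: GL2_F3_def group_GL gl_quat_bij[unfolded GL2_F3_def GL_simps] mat_mat2 u intro!: gl_quat_product)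
qed

text \<open>For \<epsilon> = \<epsilon>' = 1 the sign occurs squared, so the multiplier is N^(d/2)
  and the square root \<open>s\<close> of 2 is an admissible corner.\<close>

lemma central_product_CSU:
  assumes "\<epsilon>' = 1" "\<epsilon> = 1" shows "is_central_product_2 (Aut_group F) (integer_mod_group d) CSU2_F3"
proof -
  define u where "u n = (if n = 1 then 1 else if n = 2 then s else - 2)" for n :: int
  have u: "u 1 = 1" "u 2 * u 2 = 2" "u 4 = - 2" using s2 by (simp_all add: u_def power2_eq_square)
  have w2: "u 2 ^ d = 2 ^ half" unfolding d_half power_mult by (simp add: power2_eq_square u)
  show ?thesis
  proof (rule central_product_2[where \<beta> = csu_quat and u = u])
    show "u (qnorm q) ^ d = \<kappa> q" if "q \<in> OQ" for q
    proof -
      have "oct_sign q ^ (\<epsilon> + \<epsilon>') = 1" by (simp add: assms oct_sign_def)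
      moreover have "u 4 ^ d = 4 ^ half" unfolding d_half power_mult u by simp
      ultimately show ?thesis
        using OQ_norm[OF that] w2 u(1) unfolding \<kappa>_def by (elim disjE) (simp_all add: oct_sign_def)
    qed
  qed (auto simp: group_CSU2_F3 csu_quat_bij csu_quat_unit u intro!: csu_quat_product, simp_all add: CSU2_F3_def)
qed

end

theorem theorem1p2:
  fixes d :: nat
    and L :: "'a::{alg_closed_field, field_char_0} form"
    and \<zeta> :: "nat \<Rightarrow> 'a"
    and s :: 'a
  assumes "d \<ge> 4"
    and "binary_form d L"
    and "smooth_plane_curve d (Var 3 ^ d + L)"
    and "outer_galois_points (Var 3 ^ d + L) = {proj_point (vector [0, 0, 1])}"
    and "compatible_roots_of_unity \<zeta>"
    and "s ^ 2 = 2"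
  shows
    "(Aut_red_group (Var 3 ^ d + L) \<cong> sym_group 4 \<longleftrightarrow>
        (\<exists>\<epsilon> \<epsilon>' \<epsilon>'' t a. octahedral_data d \<epsilon> \<epsilon>' \<epsilon>'' t a \<and>
           K_equivalent (Var 3 ^ d + L) (Var 3 ^ d + octahedral_form \<epsilon> \<epsilon>' \<epsilon>'' t a)))
     \<and>
     (\<forall>\<epsilon> \<epsilon>' \<epsilon>'' t a.
        octahedral_data d \<epsilon> \<epsilon>' \<epsilon>'' t a \<and> L = octahedral_form \<epsilon> \<epsilon>' \<epsilon>'' t a \<longrightarrow>
          is_central_extension (Aut_group (Var 3 ^ d + L)) (sym_group 4) (integer_mod_group d) \<and>
          Aut (Var 3 ^ d + L) =
            generate PGL {pgl (rho \<zeta> d), pgl (rho' \<zeta>), pgl (tau \<zeta>),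
              pgl (sigma1 \<zeta> \<epsilon>''), pgl (sigma2 \<zeta> s \<epsilon> \<epsilon>')} \<and>
          (\<epsilon>' = 0 \<longrightarrow>
             is_central_product_2 (Aut_group (Var 3 ^ d + L)) (integer_mod_group d) GL2_F3) \<and>
          (\<epsilon>' = 1 \<and> \<epsilon> = 1 \<longrightarrow>
             is_central_product_2 (Aut_group (Var 3 ^ d + L)) (integer_mod_group d) CSU2_F3))"
proof -
  interpret unique_galois_curve d L \<zeta> using assms(1-5) by unfold_locales
  have oct: "octahedral_curve d L \<zeta> \<epsilon> \<epsilon>' \<epsilon>'' t a s"
    if "octahedral_data d \<epsilon> \<epsilon>' \<epsilon>'' t a \<and> L = octahedral_form \<epsilon> \<epsilon>' \<epsilon>'' t a" for \<epsilon> \<epsilon>' \<epsilon>'' t a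
    using that assms(6) unique_galois_curve_axioms
    by (auto simp: octahedral_curve_def octahedral_curve_axioms_def)
  show ?thesis
    using Aut_red_iff octahedral_curve.central_extension[OF oct] octahedral_curve.Aut_generated[OF oct]
      octahedral_curve.central_product_GL[OF oct] octahedral_curve.central_product_CSU[OF oct]
    by (intro conjI allI impI) auto
qed

end
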